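(* Let $s>1$. Consider on $\ell^2_s$ the Hamiltonian $H=\Lambda+G$, where $$\Lambda=\sum_{j\in\mathbb{Z}_*}j|q_j|^2,\qquad G=\frac{1}{4\pi}\sum_{\substack{j,k,l,m\in\mathbb{Z}_*\\ j-k+l-m=0}}q_j\bar q_kq_l\bar q_m .$$ There exists a real analytic symplectic coordinate transformation $\Psi$ defined in a neighborhood of the origin of $\ell^2_s$ such that $$H\circ\Psi=\Lambda+B+R,$$ where $$B=-\frac{1}{4\pi}\sum_{j\in\mathbb{Z}_*}|q_j|^4+\frac{1}{2\pi}\Big(\sum_{j\in\mathbb{Z}_*}|q_j|^2\Big)^2,$$ and $R$ is of order at least $6$ in $(q,\bar q)$ with $$\|X_R\|_{s-1}=O(\|q\|_s^5).$$ Moreover, $R$ is of the form $$R=\sum_{r\ge 3}\ \sum_{(j_1,\dots,j_{2r})\in\mathcal{M}_r}c(j_1,\dots,j_{2r})\,q_{j_1}\bar q_{j_2}\cdots q_{j_{2r-1}}\bar q_{j_{2r}}$$ with coefficients satisfying $$|c(j_1,\dots,j_{2r})|<C^r\Big(\frac{j_2^*j_3^*\cdots j_{2r}^*}{j_1^*}\Big)^{1/2},$$ where $C>0$ is a constant.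
   Context: $\mathbb{Z}_*=\mathbb{Z}\setminus\{0\}$. For $s\ge 0$, $\ell^2_s$ is the Hilbert space of complex sequences $q=(q_j)_{j\in\mathbb{Z}_*}$ with $\|q\|_s^2=\sum_{j\in\mathbb{Z}_*}|q_j|^2|j|^{2s}<\infty$. The symplectic structure is $-\mathrm{i}\sum_{j\in\mathbb{Z}_*}j^{-1}\,dq_j\wedge d\bar q_j$. The Hamiltonian vector field of a function $F$ of $(q,\bar q)$ is $$X_F=-\mathrm{i}\sum_{j\in\mathbb{Z}_*}j\Big(\frac{\partial F}{\partial\bar q_j}\frac{\partial}{\partial q_j}-\frac{\partial F}{\partial q_j}\frac{\partial}{\partial\bar q_j}\Big),$$ so that the equations of motion are $\dot q_j=-\mathrm{i}j\,\partial F/\partial\bar q_j$, and the Poisson bracket is $$\{H,F\}=-\mathrm{i}\sum_{j\in\mathbb{Z}_*}j\Big(\frac{\partial H}{\partial q_j}\frac{\partial F}{\partial\bar q_j}-\frac{\partial H}{\partial\bar q_j}\frac{\partial F}{\partial q_j}\Big).$$ For a real-valued $F$, $\|X_F\|_{s-1}$ denotes the $\ell^2_{s-1}$-norm of the sequence of $q_j$-components $(-\mathrm{i}j\,\partial F/\partial\bar q_j)_{j\in\mathbb{Z}_*}$ (the $\bar q_j$-components are their complex conjugates), and $O(\cdot)$ is as $q\to0$ in $\ell^2_s$. For $r\geq 1$, $\mathcal{M}_r=\{(j_1,\dots,j_{2r})\in\mathbb{Z}_*^{2r}: j_1-j_2+\cdots+j_{2r-1}-j_{2r}=0\}$, and $j_1^*\ge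 j_2^*\ge\cdots\ge j_{2r}^*$ denotes the decreasing rearrangement (with multiplicity) of $|j_1|,|j_2|,\dots,|j_{2r}|$. *)

theory Defs
  imports "HOL-Analysis.Analysis" "HOL-Library.Function_Algebras"
begin

text \<open>Sequences over the nonzero integers are functions on \<open>int\<close> vanishing at \<open>0\<close>; the pointwise
  real vector space structure on functions completes the instances of \<open>Function_Algebras\<close>.\<close>

instantiation "fun" :: (type, real_vector) real_vector
begin

definition scaleR_fun :: "real \<Rightarrow> ('a \<Rightarrow> 'b) \<Rightarrow> 'a \<Rightarrow> 'b" where
  "scaleR_fun r f = (\<lambda>x. r *\<^sub>R f x)"

instance
  by standard (auto simp: scaleR_fun_def scaleR_add_left scaleR_add_right)

end

section \<open>Analytic calculus on normed subspaces\<close>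

text \<open>A normed space is given by a carrier \<open>V\<close> (a real subspace of the ambient type) and a norm
  \<open>N\<close>, of which only the values on \<open>V\<close> matter.\<close>

abbreviation norm_topology :: "'a::real_vector set \<Rightarrow> ('a \<Rightarrow> real) \<Rightarrow> 'a topology" where
  "norm_topology V N \<equiv> Metric_space.mtopology V (\<lambda>x y. N (x - y))"

text \<open>\<open>n\<close>-linear maps \<open>V\<^sup>n \<rightarrow> W\<close>, acting on lists of length \<open>n\<close>, with bound \<open>K\<close>.\<close>

definition bounded_multilinear ::
  "'a::real_vector set \<Rightarrow> ('a \<Rightarrow> real) \<Rightarrow> 'b::real_vector set \<Rightarrow> ('b \<Rightarrow> real) \<Rightarrow>
   nat \<Rightarrow> ('a list \<Rightarrow> 'b) \<Rightarrow> real \<Rightarrow> bool" where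
  "bounded_multilinear V N W N' n A K \<longleftrightarrow>
     (\<forall>xs. length xs = n \<and> set xs \<subseteq> V \<longrightarrow>
        A xs \<in> W \<and> N' (A xs) \<le> K * prod_list (map N xs)) \<and>
     (\<forall>xs ys u v a b.
        length xs + 1 + length ys = n \<and> set xs \<subseteq> V \<and> set ys \<subseteq> V \<and> u \<in> V \<and> v \<in> V \<longrightarrow>
        A (xs @ (a *\<^sub>R u + b *\<^sub>R v) # ys) =
          a *\<^sub>R A (xs @ u # ys) + b *\<^sub>R A (xs @ v # ys))"

text \<open>\<open>f (x + h) = (\<Sum>n. A\<^sub>n(h, \<dots>, h))\<close> near \<open>x\<close>, with \<open>(\<Sum>n. K\<^sub>n \<rho>\<^sup>n) < \<infinity>\<close> for bounds
  \<open>K\<^sub>n\<close> of the \<open>n\<close>-linear maps \<open>A\<^sub>n\<close> and some \<open>\<rho> > 0\<close>.\<close>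

definition has_power_series ::
  "'a::real_vector set \<Rightarrow> ('a \<Rightarrow> real) \<Rightarrow> 'b::real_vector set \<Rightarrow> ('b \<Rightarrow> real) \<Rightarrow>
   ('a \<Rightarrow> 'b) \<Rightarrow> 'a \<Rightarrow> (nat \<Rightarrow> 'a list \<Rightarrow> 'b) \<Rightarrow> bool" where
  "has_power_series V N W N' f x A \<longleftrightarrow>
     (\<exists>\<rho> K. 0 < \<rho> \<and> summable (\<lambda>n. K n * \<rho> ^ n) \<and>
        (\<forall>n. bounded_multilinear V N W N' n (A n) (K n)) \<and>
        (\<forall>h\<in>V. N h < \<rho> \<longrightarrow> f (x + h) \<in> W \<and>
           (\<lambda>m. N' (f (x + h) - (\<Sum>n<m. A n (replicate n h)))) \<longlonglongrightarrow> 0))"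

definition real_analytic_on ::
  "'a::real_vector set \<Rightarrow> ('a \<Rightarrow> real) \<Rightarrow> 'b::real_vector set \<Rightarrow> ('b \<Rightarrow> real) \<Rightarrow>
   ('a \<Rightarrow> 'b) \<Rightarrow> 'a set \<Rightarrow> bool" where
  "real_analytic_on V N W N' f U \<longleftrightarrow> (\<forall>x\<in>U. \<exists>A. has_power_series V N W N' f x A)"

definition has_order_at_least ::
  "'a::real_vector set \<Rightarrow> ('a \<Rightarrow> real) \<Rightarrow> ('a \<Rightarrow> real) \<Rightarrow> nat \<Rightarrow> bool" where
  "has_order_at_least V N F d \<longleftrightarrow>
     (\<exists>A. has_power_series V N UNIV abs F 0 A \<and>
          (\<forall>n<d. \<forall>h\<in>V. A n (replicate n h) = 0))"

definition has_frechet_derivative ::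
  "'a::real_vector set \<Rightarrow> ('a \<Rightarrow> real) \<Rightarrow> 'b::real_vector set \<Rightarrow> ('b \<Rightarrow> real) \<Rightarrow>
   ('a \<Rightarrow> 'b) \<Rightarrow> ('a \<Rightarrow> 'b) \<Rightarrow> 'a \<Rightarrow> bool" where
  "has_frechet_derivative V N W N' f D x \<longleftrightarrow>
     (\<forall>u\<in>V. \<forall>v\<in>V. \<forall>a b. D (a *\<^sub>R u + b *\<^sub>R v) = a *\<^sub>R D u + b *\<^sub>R D v) \<and>
     (\<exists>K. \<forall>u\<in>V. D u \<in> W \<and> N' (D u) \<le> K * N u) \<and>
     (\<forall>\<epsilon>>0. \<exists>\<delta>>0. \<forall>h\<in>V. N h < \<delta> \<longrightarrow>
        f (x + h) - f x - D h \<in> W \<and> N' (f (x + h) - f x - D h) \<le> \<epsilon> * N h)"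

section \<open>Weighted sequence spaces\<close>

type_synonym seq = "int \<Rightarrow> complex"

definition Zstar :: "int set" where
  "Zstar = {j. j \<noteq> 0}"

definition ell2 :: "real \<Rightarrow> seq set" where
  "ell2 s = {q. q 0 = 0 \<and>
     (\<lambda>j. (cmod (q j))\<^sup>2 * real_of_int \<bar>j\<bar> powr (2 * s)) summable_on Zstar}"

definition ell2_norm :: "real \<Rightarrow> seq \<Rightarrow> real" where
  "ell2_norm s q = sqrt (\<Sum>\<^sub>\<infinity>j\<in>Zstar. (cmod (q j))\<^sup>2 * real_of_int \<bar>j\<bar> powr (2 * s))"

lemma ell2_add:
  assumes u: "u \<in> ell2 s" and v: "v \<in> ell2 s"
  shows "u + v \<in> ell2 s" and "ell2_norm s (u + v) \<le> ell2_norm s u + ell2_norm s v"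
proof -
  define w where "w j = real_of_int \<bar>j\<bar> powr s" for j
  define S where "S f = (\<Sum>\<^sub>\<infinity>j\<in>Zstar. (cmod (f j) * w j)\<^sup>2)" for f :: seq
  have w: "(cmod (f j))\<^sup>2 * real_of_int \<bar>j\<bar> powr (2 * s) = (cmod (f j) * w j)\<^sup>2" for f :: seq and j
  proof -
    have "real_of_int \<bar>j\<bar> powr (2 * s) = (real_of_int \<bar>j\<bar> powr s)\<^sup>2"
      by (simp only: power2_eq_square powr_add[symmetric] mult_2)
    then show ?thesis
      by (simp only: w_def power_mult_distrib)
  qed
  have N: "ell2_norm s f = sqrt (S f)" for f
    by (simp only: ell2_norm_def S_def w)
  have S0: "0 \<le> S f" for f
    unfolding S_def by (rule infsum_nonneg) simp
  have su: "(\<lambda>j. (cmod (u j) * w j)\<^sup>2) summable_on Zstar"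
    and sv: "(\<lambda>j. (cmod (v j) * w j)\<^sup>2) summable_on Zstar"
    using u v by (simp_all only: ell2_def w mem_Collect_eq)
  have fin: "(\<Sum>j\<in>F. (cmod ((u + v) j) * w j)\<^sup>2) \<le> (sqrt (S u) + sqrt (S v))\<^sup>2"
    if F: "finite F" "F \<subseteq> Zstar" for F
  proof -
    have "L2_set (\<lambda>j. cmod ((u + v) j) * w j) F \<le> L2_set (\<lambda>j. cmod (u j) * w j + cmod (v j) * w j) F"
    proof (rule L2_set_mono)
      fix j
      have "cmod (u j + v j) * w j \<le> (cmod (u j) + cmod (v j)) * w j"
        by (intro mult_right_mono norm_triangle_ineq) (simp add: w_def)
      then show "cmod ((u + v) j) * w j \<le> cmod (u j) * w j + cmod (v j) * w j"
        by (simp add: distrib_right)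
    qed (simp add: w_def)
    also have "\<dots> \<le> L2_set (\<lambda>j. cmod (u j) * w j) F + L2_set (\<lambda>j. cmod (v j) * w j) F"
      by (rule L2_set_triangle_ineq)
    also have "\<dots> \<le> sqrt (S u) + sqrt (S v)"
      unfolding L2_set_def S_def
      by (intro add_mono real_sqrt_le_mono finite_sum_le_infsum su sv F) auto
    finally have "(L2_set (\<lambda>j. cmod ((u + v) j) * w j) F)\<^sup>2 \<le> (sqrt (S u) + sqrt (S v))\<^sup>2"
      by (rule power_mono) (rule L2_set_nonneg)
    then show ?thesis
      by (simp add: L2_set_def sum_nonneg)
  qed
  have s: "(\<lambda>j. (cmod ((u + v) j) * w j)\<^sup>2) summable_on Zstar"
    by (rule nonneg_bdd_above_summable_on) (use fin in \<open>auto intro!: bdd_aboveI2\<close>)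
  then show "u + v \<in> ell2 s"
    using u v unfolding ell2_def mem_Collect_eq w by simp
  have "S (u + v) \<le> (sqrt (S u) + sqrt (S v))\<^sup>2"
    unfolding S_def[of "u + v"] by (rule infsum_le_finite_sums[OF s fin])
  then have "sqrt (S (u + v)) \<le> sqrt (S u) + sqrt (S v)"
    by (intro real_le_lsqrt) (auto simp: S0)
  then show "ell2_norm s (u + v) \<le> ell2_norm s u + ell2_norm s v"
    by (simp only: N)
qed

lemma ell2_uminus: "- u \<in> ell2 s \<longleftrightarrow> u \<in> ell2 s" "ell2_norm s (- u) = ell2_norm s u"
  by (simp_all add: ell2_def ell2_norm_def)

lemma ell2_diff: "u \<in> ell2 s \<Longrightarrow> v \<in> ell2 s \<Longrightarrow> u - v \<in> ell2 s"
  using ell2_add(1)[of u s "- v"] by (simp add: ell2_uminus)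

lemma ell2_norm_eq_0:
  assumes "u \<in> ell2 s"
  shows "ell2_norm s u = 0 \<longleftrightarrow> u = 0"
proof
  assume z: "ell2_norm s u = 0"
  have "(cmod (u j))\<^sup>2 * real_of_int \<bar>j\<bar> powr (2 * s) = 0" if "j \<in> Zstar" for j
  proof (rule nonneg_infsum_le_0D[where A = Zstar and
        f = "\<lambda>j. (cmod (u j))\<^sup>2 * real_of_int \<bar>j\<bar> powr (2 * s)"])
    show "(\<Sum>\<^sub>\<infinity>j\<in>Zstar. (cmod (u j))\<^sup>2 * real_of_int \<bar>j\<bar> powr (2 * s)) \<le> 0"
      using z by (simp only: ell2_norm_def real_sqrt_eq_0_iff order.refl)
    show "(\<lambda>j. (cmod (u j))\<^sup>2 * real_of_int \<bar>j\<bar> powr (2 * s)) summable_on Zstar"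
      using assms by (simp only: ell2_def mem_Collect_eq)
  qed (simp_all add: that)
  then have "u j = 0" for j
    using assms by (cases "j = 0") (simp_all add: ell2_def Zstar_def)
  then show "u = 0"
    by (simp add: fun_eq_iff)
qed (simp add: ell2_norm_def)

lemma Metric_space_ell2: "Metric_space (ell2 s) (\<lambda>x y. ell2_norm s (x - y))"
proof
  fix x y z
  show "0 \<le> ell2_norm s (x - y)"
    by (auto simp: ell2_norm_def intro!: infsum_nonneg)
  show "ell2_norm s (x - y) = ell2_norm s (y - x)"
    using ell2_uminus(2)[of s "x - y"] by simp
  show "ell2_norm s (x - y) = 0 \<longleftrightarrow> x = y" if "x \<in> ell2 s" "y \<in> ell2 s"
    using ell2_norm_eq_0[OF ell2_diff[OF that]] by simp
  show "ell2_norm s (x - z) \<le> ell2_norm s (x - y) + ell2_norm s (y - z)"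
    if "x \<in> ell2 s" "y \<in> ell2 s" "z \<in> ell2 s"
    using ell2_add(2)[OF ell2_diff[OF that(1,2)] ell2_diff[OF that(2,3)]] by simp
qed

section \<open>Symplectic structure\<close>

text \<open>\<open>(dq\<^sub>j \<and> d\<bar>q\<^sub>j)(u, v) = u\<^sub>j cnj v\<^sub>j - v\<^sub>j cnj u\<^sub>j\<close> for real tangent vectors \<open>u, v\<close>.\<close>

definition symp_form :: "seq \<Rightarrow> seq \<Rightarrow> complex" where
  "symp_form u v =
     - \<i> * (\<Sum>\<^sub>\<infinity>j\<in>Zstar. (u j * cnj (v j) - v j * cnj (u j)) / of_int j)"

definition symplectic_on :: "real \<Rightarrow> (seq \<Rightarrow> seq) \<Rightarrow> seq set \<Rightarrow> bool" where
  "symplectic_on s \<Psi> U \<longleftrightarrow>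
     (\<forall>q\<in>U. \<exists>D. has_frechet_derivative (ell2 s) (ell2_norm s) (ell2 s) (ell2_norm s) \<Psi> D q \<and>
        (\<forall>u\<in>ell2 s. \<forall>v\<in>ell2 s. symp_form (D u) (D v) = symp_form u v))"

definition analytic_symplectic_transformation ::
  "real \<Rightarrow> (seq \<Rightarrow> seq) \<Rightarrow> seq set \<Rightarrow> seq set \<Rightarrow> bool" where
  "analytic_symplectic_transformation s \<Psi> U V \<longleftrightarrow>
     openin (norm_topology (ell2 s) (ell2_norm s)) U \<and>
     openin (norm_topology (ell2 s) (ell2_norm s)) V \<and>
     0 \<in> U \<and> \<Psi> 0 = 0 \<and> bij_betw \<Psi> U V \<and>
     real_analytic_on (ell2 s) (ell2_norm s) (ell2 s) (ell2_norm s) \<Psi> U \<and>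
     real_analytic_on (ell2 s) (ell2_norm s) (ell2 s) (ell2_norm s) (inv_into U \<Psi>) V \<and>
     symplectic_on s \<Psi> U"

definition unit_seq :: "int \<Rightarrow> complex \<Rightarrow> seq" where
  "unit_seq j z = (\<lambda>k. if k = j then z else 0)"

text \<open>Wirtinger derivative \<open>\<partial>F/\<partial>\<bar>q\<^sub>j = (\<partial>F/\<partial>x\<^sub>j + \<i> \<partial>F/\<partial>y\<^sub>j) / 2\<close>, where \<open>q\<^sub>j = x\<^sub>j + \<i> y\<^sub>j\<close>.\<close>

definition partial_qbar :: "(seq \<Rightarrow> real) \<Rightarrow> int \<Rightarrow> seq \<Rightarrow> complex" where
  "partial_qbar F j q =
     (complex_of_real (deriv (\<lambda>t. F (q + t *\<^sub>R unit_seq j 1)) 0)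
      + \<i> * complex_of_real (deriv (\<lambda>t. F (q + t *\<^sub>R unit_seq j \<i>)) 0)) / 2"

text \<open>The \<open>q\<^sub>j\<close>-components of \<open>X\<^sub>F\<close>; for real-valued \<open>F\<close> these determine the others.\<close>

definition ham_vf :: "(seq \<Rightarrow> real) \<Rightarrow> seq \<Rightarrow> seq" where
  "ham_vf F q = (\<lambda>j. - \<i> * of_int j * partial_qbar F j q)"

section \<open>The Hamiltonian and its normal form\<close>

definition Lambda :: "seq \<Rightarrow> real" where
  "Lambda q = (\<Sum>\<^sub>\<infinity>j\<in>Zstar. real_of_int j * (cmod (q j))\<^sup>2)"

text \<open>Complex-typed, although the value is real by the symmetry of the index set.\<close>

definition Gquart :: "seq \<Rightarrow> complex" where
  "Gquart q = 1 / (4 * complex_of_real pi) *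
     (\<Sum>\<^sub>\<infinity>(j, k, l, m)\<in>{(j, k, l, m). j \<in> Zstar \<and> k \<in> Zstar \<and> l \<in> Zstar \<and> m \<in> Zstar \<and>
                          j - k + l - m = 0}.
        q j * cnj (q k) * q l * cnj (q m))"

definition Ham :: "seq \<Rightarrow> complex" where
  "Ham q = complex_of_real (Lambda q) + Gquart q"

definition Bquart :: "seq \<Rightarrow> real" where
  "Bquart q = - 1 / (4 * pi) * (\<Sum>\<^sub>\<infinity>j\<in>Zstar. (cmod (q j)) ^ 4)
     + 1 / (2 * pi) * (\<Sum>\<^sub>\<infinity>j\<in>Zstar. (cmod (q j))\<^sup>2)\<^sup>2"

text \<open>Multi-indices \<open>(j\<^sub>1, \<dots>, j\<^bsub>2r\<^esub>)\<close> are lists, indexed from \<open>0\<close>: even list positions carry the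
  sign \<open>+\<close> and the factor \<open>q\<close>, odd ones the sign \<open>-\<close> and the factor \<open>\<bar>q\<close>.\<close>

definition Mset :: "nat \<Rightarrow> int list set" where
  "Mset r = {js. length js = 2 * r \<and> set js \<subseteq> Zstar \<and> (\<Sum>i<2 * r. (- 1) ^ i * js ! i) = 0}"

definition monomial :: "int list \<Rightarrow> seq \<Rightarrow> complex" where
  "monomial js q = (\<Prod>i<length js. if even i then q (js ! i) else cnj (q (js ! i)))"

definition decr_abs :: "int list \<Rightarrow> int list" where
  "decr_abs js = rev (sort (map abs js))"

end

theory Submission
  imports Defs
begin

text \<open>Let \<open>X\<close>, cubic in \<open>q\<close>, be half the Hamiltonian vector field that removes the nonresonant part \<open>G - B\<close> of
  \<open>G\<close> to first order. Instead of a flow, \<open>\<Psi>\<close> is one step of the implicit midpoint rule,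
  \<open>\<Psi> = (id + X) \<circ> (id - X)\<^sup>-\<^sup>1\<close>: with \<open>q = z - X z\<close> the image is \<open>y = z + X z\<close>. The derivative of \<open>\<Psi>\<close> is the
  Cayley transform \<open>(1 + X' z) (1 - X' z)\<^sup>-\<^sup>1\<close> of a Hamiltonian linear map, hence symplectic. As \<open>\<Lambda>\<close> is a
  quadratic form, \<open>\<Lambda> (z + X z) - \<Lambda> (z - X z)\<close> is exactly \<open>2 \<Lambda>'(z) (X z) = B z - G z\<close>, so that
  \<open>H (\<Psi> q) = \<Lambda> q + B q + R q\<close> with \<open>R q = G y - G z + B z - B q\<close>. The coefficients \<open>\<chi>\<close> of \<open>X\<close> satisfy
  \<open>|\<chi>(a, b, c)| max(|m|, |a|, |b|, |c|) \<le> sqrt |m a b c|\<close> for \<open>m = a - b + c\<close>. This estimate is stable under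
  composition, so it passes, with a geometric factor from counting ternary trees, to the coefficients of
  \<open>(id - X)\<^sup>-\<^sup>1\<close> and from there to those of \<open>R\<close>. Since \<open>s > 1\<close>, a sequence in \<open>\<ell>\<^sup>2\<^sub>s\<close> is summable with the weight
  \<open>sqrt |j|\<close>, and all the series converge near the origin.\<close>

section \<open>Inverting the identity minus a cubic map\<close>

text \<open>The vector field of \<open>G\<close> carries the factor \<open>j\<close> of the
  symplectic structure and costs one power of \<open>j\<close>, so it cannot serve as it stands for
  a change of variables in \<open>ell2 s\<close>. Dividing by the divisor
  \<open>2 (a - b) (b - c)\<close> regains that power, and this is what makes \<open>X\<close>
  bounded on \<open>ell2 s\<close>. A flow would bring in Lie series of all orders; the midpoint
  step needs only the inversion of one cubic map, and its own inverse is the step with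
  \<open>-X\<close>. The inversion is carried out twice. Analyticity on an open set asks for a power
  series about each point, which a Banach space argument supplies without any information on
  individual coefficients. The estimate for \<open>R\<close> asks for explicit coefficients of a
  series about the origin. The two inverses agree because the fixed point equation has at most one
  small solution in the l1 space with weight \<open>sqrt |j|\<close>, where both live. All linearity
  is over the reals, since \<open>X\<close> conjugates its middle argument.\<close>

definition triples :: "nat \<Rightarrow> (nat \<times> nat \<times> nat) set" where
  "triples n = {(i, j, l). i + j + l = n \<and> i < n \<and> j < n \<and> l < n}"

lemma finite_triples [simp]: "finite (triples n)"
  by (rule finite_subset[of _ "{..n} \<times> {..n} \<times> {..n}"]) (auto simp: triples_def)

text \<open>Scalar shadow of the tree recursion: \<open>\<kappa>\<close> bounds the constant term,
  \<open>c\<close> the linear one and \<open>D\<close> the trilinear map. With the parameters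
  \<open>0\<close>, \<open>1\<close>, \<open>1\<close> it counts plane ternary trees by their
  leaves, which is its second use.\<close>

function majorant :: "real \<Rightarrow> real \<Rightarrow> real \<Rightarrow> nat \<Rightarrow> real" where
  "majorant \<kappa> c D n =
     (if n = 0 then \<kappa> else if n = 1 then c
      else D * (\<Sum>t\<in>triples n. majorant \<kappa> c D (fst t) * majorant \<kappa> c D (fst (snd t)) *
                  majorant \<kappa> c D (snd (snd t))))"
  by auto
termination
  by (relation "Wellfounded.measure (\<lambda>(_, _, _, n). n)") (auto simp: triples_def)

declare majorant.simps [simp del]

lemma majorant_0: "majorant \<kappa> c D 0 = \<kappa>" and majorant_1: "majorant \<kappa> c D (Suc 0) = c"
  by (simp_all add: majorant.simps)

lemma majorant_rec:
  "2 \<le> n \<Longrightarrow> majorant \<kappa> c D n =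
     D * (\<Sum>(i, j, l)\<in>triples n. majorant \<kappa> c D i * majorant \<kappa> c D j * majorant \<kappa> c D l)"
  by (subst majorant.simps) (simp add: case_prod_unfold)

lemma majorant_nonneg:
  assumes "0 \<le> \<kappa>" "0 \<le> c" "0 \<le> D"
  shows "0 \<le> majorant \<kappa> c D n"
proof (induction n rule: less_induct)
  case (less n)
  show ?case
    by (subst majorant.simps)
       (use less assms in \<open>auto intro!: mult_nonneg_nonneg sum_nonneg simp: triples_def\<close>)
qed

lemma sum_triple_product:
  fixes f :: "nat \<Rightarrow> real"
  shows "(\<Sum>(i, j, l)\<in>A \<times> B \<times> C. f i * f j * f l) = sum f A * sum f B * sum f C"
proof -
  have "(\<Sum>(i, j, l)\<in>A \<times> B \<times> C. f i * f j * f l) = (\<Sum>i\<in>A. \<Sum>j\<in>B. \<Sum>l\<in>C. f i * f j * f l)"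
    by (simp add: sum.cartesian_product)
  also have "\<dots> = sum f A * sum f B * sum f C"
    by (simp only: sum_distrib_left[symmetric] sum_distrib_right[symmetric])
  finally show ?thesis .
qed

text \<open>The partial sums \<open>W\<close> of \<open>\<Sum>n\<ge>1. k\<^sub>n \<rho>\<^sup>n\<close> satisfy \<open>W' \<le> c \<rho> + D (3 \<kappa> W\<^sup>2 + W\<^sup>3)\<close>, so a small bound
  \<open>\<delta>\<close> propagates.\<close>

lemma majorant_summable:
  assumes "0 \<le> \<kappa>" "0 \<le> c" "0 \<le> D"
  obtains \<rho> where "0 < \<rho>" "\<rho> \<le> 1" "summable (\<lambda>n. majorant \<kappa> c D n * \<rho> ^ n)"
proof -
  \<comment> \<open>Chosen so that \<open>D (3 \<kappa> + \<delta>) \<delta> \<le> 1 / 2\<close>: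
    the terms of order at least two then take up at most half of \<open>\<delta>\<close>, and
    \<open>\<rho>\<close> below leaves the other half to \<open>c \<rho>\<close>.\<close>
  define \<delta> where "\<delta> = 1 / (2 * (D * (3 * \<kappa> + 1)) + 1)"
  have D1: "0 \<le> D * (3 * \<kappa> + 1)"
    using assms by simp
  have \<delta>: "0 < \<delta>" "\<delta> \<le> 1"
    using D1 by (auto simp: \<delta>_def)
  have "D * (3 * \<kappa> + \<delta>) * \<delta> \<le> D * (3 * \<kappa> + 1) * \<delta>"
    using assms \<delta> by (intro mult_right_mono mult_left_mono) auto
  also have "\<dots> \<le> 1 / 2"
    using D1 by (simp add: \<delta>_def divide_simps)
  finally have \<delta>2: "D * (3 * \<kappa> + \<delta>) * \<delta> \<le> 1 / 2" .
  define \<rho> where "\<rho> = \<delta> / (2 * (c + 1))"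
  have \<rho>: "0 < \<rho>" "\<rho> \<le> 1" "c * \<rho> \<le> \<delta> / 2"
    using \<delta> assms by (auto simp: \<rho>_def divide_simps intro: mult_left_mono)
  define p where "p n = majorant \<kappa> c D n * \<rho> ^ n" for n
  have p0: "0 \<le> p n" for n
    unfolding p_def using majorant_nonneg[OF assms] \<rho> by simp
  have bound: "sum p {1..N} \<le> \<delta>" for N
  proof (induction N)
    case 0
    then show ?case using \<delta> by simp
  next
    case (Suc N)
    define W where "W = sum p {1..N}"
    have W: "0 \<le> W" "W \<le> \<delta>"
      using Suc p0 by (auto simp: W_def intro: sum_nonneg)
    let ?A = "{1..N}"
    let ?f = "\<lambda>(i, j, l). p i * p j * p l"
    \<comment> \<open>A triple in \<open>triples n\<close> has at most one zero entry, since two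
      zeros would make the third equal to \<open>n\<close>. \<open>S\<close> collects the triples by
      the position of that zero.\<close>
    define S where "S = {0} \<times> ?A \<times> ?A \<union> ?A \<times> {0} \<times> ?A \<union> ?A \<times> ?A \<times> {0} \<union> ?A \<times> ?A \<times> ?A"
    have step: "p n = D * sum ?f (triples n)" if "n \<in> {2..Suc N}" for n
    proof -
      have "p n = D * (\<Sum>(i, j, l)\<in>triples n. majorant \<kappa> c D i * majorant \<kappa> c D j * majorant \<kappa> c D l * \<rho> ^ n)"
        using that by (simp add: p_def majorant_rec sum_distrib_right case_prod_unfold)
      also have "(\<Sum>(i, j, l)\<in>triples n. majorant \<kappa> c D i * majorant \<kappa> c D j * majorant \<kappa> c D l * \<rho> ^ n) = sum ?f (triples n)"
        by (intro sum.cong) (auto simp: p_def triples_def power_add)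
      finally show ?thesis .
    qed
    have "sum ?f S = sum ?f ({0} \<times> ?A \<times> ?A) + sum ?f (?A \<times> {0} \<times> ?A) + sum ?f (?A \<times> ?A \<times> {0})
        + sum ?f (?A \<times> ?A \<times> ?A)"
      unfolding S_def by (subst sum.union_disjoint; auto)+
    also have "\<dots> = 3 * \<kappa> * W\<^sup>2 + W ^ 3"
      unfolding sum_triple_product W_def[symmetric]
      by (simp add: p_def majorant_0 algebra_simps power2_eq_square power3_eq_cube)
    finally have S: "sum ?f S = 3 * \<kappa> * W\<^sup>2 + W ^ 3" .
    have "(\<Sum>n\<in>{2..Suc N}. p n) = D * (\<Sum>n\<in>{2..Suc N}. sum ?f (triples n))"
      by (subst sum_distrib_left, intro sum.cong refl step)
    also have "(\<Sum>n\<in>{2..Suc N}. sum ?f (triples n)) = sum ?f (\<Union>n\<in>{2..Suc N}. triples n)"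
      by (intro sum.UNION_disjoint[symmetric] ballI impI finite_triples finite_atLeastAtMost)
         (auto simp: triples_def)
    also have "\<dots> \<le> sum ?f S"
      by (intro sum_mono2) (auto simp: triples_def S_def intro!: mult_nonneg_nonneg p0)
    also note S
    also have "3 * \<kappa> * W\<^sup>2 + W ^ 3 = (3 * \<kappa> + W) * W * W"
      by (simp add: power2_eq_square power3_eq_cube algebra_simps)
    also have "\<dots> \<le> (3 * \<kappa> + \<delta>) * \<delta> * \<delta>"
      using W assms \<delta> by (intro mult_mono) auto
    finally have "(\<Sum>n\<in>{2..Suc N}. p n) \<le> (D * (3 * \<kappa> + \<delta>) * \<delta>) * \<delta>"
      using assms by (simp add: mult_left_mono mult.assoc)
    also have "\<dots> \<le> 1 / 2 * \<delta>"
      using \<delta>2 \<delta> by (intro mult_right_mono) auto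
    finally have "(\<Sum>n\<in>{2..Suc N}. p n) \<le> \<delta> / 2" by simp
    moreover have "sum p {1..Suc N} = p 1 + (\<Sum>n\<in>{2..Suc N}. p n)"
      by (subst sum.atLeast_Suc_atMost) (auto simp: numeral_2_eq_2)
    moreover have "p 1 \<le> \<delta> / 2"
      using \<rho> by (simp add: p_def majorant_1)
    ultimately show ?case by simp
  qed
  have "summable p"
  proof (rule summableI_nonneg_bounded[where x = "\<kappa> + \<delta>"])
    fix n
    have "sum p {..<n} \<le> sum p (insert 0 {1..n})"
      by (intro sum_mono2) (auto intro: p0)
    also have "\<dots> = \<kappa> + sum p {1..n}"
      by (subst sum.insert) (auto simp: p_def majorant_0)
    finally show "sum p {..<n} \<le> \<kappa> + \<delta>"
      using bound[of n] by simp
  qed (rule p0)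
  then show ?thesis
    using that \<rho> unfolding p_def by blast
qed

text \<open>A leaf is \<open>J\<close> applied to an entry, an empty branch is the base point
  \<open>z\<close>. The index triples that contain the full length, absent from
  \<open>triples\<close>, are linear in the coefficient being computed; moved to the left they turn
  its equation into \<open>w - L z w = ...\<close>, and \<open>J\<close> is meant to invert that
  operator.\<close>

function tree :: "('a \<Rightarrow> 'a \<Rightarrow> 'a \<Rightarrow> 'a) \<Rightarrow> ('a \<Rightarrow> 'a) \<Rightarrow> 'a \<Rightarrow> 'a list \<Rightarrow> 'a::real_normed_vector" where
  "tree X J z xs =
     (if length xs = 0 then z else if length xs = 1 then J (hd xs)
      else J (\<Sum>t\<in>triples (length xs). X (tree X J z (take (fst t) xs))
             (tree X J z (take (fst (snd t)) (drop (fst t) xs)))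
             (tree X J z (drop (fst (snd t)) (drop (fst t) xs)))))"
  by auto
termination
  by (relation "Wellfounded.measure (\<lambda>(_, _, _, xs). length xs)") (auto simp: triples_def)

declare tree.simps [simp del]

lemma tree_Nil: "tree X J z [] = z" and tree_single: "tree X J z [x] = J x"
  by (subst tree.simps, simp)+

lemma tree_rec:
  "2 \<le> length xs \<Longrightarrow> tree X J z xs =
     J (\<Sum>(i, j, l)\<in>triples (length xs). X (tree X J z (take i xs))
          (tree X J z (take j (drop i xs))) (tree X J z (drop j (drop i xs))))"
  by (subst tree.simps, subst if_not_P, linarith, subst if_not_P, linarith) (simp add: case_prod_unfold)

section \<open>Cubic maps on a Banach space\<close>

locale trilinear =
  fixes X :: "'a::banach \<Rightarrow> 'a \<Rightarrow> 'a \<Rightarrow> 'a" and M :: real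
  assumes lin1: "X (a *\<^sub>R u + b *\<^sub>R v) y z = a *\<^sub>R X u y z + b *\<^sub>R X v y z"
    and lin2: "X y (a *\<^sub>R u + b *\<^sub>R v) z = a *\<^sub>R X y u z + b *\<^sub>R X y v z"
    and lin3: "X y z (a *\<^sub>R u + b *\<^sub>R v) = a *\<^sub>R X y z u + b *\<^sub>R X y z v"
    and bound: "norm (X x y z) \<le> M * (norm x * norm y * norm z)"
    and M_nonneg: "0 \<le> M"
begin

lemma add1: "X (u + v) y z = X u y z + X v y z"
  using lin1[of 1 u 1 v] by simp
lemma add2: "X y (u + v) z = X y u z + X y v z"
  using lin2[of _ 1 u 1 v] by simp
lemma add3: "X y z (u + v) = X y z u + X y z v"
  using lin3[of _ _ 1 u 1 v] by simp
lemma diff1: "X (u - v) y z = X u y z - X v y z"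
  using lin1[of 1 u "-1" v] by simp
lemma diff2: "X y (u - v) z = X y u z - X y v z"
  using lin2[of _ 1 u "-1" v] by simp
lemma diff3: "X y z (u - v) = X y z u - X y z v"
  using lin3[of _ _ 1 u "-1" v] by simp

lemma bounded_linear1: "bounded_linear (\<lambda>u. X u y z)"
proof (rule bounded_linear_intro[where K = "M * (norm y * norm z)"])
  show "X (r *\<^sub>R x) y z = r *\<^sub>R X x y z" for r x
    using lin1[of r x 0 0] by simp
  show "norm (X x y z) \<le> norm x * (M * (norm y * norm z))" for x
    using bound[of x y z] by (simp add: mult_ac)
qed (rule add1)

lemma bounded_linear2: "bounded_linear (\<lambda>u. X y u z)"
proof (rule bounded_linear_intro[where K = "M * (norm y * norm z)"])
  show "X y (r *\<^sub>R x) z = r *\<^sub>R X y x z" for r x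
    using lin2[of y r x 0 0] by simp
  show "norm (X y x z) \<le> norm x * (M * (norm y * norm z))" for x
    using bound[of y x z] by (simp add: mult_ac)
qed (rule add2)

lemma bounded_linear3: "bounded_linear (\<lambda>u. X y z u)"
proof (rule bounded_linear_intro[where K = "M * (norm y * norm z)"])
  show "X y z (r *\<^sub>R x) = r *\<^sub>R X y z x" for r x
    using lin3[of y z r x 0 0] by simp
  show "norm (X y z x) \<le> norm x * (M * (norm y * norm z))" for x
    using bound[of y z x] by (simp add: mult_ac)
qed (rule add3)

text \<open>The derivative of \<open>z \<mapsto> X z z z\<close>; three summands, because no
  symmetry of \<open>X\<close> is assumed.\<close>

definition L :: "'a \<Rightarrow> 'a \<Rightarrow> 'a" where
  "L z w = X w z z + X z w z + X z z w"

lemma bounded_linear_L: "bounded_linear (L z)"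
  unfolding L_def by (intro bounded_linear_add bounded_linear1 bounded_linear2 bounded_linear3)

lemma norm_L: "norm (L z w) \<le> 3 * M * (norm z)\<^sup>2 * norm w"
proof -
  have "norm (L z w) \<le> norm (X w z z) + norm (X z w z) + norm (X z z w)"
    unfolding L_def by (meson norm_triangle_ineq norm_triangle_mono order_refl)
  also have "\<dots> \<le> 3 * M * (norm z)\<^sup>2 * norm w"
    using bound[of w z z] bound[of z w z] bound[of z z w] by (simp add: power2_eq_square mult_ac)
  finally show ?thesis .
qed

text \<open>Under the hypothesis \<open>w \<mapsto> y + L z w\<close> is a contraction with factor
  1/2. Uniqueness of its fixed point gives linearity of \<open>J\<close>, and the factor gives the
  bound 2.\<close>

lemma inverse_exists:
  assumes "6 * M * (norm z)\<^sup>2 \<le> 1"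
  obtains J where "bounded_linear J" "\<And>y. J y - L z (J y) = y" "\<And>y. norm (J y) \<le> 2 * norm y"
proof -
  interpret L: bounded_linear "L z" by (rule bounded_linear_L)
  have half: "norm (L z w) \<le> 1/2 * norm w" for w
  proof -
    have "3 * M * (norm z)\<^sup>2 * norm w \<le> 1/2 * norm w"
      using assms by (intro mult_right_mono) auto
    then show ?thesis using norm_L[of z w] by simp
  qed
  have ex: "\<exists>!w. y + L z w = w" for y
    using half by (intro banach_fix_type[of "1/2"]) (auto simp: dist_norm simp flip: L.diff)
  define J where "J y = (THE w. y + L z w = w)" for y
  have J: "y + L z (J y) = J y" for y
    unfolding J_def by (rule theI'[OF ex])
  have uniq: "w = J y" if "y + L z w = w" for w y
    using that J ex[of y] by blast
  have norm_J: "norm (J y) \<le> 2 * norm y" for y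
  proof -
    have "norm (J y) \<le> norm y + norm (L z (J y))"
      using J[of y] norm_triangle_ineq[of y "L z (J y)"] by simp
    then show ?thesis using half[of "J y"] by simp
  qed
  have "bounded_linear J"
  proof (rule bounded_linear_intro[where K = 2])
    show "J (x + y) = J x + J y" for x y
    proof (rule uniq[symmetric])
      have "x + y + L z (J x + J y) = (x + L z (J x)) + (y + L z (J y))"
        by (simp add: L.add algebra_simps)
      then show "x + y + L z (J x + J y) = J x + J y"
        by (simp only: J)
    qed
    show "J (r *\<^sub>R x) = r *\<^sub>R J x" for r x
      using J[of x] by (intro uniq[symmetric]) (simp add: L.scaleR flip: scaleR_add_right)
    show "norm (J x) \<le> norm x * 2" for x
      using norm_J[of x] by simp
  qed
  then show ?thesis
    using that[of J] J norm_J by (metis add_diff_cancel_right')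
qed

text \<open>In every split the marked entry lies in exactly one of the three pieces, and the other
  two branches do not see it; the case distinctions locate that piece.\<close>

lemma tree_multilinear:
  assumes J: "bounded_linear J"
  shows "tree X J z (xs @ (a *\<^sub>R u + b *\<^sub>R v) # ys) =
    a *\<^sub>R tree X J z (xs @ u # ys) + b *\<^sub>R tree X J z (xs @ v # ys)"
proof (induction "length (xs @ u # ys)" arbitrary: xs ys rule: less_induct)
  case less
  interpret J: bounded_linear J by fact
  let ?n = "length (xs @ u # ys)"
  let ?T = "tree X J z"
  show ?case
  proof (cases "2 \<le> ?n")
    case False
    then have "xs = []" "ys = []" by (cases xs; cases ys; auto)+
    then show ?thesis by (simp add: tree_single J.add J.scaleR)
  next
    case True
    define F where "F w = (\<lambda>(i :: nat, j :: nat, l :: nat). X (?T (take i (xs @ w # ys)))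
          (?T (take j (drop i (xs @ w # ys)))) (?T (drop j (drop i (xs @ w # ys)))))" for w
    have rec: "?T (xs @ w # ys) = J (sum (F w) (triples ?n))" for w
      using True by (simp add: tree_rec F_def)
    have td1: "take i (xs @ w # ys) = xs @ w # take (i - length xs - 1) ys"
       "drop i (xs @ w # ys) = drop (i - length xs - 1) ys" if "length xs < i" for i w and xs ys :: "'a list"
      using that by (auto simp: take_Cons' drop_Cons')
    have td2: "take i (xs @ w # ys) = take i xs"
       "drop i (xs @ w # ys) = drop i xs @ w # ys" if "\<not> length xs < i" for i w and xs ys :: "'a list"
      using that by auto
    have "F (a *\<^sub>R u + b *\<^sub>R v) t = a *\<^sub>R F u t + b *\<^sub>R F v t" if t: "t \<in> triples ?n" for t
    proof -
      obtain i j l where tt: "t = (i, j, l)" by (cases t)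
      have ij: "i + j + l = ?n" "i < ?n" "j < ?n" "l < ?n"
        using t by (auto simp: tt triples_def)
      show ?thesis
      proof (cases "length xs < i")
        case True
        have "?T (xs @ (a *\<^sub>R u + b *\<^sub>R v) # take (i - length xs - 1) ys) =
          a *\<^sub>R ?T (xs @ u # take (i - length xs - 1) ys) + b *\<^sub>R ?T (xs @ v # take (i - length xs - 1) ys)"
          using True ij by (intro less) auto
        then show ?thesis
          by (simp only: tt F_def prod.case td1[OF True] lin1)
      next
        case False
        note F1 = False
        show ?thesis
        proof (cases "length (drop i xs) < j")
          case True
          have "?T (drop i xs @ (a *\<^sub>R u + b *\<^sub>R v) # take (j - length (drop i xs) - 1) ys) =
            a *\<^sub>R ?T (drop i xs @ u # take (j - length (drop i xs) - 1) ys) +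
            b *\<^sub>R ?T (drop i xs @ v # take (j - length (drop i xs) - 1) ys)"
            using True F1 ij by (intro less) auto
          then show ?thesis
            by (simp only: tt F_def prod.case td2[OF F1] td1[OF True] lin2)
        next
          case False
          have "?T (drop j (drop i xs) @ (a *\<^sub>R u + b *\<^sub>R v) # ys) =
            a *\<^sub>R ?T (drop j (drop i xs) @ u # ys) + b *\<^sub>R ?T (drop j (drop i xs) @ v # ys)"
            using False F1 ij by (intro less) auto
          then show ?thesis
            by (simp only: tt F_def prod.case td2[OF F1] td2[OF False] lin3)
        qed
      qed
    qed
    then have "sum (F (a *\<^sub>R u + b *\<^sub>R v)) (triples ?n) =
        a *\<^sub>R sum (F u) (triples ?n) + b *\<^sub>R sum (F v) (triples ?n)"
      by (simp add: sum.distrib scaleR_sum_right)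
    then show ?thesis
      unfolding rec by (simp add: J.add J.scaleR)
  qed
qed

text \<open>The parameters of the majorant are the norm of the base point, the bound 2 for
  \<open>J\<close> at a leaf, and \<open>2 * M\<close> because an inner node applies
  \<open>X\<close> and then \<open>J\<close>.\<close>

lemma norm_tree:
  assumes J: "\<And>y. norm (J y) \<le> 2 * norm y"
  shows "norm (tree X J z xs) \<le> majorant (norm z) 2 (2 * M) (length xs) * prod_list (map norm xs)"
proof (induction "length xs" arbitrary: xs rule: less_induct)
  case less
  let ?T = "tree X J z" and ?k = "majorant (norm z) 2 (2 * M)" and ?p = "\<lambda>xs. prod_list (map norm xs)"
  show ?case
  proof (cases "2 \<le> length xs")
    case False
    then consider "xs = []" | x where "xs = [x]"
      by (cases xs; cases "tl xs") auto
    then show ?thesis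
      using J by cases (auto simp: tree_Nil tree_single majorant_0 majorant_1)
  next
    case True
    have p0: "0 \<le> ?p ys" for ys :: "'a list" by (induction ys) auto
    have k0: "0 \<le> ?k n" for n by (rule majorant_nonneg) (auto simp: M_nonneg)
    have "norm (?T xs) \<le> 2 * norm (\<Sum>(i, j, l)\<in>triples (length xs). X (?T (take i xs))
          (?T (take j (drop i xs))) (?T (drop j (drop i xs))))"
      unfolding tree_rec[OF True] by (rule J)
    also have "\<dots> \<le> 2 * (\<Sum>(i, j, l)\<in>triples (length xs). M * (?k i * ?k j * ?k l * ?p xs))"
    proof (intro mult_left_mono sum_norm_le)
      fix t assume t: "t \<in> triples (length xs)"
      obtain i j l where tt: "t = (i, j, l)" by (cases t)
      have ij: "i + j + l = length xs" "i < length xs" "j < length xs" "l < length xs"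
        using t by (auto simp: tt triples_def)
      let ?a = "take i xs" and ?b = "take j (drop i xs)" and ?c = "drop j (drop i xs)"
      have len: "length ?a = i" "length ?b = j" "length ?c = l" using ij by auto
      have 1: "norm (?T ?a) \<le> ?k i * ?p ?a" "norm (?T ?b) \<le> ?k j * ?p ?b" "norm (?T ?c) \<le> ?k l * ?p ?c"
        using less[of ?a] less[of ?b] less[of ?c] ij unfolding len by auto
      have "xs = ?a @ ?b @ ?c" by (metis append_take_drop_id)
      then have "?p xs = ?p (?a @ ?b @ ?c)" by simp
      also have "\<dots> = ?p ?a * ?p ?b * ?p ?c" by (simp only: map_append prod_list.append mult.assoc)
      finally have pp: "?p xs = ?p ?a * ?p ?b * ?p ?c" .
      have "norm (X (?T ?a) (?T ?b) (?T ?c)) \<le> M * (norm (?T ?a) * norm (?T ?b) * norm (?T ?c))"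
        by (rule bound)
      also have "\<dots> \<le> M * ((?k i * ?p ?a) * (?k j * ?p ?b) * (?k l * ?p ?c))"
        using 1 by (intro mult_left_mono mult_mono M_nonneg mult_nonneg_nonneg k0 p0) auto
      also have "\<dots> = M * (?k i * ?k j * ?k l * ?p xs)"
        unfolding pp by (simp add: mult_ac)
      finally show "norm (case t of (i, j, l) \<Rightarrow> X (?T (take i xs)) (?T (take j (drop i xs)))
          (?T (drop j (drop i xs)))) \<le> (case t of (i, j, l) \<Rightarrow> M * (?k i * ?k j * ?k l * ?p xs))"
        by (simp add: tt)
    qed auto
    also have "\<dots> = ?k (length xs) * ?p xs"
      using True by (simp add: majorant_rec sum_distrib_left sum_distrib_right case_prod_unfold mult_ac)
    finally show ?thesis .
  qed
qed

text \<open>Absolute summability over all triples, and not merely an iterated limit, is what later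
  permits regrouping by the total degree \<open>i + j + l\<close>.\<close>

lemma has_sum_triple:
  fixes a :: "nat \<Rightarrow> 'a"
  assumes "summable (\<lambda>n. norm (a n))" and s: "a sums z"
  shows "((\<lambda>(i, j, l). X (a i) (a j) (a l)) has_sum X z z z) UNIV"
    and "(\<lambda>(i, j, l). norm (X (a i) (a j) (a l))) summable_on UNIV"
proof -
  have abs: "(\<lambda>n. norm (a n)) summable_on UNIV"
    using assms(1) by (subst summable_on_UNIV_nonneg_real_iff) auto
  define N where "N = (\<Sum>\<^sub>\<infinity>n. norm (a n))"
  have N: "((\<lambda>n. norm (a n)) has_sum N) UNIV"
    unfolding N_def using abs by simp
  have hs: "(a has_sum z) UNIV"
    using assms norm_summable_imp_has_sum by blast
  have pair: "(\<lambda>(j, l). norm (a j) * norm (a l)) summable_on UNIV \<times> UNIV"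
  proof (rule summable_on_SigmaI)
    show "((\<lambda>l. case (j, l) of (j, l) \<Rightarrow> norm (a j) * norm (a l)) has_sum norm (a j) * N) UNIV" for j
      using has_sum_cmult_right[OF N] by simp
    show "(\<lambda>j. norm (a j) * N) summable_on UNIV"
      using has_sum_cmult_left[OF N] by (auto simp: summable_on_def)
  qed auto
  have N2: "((\<lambda>(j, l). norm (a j) * norm (a l)) has_sum N * N) (UNIV \<times> UNIV)"
    by (rule has_sum_SigmaI[OF _ has_sum_cmult_left[OF N] pair]) (use has_sum_cmult_right[OF N] in simp)
  have "(\<lambda>(i, j, l). norm (a i) * (norm (a j) * norm (a l))) summable_on UNIV \<times> UNIV"
  proof (rule summable_on_SigmaI)
    show "((\<lambda>q. case (i, q) of (i, j, l) \<Rightarrow> norm (a i) * (norm (a j) * norm (a l))) has_sum norm (a i) * (N * N)) UNIV" for i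
      using has_sum_cmult_right[OF N2, of "norm (a i)"] by (simp add: case_prod_unfold)
    show "(\<lambda>i. norm (a i) * (N * N)) summable_on UNIV"
      using has_sum_cmult_left[OF N] by (auto simp: summable_on_def)
  qed auto
  then have "(\<lambda>t. M * (case t of (i, j, l) \<Rightarrow> norm (a i) * (norm (a j) * norm (a l)))) summable_on UNIV"
    by (intro summable_on_cmult_right) simp
  then have "(\<lambda>t. norm (case t of (i, j, l) \<Rightarrow> X (a i) (a j) (a l))) summable_on UNIV"
    by (rule Infinite_Sum.abs_summable_on_comparison_test') (use bound in \<open>auto simp: mult_ac\<close>)
  note ab = this
  then show "(\<lambda>(i, j, l). norm (X (a i) (a j) (a l))) summable_on UNIV"
    by (simp add: case_prod_unfold)
  from ab have su: "(\<lambda>(i, j, l). X (a i) (a j) (a l)) summable_on UNIV"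
    by (rule abs_summable_summable)
  have su2: "(\<lambda>(j, l). X (a i) (a j) (a l)) summable_on UNIV" for i
  proof (rule abs_summable_summable, rule Infinite_Sum.abs_summable_on_comparison_test')
    show "(\<lambda>t. M * norm (a i) * (case t of (j, l) \<Rightarrow> norm (a j) * norm (a l))) summable_on UNIV"
      using pair by (intro summable_on_cmult_right) simp
  qed (use bound in \<open>auto simp: mult_ac\<close>)
  have "((\<lambda>(j, l). X (a i) (a j) (a l)) has_sum X (a i) z z) (UNIV \<times> UNIV)" for i
  proof (rule has_sum_SigmaI)
    show "((\<lambda>j. X (a i) (a j) z) has_sum X (a i) z z) UNIV"
      by (rule has_sum_bounded_linear[OF bounded_linear2 hs])
  qed (use su2 has_sum_bounded_linear[OF bounded_linear3 hs] in auto)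
  then have "((\<lambda>(i, j, l). X (a i) (a j) (a l)) has_sum X z z z) (UNIV \<times> UNIV)"
    by (intro has_sum_SigmaI[where g = "\<lambda>i. X (a i) z z"])
       (use su has_sum_bounded_linear[OF bounded_linear1 hs] in auto)
  then show "((\<lambda>(i, j, l). X (a i) (a j) (a l)) has_sum X z z z) UNIV" by simp
qed

text \<open>The equation is compared degree by degree in \<open>h\<close>: degree zero fixes
  \<open>z\<close>, degree one is the linearised equation solved by \<open>J\<close>, and from
  degree two on the recursion of \<open>tree\<close> matches the cubic term. The clauses on
  \<open>A 0\<close> and \<open>A 1\<close> are kept for the domain and the derivative of the
  midpoint map.\<close>

lemma local_inverse:
  assumes z: "6 * M * (norm z)\<^sup>2 \<le> 1"
  obtains \<rho> K A J where "0 < \<rho>" "\<forall>n. 0 \<le> K n" "summable (\<lambda>n. K n * \<rho> ^ n)"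
    "\<forall>n. bounded_multilinear UNIV norm UNIV norm n (A n) (K n)"
    "A 0 [] = z" "\<forall>h. A 1 [h] = J h" "\<forall>h. J h - L z (J h) = h"
    "\<forall>h. norm h < \<rho> \<longrightarrow>
       (\<exists>w. (\<lambda>n. A n (replicate n h)) sums w \<and> w - X w w w = z - X z z z + h)"
proof -
  obtain J where J: "bounded_linear J" "\<And>y. J y - L z (J y) = y" "\<And>y. norm (J y) \<le> 2 * norm y"
    using inverse_exists[OF z] by blast
  interpret J: bounded_linear J by (rule J(1))
  let ?k = "majorant (norm z) 2 (2 * M)" and ?T = "tree X J z"
  obtain \<rho> where \<rho>: "0 < \<rho>" "summable (\<lambda>n. ?k n * \<rho> ^ n)"
    using majorant_summable[of "norm z" 2 "2 * M"] M_nonneg by auto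
  have ml: "bounded_multilinear UNIV norm UNIV norm n ?T (?k n)" for n
    unfolding bounded_multilinear_def using tree_multilinear[OF J(1)] norm_tree[OF J(3)] by auto
  have sol: "\<exists>w. (\<lambda>n. ?T (replicate n h)) sums w \<and> w - X w w w = z - X z z z + h" if h: "norm h < \<rho>" for h
  proof -
    define a where "a n = ?T (replicate n h)" for n
    have a0: "a 0 = z" by (simp add: a_def tree_Nil)
    have k0: "0 \<le> ?k n" for n by (rule majorant_nonneg) (auto simp: M_nonneg)
    have "norm (a n) \<le> ?k n * \<rho> ^ n" for n
    proof -
      have "norm (a n) \<le> ?k n * norm h ^ n"
        using norm_tree[OF J(3), of z "replicate n h"] by (simp add: a_def)
      also have "\<dots> \<le> ?k n * \<rho> ^ n"
        using h k0 by (intro mult_left_mono power_mono) auto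
      finally show ?thesis .
    qed
    then have su: "summable (\<lambda>n. norm (a n))"
      using \<rho>(2) by (intro summable_comparison_test'[OF \<rho>(2), where N = 0]) simp
    then obtain w where w: "a sums w"
      using summable_norm_cancel summable_sums by blast
    let ?f = "\<lambda>(i, j, l). X (a i) (a j) (a l)"
    define P where "P n = {(i, j, l). i + j + l = (n::nat)}" for n
    have finP: "finite (P n)" for n
      by (rule finite_subset[of _ "{..n} \<times> {..n} \<times> {..n}"]) (auto simp: P_def)
    have step: "a n = (if n = 1 then h else 0) + sum ?f (P n)" if "1 \<le> n" for n
    proof -
      have "a n = J ((if n = 1 then h else 0) + sum ?f (triples n))"
      proof (cases "n = 1")
        case True
        moreover have "triples 1 = {}" by (auto simp: triples_def)
        ultimately show ?thesis by (simp add: a_def tree_single)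
      next
        case False
        have "sum ?f (triples n) = (\<Sum>(i, j, l)\<in>triples n. X (?T (take i (replicate n h)))
          (?T (take j (drop i (replicate n h)))) (?T (drop j (drop i (replicate n h)))))"
          by (intro sum.cong) (auto simp: a_def triples_def min_def)
        then show ?thesis
          using False that by (simp add: a_def tree_rec)
      qed
      then have "a n - L z (a n) = (if n = 1 then h else 0) + sum ?f (triples n)"
        using J(2) by simp
      \<comment> \<open>Besides \<open>triples n\<close>, exactly the three triples with two zeros
        have sum \<open>n\<close>; together they form \<open>L z (a n)\<close>.\<close>
      moreover have "P n = triples n \<union> {(n, 0, 0), (0, n, 0), (0, 0, n)}"
        using that by (auto simp: P_def triples_def)
      then have "sum ?f (P n) = sum ?f (triples n) + L z (a n)"
      proof -
        assume P: "P n = triples n \<union> {(n, 0, 0), (0, n, 0), (0, 0, n)}"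
        have "triples n \<inter> {(n, 0, 0), (0, n, 0), (0, 0, n)} = {}"
          by (auto simp: triples_def)
        from sum.union_disjoint[OF finite_triples _ this, of ?f] show ?thesis
          using that by (simp add: P L_def a0)
      qed
      ultimately show ?thesis by (simp add: algebra_simps)
    qed
    have tr: "(?f has_sum X w w w) UNIV"
      by (rule has_sum_triple[OF su w])
    have "bij_betw snd (Sigma UNIV P) UNIV"
      by (rule bij_betwI[where g = "\<lambda>(i, j, l). (i + j + l, (i, j, l))"]) (auto simp: P_def)
    from has_sum_reindex_bij_betw[OF this, of ?f "X w w w"] tr
    have "((\<lambda>x. ?f (snd x)) has_sum X w w w) (Sigma UNIV P)" by simp
    then have "((\<lambda>n. sum ?f (P n)) has_sum X w w w) UNIV"
      by (rule has_sum_SigmaD) (use finP in \<open>simp add: has_sum_finiteI\<close>)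
    then have s1: "(\<lambda>n. sum ?f (P n)) sums X w w w"
      by (rule has_sum_imp_sums)
    have "(\<lambda>n. (if n = 0 then z - X z z z else 0) + (if n = 1 then h else 0) + sum ?f (P n)) sums
        ((z - X z z z) + h + X w w w)"
      by (intro sums_add s1 sums_single)
    moreover have "(if n = 0 then z - X z z z else 0) + (if n = 1 then h else 0) + sum ?f (P n) = a n" for n
    proof (cases "n = 0")
      case True
      have "P 0 = {(0, 0, 0)}" by (auto simp: P_def)
      with True show ?thesis by (simp add: a0)
    qed (use step[of n] in auto)
    ultimately have "w = (z - X z z z) + h + X w w w"
      using w sums_unique2 by simp
    then have "w - X w w w = z - X z z z + h"
      by (metis add_diff_cancel_right')
    then show ?thesis using w unfolding a_def by blast
  qed
  show ?thesis
    by (rule that[of \<rho> ?k "\<lambda>n. ?T" J])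
       (use \<rho> ml sol J(2) majorant_nonneg[of "norm z" 2 "2 * M"] M_nonneg in \<open>auto simp: tree_Nil tree_single\<close>)
qed

end

section \<open>Weighted sequence spaces\<close>

text \<open>The type \<open>l2\<close> serves as the model of all the spaces \<open>ell2 s\<close>, through the isometries \<open>emb s\<close>.\<close>

definition wt :: "real \<Rightarrow> int \<Rightarrow> real" where
  "wt s j = real_of_int \<bar>j\<bar> powr s"

text \<open>\<open>0 powr s = 0\<close> holds also for \<open>s = 0\<close>, so the weight vanishes
  at the excluded index and sums over \<open>Zstar\<close> may be taken over all integers.\<close>

lemma wt_nonneg [simp]: "0 \<le> wt s j" and wt_at_0 [simp]: "wt s 0 = 0"
  and wt_0 [simp]: "j \<noteq> 0 \<Longrightarrow> wt 0 j = 1"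
  by (simp_all add: wt_def)

lemma wt_cancel: "j \<noteq> 0 \<Longrightarrow> wt s j * wt (- s) j = 1" "j \<noteq> 0 \<Longrightarrow> wt (- s) j * wt s j = 1"
  by (simp_all add: wt_def flip: powr_add)

lemma wt_square: "(cmod z)\<^sup>2 * real_of_int \<bar>j\<bar> powr (2 * s) = (cmod z * wt s j)\<^sup>2"
  by (simp add: wt_def power_mult_distrib power2_eq_square powr_add[symmetric] flip: mult_2)

lemma ell2_norm_UNIV: "ell2_norm s f = sqrt (\<Sum>\<^sub>\<infinity>j. (cmod (f j) * wt s j)\<^sup>2)"
  unfolding ell2_norm_def wt_square
  by (intro arg_cong[of _ _ sqrt] infsum_cong_neutral) (auto simp: Zstar_def)

lemma ell2_iff: "f \<in> ell2 s \<longleftrightarrow> f 0 = 0 \<and> (\<lambda>j. (cmod (f j) * wt s j)\<^sup>2) summable_on UNIV"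
proof -
  have "(\<lambda>j. (cmod (f j) * wt s j)\<^sup>2) summable_on Zstar \<longleftrightarrow> (\<lambda>j. (cmod (f j) * wt s j)\<^sup>2) summable_on UNIV"
    by (intro summable_on_cong_neutral) (auto simp: Zstar_def)
  then show ?thesis unfolding ell2_def wt_square by simp
qed

lemma ell2_norm_nonneg [simp]: "0 \<le> ell2_norm s f"
  unfolding ell2_norm_UNIV by (intro real_sqrt_ge_zero infsum_nonneg) simp

lemma ell2I:
  assumes "f 0 = 0" "0 \<le> B" "\<And>F. finite F \<Longrightarrow> (\<Sum>j\<in>F. (cmod (f j) * wt s j)\<^sup>2) \<le> B\<^sup>2"
  shows "f \<in> ell2 s" "ell2_norm s f \<le> B"
proof -
  have su: "(\<lambda>j. (cmod (f j) * wt s j)\<^sup>2) summable_on UNIV"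
    by (rule nonneg_bdd_above_summable_on) (use assms in \<open>auto intro!: bdd_aboveI2\<close>)
  then show "f \<in> ell2 s" using assms by (simp add: ell2_iff)
  have "(\<Sum>\<^sub>\<infinity>j. (cmod (f j) * wt s j)\<^sup>2) \<le> B\<^sup>2"
    by (rule infsum_le_finite_sums[OF su]) (use assms in auto)
  then show "ell2_norm s f \<le> B"
    unfolding ell2_norm_UNIV using assms(2) by (simp add: real_le_lsqrt infsum_nonneg)
qed

lemma ell2_finite_sum_le:
  assumes "f \<in> ell2 s" "finite F"
  shows "(\<Sum>j\<in>F. (cmod (f j) * wt s j)\<^sup>2) \<le> (ell2_norm s f)\<^sup>2"
  unfolding ell2_norm_UNIV using assms
  by (simp add: ell2_iff infsum_nonneg finite_sum_le_infsum)

lemma ell2_norm_ge: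
  assumes "f \<in> ell2 s"
  shows "cmod (f j) * wt s j \<le> ell2_norm s f"
  by (rule power2_le_imp_le) (use ell2_finite_sum_le[OF assms, of "{j}"] in auto)

lemma ell2_mono:
  assumes g: "g \<in> ell2 s" and "f 0 = 0" "\<And>j. cmod (f j) * wt t j \<le> C * (cmod (g j) * wt s j)" "0 \<le> C"
  shows "f \<in> ell2 t" "ell2_norm t f \<le> C * ell2_norm s g"
proof -
  have "(\<Sum>j\<in>F. (cmod (f j) * wt t j)\<^sup>2) \<le> (C * ell2_norm s g)\<^sup>2" if "finite F" for F
  proof -
    have "(\<Sum>j\<in>F. (cmod (f j) * wt t j)\<^sup>2) \<le> (\<Sum>j\<in>F. C\<^sup>2 * (cmod (g j) * wt s j)\<^sup>2)"
      unfolding power_mult_distrib[symmetric] by (intro sum_mono power_mono assms) auto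
    also have "\<dots> \<le> C\<^sup>2 * (ell2_norm s g)\<^sup>2"
      unfolding sum_distrib_left[symmetric] by (intro mult_left_mono ell2_finite_sum_le g that) auto
    finally show ?thesis by (simp add: power_mult_distrib)
  qed
  from ell2I[OF assms(2) _ this] show "f \<in> ell2 t" "ell2_norm t f \<le> C * ell2_norm s g"
    using \<open>0 \<le> C\<close> by auto
qed

lemma zero_in_ell2 [simp]: "0 \<in> ell2 s"
  by (simp add: ell2_iff)

lemma ell2_scaleR:
  assumes "f \<in> ell2 s"
  shows "r *\<^sub>R f \<in> ell2 s" "ell2_norm s (r *\<^sub>R f) = \<bar>r\<bar> * ell2_norm s f"
proof -
  have *: "(cmod ((r *\<^sub>R f) j) * wt s j)\<^sup>2 = r\<^sup>2 * (cmod (f j) * wt s j)\<^sup>2" for j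
    by (simp add: scaleR_fun_def power_mult_distrib)
  show "r *\<^sub>R f \<in> ell2 s"
    using assms unfolding ell2_iff * by (auto simp: scaleR_fun_def intro: summable_on_cmult_right)
  show "ell2_norm s (r *\<^sub>R f) = \<bar>r\<bar> * ell2_norm s f"
    unfolding ell2_norm_UNIV * using assms
    by (simp add: infsum_cmult_right' real_sqrt_mult)
qed

section \<open>The model space and its completeness\<close>

typedef l2 = "ell2 0" morphisms l2_seq Abs_l2
  by (rule exI[of _ 0]) simp

setup_lifting type_definition_l2

instantiation l2 :: real_normed_vector
begin

lift_definition zero_l2 :: l2 is 0 by simp
lift_definition plus_l2 :: "l2 \<Rightarrow> l2 \<Rightarrow> l2" is "\<lambda>u v. u + v" by (rule ell2_add)
lift_definition uminus_l2 :: "l2 \<Rightarrow> l2" is "\<lambda>u. - u" by (simp add: ell2_uminus)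
lift_definition minus_l2 :: "l2 \<Rightarrow> l2 \<Rightarrow> l2" is "\<lambda>u v. u - v" by (rule ell2_diff)
lift_definition scaleR_l2 :: "real \<Rightarrow> l2 \<Rightarrow> l2" is "\<lambda>r u. r *\<^sub>R u" by (rule ell2_scaleR)
lift_definition norm_l2 :: "l2 \<Rightarrow> real" is "ell2_norm 0" .

definition dist_l2 :: "l2 \<Rightarrow> l2 \<Rightarrow> real" where "dist_l2 x y = norm (x - y)"
definition sgn_l2 :: "l2 \<Rightarrow> l2" where "sgn_l2 x = inverse (norm x) *\<^sub>R x"
definition uniformity_l2 :: "(l2 \<times> l2) filter" where
  "uniformity_l2 = (INF e\<in>{0<..}. principal {(x, y). dist x y < e})"
definition open_l2 :: "l2 set \<Rightarrow> bool" where
  "open_l2 U = (\<forall>x\<in>U. \<forall>\<^sub>F (x', y) in uniformity. x' = x \<longrightarrow> y \<in> U)"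

instance
proof
  fix x y z :: l2 and a b :: real
  show "x + y + z = x + (y + z)" by transfer (rule add.assoc)
  show "x + y = y + x" by transfer (rule add.commute)
  show "0 + x = x" by transfer (rule add_0)
  show "- x + x = 0" by transfer (rule add.left_inverse)
  show "x - y = x + - y" by transfer (rule diff_conv_add_uminus)
  show "a *\<^sub>R (x + y) = a *\<^sub>R x + a *\<^sub>R y" by transfer (rule scaleR_add_right)
  show "(a + b) *\<^sub>R x = a *\<^sub>R x + b *\<^sub>R x" by transfer (rule scaleR_add_left)
  show "a *\<^sub>R b *\<^sub>R x = (a * b) *\<^sub>R x" by transfer (rule scaleR_scaleR)
  show "1 *\<^sub>R x = x" by transfer (rule scaleR_one)
  show "norm (x + y) \<le> norm x + norm y" by transfer (rule ell2_add)
  show "norm (a *\<^sub>R x) = \<bar>a\<bar> * norm x" by transfer (rule ell2_scaleR)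
  show "norm x = 0 \<longleftrightarrow> x = 0" by transfer (rule ell2_norm_eq_0)
qed (rule dist_l2_def sgn_l2_def uniformity_l2_def open_l2_def)+

end

lemma l2_seq_simps [simp]:
  "l2_seq 0 j = 0" "l2_seq (x + y) j = l2_seq x j + l2_seq y j" "l2_seq (x - y) j = l2_seq x j - l2_seq y j"
  "l2_seq (- x) j = - l2_seq x j" "l2_seq (r *\<^sub>R x) j = r *\<^sub>R l2_seq x j" "l2_seq x 0 = 0"
  using l2_seq[of x] by (simp_all add: zero_l2.rep_eq plus_l2.rep_eq minus_l2.rep_eq uminus_l2.rep_eq
    scaleR_l2.rep_eq scaleR_fun_def ell2_iff)

instance l2 :: banach
proof
  fix x :: "nat \<Rightarrow> l2"
  assume C: "Cauchy x"
  let ?x = "\<lambda>n. l2_seq (x n)"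
  have le: "cmod (?x m j - ?x n j) \<le> dist (x m) (x n)" for m n j
  proof (cases "j = 0")
    case False
    then show ?thesis
      using ell2_norm_ge[OF l2_seq, of "x m - x n" j] by (simp add: dist_norm norm_l2.rep_eq)
  qed simp
  have "Cauchy (\<lambda>n. ?x n j)" for j
    using C unfolding Cauchy_def by (metis dist_norm le order.strict_trans1)
  then have "\<exists>f. \<forall>j. (\<lambda>n. ?x n j) \<longlonglongrightarrow> f j"
    by (intro choice) (metis Cauchy_convergent convergent_def)
  then obtain f where f: "\<And>j. (\<lambda>n. ?x n j) \<longlonglongrightarrow> f j" by blast
  have f0: "f 0 = 0"
    using LIMSEQ_unique[OF f[of 0]] by simp
  \<comment> \<open>The limit \<open>f\<close> is known only entry by entry. The Cauchy bound is
    uniform over finite index sets and survives the entrywise limit, which also places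
    \<open>f\<close> in the space.\<close>
  have key: "\<exists>N. \<forall>n\<ge>N. ?x n - f \<in> ell2 0 \<and> ell2_norm 0 (?x n - f) \<le> e" if "0 < e" for e
  proof -
    obtain N where N: "\<And>m n. m \<ge> N \<Longrightarrow> n \<ge> N \<Longrightarrow> dist (x m) (x n) < e"
      using C \<open>0 < e\<close> unfolding Cauchy_def by blast
    have "?x n - f \<in> ell2 0 \<and> ell2_norm 0 (?x n - f) \<le> e" if "n \<ge> N" for n
    proof -
      have "(\<Sum>j\<in>F. (cmod ((?x n - f) j) * wt 0 j)\<^sup>2) \<le> e\<^sup>2" if "finite F" for F
      proof (rule tendsto_upperbound)
        show "((\<lambda>m. \<Sum>j\<in>F. (cmod ((?x n - ?x m) j) * wt 0 j)\<^sup>2) \<longlongrightarrow>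
           (\<Sum>j\<in>F. (cmod ((?x n - f) j) * wt 0 j)\<^sup>2)) sequentially"
          unfolding minus_apply by (intro tendsto_intros f)
        show "\<forall>\<^sub>F m in sequentially. (\<Sum>j\<in>F. (cmod ((?x n - ?x m) j) * wt 0 j)\<^sup>2) \<le> e\<^sup>2"
        proof (rule eventually_sequentiallyI[of N])
          fix m assume "m \<ge> N"
          have "(\<Sum>j\<in>F. (cmod ((?x n - ?x m) j) * wt 0 j)\<^sup>2) \<le> (dist (x n) (x m))\<^sup>2"
            using ell2_finite_sum_le[OF l2_seq \<open>finite F\<close>, of "x n - x m"]
            by (simp add: dist_norm norm_l2.rep_eq minus_l2.rep_eq)
          also have "\<dots> \<le> e\<^sup>2"
            using N[OF \<open>n \<ge> N\<close> \<open>m \<ge> N\<close>] by (intro power_mono) auto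
          finally show "(\<Sum>j\<in>F. (cmod ((?x n - ?x m) j) * wt 0 j)\<^sup>2) \<le> e\<^sup>2" .
        qed
      qed simp
      from ell2I[where f = "?x n - f", OF _ _ this] show ?thesis using f0 \<open>0 < e\<close> by auto
    qed
    then show ?thesis by blast
  qed
  obtain n where "?x n - f \<in> ell2 0" using key[of 1] by auto
  from ell2_diff[OF l2_seq this, of "x n"] have fe: "f \<in> ell2 0" by simp
  have "x \<longlonglongrightarrow> Abs_l2 f"
  proof (rule LIMSEQ_I)
    fix r :: real assume "0 < r"
    then obtain N where N: "\<forall>n\<ge>N. ell2_norm 0 (?x n - f) \<le> r / 2" using key[of "r / 2"] by auto
    have "norm (x n - Abs_l2 f) < r" if "n \<ge> N" for n
    proof -
      have "norm (x n - Abs_l2 f) = ell2_norm 0 (?x n - f)"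
        by (simp add: norm_l2.rep_eq minus_l2.rep_eq Abs_l2_inverse fe)
      also have "\<dots> \<le> r / 2" using N that by blast
      finally show ?thesis using \<open>0 < r\<close> by simp
    qed
    then show "\<exists>no. \<forall>n\<ge>no. norm (x n - Abs_l2 f) < r" by blast
  qed
  then show "convergent x" by (auto simp: convergent_def)
qed

section \<open>Isometries between the model and the weighted spaces\<close>

definition emb :: "real \<Rightarrow> l2 \<Rightarrow> seq" where
  "emb s x = (\<lambda>j. l2_seq x j * of_real (wt (- s) j))"

definition proj :: "real \<Rightarrow> seq \<Rightarrow> l2" where
  "proj s f = Abs_l2 (\<lambda>j. f j * of_real (wt s j))"

lemma emb_lin [simp]: "emb s (x + y) = emb s x + emb s y" "emb s (x - y) = emb s x - emb s y"
  "emb s (- x) = - emb s x" "emb s (r *\<^sub>R x) = r *\<^sub>R emb s x" "emb s 0 = 0"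
  by (auto simp: emb_def fun_eq_iff scaleR_fun_def algebra_simps)

lemma emb_weighted: "cmod (emb s x j) * wt s j = cmod (l2_seq x j) * wt 0 j"
proof (cases "j = 0")
  case False
  have "cmod (emb s x j) * wt s j = cmod (l2_seq x j) * (wt (- s) j * wt s j)"
    by (simp add: emb_def norm_mult)
  also have "\<dots> = cmod (l2_seq x j) * wt 0 j" by (simp only: wt_cancel[OF False] wt_0[OF False])
  finally show ?thesis .
qed simp

lemma emb_in [simp]: "emb s x \<in> ell2 s"
  using l2_seq[of x] unfolding ell2_iff emb_weighted by (simp add: emb_def)

lemma norm_emb [simp]: "ell2_norm s (emb s x) = norm x"
  unfolding ell2_norm_UNIV norm_l2.rep_eq emb_weighted ..

lemma emb_proj:
  assumes "f \<in> ell2 s"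
  shows "emb s (proj s f) = f"
proof -
  have "(\<lambda>j. f j * of_real (wt s j)) \<in> ell2 0"
  proof (rule ell2_mono(1)[OF assms, of _ _ 1])
    show "cmod (f j * complex_of_real (wt s j)) * wt 0 j \<le> 1 * (cmod (f j) * wt s j)" for j
      by (cases "j = 0") (auto simp: norm_mult)
  qed auto
  then have *: "l2_seq (proj s f) j = f j * of_real (wt s j)" for j
    by (simp add: proj_def Abs_l2_inverse)
  have "emb s (proj s f) j = f j" for j
  proof (cases "j = 0")
    case True
    then show ?thesis using assms by (simp add: emb_def ell2_iff)
  next
    case False
    have "emb s (proj s f) j = f j * of_real (wt s j * wt (- s) j)"
      by (simp only: emb_def * of_real_mult mult.assoc)
    also have "\<dots> = f j" by (simp only: wt_cancel[OF False]) simp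
    finally show ?thesis .
  qed
  then show ?thesis by auto
qed

lemma inj_emb: "emb s x = emb s y \<longleftrightarrow> x = y"
proof
  assume "emb s x = emb s y"
  then have "emb s (x - y) = 0" by simp
  then have "norm (x - y) = 0"
    using norm_emb[of s "x - y"] ell2_norm_eq_0[OF zero_in_ell2, of s] by (simp only:)
  then show "x = y" by simp
qed simp

lemma proj_emb [simp]: "proj s (emb s x) = x"
  using emb_proj[OF emb_in, of s x] by (simp add: inj_emb)

lemma openin_norm_topology:
  "openin (norm_topology (ell2 s) (ell2_norm s)) U \<longleftrightarrow>
     U \<subseteq> ell2 s \<and> (\<forall>x\<in>U. \<exists>r>0. \<forall>h\<in>ell2 s. ell2_norm s h < r \<longrightarrow> x + h \<in> U)"
proof -
  interpret Metric_space "ell2 s" "\<lambda>x y. ell2_norm s (x - y)" by (rule Metric_space_ell2)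
  have "(mball x r \<subseteq> U) \<longleftrightarrow> (\<forall>h\<in>ell2 s. ell2_norm s h < r \<longrightarrow> x + h \<in> U)" if "x \<in> ell2 s" for x r
  proof
    assume *: "mball x r \<subseteq> U"
    show "\<forall>h\<in>ell2 s. ell2_norm s h < r \<longrightarrow> x + h \<in> U"
    proof (intro ballI impI)
      fix h assume "h \<in> ell2 s" "ell2_norm s h < r"
      then have "x + h \<in> mball x r"
        using ell2_uminus(2)[of s h] that ell2_add(1)[of x s h] by (simp add: in_mball)
      then show "x + h \<in> U" using * by blast
    qed
  next
    assume *: "\<forall>h\<in>ell2 s. ell2_norm s h < r \<longrightarrow> x + h \<in> U"
    show "mball x r \<subseteq> U"
    proof
      fix y assume y: "y \<in> mball x r"
      then have "y - x \<in> ell2 s" "ell2_norm s (y - x) < r"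
        using ell2_diff commute by (auto simp: in_mball)
      then have "x + (y - x) \<in> U" using * by blast
      then show "y \<in> U" by simp
    qed
  qed
  then show ?thesis
    unfolding openin_mtopology by (auto simp: subset_iff)
qed

section \<open>The implicit midpoint map\<close>

text \<open>Used with \<open>m = 1\<close>, to keep a solution inside a ball, and with
  \<open>m = 2\<close>, where the quadratic smallness in \<open>t\<close> gives
  differentiability.\<close>

lemma power_series_tail:
  fixes g :: "'a::banach"
  assumes \<rho>: "0 < \<rho>" "summable (\<lambda>n. K n * \<rho> ^ n)" "\<And>n. 0 \<le> K n"
    and le: "\<And>n. norm (a n) \<le> K n * t ^ n" and t: "0 \<le> t" "t < \<rho>" and "a sums g"
  shows "norm (g - (\<Sum>n<m. a n)) \<le> (\<Sum>n. K n * \<rho> ^ n) * (t / \<rho>) ^ m"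
proof -
  have K0: "0 \<le> K n * \<rho> ^ n" for n using \<rho> by simp
  have s: "(\<lambda>n. a (n + m)) sums (g - (\<Sum>n<m. a n))"
    using \<open>a sums g\<close> by (rule sums_split_initial_segment)
  have le2: "norm (a (n + m)) \<le> (K (n + m) * \<rho> ^ (n + m)) * (t / \<rho>) ^ m" for n
  proof -
    have "t ^ n \<le> \<rho> ^ n" using t by (intro power_mono) auto
    then have "K (n + m) * (t ^ n * t ^ m) \<le> K (n + m) * (\<rho> ^ n * t ^ m)"
      using \<rho> t by (intro mult_left_mono mult_right_mono) auto
    then have "K (n + m) * t ^ (n + m) \<le> (K (n + m) * \<rho> ^ (n + m)) * (t / \<rho>) ^ m"
      using \<rho> by (simp add: power_add power_divide)
    then show ?thesis using le[of "n + m"] by linarith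
  qed
  have su: "summable (\<lambda>n. K (n + m) * \<rho> ^ (n + m))"
    using \<rho>(2) by (subst summable_iff_shift)
  have "norm (g - (\<Sum>n<m. a n)) \<le> (\<Sum>n. (K (n + m) * \<rho> ^ (n + m)) * (t / \<rho>) ^ m)"
    unfolding sums_unique[OF s] by (rule norm_suminf_le[OF le2]) (intro summable_mult2 su)
  also have "\<dots> = (\<Sum>n. K (n + m) * \<rho> ^ (n + m)) * (t / \<rho>) ^ m"
    by (rule suminf_mult2[OF su, symmetric])
  also have "\<dots> \<le> (\<Sum>n. K n * \<rho> ^ n) * (t / \<rho>) ^ m"
    using suminf_minus_initial_segment[OF \<rho>(2), of m] \<rho> t K0
    by (intro mult_right_mono) (auto intro: sum_nonneg)
  finally show ?thesis .
qed

lemma multilinear_replicate: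
  assumes "bounded_multilinear UNIV norm UNIV norm n a k"
  shows "norm (a (replicate n h)) \<le> k * norm h ^ n"
proof -
  have "norm (a (replicate n h)) \<le> k * prod_list (map norm (replicate n h))"
    using assms unfolding bounded_multilinear_def by (metis length_replicate subset_UNIV)
  then show ?thesis by simp
qed

definition mid_inv :: "('a \<Rightarrow> 'a \<Rightarrow> 'a \<Rightarrow> 'a) \<Rightarrow> real \<Rightarrow> 'a \<Rightarrow> 'a::real_normed_vector" where
  "mid_inv X r = inv_into (ball 0 r) (\<lambda>z. z - X z z z)"

definition mid_dom :: "('a \<Rightarrow> 'a \<Rightarrow> 'a \<Rightarrow> 'a) \<Rightarrow> real \<Rightarrow> 'a::real_normed_vector set" where
  "mid_dom X r = (\<lambda>z. z - X z z z) ` ball 0 r"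

text \<open>For \<open>z = mid_inv X r x\<close> one has \<open>X z z z = z - x\<close>, hence
  \<open>z + X z z z = 2 z - x\<close>. In this form a power series of the inverse is at once a
  power series of the map.\<close>

definition mid_map :: "('a \<Rightarrow> 'a \<Rightarrow> 'a \<Rightarrow> 'a) \<Rightarrow> real \<Rightarrow> 'a \<Rightarrow> 'a::real_normed_vector" where
  "mid_map X r x = 2 *\<^sub>R mid_inv X r x - x"

context trilinear
begin

text \<open>The difference telescopes into three terms, each at most
  \<open>M r^2 norm (z - w)\<close>; the 6 in the hypothesis turns their sum into one half.\<close>

lemma cubic_lipschitz:
  assumes "6 * M * r\<^sup>2 \<le> 1" "norm z \<le> r" "norm w \<le> r"
  shows "norm (X z z z - X w w w) \<le> 1/2 * norm (z - w)"
proof -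
  have "X z z z - X w w w = X (z - w) z z + X w (z - w) z + X w w (z - w)"
    by (simp add: diff1 diff2 diff3)
  then have "norm (X z z z - X w w w) \<le> norm (X (z - w) z z) + norm (X w (z - w) z) + norm (X w w (z - w))"
    by (metis norm_triangle_ineq norm_triangle_mono order_refl)
  also have "\<dots> \<le> M * (norm (z - w) * r * r) + M * (r * norm (z - w) * r) + M * (r * r * norm (z - w))"
    using assms(2,3) order_trans[OF norm_ge_zero assms(2)]
    by (intro add_mono order_trans[OF bound] mult_left_mono M_nonneg mult_mono) auto
  also have "\<dots> = (6 * M * r\<^sup>2) / 2 * norm (z - w)"
    by (simp add: power2_eq_square algebra_simps)
  also have "\<dots> \<le> 1/2 * norm (z - w)"
    using assms by (intro mult_right_mono) auto
  finally show ?thesis .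
qed

lemma inj_cubic:
  assumes "6 * M * r\<^sup>2 \<le> 1"
  shows "inj_on (\<lambda>z. z - X z z z) (ball 0 r)"
proof (rule inj_onI)
  fix z w assume "z \<in> ball 0 r" "w \<in> ball 0 r" and eq: "z - X z z z = w - X w w w"
  then have "norm (X z z z - X w w w) \<le> 1/2 * norm (z - w)"
    by (intro cubic_lipschitz[OF assms]) auto
  moreover have "X z z z - X w w w = z - w" using eq by (simp add: algebra_simps)
  ultimately show "z = w" by simp
qed

lemma mid_inv:
  assumes "6 * M * r\<^sup>2 \<le> 1"
  shows "norm z < r \<Longrightarrow> mid_inv X r (z - X z z z) = z"
    and "x \<in> mid_dom X r \<Longrightarrow> norm (mid_inv X r x) < r"
    and "x \<in> mid_dom X r \<Longrightarrow> mid_inv X r x - X (mid_inv X r x) (mid_inv X r x) (mid_inv X r x) = x"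
    and "x \<in> mid_dom X r \<Longrightarrow> mid_map X r x = mid_inv X r x + X (mid_inv X r x) (mid_inv X r x) (mid_inv X r x)"
proof -
  show 1: "mid_inv X r (z - X z z z) = z" if "norm z < r" for z
    using inv_into_f_f[OF inj_cubic[OF assms], of z] that by (simp add: mid_inv_def)
  show "norm (mid_inv X r x) < r" if "x \<in> mid_dom X r"
    using that 1 by (auto simp: mid_dom_def)
  show 2: "mid_inv X r x - X (mid_inv X r x) (mid_inv X r x) (mid_inv X r x) = x" if "x \<in> mid_dom X r"
    using that 1 by (auto simp: mid_dom_def)
  show "mid_map X r x = mid_inv X r x + X (mid_inv X r x) (mid_inv X r x) (mid_inv X r x)" if "x \<in> mid_dom X r"
    using 2[OF that] by (simp add: mid_map_def scaleR_2 algebra_simps)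
qed

text \<open>The last clause is the Cayley form of the derivative, written through the preimage
  \<open>a\<close> of \<open>u\<close> under \<open>1 - L\<close> so that no inverse operator has to
  be named.\<close>

lemma mid_map_series:
  assumes r: "6 * M * r\<^sup>2 \<le> 1" and x: "x \<in> mid_dom X r"
  obtains \<rho> K A where "0 < \<rho>" "\<forall>n. 0 \<le> K n" "summable (\<lambda>n. K n * \<rho> ^ n)"
    "\<forall>n. bounded_multilinear UNIV norm UNIV norm n (A n) (K n)"
    "\<forall>h. norm h < \<rho> \<longrightarrow> x + h \<in> mid_dom X r \<and> (\<lambda>n. A n (replicate n h)) sums mid_map X r (x + h)"
    "\<forall>u. \<exists>a. u = a - L (mid_inv X r x) a \<and> A 1 [u] = a + L (mid_inv X r x) a"
proof -
  define z where "z = mid_inv X r x"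
  have z: "norm z < r" "z - X z z z = x" using mid_inv(2,3)[OF r x] by (simp_all add: z_def)
  have "6 * M * (norm z)\<^sup>2 \<le> 6 * M * r\<^sup>2"
    using z M_nonneg by (intro mult_left_mono power_mono) auto
  with r have "6 * M * (norm z)\<^sup>2 \<le> 1" by linarith
  then obtain \<rho> K A J where A: "0 < \<rho>" "\<forall>n. 0 \<le> K n" "summable (\<lambda>n. K n * \<rho> ^ n)"
    "\<forall>n. bounded_multilinear UNIV norm UNIV norm n (A n) (K n)"
    "A 0 [] = z" "\<forall>h. A 1 [h] = J h" "\<forall>h. J h - L z (J h) = h"
    "\<forall>h. norm h < \<rho> \<longrightarrow>
       (\<exists>w. (\<lambda>n. A n (replicate n h)) sums w \<and> w - X w w w = z - X z z z + h)"
    by (rule local_inverse) (rule that)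
  note A = A[rule_format]
  define S where "S = (\<Sum>n. K n * \<rho> ^ n)"
  have S: "0 \<le> S" unfolding S_def using A by (intro suminf_nonneg) auto
  \<comment> \<open>Small enough for the solution \<open>w\<close> to stay in the ball of radius
    \<open>r\<close>; only there is it known to be the value of \<open>mid_inv\<close>.\<close>
  define \<rho>' where "\<rho>' = min \<rho> ((r - norm z) * \<rho> / (S + 1))"
  have \<rho>': "0 < \<rho>'" "\<rho>' \<le> \<rho>" using A(1) z S by (auto simp: \<rho>'_def)
  have sol: "x + h \<in> mid_dom X r \<and> (\<lambda>n. A n (replicate n h)) sums mid_inv X r (x + h)" if h: "norm h < \<rho>'" for h
  proof -
    obtain w where w: "(\<lambda>n. A n (replicate n h)) sums w" "w - X w w w = x + h"
      using A(8)[of h] h \<rho>' z by auto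
    have le: "norm (A n (replicate n h)) \<le> K n * norm h ^ n" for n
      by (rule multilinear_replicate[OF A(4)])
    have "norm (w - (\<Sum>n<1. A n (replicate n h))) \<le> S * (norm h / \<rho>) ^ 1"
      unfolding S_def using h \<rho>' w by (intro power_series_tail[OF A(1,3,2) le]) auto
    then have "norm (w - z) \<le> S * (norm h / \<rho>)" using A(5) by simp
    also have "\<dots> \<le> S * (((r - norm z) * \<rho> / (S + 1)) / \<rho>)"
      using h S A(1) by (intro mult_left_mono divide_right_mono) (auto simp: \<rho>'_def)
    also have "\<dots> = S / (S + 1) * (r - norm z)" using A(1) by simp
    also have "\<dots> < 1 * (r - norm z)" using S z by (intro mult_strict_right_mono) auto
    finally have "norm w < r" using norm_triangle_ineq2[of w z] by simp
    then show ?thesis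
      using w mid_inv(1)[OF r, of w] by (auto simp: mid_dom_def intro!: image_eqI[of _ _ w])
  qed
  \<comment> \<open>Taylor coefficients of \<open>h \<mapsto> x + h\<close>, to be subtracted from
    twice those of the inverse.\<close>
  define B where "B n = (if n = 0 then (\<lambda>_. x) else if n = 1 then hd else (\<lambda>_. 0))" for n :: nat
  define KB where "KB n = (if n = 0 then norm x else if n = 1 then 1 else 0)" for n :: nat
  have B: "(\<lambda>n. B n (replicate n h)) sums (x + h)" for h
  proof -
    have "(\<lambda>n. (if n = 0 then x else 0) + (if n = 1 then h else 0)) sums (x + h)"
      by (intro sums_add sums_single)
    moreover have "(if n = 0 then x else 0) + (if n = 1 then h else 0) = B n (replicate n h)" for n
      by (auto simp: B_def)
    ultimately show ?thesis by simp
  qed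
  have Bl: "B n (xs @ (a *\<^sub>R u + b *\<^sub>R v) # ys) = a *\<^sub>R B n (xs @ u # ys) + b *\<^sub>R B n (xs @ v # ys)"
    if "length xs + 1 + length ys = n" for n xs ys a b u v
    using that by (auto simp: B_def)
  have Bb: "norm (B n xs) \<le> KB n * prod_list (map norm xs)" if "length xs = n" for n xs
    using that by (cases xs) (auto simp: B_def KB_def)
  define A' where "A' n xs = 2 *\<^sub>R A n xs - B n xs" for n xs
  define K' where "K' n = 2 * K n + KB n" for n
  have "summable KB" by (rule summable_finite[of "{0,1}"]) (auto simp: KB_def)
  have sKB: "summable (\<lambda>n. KB n * \<rho>' ^ n)" by (rule summable_finite[of "{0,1}"]) (auto simp: KB_def)
  have sK: "summable (\<lambda>n. K n * \<rho>' ^ n)"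
    by (rule summable_comparison_test'[OF A(3), where N = 0])
       (use A \<rho>' in \<open>auto intro!: mult_left_mono power_mono\<close>)
  show ?thesis
  proof (rule that[of \<rho>' K' A'], unfold atomize_all[symmetric] atomize_imp[symmetric])
    show "0 \<le> K' n" for n using A(2) by (simp add: K'_def KB_def)
    have "summable (\<lambda>n. 2 * (K n * \<rho>' ^ n) + KB n * \<rho>' ^ n)"
      by (intro summable_add summable_mult sKB sK)
    then show "summable (\<lambda>n. K' n * \<rho>' ^ n)" by (simp add: K'_def algebra_simps)
    show "bounded_multilinear UNIV norm UNIV norm n (A' n) (K' n)" for n
      unfolding bounded_multilinear_def
    proof (intro conjI allI impI UNIV_I)
      fix xs :: "'a list" assume xs: "length xs = n \<and> set xs \<subseteq> UNIV"
      have "norm (A' n xs) \<le> 2 * norm (A n xs) + norm (B n xs)"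
        unfolding A'_def by (metis abs_numeral norm_scaleR norm_triangle_ineq4)
      also have "\<dots> \<le> 2 * (K n * prod_list (map norm xs)) + KB n * prod_list (map norm xs)"
        using A(4)[of n] Bb xs unfolding bounded_multilinear_def by (intro add_mono mult_left_mono) auto
      finally show "norm (A' n xs) \<le> K' n * prod_list (map norm xs)"
        by (simp add: K'_def algebra_simps)
    next
      fix xs ys :: "'a list" and u v :: 'a and a b :: real
      assume len: "length xs + 1 + length ys = n \<and> set xs \<subseteq> UNIV \<and> set ys \<subseteq> UNIV \<and> u \<in> UNIV \<and> v \<in> UNIV"
      then have "A n (xs @ (a *\<^sub>R u + b *\<^sub>R v) # ys) = a *\<^sub>R A n (xs @ u # ys) + b *\<^sub>R A n (xs @ v # ys)"
        using A(4)[of n] unfolding bounded_multilinear_def by blast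
      then show "A' n (xs @ (a *\<^sub>R u + b *\<^sub>R v) # ys) = a *\<^sub>R A' n (xs @ u # ys) + b *\<^sub>R A' n (xs @ v # ys)"
        using Bl len by (simp add: A'_def algebra_simps)
    qed
    show "x + h \<in> mid_dom X r \<and> (\<lambda>n. A' n (replicate n h)) sums mid_map X r (x + h)" if h: "norm h < \<rho>'" for h
      unfolding A'_def mid_map_def using sol[OF h] B[of h] by (auto intro!: sums_diff sums_scaleR_right)
    show "\<exists>a. u = a - L (mid_inv X r x) a \<and> A' 1 [u] = a + L (mid_inv X r x) a" for u
    proof (intro exI conjI)
      show "u = J u - L (mid_inv X r x) (J u)" using A(7)[of u] by (simp add: z_def)
      have "L z (J u) = J u - u" using A(7)[of u] by (simp add: algebra_simps)
      then have "A' 1 [u] = J u + L z (J u)" using A(6)[of u] by (simp add: A'_def B_def scaleR_2)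
      then show "A' 1 [u] = J u + L (mid_inv X r x) (J u)" by (simp add: z_def)
    qed
  qed (use \<rho>' in auto)
qed

lemma uminus: "trilinear (\<lambda>x y z. - X x y z) M"
  by unfold_locales (use bound in \<open>auto simp: lin1 lin2 lin3 M_nonneg\<close>)

text \<open>The midpoint rule is symmetric: the midpoint \<open>z\<close> of
  \<open>x = z - X z z z\<close> and \<open>y = z + X z z z\<close> is also the midpoint for
  \<open>-X\<close>, with the two ends exchanged. Analyticity of the inverse thus needs no separate
  argument.\<close>

lemma mid_map_inverse:
  assumes r: "6 * M * r\<^sup>2 \<le> 1" and x: "x \<in> mid_dom X r"
  shows "mid_map X r x \<in> mid_dom (\<lambda>x y z. - X x y z) r"
    and "mid_map (\<lambda>x y z. - X x y z) r (mid_map X r x) = x"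
proof -
  interpret U: trilinear "\<lambda>x y z. - X x y z" M by (rule uminus)
  let ?z = "mid_inv X r x"
  have y: "mid_map X r x = ?z - - X ?z ?z ?z" using mid_inv(4)[OF r x] by simp
  show "mid_map X r x \<in> mid_dom (\<lambda>x y z. - X x y z) r"
    unfolding y mid_dom_def using mid_inv(2)[OF r x] by (intro image_eqI[of _ _ ?z]) auto
  have "mid_inv (\<lambda>x y z. - X x y z) r (mid_map X r x) = ?z"
    unfolding y using mid_inv(2)[OF r x] by (rule U.mid_inv(1)[OF r])
  then show "mid_map (\<lambda>x y z. - X x y z) r (mid_map X r x) = x"
    by (simp add: mid_map_def[of "\<lambda>x y z. - X x y z"]) (simp add: mid_map_def)
qed

end

section \<open>Transport of power series and derivatives to sequences\<close>

lemma norm_proj [simp]: "f \<in> ell2 s \<Longrightarrow> norm (proj s f) = ell2_norm s f"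
  using norm_emb[of s "proj s f"] by (simp add: emb_proj)

text \<open>Series are built on the Banach type \<open>l2\<close>, whereas
  \<open>has_power_series\<close> speaks of normed subspaces of functions; as \<open>emb s\<close>
  is a linear isometry onto \<open>ell2 s\<close>, the bounds carry over with the same
  \<open>K\<close> and \<open>\<rho>\<close>.\<close>

lemma has_power_series_emb:
  assumes \<rho>: "0 < \<rho>" "summable (\<lambda>n. K n * \<rho> ^ n)"
    and ml: "\<And>n. bounded_multilinear UNIV norm UNIV norm n (A n) (K n)"
    and f: "\<And>h. norm h < \<rho> \<Longrightarrow> (\<lambda>n. A n (replicate n h)) sums g h"
      "\<And>h. norm h < \<rho> \<Longrightarrow> f (q + emb s h) = emb s (g h)"
  shows "has_power_series (ell2 s) (ell2_norm s) (ell2 s) (ell2_norm s) f q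
    (\<lambda>n xs. emb s (A n (map (proj s) xs)))"
  unfolding has_power_series_def
proof (intro exI[of _ \<rho>] exI[of _ K] conjI allI ballI impI)
  have lin: "proj s (a *\<^sub>R u + b *\<^sub>R v) = a *\<^sub>R proj s u + b *\<^sub>R proj s v"
    if uv: "u \<in> ell2 s" "v \<in> ell2 s" for a b u v
  proof -
    have "a *\<^sub>R u + b *\<^sub>R v = emb s (a *\<^sub>R proj s u + b *\<^sub>R proj s v)"
      by (simp add: emb_proj uv)
    then show ?thesis by (metis proj_emb)
  qed
  have pn: "map norm (map (proj s) xs) = map (ell2_norm s) xs" if "set xs \<subseteq> ell2 s" for xs
    using that by (induction xs) auto
  show "bounded_multilinear (ell2 s) (ell2_norm s) (ell2 s) (ell2_norm s) n
      (\<lambda>xs. emb s (A n (map (proj s) xs))) (K n)" for n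
    unfolding bounded_multilinear_def
  proof (intro conjI allI impI emb_in)
    fix xs assume xs: "length xs = n \<and> set xs \<subseteq> ell2 s"
    have "norm (A n ys) \<le> K n * prod_list (map norm ys)" if "length ys = n" for ys
      using ml[of n] that unfolding bounded_multilinear_def by blast
    from this[of "map (proj s) xs"] have "norm (A n (map (proj s) xs)) \<le> K n * prod_list (map norm (map (proj s) xs))"
      using xs by (simp only: length_map)
    then show "ell2_norm s (emb s (A n (map (proj s) xs))) \<le> K n * prod_list (map (ell2_norm s) xs)"
      unfolding norm_emb using pn xs by (simp only:)
  next
    fix xs ys u v and a b :: real
    assume *: "length xs + 1 + length ys = n \<and> set xs \<subseteq> ell2 s \<and> set ys \<subseteq> ell2 s \<and> u \<in> ell2 s \<and> v \<in> ell2 s"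
    have "A n (map (proj s) xs @ (a *\<^sub>R proj s u + b *\<^sub>R proj s v) # map (proj s) ys) =
      a *\<^sub>R A n (map (proj s) xs @ proj s u # map (proj s) ys) + b *\<^sub>R A n (map (proj s) xs @ proj s v # map (proj s) ys)"
      using ml[of n] * unfolding bounded_multilinear_def by simp
    then show "emb s (A n (map (proj s) (xs @ (a *\<^sub>R u + b *\<^sub>R v) # ys))) =
          a *\<^sub>R emb s (A n (map (proj s) (xs @ u # ys))) + b *\<^sub>R emb s (A n (map (proj s) (xs @ v # ys)))"
      using * by (simp add: lin)
  qed
  fix h assume h: "h \<in> ell2 s" "ell2_norm s h < \<rho>"
  define h' where "h' = proj s h"
  have h': "h = emb s h'" "norm h' < \<rho>" using h by (auto simp: h'_def emb_proj)
  show "f (q + h) \<in> ell2 s" using f(2)[OF h'(2)] by (simp add: h')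
  have emb_sum: "emb s (sum a I) = (\<Sum>n\<in>I. emb s (a n))" for a and I :: "nat set"
    by (induction I rule: infinite_finite_induct) auto
  have "(\<lambda>m. norm (g h' - (\<Sum>n<m. A n (replicate n h')))) \<longlonglongrightarrow> norm (g h' - g h')"
    using f(1)[OF h'(2)] unfolding sums_def by (intro tendsto_intros)
  moreover have "ell2_norm s (f (q + h) - (\<Sum>n<m. emb s (A n (map (proj s) (replicate n h))))) =
      norm (g h' - (\<Sum>n<m. A n (replicate n h')))" for m
    unfolding norm_emb[of s, symmetric] by (simp add: h'(1) f(2)[OF h'(2)] emb_sum)
  ultimately show "(\<lambda>m. ell2_norm s (f (q + h) - (\<Sum>n<m. emb s (A n (map (proj s) (replicate n h)))))) \<longlonglongrightarrow> 0"
    by simp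
qed (use \<rho> in auto)

lemma has_frechet_derivative_emb:
  assumes \<rho>: "0 < \<rho>" "summable (\<lambda>n. K n * \<rho> ^ n)" "\<And>n. 0 \<le> K n"
    and ml: "\<And>n. bounded_multilinear UNIV norm UNIV norm n (A n) (K n)"
    and f: "\<And>h. norm h < \<rho> \<Longrightarrow> (\<lambda>n. A n (replicate n h)) sums g h"
      "\<And>h. norm h < \<rho> \<Longrightarrow> f (q + emb s h) = emb s (g h)"
  shows "has_frechet_derivative (ell2 s) (ell2_norm s) (ell2 s) (ell2_norm s) f
    (\<lambda>u. emb s (A 1 [proj s u])) q"
  unfolding has_frechet_derivative_def
proof (intro conjI ballI allI impI)
  show "emb s (A 1 [proj s (a *\<^sub>R u + b *\<^sub>R v)]) = a *\<^sub>R emb s (A 1 [proj s u]) + b *\<^sub>R emb s (A 1 [proj s v])"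
    if uv: "u \<in> ell2 s" "v \<in> ell2 s" for u v a b
  proof -
    have "a *\<^sub>R u + b *\<^sub>R v = emb s (a *\<^sub>R proj s u + b *\<^sub>R proj s v)"
      by (simp add: emb_proj uv)
    then have "proj s (a *\<^sub>R u + b *\<^sub>R v) = a *\<^sub>R proj s u + b *\<^sub>R proj s v" by (metis proj_emb)
    moreover have "A 1 ([] @ (a *\<^sub>R proj s u + b *\<^sub>R proj s v) # []) = a *\<^sub>R A 1 ([] @ proj s u # []) + b *\<^sub>R A 1 ([] @ proj s v # [])"
      using ml[of 1] unfolding bounded_multilinear_def by (metis One_nat_def UNIV_I add.right_neutral add_0 list.size(3) subset_UNIV)
    ultimately show ?thesis by simp
  qed
  show "\<exists>C. \<forall>u\<in>ell2 s. emb s (A 1 [proj s u]) \<in> ell2 s \<and> ell2_norm s (emb s (A 1 [proj s u])) \<le> C * ell2_norm s u"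
  proof (intro exI ballI conjI emb_in)
    fix u assume u: "u \<in> ell2 s"
    have "norm (A 1 (replicate 1 (proj s u))) \<le> K 1 * norm (proj s u) ^ 1"
      by (rule multilinear_replicate[OF ml])
    then show "ell2_norm s (emb s (A 1 [proj s u])) \<le> K 1 * ell2_norm s u"
      using u by simp
  qed
  fix e :: real assume "0 < e"
  define S where "S = (\<Sum>n. K n * \<rho> ^ n)"
  have S: "0 \<le> S" unfolding S_def using \<rho> by (intro suminf_nonneg) auto
  \<comment> \<open>The Taylor remainder of order two is at most \<open>S (t / \<rho>)^2\<close>,
    which is at most \<open>e t\<close> for \<open>t < \<delta>\<close>.\<close>
  define \<delta> where "\<delta> = min \<rho> (e * \<rho>\<^sup>2 / (S + 1))"
  have \<delta>: "0 < \<delta>" "\<delta> \<le> \<rho>" using \<open>0 < e\<close> \<rho>(1) S by (auto simp: \<delta>_def)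
  show "\<exists>\<delta>>0. \<forall>h\<in>ell2 s. ell2_norm s h < \<delta> \<longrightarrow> f (q + h) - f q - emb s (A 1 [proj s h]) \<in> ell2 s \<and>
      ell2_norm s (f (q + h) - f q - emb s (A 1 [proj s h])) \<le> e * ell2_norm s h"
  proof (intro exI[of _ \<delta>] conjI ballI impI)
    fix h assume h: "h \<in> ell2 s" "ell2_norm s h < \<delta>"
    define h' where "h' = proj s h"
    have h': "h = emb s h'" "norm h' < \<delta>" using h by (auto simp: h'_def emb_proj)
    then have h\<rho>: "norm h' < \<rho>" using \<delta> by simp
    have "A n (replicate n 0) = 0" if "n > 0" for n :: nat
      using multilinear_replicate[OF ml, of n 0] that by (simp add: power_0_left)
    then have "(\<lambda>n. A n (replicate n 0)) = (\<lambda>n. if n = 0 then A 0 [] else 0)" by auto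
    then have g0: "g 0 = A 0 []"
      using f(1)[of 0] \<rho>(1) sums_single[of 0 "\<lambda>_. A 0 []"] sums_unique2 by fastforce
    have eq: "f (q + h) - f q - emb s (A 1 [proj s h]) = emb s (g h' - g 0 - A 1 [h'])"
      using f(2)[of 0] f(2)[OF h\<rho>] \<rho>(1) by (simp add: h'(1))
    show "f (q + h) - f q - emb s (A 1 [proj s h]) \<in> ell2 s" unfolding eq by (rule emb_in)
    have le: "norm (A n (replicate n h')) \<le> K n * norm h' ^ n" for n
      by (rule multilinear_replicate[OF ml])
    have "norm (g h' - (\<Sum>n<2. A n (replicate n h'))) \<le> S * (norm h' / \<rho>) ^ 2"
      unfolding S_def using h\<rho> f(1)[OF h\<rho>] by (intro power_series_tail[OF \<rho> le]) auto
    then have "norm (g h' - g 0 - A 1 [h']) \<le> S * (norm h' / \<rho>)\<^sup>2"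
      by (simp add: numeral_2_eq_2 g0 diff_diff_eq)
    also have "\<dots> = S * norm h' / \<rho>\<^sup>2 * norm h'" by (simp add: power2_eq_square)
    also have "\<dots> \<le> S * (e * \<rho>\<^sup>2 / (S + 1)) / \<rho>\<^sup>2 * norm h'"
      using h'(2) S by (intro mult_right_mono divide_right_mono mult_left_mono) (auto simp: \<delta>_def)
    also have "\<dots> = S / (S + 1) * (e * norm h')" using \<rho>(1) by simp
    also have "\<dots> \<le> 1 * (e * norm h')" using S \<open>0 < e\<close> by (intro mult_right_mono) auto
    finally show "ell2_norm s (f (q + h) - f q - emb s (A 1 [proj s h])) \<le> e * ell2_norm s h"
      unfolding eq norm_emb by (simp add: h'(1))
  qed (use \<delta> in auto)
qed

section \<open>Estimates in weighted spaces\<close>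

lemma L2_set_sum_le:
  assumes "finite J" "\<And>i m. i \<in> J \<Longrightarrow> 0 \<le> h i m"
  shows "L2_set (\<lambda>m. \<Sum>i\<in>J. h i m) F \<le> (\<Sum>i\<in>J. L2_set (h i) F)"
  using assms
proof (induction J rule: finite_induct)
  case (insert x J)
  have "L2_set (\<lambda>m. h x m + (\<Sum>i\<in>J. h i m)) F \<le> L2_set (h x) F + L2_set (\<lambda>m. \<Sum>i\<in>J. h i m) F"
    by (rule L2_set_triangle_ineq)
  then show ?case using insert by auto
qed (simp add: L2_set_def)

text \<open>The finite Minkowski inequality passes to the limit along the finite subsets of
  \<open>I\<close>. The set \<open>F\<close> stays finite because \<open>ell2I\<close> asks only for
  bounds on finite partial sums.\<close>

lemma minkowski:
  fixes h :: "'i \<Rightarrow> 'j \<Rightarrow> real"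
  assumes h0: "\<And>i m. i \<in> I \<Longrightarrow> 0 \<le> h i m"
    and hg: "\<And>i F. i \<in> I \<Longrightarrow> finite F \<Longrightarrow> L2_set (h i) F \<le> g i" and g: "g summable_on I"
  shows "(\<lambda>i. h i m) summable_on I"
    and "finite F \<Longrightarrow> L2_set (\<lambda>m. \<Sum>\<^sub>\<infinity>i\<in>I. h i m) F \<le> infsum g I"
proof -
  have g0: "0 \<le> g i" if "i \<in> I" for i using hg[OF that, of "{}"] by simp
  show su: "(\<lambda>i. h i m) summable_on I" for m
    by (rule summable_on_comparison_test[OF g]) (use hg[of _ "{m}"] h0 in \<open>auto simp: L2_set_def\<close>)
  assume F: "finite F"
  show "L2_set (\<lambda>m. \<Sum>\<^sub>\<infinity>i\<in>I. h i m) F \<le> infsum g I"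
  proof (rule tendsto_upperbound)
    show "((\<lambda>J. L2_set (\<lambda>m. \<Sum>i\<in>J. h i m) F) \<longlongrightarrow> L2_set (\<lambda>m. \<Sum>\<^sub>\<infinity>i\<in>I. h i m) F) (finite_subsets_at_top I)"
      unfolding L2_set_def by (intro tendsto_intros infsum_tendsto su)
    show "\<forall>\<^sub>F J in finite_subsets_at_top I. L2_set (\<lambda>m. \<Sum>i\<in>J. h i m) F \<le> infsum g I"
    proof (rule eventually_finite_subsets_at_top_weakI)
      fix J assume J: "finite J" "J \<subseteq> I"
      have "L2_set (\<lambda>m. \<Sum>i\<in>J. h i m) F \<le> (\<Sum>i\<in>J. L2_set (h i) F)"
        using J h0 by (intro L2_set_sum_le) auto
      also have "\<dots> \<le> sum g J" using J hg F by (intro sum_mono) auto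
      also have "\<dots> \<le> infsum g I" using J g0 g by (intro finite_sum_le_infsum) auto
      finally show "L2_set (\<lambda>m. \<Sum>i\<in>J. h i m) F \<le> infsum g I" .
    qed
  qed simp
qed

lemma has_sum_prod:
  fixes f :: "'a \<Rightarrow> real" and g :: "'b \<Rightarrow> real"
  assumes f: "(f has_sum x) A" and g: "(g has_sum y) B"
    and "\<And>a. a \<in> A \<Longrightarrow> 0 \<le> f a" "\<And>b. b \<in> B \<Longrightarrow> 0 \<le> g b"
  shows "((\<lambda>(a, b). f a * g b) has_sum x * y) (A \<times> B)"
proof (rule has_sum_SigmaI)
  show r: "((\<lambda>b. case (a, b) of (a, b) \<Rightarrow> f a * g b) has_sum f a * y) B" for a
    using has_sum_cmult_right[OF g] by simp
  show l: "((\<lambda>a. f a * y) has_sum x * y) A" by (rule has_sum_cmult_left[OF f])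
  show "(\<lambda>(a, b). f a * g b) summable_on A \<times> B"
    by (rule summable_on_SigmaI[OF r has_sum_imp_summable[OF l]]) (use assms in auto)
qed

section \<open>The l1 space with square root weight\<close>

definition rt :: "int \<Rightarrow> real" where "rt j = sqrt (real_of_int \<bar>j\<bar>)"

lemma rt_nonneg [simp]: "0 \<le> rt j" and rt_0 [simp]: "rt 0 = 0" and rt_minus [simp]: "rt (- j) = rt j"
  and rt_sq: "rt j * rt j = \<bar>real_of_int j\<bar>"
  by (simp_all add: rt_def)

lemma rt_ge_1: "j \<noteq> 0 \<Longrightarrow> 1 \<le> rt j"
  by (simp add: rt_def)

text \<open>Coefficients will be bounded by products of \<open>rt\<close> over their indices;
  against such bounds a multilinear sum factorises into the norms \<open>n1\<close>.\<close>

definition w1 :: "seq \<Rightarrow> bool" where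
  "w1 f \<longleftrightarrow> f 0 = 0 \<and> (\<lambda>j. rt j * cmod (f j)) summable_on UNIV"

definition n1 :: "seq \<Rightarrow> real" where
  "n1 f = (\<Sum>\<^sub>\<infinity>j. rt j * cmod (f j))"

lemma n1_nonneg [simp]: "0 \<le> n1 f"
  unfolding n1_def by (intro infsum_nonneg) simp

lemma w1_has_sum: "w1 f \<Longrightarrow> ((\<lambda>j. rt j * cmod (f j)) has_sum n1 f) UNIV"
  by (simp add: w1_def n1_def)

lemma n1_ge: "w1 f \<Longrightarrow> rt j * cmod (f j) \<le> n1 f"
  using finite_sum_le_infsum[of "\<lambda>j. rt j * cmod (f j)" UNIV "{j}"] by (simp add: w1_def n1_def)

lemma summable_on_int:
  fixes f :: "int \<Rightarrow> real"
  assumes "summable (\<lambda>n. f (int n))" "summable (\<lambda>n. f (- int n))" "\<And>j. 0 \<le> f j"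
  shows "f summable_on UNIV"
proof -
  have "f summable_on range int"
    using assms by (subst summable_on_reindex) (auto simp: o_def summable_on_UNIV_nonneg_real_iff inj_on_def)
  moreover have "f summable_on range (\<lambda>n. - int n)"
    using assms by (subst summable_on_reindex) (auto simp: o_def summable_on_UNIV_nonneg_real_iff inj_on_def)
  moreover have "UNIV = range int \<union> range (\<lambda>n. - int n)"
  proof -
    have "x \<in> range int \<union> range (\<lambda>n. - int n)" for x
      by (cases x rule: int_cases2) auto
    then show ?thesis by blast
  qed
  ultimately show ?thesis by (metis summable_on_union)
qed

definition k1 :: "real \<Rightarrow> real" where
  "k1 s = sqrt (\<Sum>\<^sub>\<infinity>j. (rt j * wt (- s) j)\<^sup>2)"

lemma k1_nonneg [simp]: "0 \<le> k1 s"
  unfolding k1_def by (intro real_sqrt_ge_zero infsum_nonneg) simp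

text \<open>Cauchy-Schwarz against \<open>rt j * wt (- s) j\<close>, whose square is
  \<open>|j| powr (1 - 2 * s)\<close>. Here the hypothesis \<open>1 < s\<close> enters: it makes
  this exponent less than -1.\<close>

lemma ell2_w1:
  assumes s: "1 < s" and f: "f \<in> ell2 s"
  shows "w1 f" "n1 f \<le> k1 s * ell2_norm s f"
proof -
  have eq: "(rt j * wt (- s) j)\<^sup>2 = real_of_int \<bar>j\<bar> powr (1 - 2 * s)" for j
  proof (cases "j = 0")
    case False
    then show ?thesis
      by (simp add: rt_def wt_def power_mult_distrib power2_eq_square powr_add[symmetric]
          powr_diff powr_minus field_simps flip: mult_2)
  qed simp
  have su: "(\<lambda>j. (rt j * wt (- s) j)\<^sup>2) summable_on UNIV"
    unfolding eq by (rule summable_on_int) (use s in \<open>auto simp: summable_real_powr_iff\<close>)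
  have bound: "(\<Sum>j\<in>F. rt j * cmod (f j)) \<le> k1 s * ell2_norm s f" if "finite F" for F
  proof -
    have "(\<Sum>j\<in>F. rt j * cmod (f j)) = (\<Sum>j\<in>F. \<bar>rt j * wt (- s) j\<bar> * \<bar>cmod (f j) * wt s j\<bar>)"
    proof (rule sum.cong)
      show "rt j * cmod (f j) = \<bar>rt j * wt (- s) j\<bar> * \<bar>cmod (f j) * wt s j\<bar>" for j
      proof (cases "j = 0")
        case False
        have "\<bar>rt j * wt (- s) j\<bar> * \<bar>cmod (f j) * wt s j\<bar> = rt j * cmod (f j) * (wt (- s) j * wt s j)"
          by (simp add: abs_mult)
        then show ?thesis using wt_cancel(2)[OF False] by simp
      qed simp
    qed simp
    also have "\<dots> \<le> L2_set (\<lambda>j. rt j * wt (- s) j) F * L2_set (\<lambda>j. cmod (f j) * wt s j) F"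
      by (rule L2_set_mult_ineq)
    also have "\<dots> \<le> k1 s * ell2_norm s f"
    proof (rule mult_mono)
      show "L2_set (\<lambda>j. rt j * wt (- s) j) F \<le> k1 s"
        unfolding L2_set_def k1_def using su that by (intro real_sqrt_le_mono finite_sum_le_infsum) auto
      show "L2_set (\<lambda>j. cmod (f j) * wt s j) F \<le> ell2_norm s f"
        unfolding L2_set_def using ell2_finite_sum_le[OF f that] by (simp add: real_le_lsqrt)
    qed auto
    finally show ?thesis .
  qed
  have "(\<lambda>j. rt j * cmod (f j)) summable_on UNIV"
    by (rule nonneg_bdd_above_summable_on) (use bound in \<open>auto intro!: bdd_aboveI2\<close>)
  then show "w1 f" using f by (simp add: w1_def ell2_iff)
  then show "n1 f \<le> k1 s * ell2_norm s f"
    unfolding n1_def w1_def using bound by (intro infsum_le_finite_sums) auto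
qed

text \<open>The factor \<open>1 / (8 \<pi>)\<close> is half of the coefficient \<open>1 / (4 \<pi>)\<close> of the quartic Hamiltonian, and
  \<open>2 (a - b) (b - c)\<close> is the divisor \<open>a\<^sup>2 - b\<^sup>2 + c\<^sup>2 - m\<^sup>2\<close> with \<open>m = a - b + c\<close>. Resonant quadruples
  get the coefficient \<open>0\<close> by division by zero.\<close>

definition chi :: "int \<Rightarrow> int \<Rightarrow> int \<Rightarrow> real" where
  "chi a b c = real_of_int (a - b + c) / (8 * pi * real_of_int ((a - b) * (b - c)))"

text \<open>The four indices form a cycle in which neighbours differ by \<open>p\<close> or
  \<open>q\<close>: \<open>m - c = a - b = p\<close> and \<open>a - m = b - c = q\<close>. Distinct
  nonzero integers satisfy \<open>|y| \<le> 2 |z| |y - z|\<close>, so a large index forces a large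
  neighbour or a large divisor.\<close>

lemma chi_bound_int:
  fixes a b c m p q :: int
  assumes "a \<noteq> 0" "b \<noteq> 0" "c \<noteq> 0" "p = a - b" "q = b - c" "m = a - b + c" "p \<noteq> 0" "q \<noteq> 0" "m \<noteq> 0"
    and x: "x \<in> {m, a, b, c}"
  shows "\<bar>m\<bar> * x\<^sup>2 \<le> 12 * p\<^sup>2 * q\<^sup>2 * (\<bar>a\<bar> * \<bar>b\<bar> * \<bar>c\<bar>)"
proof -
  define A B C M P Q where "A = \<bar>a\<bar>" "B = \<bar>b\<bar>" "C = \<bar>c\<bar>" "M = \<bar>m\<bar>" "P = \<bar>p\<bar>" "Q = \<bar>q\<bar>"
  note defs = A_B_C_M_P_Q_def
  have pos: "1 \<le> A" "1 \<le> B" "1 \<le> C" "1 \<le> M" "1 \<le> P" "1 \<le> Q"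
    using assms by (auto simp: defs)
  have sp: "y + z \<le> 2 * (y * z)" if "1 \<le> y" "1 \<le> z" for y z :: int
  proof -
    have "0 \<le> (y - 1) * (z - 1)" "1 * 1 \<le> y * z"
      using that mult_mono[of 1 y 1 z] by auto
    then show ?thesis by (simp add: algebra_simps)
  qed
  have sp3: "y + z + w \<le> 3 * (y * z * w)" if "1 \<le> y" "1 \<le> z" "1 \<le> w" for y z w :: int
  proof -
    have "y * 1 * 1 \<le> y * z * w" "1 * z * 1 \<le> y * z * w" "1 * 1 * w \<le> y * z * w"
      using that by (intro mult_mono mult_nonneg_nonneg; simp)+
    then show ?thesis by simp
  qed
  have tri: "M \<le> A + Q" "M \<le> C + P" "M \<le> B + P + Q" "A \<le> B + P" "C \<le> B + Q" "B \<le> A + P"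
    using assms(4-6) unfolding defs by linarith+
  have i1: "M \<le> 2 * (A * Q)" using sp[OF pos(1,6)] tri by linarith
  have i2: "M \<le> 2 * (C * P)" using sp[OF pos(3,5)] tri by linarith
  have i3: "M \<le> 3 * (B * P * Q)" using sp3[OF pos(2,5,6)] tri by linarith
  have i4: "A \<le> 2 * (B * P)" using sp[OF pos(2,5)] tri by linarith
  have i5: "C \<le> 2 * (B * Q)" using sp[OF pos(2,6)] tri by linarith
  have i6: "B \<le> 2 * (A * P)" using sp[OF pos(1,5)] tri by linarith
  have nn: "0 \<le> A" "0 \<le> B" "0 \<le> C" "0 \<le> M" "0 \<le> P" "0 \<le> Q" using pos by auto
  have sq: "1 \<le> P\<^sup>2" "1 \<le> Q\<^sup>2" using pos by (auto simp: one_le_power)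
  have fin: "4 * (A * B * C) * Z \<le> 12 * P\<^sup>2 * Q\<^sup>2 * (A * B * C)" if "Z \<le> P\<^sup>2 * Q\<^sup>2" "0 \<le> Z" for Z
  proof -
    have "4 * (A * B * C) * Z \<le> 12 * (A * B * C) * (P\<^sup>2 * Q\<^sup>2)"
      using nn that by (intro mult_mono mult_nonneg_nonneg) auto
    then show ?thesis by (simp add: mult_ac)
  qed
  have PQ: "P\<^sup>2 \<le> P\<^sup>2 * Q\<^sup>2" "Q\<^sup>2 \<le> P\<^sup>2 * Q\<^sup>2"
    using mult_left_mono[OF sq(2), of "P\<^sup>2"] mult_right_mono[OF sq(1), of "Q\<^sup>2"] by auto
  \<comment> \<open>The worst case. \<open>M\<close> is compared once with each of \<open>A\<close>,
    \<open>C\<close> and \<open>B\<close>; since \<open>b\<close> is opposite to \<open>m\<close> in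
    the cycle, both differences enter there with factor 3, and \<open>2 * 2 * 3\<close> is the
    12.\<close>
  have "M * M * M \<le> 12 * P\<^sup>2 * Q\<^sup>2 * (A * B * C)"
  proof -
    have "M * M * M \<le> (2 * (A * Q)) * (2 * (C * P)) * (3 * (B * P * Q))"
      using nn by (intro mult_mono i1 i2 i3 mult_nonneg_nonneg) auto
    then show ?thesis by (simp add: power2_eq_square mult_ac)
  qed
  moreover have "M * A * A \<le> 12 * P\<^sup>2 * Q\<^sup>2 * (A * B * C)"
  proof -
    have "M * A * A \<le> (2 * (C * P)) * A * (2 * (B * P))"
      using nn by (intro mult_mono i2 i4 mult_nonneg_nonneg) auto
    also have "\<dots> = 4 * (A * B * C) * P\<^sup>2" by (simp add: power2_eq_square mult_ac)
    also have "\<dots> \<le> 12 * P\<^sup>2 * Q\<^sup>2 * (A * B * C)" by (rule fin[OF PQ(1)]) simp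
    finally show ?thesis .
  qed
  moreover have "M * B * B \<le> 12 * P\<^sup>2 * Q\<^sup>2 * (A * B * C)"
  proof -
    have "M * B * B \<le> (2 * (C * P)) * B * (2 * (A * P))"
      using nn by (intro mult_mono i2 i6 mult_nonneg_nonneg) auto
    also have "\<dots> = 4 * (A * B * C) * P\<^sup>2" by (simp add: power2_eq_square mult_ac)
    also have "\<dots> \<le> 12 * P\<^sup>2 * Q\<^sup>2 * (A * B * C)" by (rule fin[OF PQ(1)]) simp
    finally show ?thesis .
  qed
  moreover have "M * C * C \<le> 12 * P\<^sup>2 * Q\<^sup>2 * (A * B * C)"
  proof -
    have "M * C * C \<le> (2 * (A * Q)) * C * (2 * (B * Q))"
      using nn by (intro mult_mono i1 i5 mult_nonneg_nonneg) auto
    also have "\<dots> = 4 * (A * B * C) * Q\<^sup>2" by (simp add: power2_eq_square mult_ac)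
    also have "\<dots> \<le> 12 * P\<^sup>2 * Q\<^sup>2 * (A * B * C)" by (rule fin[OF PQ(2)]) simp
    finally show ?thesis .
  qed
  ultimately have "M * \<bar>x\<bar> * \<bar>x\<bar> \<le> 12 * P\<^sup>2 * Q\<^sup>2 * (A * B * C)"
    using x unfolding defs by (elim insertE emptyE; simp only:)
  then show ?thesis by (simp add: defs power2_eq_square mult.assoc)
qed

text \<open>\<open>chi_bound_int\<close>, multiplied once more by \<open>|m|\<close>, is essentially
  the square of the claim, and its constant 12 is absorbed by \<open>(8 * pi)^2\<close>. If
  \<open>a = b\<close>, \<open>b = c\<close> or \<open>a - b + c = 0\<close>, then
  \<open>chi\<close> vanishes.\<close>

lemma chi_bound:
  assumes "a \<noteq> 0" "b \<noteq> 0" "c \<noteq> 0" and x: "x \<in> {a - b + c, a, b, c}"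
  shows "\<bar>chi a b c\<bar> * \<bar>real_of_int x\<bar> \<le> rt (a - b + c) * (rt a * rt b * rt c)"
proof (cases "a = b \<or> b = c \<or> a - b + c = 0")
  case True
  then have "chi a b c = 0" by (auto simp: chi_def simp del: of_int_add of_int_diff)
  then show ?thesis by simp
next
  case False
  define m p q where "m = a - b + c" "p = a - b" "q = b - c"
  note defs = m_p_q_def
  have nz: "m \<noteq> 0" "p \<noteq> 0" "q \<noteq> 0" using False by (auto simp: defs)
  have "\<bar>m\<bar> * x\<^sup>2 \<le> 12 * p\<^sup>2 * q\<^sup>2 * (\<bar>a\<bar> * \<bar>b\<bar> * \<bar>c\<bar>)"
    using assms nz by (intro chi_bound_int[of a b c]) (auto simp: defs)
  then have "real_of_int (\<bar>m\<bar> * x\<^sup>2) \<le> real_of_int (12 * p\<^sup>2 * q\<^sup>2 * (\<bar>a\<bar> * \<bar>b\<bar> * \<bar>c\<bar>))"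
    by (simp only: of_int_le_iff)
  then have *: "\<bar>real_of_int m\<bar> * (real_of_int x)\<^sup>2 \<le> 12 * ((real_of_int p)\<^sup>2 * (real_of_int q)\<^sup>2 * (\<bar>real_of_int a\<bar> * \<bar>real_of_int b\<bar> * \<bar>real_of_int c\<bar>))"
    by (simp add: mult_ac)
  let ?R = "(real_of_int p)\<^sup>2 * (real_of_int q)\<^sup>2 * (\<bar>real_of_int a\<bar> * \<bar>real_of_int b\<bar> * \<bar>real_of_int c\<bar>)"
  have "12 * ?R \<le> (8 * pi)\<^sup>2 * ?R"
  proof (intro mult_right_mono)
    have "(4::real)\<^sup>2 \<le> (8 * pi)\<^sup>2" using pi_gt3 by (intro power_mono) auto
    then show "(12::real) \<le> (8 * pi)\<^sup>2" by simp
  qed auto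
  with * have "\<bar>real_of_int m\<bar> * (real_of_int x)\<^sup>2 \<le> (8 * pi)\<^sup>2 * ?R" by linarith
  then have "\<bar>real_of_int m\<bar> * (\<bar>real_of_int m\<bar> * (real_of_int x)\<^sup>2) \<le> \<bar>real_of_int m\<bar> * ((8 * pi)\<^sup>2 * ?R)"
    by (intro mult_left_mono) auto
  then have "(\<bar>real_of_int m\<bar> * \<bar>real_of_int x\<bar>)\<^sup>2 \<le> (8 * pi * (real_of_int p * real_of_int q))\<^sup>2 * (\<bar>real_of_int m\<bar> * (\<bar>real_of_int a\<bar> * \<bar>real_of_int b\<bar> * \<bar>real_of_int c\<bar>))"
    by (simp add: power_mult_distrib power2_eq_square mult_ac)
  then have "\<bar>real_of_int m\<bar> * \<bar>real_of_int x\<bar> \<le> sqrt ((8 * pi * (real_of_int p * real_of_int q))\<^sup>2 * (\<bar>real_of_int m\<bar> * (\<bar>real_of_int a\<bar> * \<bar>real_of_int b\<bar> * \<bar>real_of_int c\<bar>)))"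
    by (rule real_le_rsqrt)
  also have "\<dots> = 8 * pi * \<bar>real_of_int p * real_of_int q\<bar> * (rt m * (rt a * rt b * rt c))"
    by (simp add: real_sqrt_mult rt_def abs_mult)
  finally have le: "\<bar>real_of_int m\<bar> * \<bar>real_of_int x\<bar> \<le> 8 * pi * \<bar>real_of_int p * real_of_int q\<bar> * (rt m * (rt a * rt b * rt c))" .
  have "chi a b c = real_of_int m / (8 * pi * real_of_int (p * q))"
    unfolding chi_def defs ..
  then have "\<bar>chi a b c\<bar> * \<bar>real_of_int x\<bar> = \<bar>real_of_int m\<bar> * \<bar>real_of_int x\<bar> / (8 * pi * \<bar>real_of_int p * real_of_int q\<bar>)"
    by (simp add: abs_mult)
  also have "\<dots> \<le> rt m * (rt a * rt b * rt c)"
    using le nz by (simp add: divide_le_eq mult_ac)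
  finally show ?thesis by (simp only: defs)
qed

lemma chi_rt:
  assumes "a \<noteq> 0" "b \<noteq> 0" "c \<noteq> 0"
  shows "rt (a - b + c) * \<bar>chi a b c\<bar> \<le> rt a * rt b * rt c" "\<bar>chi a b c\<bar> \<le> rt a * rt b * rt c"
proof -
  let ?m = "a - b + c"
  show "rt ?m * \<bar>chi a b c\<bar> \<le> rt a * rt b * rt c"
  proof (cases "?m = 0")
    case False
    have "rt ?m * (rt ?m * \<bar>chi a b c\<bar>) \<le> rt ?m * (rt a * rt b * rt c)"
      using chi_bound[OF assms, of ?m] by (simp only: mult.assoc[symmetric] rt_sq) (simp add: mult_ac)
    then show ?thesis using rt_ge_1[OF False] by simp
  qed simp
  then show "\<bar>chi a b c\<bar> \<le> rt a * rt b * rt c"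
  proof (cases "?m = 0")
    case False
    have "1 * \<bar>chi a b c\<bar> \<le> rt ?m * \<bar>chi a b c\<bar>"
      using rt_ge_1[OF False] by (intro mult_right_mono) auto
    then show ?thesis using \<open>rt ?m * \<bar>chi a b c\<bar> \<le> rt a * rt b * rt c\<close> by simp
  qed (simp add: chi_def)
qed

section \<open>The cubic vector field on the weighted spaces\<close>

definition fib :: "int \<Rightarrow> (int \<times> int \<times> int) set" where
  "fib m = {(a, b, c). a - b + c = m}"

lemma fib_sum:
  fixes f :: "int \<times> int \<times> int \<Rightarrow> 'b::banach"
  assumes "(f has_sum S) UNIV"
  shows "f summable_on fib m" "((\<lambda>m. \<Sum>\<^sub>\<infinity>t\<in>fib m. f t) has_sum S) UNIV"
proof -
  show su: "f summable_on fib m" for m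
    using assms by (meson has_sum_imp_summable subset_UNIV summable_on_subset_banach)
  have "bij_betw snd (Sigma UNIV fib) UNIV"
    by (rule bij_betwI[where g = "\<lambda>(a, b, c). (a - b + c, (a, b, c))"]) (auto simp: fib_def)
  from has_sum_reindex_bij_betw[OF this, of f S] assms
  have "((\<lambda>x. f (snd x)) has_sum S) (Sigma UNIV fib)" by simp
  then show "((\<lambda>m. \<Sum>\<^sub>\<infinity>t\<in>fib m. f t) has_sum S) UNIV"
    by (rule has_sum_SigmaD) (use su in simp)
qed

lemma w1_0: "w1 f \<Longrightarrow> f 0 = 0"
  by (simp add: w1_def)

lemma w1_lin:
  assumes "w1 u" "w1 v"
  shows "w1 (a *\<^sub>R u + b *\<^sub>R v)" "w1 (u + v)" "w1 (u - v)"
proof -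
  have *: "w1 (a *\<^sub>R u + b *\<^sub>R v)" for a b
  proof -
    have su: "(\<lambda>j. \<bar>a\<bar> * (rt j * cmod (u j)) + \<bar>b\<bar> * (rt j * cmod (v j))) summable_on UNIV"
      using assms unfolding w1_def by (intro summable_on_add summable_on_cmult_right) auto
    have "rt j * cmod ((a *\<^sub>R u + b *\<^sub>R v) j) \<le> \<bar>a\<bar> * (rt j * cmod (u j)) + \<bar>b\<bar> * (rt j * cmod (v j))" for j
    proof -
      have "cmod ((a *\<^sub>R u + b *\<^sub>R v) j) \<le> \<bar>a\<bar> * cmod (u j) + \<bar>b\<bar> * cmod (v j)"
        using norm_triangle_ineq[of "a *\<^sub>R u j" "b *\<^sub>R v j"] by (simp add: scaleR_fun_def)
      then have "rt j * cmod ((a *\<^sub>R u + b *\<^sub>R v) j) \<le> rt j * (\<bar>a\<bar> * cmod (u j) + \<bar>b\<bar> * cmod (v j))"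
        by (intro mult_left_mono) auto
      then show ?thesis by (simp add: algebra_simps)
    qed
    then have "(\<lambda>j. rt j * cmod ((a *\<^sub>R u + b *\<^sub>R v) j)) summable_on UNIV"
      by (intro summable_on_comparison_test[OF su]) auto
    then show ?thesis using assms by (simp add: w1_def scaleR_fun_def)
  qed
  show "w1 (a *\<^sub>R u + b *\<^sub>R v)" by (rule *)
  show "w1 (u + v)" using *[of 1 1] by simp
  show "w1 (u - v)" using *[of 1 "-1"] by simp
qed

definition p3 :: "seq \<Rightarrow> seq \<Rightarrow> seq \<Rightarrow> int \<times> int \<times> int \<Rightarrow> real" where
  "p3 u v w = (\<lambda>(a, b, c). (rt a * cmod (u a)) * ((rt b * cmod (v b)) * (rt c * cmod (w c))))"

lemma p3_nonneg [simp]: "0 \<le> p3 u v w t"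
  by (auto simp: p3_def split: prod.split)

lemma p3_has_sum:
  assumes "w1 u" "w1 v" "w1 w"
  shows "(p3 u v w has_sum n1 u * (n1 v * n1 w)) UNIV"
proof -
  have "((\<lambda>(b, c). (rt b * cmod (v b)) * (rt c * cmod (w c))) has_sum n1 v * n1 w) (UNIV \<times> UNIV)"
    using assms by (intro has_sum_prod w1_has_sum) auto
  then have "((\<lambda>(a, t). (rt a * cmod (u a)) * (case t of (b, c) \<Rightarrow> (rt b * cmod (v b)) * (rt c * cmod (w c))))
     has_sum n1 u * (n1 v * n1 w)) (UNIV \<times> UNIV \<times> UNIV)"
    using assms by (intro has_sum_prod w1_has_sum) auto
  then show ?thesis by (simp add: p3_def case_prod_unfold)
qed

lemma kernel_summable:
  assumes w: "w1 u" "w1 v" "w1 w"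
    and \<kappa>: "\<And>a b c. a \<noteq> 0 \<Longrightarrow> b \<noteq> 0 \<Longrightarrow> c \<noteq> 0 \<Longrightarrow> cmod (\<kappa> a b c) \<le> C * (rt a * rt b * rt c)"
  shows "(\<lambda>(a, b, c). cmod (\<kappa> a b c * u a * cnj (v b) * w c)) summable_on UNIV"
    and "(\<lambda>(a, b, c). \<kappa> a b c * u a * cnj (v b) * w c) summable_on UNIV"
proof -
  have le: "cmod (\<kappa> a b c * u a * cnj (v b) * w c) \<le> C * p3 u v w (a, b, c)" for a b c
  proof (cases "a = 0 \<or> b = 0 \<or> c = 0")
    case True
    then show ?thesis using w1_0[OF w(1)] w1_0[OF w(2)] w1_0[OF w(3)] by (auto simp: p3_def)
  next
    case False
    then have "cmod (\<kappa> a b c) * (cmod (u a) * cmod (v b) * cmod (w c)) \<le>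
      C * (rt a * rt b * rt c) * (cmod (u a) * cmod (v b) * cmod (w c))"
      by (intro mult_right_mono \<kappa>) auto
    then show ?thesis by (simp add: p3_def norm_mult mult_ac)
  qed
  have su: "(\<lambda>t. C * p3 u v w t) summable_on UNIV"
    using p3_has_sum[OF w] by (intro summable_on_cmult_right) (auto simp: summable_on_def)
  have ab: "(\<lambda>t. cmod (case t of (a, b, c) \<Rightarrow> \<kappa> a b c * u a * cnj (v b) * w c)) summable_on UNIV"
    by (rule Infinite_Sum.abs_summable_on_comparison_test'[OF su]) (use le in auto)
  then show "(\<lambda>(a, b, c). cmod (\<kappa> a b c * u a * cnj (v b) * w c)) summable_on UNIV"
    by (simp add: case_prod_unfold)
  from abs_summable_summable[OF ab]
  show "(\<lambda>(a, b, c). \<kappa> a b c * u a * cnj (v b) * w c) summable_on UNIV" .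
qed

text \<open>The field \<open>X\<close> is the diagonal of this map; antilinearity in the middle
  argument reflects the factor \<open>cnj\<close> in the quartic monomials.\<close>

definition XX :: "seq \<Rightarrow> seq \<Rightarrow> seq \<Rightarrow> seq" where
  "XX u v w m = (\<Sum>\<^sub>\<infinity>(a, b, c)\<in>fib m. of_real (chi a b c) * u a * cnj (v b) * w c)"

lemma XX_summable:
  assumes "w1 u" "w1 v" "w1 w"
  shows "(\<lambda>(a, b, c). of_real (chi a b c) * u a * cnj (v b) * w c) summable_on UNIV"
    and "((\<lambda>(a, b, c). of_real (chi a b c) * u a * cnj (v b) * w c) has_sum XX u v w m) (fib m)"
proof -
  show su: "(\<lambda>(a, b, c). of_real (chi a b c) * u a * cnj (v b) * w c) summable_on UNIV"
    by (rule kernel_summable(2)[OF assms, where C = 1]) (use chi_rt(2) in auto)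
  then have "(\<lambda>(a, b, c). of_real (chi a b c) * u a * cnj (v b) * w c) summable_on fib m"
    by (rule summable_on_subset_banach) auto
  then show "((\<lambda>(a, b, c). of_real (chi a b c) * u a * cnj (v b) * w c) has_sum XX u v w m) (fib m)"
    unfolding XX_def by simp
qed

lemma XX_0 [simp]: "XX u v w 0 = 0"
  unfolding XX_def by (intro infsum_0) (auto simp: fib_def chi_def simp del: of_int_add of_int_diff)

lemma XX_lin:
  assumes w: "w1 u" "w1 v" "w1 y" "w1 z"
  shows "XX (a *\<^sub>R u + b *\<^sub>R v) y z = a *\<^sub>R XX u y z + b *\<^sub>R XX v y z"
    and "XX y (a *\<^sub>R u + b *\<^sub>R v) z = a *\<^sub>R XX y u z + b *\<^sub>R XX y v z"
    and "XX y z (a *\<^sub>R u + b *\<^sub>R v) = a *\<^sub>R XX y z u + b *\<^sub>R XX y z v"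
proof -
  have sc: "((\<lambda>t. a *\<^sub>R f t + b *\<^sub>R g t) has_sum a *\<^sub>R x + b *\<^sub>R x') A"
    if "(f has_sum x) A" "(g has_sum x') A" for f g :: "int \<times> int \<times> int \<Rightarrow> complex" and x x' A
    by (intro has_sum_add has_sum_bounded_linear[OF bounded_linear_scaleR_right] that)
  show "XX (a *\<^sub>R u + b *\<^sub>R v) y z = a *\<^sub>R XX u y z + b *\<^sub>R XX v y z"
  proof
    fix m
    from sc[OF XX_summable(2)[OF w(1,3,4), of m] XX_summable(2)[OF w(2,3,4), of m]]
    have "((\<lambda>(i, j, k). of_real (chi i j k) * (a *\<^sub>R u + b *\<^sub>R v) i * cnj (y j) * z k) has_sum
       a *\<^sub>R XX u y z m + b *\<^sub>R XX v y z m) (fib m)"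
      by (rule has_sum_cong[THEN iffD1, rotated]) (auto simp: scaleR_fun_def algebra_simps scaleR_conv_of_real)
    then show "XX (a *\<^sub>R u + b *\<^sub>R v) y z m = (a *\<^sub>R XX u y z + b *\<^sub>R XX v y z) m"
      unfolding XX_def[of "a *\<^sub>R u + b *\<^sub>R v"] by (simp add: infsumI scaleR_fun_def)
  qed
  show "XX y (a *\<^sub>R u + b *\<^sub>R v) z = a *\<^sub>R XX y u z + b *\<^sub>R XX y v z"
  proof
    fix m
    from sc[OF XX_summable(2)[OF w(3,1,4), of m] XX_summable(2)[OF w(3,2,4), of m]]
    have "((\<lambda>(i, j, k). of_real (chi i j k) * y i * cnj ((a *\<^sub>R u + b *\<^sub>R v) j) * z k) has_sum
       a *\<^sub>R XX y u z m + b *\<^sub>R XX y v z m) (fib m)"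
      by (rule has_sum_cong[THEN iffD1, rotated]) (auto simp: scaleR_fun_def algebra_simps scaleR_conv_of_real)
    then show "XX y (a *\<^sub>R u + b *\<^sub>R v) z m = (a *\<^sub>R XX y u z + b *\<^sub>R XX y v z) m"
      unfolding XX_def[of y "a *\<^sub>R u + b *\<^sub>R v"] by (simp add: infsumI scaleR_fun_def)
  qed
  show "XX y z (a *\<^sub>R u + b *\<^sub>R v) = a *\<^sub>R XX y z u + b *\<^sub>R XX y z v"
  proof
    fix m
    from sc[OF XX_summable(2)[OF w(3,4,1), of m] XX_summable(2)[OF w(3,4,2), of m]]
    have "((\<lambda>(i, j, k). of_real (chi i j k) * y i * cnj (z j) * (a *\<^sub>R u + b *\<^sub>R v) k) has_sum
       a *\<^sub>R XX y z u m + b *\<^sub>R XX y z v m) (fib m)"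
      by (rule has_sum_cong[THEN iffD1, rotated]) (auto simp: scaleR_fun_def algebra_simps scaleR_conv_of_real)
    then show "XX y z (a *\<^sub>R u + b *\<^sub>R v) m = (a *\<^sub>R XX y z u + b *\<^sub>R XX y z v) m"
      unfolding XX_def[of y z "a *\<^sub>R u + b *\<^sub>R v"] by (simp add: infsumI scaleR_fun_def)
  qed
qed

text \<open>\<open>chi_rt\<close> transfers the weight \<open>rt m\<close> of the output to the
  three inputs with constant 1, so the trilinear map has norm at most 1. The uniqueness argument in
  \<open>cubic_unique\<close> relies on this constant.\<close>

lemma XX_w1:
  assumes w: "w1 u" "w1 v" "w1 w"
  shows "w1 (XX u v w)" "n1 (XX u v w) \<le> n1 u * (n1 v * n1 w)"
proof -
  let ?t = "\<lambda>(a, b, c). of_real (chi a b c) * u a * cnj (v b) * w c"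
  define S where "S m = (\<Sum>\<^sub>\<infinity>t\<in>fib m. p3 u v w t)" for m
  note fs = fib_sum[OF p3_has_sum[OF w]]
  have le: "rt m * cmod (XX u v w m) \<le> S m" for m
  proof -
    have "norm (rt m *\<^sub>R XX u v w m) \<le> S m"
    proof (rule norm_infsum_le[where f = "\<lambda>t. rt m *\<^sub>R ?t t"])
      show "((\<lambda>t. rt m *\<^sub>R ?t t) has_sum rt m *\<^sub>R XX u v w m) (fib m)"
        by (intro has_sum_bounded_linear[OF bounded_linear_scaleR_right] XX_summable(2) w)
      show "(p3 u v w has_sum S m) (fib m)" using fs(1) by (simp add: S_def)
      fix t assume t: "t \<in> fib m"
      obtain a b c where tt: "t = (a, b, c)" by (cases t)
      have m: "m = a - b + c" using t by (simp add: tt fib_def)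
      show "norm (rt m *\<^sub>R ?t t) \<le> p3 u v w t"
      proof (cases "a = 0 \<or> b = 0 \<or> c = 0")
        case True
        then show ?thesis using w1_0[OF w(1)] w1_0[OF w(2)] w1_0[OF w(3)] by (auto simp: tt)
      next
        case False
        then have "rt m * \<bar>chi a b c\<bar> * (cmod (u a) * cmod (v b) * cmod (w c)) \<le>
          (rt a * rt b * rt c) * (cmod (u a) * cmod (v b) * cmod (w c))"
          unfolding m by (intro mult_right_mono chi_rt) auto
        then show ?thesis by (simp add: tt p3_def norm_mult mult_ac)
      qed
    qed
    then show ?thesis by simp
  qed
  have S: "(S has_sum n1 u * (n1 v * n1 w)) UNIV" using fs(2) unfolding S_def .
  have "(\<lambda>m. rt m * cmod (XX u v w m)) summable_on UNIV"
    by (rule summable_on_comparison_test[OF has_sum_imp_summable[OF S]]) (use le in auto)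
  then show *: "w1 (XX u v w)" by (simp add: w1_def)
  show "n1 (XX u v w) \<le> n1 u * (n1 v * n1 w)"
    by (rule has_sum_mono[OF w1_has_sum[OF *] S le])
qed

text \<open>Young's inequality for one l2 factor and two l1 factors. For fixed \<open>x\<close> and
  \<open>y\<close> the map \<open>m \<mapsto> \<tau> m x y\<close> is injective, so reindexing does
  not increase the l2 norm; Minkowski then sums over \<open>(x, y)\<close>.\<close>

lemma conv_L2:
  assumes u: "u \<in> ell2 s" and vw: "w1 v" "w1 w" and inj: "\<And>x y. inj (\<lambda>m. \<tau> m x y)"
  defines "h \<equiv> \<lambda>m (x, y). (cmod (u (\<tau> m x y)) * wt s (\<tau> m x y)) * ((rt x * cmod (v x)) * (rt y * cmod (w y)))"
  shows "h m summable_on UNIV"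
    and "finite F \<Longrightarrow> L2_set (\<lambda>m. infsum (h m) UNIV) F \<le> ell2_norm s u * (n1 v * n1 w)"
proof -
  let ?g = "\<lambda>(x, y). (rt x * cmod (v x)) * (rt y * cmod (w y))"
  have g: "(?g has_sum n1 v * n1 w) UNIV"
    using has_sum_prod[OF w1_has_sum[OF vw(1)] w1_has_sum[OF vw(2)]] by simp
  have L: "L2_set (\<lambda>m. h m i) F \<le> ell2_norm s u * ?g i" if "i \<in> UNIV" "finite F" for i F
  proof -
    obtain x y where i: "i = (x, y)" by (cases i)
    have "L2_set (\<lambda>m. h m i) F = L2_set (\<lambda>m. cmod (u (\<tau> m x y)) * wt s (\<tau> m x y)) F * ?g i"
      unfolding h_def i prod.case by (rule L2_set_left_distrib[symmetric]) simp
    also have "L2_set (\<lambda>m. cmod (u (\<tau> m x y)) * wt s (\<tau> m x y)) F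
       = L2_set (\<lambda>j. cmod (u j) * wt s j) ((\<lambda>m. \<tau> m x y) ` F)"
      unfolding L2_set_def using inj[of x y] by (subst sum.reindex) (auto simp: inj_on_def)
    also have "\<dots> \<le> ell2_norm s u"
      unfolding L2_set_def using ell2_finite_sum_le[OF u, of "(\<lambda>m. \<tau> m x y) ` F"] that(2)
      by (simp add: real_le_lsqrt)
    finally show ?thesis using i by (simp add: mult_right_mono)
  qed
  have su: "(\<lambda>i. ell2_norm s u * ?g i) summable_on UNIV"
    using g by (intro summable_on_cmult_right) (auto simp: summable_on_def)
  have h0: "0 \<le> h m i" for m i by (auto simp: h_def split: prod.split)
  show "h m summable_on UNIV"
    by (rule minkowski(1)[where h = "\<lambda>i m. h m i" and I = UNIV, OF h0 L su]) auto
  assume "finite F"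
  have "L2_set (\<lambda>m. infsum (h m) UNIV) F \<le> (\<Sum>\<^sub>\<infinity>i. ell2_norm s u * ?g i)"
    by (rule minkowski(2)[where h = "\<lambda>i m. h m i" and I = UNIV, OF h0 _ su]) (use L \<open>finite F\<close> in auto)
  also have "\<dots> = ell2_norm s u * (n1 v * n1 w)"
    using has_sum_cmult_right[OF g] by (rule infsumI)
  finally show "L2_set (\<lambda>m. infsum (h m) UNIV) F \<le> ell2_norm s u * (n1 v * n1 w)" .
qed

lemma chi_max:
  assumes "a \<noteq> 0" "b \<noteq> 0" "c \<noteq> 0" and x: "x \<in> {a, b, c}" and mx: "\<bar>a - b + c\<bar> \<le> 3 * \<bar>x\<bar>"
  shows "\<bar>chi a b c\<bar> * rt x \<le> 2 * (rt a * rt b * rt c)"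
proof -
  have x0: "x \<noteq> 0" using assms by auto
  have "rt (a - b + c) \<le> sqrt (3 * \<bar>real_of_int x\<bar>)"
    unfolding rt_def using mx by (intro real_sqrt_le_mono) linarith
  also have "\<dots> = sqrt 3 * rt x" by (simp add: real_sqrt_mult rt_def)
  also have "\<dots> \<le> sqrt 4 * rt x" by (rule mult_right_mono, rule real_sqrt_le_mono) auto
  finally have m: "rt (a - b + c) \<le> 2 * rt x" by simp
  have "rt x * (\<bar>chi a b c\<bar> * rt x) = \<bar>chi a b c\<bar> * \<bar>real_of_int x\<bar>"
    by (simp add: rt_sq[symmetric])
  also have "\<dots> \<le> rt (a - b + c) * (rt a * rt b * rt c)"
    using x by (intro chi_bound assms) auto
  also have "\<dots> \<le> 2 * rt x * (rt a * rt b * rt c)"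
    using m by (intro mult_right_mono) auto
  finally have "rt x * (\<bar>chi a b c\<bar> * rt x) \<le> rt x * (2 * (rt a * rt b * rt c))" by simp
  then show ?thesis using rt_ge_1[OF x0] by simp
qed

lemma wt_3:
  assumes "0 \<le> s" "\<bar>m\<bar> \<le> 3 * \<bar>x\<bar>"
  shows "wt s m \<le> 3 powr s * wt s x"
proof -
  have "wt s m \<le> (3 * real_of_int \<bar>x\<bar>) powr s"
    unfolding wt_def using assms by (intro powr_mono2) auto
  then show ?thesis by (simp add: wt_def powr_mult)
qed

text \<open>One of the inputs has at least a third of the modulus of \<open>a - b + c\<close>. It
  takes over the weight \<open>wt s\<close>, and \<open>chi_max\<close> shows that its own factor
  \<open>rt\<close> can be spared, which leaves the other two inputs to be measured in l1.\<close>

lemma chi_wt: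
  assumes s: "0 \<le> s" and nz: "a \<noteq> 0" "b \<noteq> 0" "c \<noteq> 0"
  shows "wt s (a - b + c) * \<bar>chi a b c\<bar> \<le> 2 * 3 powr s *
    (wt s a * (rt b * rt c) + wt s b * (rt a * rt c) + wt s c * (rt a * rt b))"
proof -
  have key: "wt s (a - b + c) * \<bar>chi a b c\<bar> \<le> 2 * 3 powr s * (wt s x * y)"
    if "x \<in> {a, b, c}" "\<bar>a - b + c\<bar> \<le> 3 * \<bar>x\<bar>" "rt a * rt b * rt c = rt x * y" "0 \<le> y" for x y
  proof -
    have x0: "1 \<le> rt x" using that nz rt_ge_1 by auto
    have "\<bar>chi a b c\<bar> * rt x \<le> (2 * y) * rt x"
      using chi_max[OF nz that(1,2)] that(3) by (simp add: mult_ac)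
    then have "\<bar>chi a b c\<bar> \<le> 2 * y" using x0 by simp
    then have "wt s (a - b + c) * \<bar>chi a b c\<bar> \<le> (3 powr s * wt s x) * (2 * y)"
      using wt_3[OF s that(2)] by (intro mult_mono) auto
    then show ?thesis by (simp add: mult_ac)
  qed
  have nn: "0 \<le> wt s a * (rt b * rt c)" "0 \<le> wt s b * (rt a * rt c)" "0 \<le> wt s c * (rt a * rt b)"
    by auto
  consider "\<bar>a - b + c\<bar> \<le> 3 * \<bar>a\<bar>" | "\<bar>a - b + c\<bar> \<le> 3 * \<bar>b\<bar>" | "\<bar>a - b + c\<bar> \<le> 3 * \<bar>c\<bar>"
    by linarith
  then show ?thesis
  proof cases
    case 1
    have "wt s (a - b + c) * \<bar>chi a b c\<bar> \<le> 2 * 3 powr s * (wt s a * (rt b * rt c))"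
      by (rule key[OF _ 1]) auto
    also have "\<dots> \<le> 2 * 3 powr s * (wt s a * (rt b * rt c) + wt s b * (rt a * rt c) + wt s c * (rt a * rt b))"
      using nn by (intro mult_left_mono) auto
    finally show ?thesis .
  next
    case 2
    have "wt s (a - b + c) * \<bar>chi a b c\<bar> \<le> 2 * 3 powr s * (wt s b * (rt a * rt c))"
      by (rule key[OF _ 2]) auto
    also have "\<dots> \<le> 2 * 3 powr s * (wt s a * (rt b * rt c) + wt s b * (rt a * rt c) + wt s c * (rt a * rt b))"
      using nn by (intro mult_left_mono) auto
    finally show ?thesis .
  next
    case 3
    have "wt s (a - b + c) * \<bar>chi a b c\<bar> \<le> 2 * 3 powr s * (wt s c * (rt a * rt b))"
      by (rule key[OF _ 3]) auto
    also have "\<dots> \<le> 2 * 3 powr s * (wt s a * (rt b * rt c) + wt s b * (rt a * rt c) + wt s c * (rt a * rt b))"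
      using nn by (intro mult_left_mono) auto
    finally show ?thesis .
  qed
qed

text \<open>\<open>2 * 3 powr s\<close> comes from \<open>chi_wt\<close>, a 3 from the three
  possible positions of the weight, and one \<open>k1 s\<close> from each of the two inputs measured
  by \<open>n1\<close>.\<close>

definition x_bound :: "real \<Rightarrow> real" where
  "x_bound s = 6 * 3 powr s * (k1 s)\<^sup>2"

lemma XX_ell2:
  assumes s: "1 < s" and uvw: "u \<in> ell2 s" "v \<in> ell2 s" "w \<in> ell2 s"
  shows "XX u v w \<in> ell2 s" "ell2_norm s (XX u v w) \<le> x_bound s * (ell2_norm s u * ell2_norm s v * ell2_norm s w)"
proof -
  note W = uvw[THEN ell2_w1(1)[OF s]] and N = uvw[THEN ell2_w1(2)[OF s]]
  let ?t = "\<lambda>(a, b, c). of_real (chi a b c) * u a * cnj (v b) * w c"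
  \<comment> \<open>In \<open>h1\<close>, \<open>h2\<close>, \<open>h3\<close> the weight
    \<open>wt s\<close> sits on the first, second, third input. The free pair \<open>(x, y)\<close>
    indexes the other two inputs, and the relation \<open>m = a - b + c\<close> gives the index of
    the weighted one.\<close>
  define h1 where "h1 = (\<lambda>m (x, y). (cmod (u (m + x - y)) * wt s (m + x - y)) * ((rt x * cmod (v x)) * (rt y * cmod (w y))))"
  define h2 where "h2 = (\<lambda>m (x, y). (cmod (v (x + y - m)) * wt s (x + y - m)) * ((rt x * cmod (u x)) * (rt y * cmod (w y))))"
  define h3 where "h3 = (\<lambda>m (x, y). (cmod (w (m - x + y)) * wt s (m - x + y)) * ((rt x * cmod (u x)) * (rt y * cmod (v y))))"
  have c1: "h1 m summable_on UNIV" "finite F \<Longrightarrow> L2_set (\<lambda>m. infsum (h1 m) UNIV) F \<le> ell2_norm s u * (n1 v * n1 w)" for m F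
    unfolding h1_def by (intro conv_L2 uvw W; simp add: inj_def)+
  have c2: "h2 m summable_on UNIV" "finite F \<Longrightarrow> L2_set (\<lambda>m. infsum (h2 m) UNIV) F \<le> ell2_norm s v * (n1 u * n1 w)" for m F
    unfolding h2_def by (intro conv_L2 uvw W; simp add: inj_def)+
  have c3: "h3 m summable_on UNIV" "finite F \<Longrightarrow> L2_set (\<lambda>m. infsum (h3 m) UNIV) F \<le> ell2_norm s w * (n1 u * n1 v)" for m F
    unfolding h3_def by (intro conv_L2 uvw W; simp add: inj_def)+
  define T1 where "T1 = (\<lambda>(a, b, c). (cmod (u a) * wt s a) * ((rt b * cmod (v b)) * (rt c * cmod (w c))))"
  define T2 where "T2 = (\<lambda>(a, b, c). (cmod (v b) * wt s b) * ((rt a * cmod (u a)) * (rt c * cmod (w c))))"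
  define T3 where "T3 = (\<lambda>(a, b, c). (cmod (w c) * wt s c) * ((rt a * cmod (u a)) * (rt b * cmod (v b))))"
  have t1: "(T1 has_sum infsum (h1 m) UNIV) (fib m)" for m
    using has_sum_infsum[OF c1(1), of m]
    by (subst has_sum_reindex_bij_witness[where i = "\<lambda>(x, y). (m + x - y, x, y)" and j = "\<lambda>(a, b, c). (b, c)" and T = UNIV])
       (auto simp: fib_def h1_def T1_def)
  have t2: "(T2 has_sum infsum (h2 m) UNIV) (fib m)" for m
    using has_sum_infsum[OF c2(1), of m]
    by (subst has_sum_reindex_bij_witness[where i = "\<lambda>(x, y). (x, x + y - m, y)" and j = "\<lambda>(a, b, c). (a, c)" and T = UNIV])
       (auto simp: fib_def h2_def T2_def algebra_simps)
  have t3: "(T3 has_sum infsum (h3 m) UNIV) (fib m)" for m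
    using has_sum_infsum[OF c3(1), of m]
    by (subst has_sum_reindex_bij_witness[where i = "\<lambda>(x, y). (x, y, m - x + y)" and j = "\<lambda>(a, b, c). (a, b)" and T = UNIV])
       (auto simp: fib_def h3_def T3_def)
  let ?C = "2 * 3 powr s"
  let ?H = "\<lambda>m. infsum (h1 m) UNIV + infsum (h2 m) UNIV + infsum (h3 m) UNIV"
  have le: "cmod (XX u v w m) * wt s m \<le> ?C * ?H m" for m
  proof -
    have "norm (wt s m *\<^sub>R XX u v w m) \<le> ?C * ?H m"
    proof (rule norm_infsum_le[where f = "\<lambda>t. wt s m *\<^sub>R ?t t"])
      show "((\<lambda>t. wt s m *\<^sub>R ?t t) has_sum wt s m *\<^sub>R XX u v w m) (fib m)"
        by (intro has_sum_bounded_linear[OF bounded_linear_scaleR_right] XX_summable(2) W)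
      show "((\<lambda>t. ?C * (T1 t + T2 t + T3 t)) has_sum ?C * ?H m) (fib m)"
        by (intro has_sum_cmult_right has_sum_add t1 t2 t3)
      fix t assume t: "t \<in> fib m"
      obtain a b c where tt: "t = (a, b, c)" by (cases t)
      have m: "m = a - b + c" using t by (simp add: tt fib_def)
      show "norm (wt s m *\<^sub>R ?t t) \<le> ?C * (T1 t + T2 t + T3 t)"
      proof (cases "a = 0 \<or> b = 0 \<or> c = 0")
        case True
        then show ?thesis using W[THEN w1_0] by (auto simp: tt T1_def T2_def T3_def)
      next
        case False
        then have "wt s m * \<bar>chi a b c\<bar> * (cmod (u a) * cmod (v b) * cmod (w c)) \<le>
          ?C * (wt s a * (rt b * rt c) + wt s b * (rt a * rt c) + wt s c * (rt a * rt b)) * (cmod (u a) * cmod (v b) * cmod (w c))"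
          unfolding m using s by (intro mult_right_mono chi_wt) auto
        then show ?thesis by (simp add: tt T1_def T2_def T3_def norm_mult algebra_simps)
      qed
    qed
    then show ?thesis by (simp add: mult_ac)
  qed
  have H0: "0 \<le> infsum (h1 m) UNIV" "0 \<le> infsum (h2 m) UNIV" "0 \<le> infsum (h3 m) UNIV" for m
    by (auto intro!: infsum_nonneg simp: h1_def h2_def h3_def)
  define Bd where "Bd = x_bound s * (ell2_norm s u * ell2_norm s v * ell2_norm s w)"
  have Bd: "0 \<le> Bd" unfolding Bd_def x_bound_def by simp
  have fin: "(\<Sum>m\<in>F. (cmod (XX u v w m) * wt s m)\<^sup>2) \<le> Bd\<^sup>2" if F: "finite F" for F
  proof -
    have "L2_set (\<lambda>m. cmod (XX u v w m) * wt s m) F \<le> L2_set (\<lambda>m. ?C * ?H m) F"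
      by (intro L2_set_mono le) auto
    also have "\<dots> = ?C * L2_set ?H F" by (rule L2_set_right_distrib[symmetric]) auto
    also have "L2_set ?H F \<le> L2_set (\<lambda>m. infsum (h1 m) UNIV + infsum (h2 m) UNIV) F + L2_set (\<lambda>m. infsum (h3 m) UNIV) F"
      by (rule L2_set_triangle_ineq)
    also have "\<dots> \<le> L2_set (\<lambda>m. infsum (h1 m) UNIV) F + L2_set (\<lambda>m. infsum (h2 m) UNIV) F + L2_set (\<lambda>m. infsum (h3 m) UNIV) F"
      by (intro add_right_mono L2_set_triangle_ineq)
    also have "\<dots> \<le> ell2_norm s u * (n1 v * n1 w) + ell2_norm s v * (n1 u * n1 w) + ell2_norm s w * (n1 u * n1 v)"
      by (intro add_mono c1 c2 c3 F)
    also have "\<dots> \<le> ell2_norm s u * ((k1 s * ell2_norm s v) * (k1 s * ell2_norm s w)) + ell2_norm s v * ((k1 s * ell2_norm s u) * (k1 s * ell2_norm s w)) + ell2_norm s w * ((k1 s * ell2_norm s u) * (k1 s * ell2_norm s v))"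
      by (intro add_mono mult_left_mono mult_mono N) auto
    also have "\<dots> = 3 * (k1 s)\<^sup>2 * (ell2_norm s u * ell2_norm s v * ell2_norm s w)"
      by (simp add: power2_eq_square algebra_simps)
    finally have "L2_set (\<lambda>m. cmod (XX u v w m) * wt s m) F \<le> Bd"
      by (simp add: Bd_def x_bound_def mult_ac)
    then have "(L2_set (\<lambda>m. cmod (XX u v w m) * wt s m) F)\<^sup>2 \<le> Bd\<^sup>2"
      by (intro power_mono) auto
    then show ?thesis by (simp add: L2_set_def sum_nonneg)
  qed
  from ell2I[OF XX_0 Bd fin] show "XX u v w \<in> ell2 s" "ell2_norm s (XX u v w) \<le> x_bound s * (ell2_norm s u * ell2_norm s v * ell2_norm s w)"
    by (auto simp: Bd_def)
qed

definition Xl :: "real \<Rightarrow> l2 \<Rightarrow> l2 \<Rightarrow> l2 \<Rightarrow> l2" where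
  "Xl s x y z = proj s (XX (emb s x) (emb s y) (emb s z))"

lemma emb_Xl: "1 < s \<Longrightarrow> emb s (Xl s x y z) = XX (emb s x) (emb s y) (emb s z)"
  unfolding Xl_def by (intro emb_proj XX_ell2) auto

lemma trilinear_Xl:
  assumes s: "1 < s"
  shows "trilinear (Xl s) (x_bound s)"
proof
  note W = ell2_w1(1)[OF s emb_in]
  show "Xl s (a *\<^sub>R u + b *\<^sub>R v) y z = a *\<^sub>R Xl s u y z + b *\<^sub>R Xl s v y z" for a b u v y z
    unfolding inj_emb[of s, symmetric] by (simp add: emb_Xl s XX_lin W)
  show "Xl s y (a *\<^sub>R u + b *\<^sub>R v) z = a *\<^sub>R Xl s y u z + b *\<^sub>R Xl s y v z" for a b u v y z
    unfolding inj_emb[of s, symmetric] by (simp add: emb_Xl s XX_lin W)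
  show "Xl s y z (a *\<^sub>R u + b *\<^sub>R v) = a *\<^sub>R Xl s y z u + b *\<^sub>R Xl s y z v" for a b u v y z
    unfolding inj_emb[of s, symmetric] by (simp add: emb_Xl s XX_lin W)
  show "norm (Xl s x y z) \<le> x_bound s * (norm x * norm y * norm z)" for x y z
    unfolding norm_emb[of s, symmetric] emb_Xl[OF s] by (intro XX_ell2 s emb_in)
  show "0 \<le> x_bound s" by (simp add: x_bound_def)
qed

section \<open>Quartic forms\<close>

lemma has_sum_diff:
  fixes f g :: "'a \<Rightarrow> 'b::real_normed_vector"
  assumes "(f has_sum a) A" "(g has_sum b) A"
  shows "((\<lambda>x. f x - g x) has_sum a - b) A"
proof -
  have "((\<lambda>x. - g x) has_sum - b) A" using assms(2) by (simp add: has_sum_uminus)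
  from has_sum_add[OF assms(1) this] show ?thesis by simp
qed

text \<open>Zero-momentum quadruples \<open>(a, b, c, d)\<close> are parametrised by \<open>(a, b, c)\<close>, with \<open>d = a - b + c\<close>.\<close>

definition qt :: "(int \<Rightarrow> int \<Rightarrow> int \<Rightarrow> real) \<Rightarrow> seq \<Rightarrow> seq \<Rightarrow> seq \<Rightarrow> seq \<Rightarrow> int \<times> int \<times> int \<Rightarrow> complex" where
  "qt \<kappa> u v w x = (\<lambda>(a, b, c). of_real (\<kappa> a b c) * u a * cnj (v b) * w c * cnj (x (a - b + c)))"

definition quad :: "(int \<Rightarrow> int \<Rightarrow> int \<Rightarrow> real) \<Rightarrow> seq \<Rightarrow> seq \<Rightarrow> seq \<Rightarrow> seq \<Rightarrow> complex" where
  "quad \<kappa> u v w x = infsum (qt \<kappa> u v w x) UNIV"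

text \<open>With \<open>d = a - b + c\<close>, zero momentum is preserved by exchanging
  \<open>b\<close> with \<open>d\<close>, by exchanging \<open>a\<close> with \<open>c\<close>, and,
  under conjugation, by exchanging \<open>(a, c)\<close> with \<open>(b, d)\<close>. These three
  substitutions carry all later symmetry arguments.\<close>

lemma qt_swap_bd: "(qt \<kappa> u v w x has_sum S) UNIV \<longleftrightarrow> (qt (\<lambda>a b c. \<kappa> a (a - b + c) c) u x w v has_sum S) UNIV"
  by (rule has_sum_reindex_bij_witness[where i = "\<lambda>(a, b, c). (a, a - b + c, c)" and j = "\<lambda>(a, b, c). (a, a - b + c, c)"])
     (auto simp: qt_def)

lemma qt_swap_ac: "(qt \<kappa> u v w x has_sum S) UNIV \<longleftrightarrow> (qt (\<lambda>a b c. \<kappa> c b a) w v u x has_sum S) UNIV"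
  by (rule has_sum_reindex_bij_witness[where i = "\<lambda>(a, b, c). (c, b, a)" and j = "\<lambda>(a, b, c). (c, b, a)"])
     (auto simp: qt_def algebra_simps)

lemma qt_cnj: "((\<lambda>t. cnj (qt \<kappa> u v w x t)) has_sum S) UNIV \<longleftrightarrow>
    (qt (\<lambda>a b c. \<kappa> b a (a - b + c)) v u x w has_sum S) UNIV"
  by (rule has_sum_reindex_bij_witness[where i = "\<lambda>(a, b, c). (b, a, a - b + c)" and j = "\<lambda>(a, b, c). (b, a, a - b + c)"])
     (auto simp: qt_def algebra_simps)

lemma quad_swap_bd: "quad \<kappa> u v w x = quad (\<lambda>a b c. \<kappa> a (a - b + c) c) u x w v"
  and quad_swap_ac: "quad \<kappa> u v w x = quad (\<lambda>a b c. \<kappa> c b a) w v u x"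
  and quad_cnj: "cnj (quad \<kappa> u v w x) = quad (\<lambda>a b c. \<kappa> b a (a - b + c)) v u x w"
proof -
  show "quad \<kappa> u v w x = quad (\<lambda>a b c. \<kappa> a (a - b + c) c) u x w v"
    unfolding quad_def by (rule infsum_eqI'[OF qt_swap_bd])
  show "quad \<kappa> u v w x = quad (\<lambda>a b c. \<kappa> c b a) w v u x"
    unfolding quad_def by (rule infsum_eqI'[OF qt_swap_ac])
  have "cnj (infsum (qt \<kappa> u v w x) UNIV) = infsum (\<lambda>t. cnj (qt \<kappa> u v w x t)) UNIV" by simp
  also have "\<dots> = infsum (qt (\<lambda>a b c. \<kappa> b a (a - b + c)) v u x w) UNIV"
    by (rule infsum_eqI'[OF qt_cnj])
  finally show "cnj (quad \<kappa> u v w x) = quad (\<lambda>a b c. \<kappa> b a (a - b + c)) v u x w"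
    unfolding quad_def .
qed

lemma qt_has_sum:
  assumes w: "w1 u" "w1 v" "w1 w" "w1 x"
    and \<kappa>: "\<And>a b c. a \<noteq> 0 \<Longrightarrow> b \<noteq> 0 \<Longrightarrow> c \<noteq> 0 \<Longrightarrow> a - b + c \<noteq> 0 \<Longrightarrow>
       \<bar>\<kappa> a b c\<bar> \<le> C * (rt a * rt b * rt c * rt (a - b + c))"
  shows "(qt \<kappa> u v w x has_sum quad \<kappa> u v w x) UNIV"
    and "(\<lambda>t. cmod (qt \<kappa> u v w x t)) summable_on UNIV"
proof -
  have le: "cmod (of_real (\<kappa> a b c) * cnj (x (a - b + c))) \<le> (\<bar>C\<bar> * n1 x) * (rt a * rt b * rt c)"
    if nz: "a \<noteq> 0" "b \<noteq> 0" "c \<noteq> 0" for a b c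
  proof (cases "a - b + c = 0")
    case True
    then show ?thesis using w1_0[OF w(4)] by simp
  next
    case False
    have "\<bar>\<kappa> a b c\<bar> \<le> \<bar>C\<bar> * (rt a * rt b * rt c * rt (a - b + c))"
      by (rule order_trans[OF \<kappa>[OF nz False]]) (auto intro!: mult_right_mono)
    then have "\<bar>\<kappa> a b c\<bar> * cmod (x (a - b + c)) \<le> \<bar>C\<bar> * (rt a * rt b * rt c * rt (a - b + c)) * cmod (x (a - b + c))"
      by (intro mult_right_mono) auto
    also have "\<dots> = \<bar>C\<bar> * (rt a * rt b * rt c) * (rt (a - b + c) * cmod (x (a - b + c)))"
      by simp
    also have "\<dots> \<le> \<bar>C\<bar> * (rt a * rt b * rt c) * n1 x"
      by (intro mult_left_mono n1_ge w) auto
    finally show ?thesis by (simp add: norm_mult mult_ac)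
  qed
  have eq: "(\<lambda>(a, b, c). (of_real (\<kappa> a b c) * cnj (x (a - b + c))) * u a * cnj (v b) * w c) = qt \<kappa> u v w x"
    by (auto simp: qt_def fun_eq_iff)
  have "qt \<kappa> u v w x summable_on UNIV"
    using kernel_summable(2)[OF w(1-3) le] unfolding eq .
  then show "(qt \<kappa> u v w x has_sum quad \<kappa> u v w x) UNIV"
    unfolding quad_def by simp
  have "(\<lambda>t. cmod (case t of (a, b, c) \<Rightarrow> (of_real (\<kappa> a b c) * cnj (x (a - b + c))) * u a * cnj (v b) * w c)) summable_on UNIV"
    using kernel_summable(1)[OF w(1-3) le] by (simp add: case_prod_unfold)
  then show "(\<lambda>t. cmod (qt \<kappa> u v w x t)) summable_on UNIV" by (simp add: qt_def case_prod_unfold mult_ac)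
qed

text \<open>Pairing with a weight on the output index turns the cubic map into a quartic form. The
  weights that occur are \<open>1 / m\<close>, for the symplectic form, and \<open>m\<close>, for
  \<open>Lambda\<close>.\<close>

lemma XX_pairing:
  assumes w: "w1 u" "w1 v" "w1 w" "w1 x"
    and hs: "(qt (\<lambda>a b c. \<mu> (a - b + c) * chi a b c) u v w x has_sum S) UNIV"
  shows "((\<lambda>m. of_real (\<mu> m) * XX u v w m * cnj (x m)) has_sum S) UNIV"
proof -
  note fs = fib_sum[OF hs]
  have "infsum (qt (\<lambda>a b c. \<mu> (a - b + c) * chi a b c) u v w x) (fib m) = of_real (\<mu> m) * XX u v w m * cnj (x m)" for m
  proof (rule infsumI)
    have "((\<lambda>t. (of_real (\<mu> m) * cnj (x m)) * (case t of (a, b, c) \<Rightarrow> of_real (chi a b c) * u a * cnj (v b) * w c)) has_sum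
        (of_real (\<mu> m) * cnj (x m)) * XX u v w m) (fib m)"
      by (intro has_sum_cmult_right XX_summable w)
    then show "(qt (\<lambda>a b c. \<mu> (a - b + c) * chi a b c) u v w x has_sum of_real (\<mu> m) * XX u v w m * cnj (x m)) (fib m)"
      by (rule has_sum_cong[THEN iffD1, rotated, OF back_subst[of "\<lambda>s. (_ has_sum s) _"]])
         (auto simp: qt_def fib_def)
  qed
  then show ?thesis using fs(2) by simp
qed

subsection \<open>The symplectic form\<close>

text \<open>Hermitian form whose imaginary part is half of the symplectic form. The index 0
  contributes nothing, as division by zero gives zero.\<close>

definition sp :: "seq \<Rightarrow> seq \<Rightarrow> complex" where
  "sp u v = (\<Sum>\<^sub>\<infinity>j. u j * cnj (v j) / of_int j)"

lemma sp_has_sum: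
  assumes "w1 u" "w1 v"
  shows "((\<lambda>j. u j * cnj (v j) / of_int j) has_sum sp u v) UNIV"
proof -
  have su: "(\<lambda>j. n1 v * (rt j * cmod (u j))) summable_on UNIV"
    using assms by (intro summable_on_cmult_right) (simp add: w1_def)
  have "(\<lambda>j. norm (u j * cnj (v j) / of_int j)) summable_on UNIV"
  proof (rule Infinite_Sum.abs_summable_on_comparison_test'[OF su])
    fix j :: int
    show "norm (u j * cnj (v j) / of_int j) \<le> n1 v * (rt j * cmod (u j))"
    proof (cases "j = 0")
      case False
      then have j: "1 \<le> \<bar>real_of_int j\<bar>" "1 \<le> rt j" using rt_ge_1 by auto
      have "norm (u j * cnj (v j) / of_int j) = cmod (u j) * cmod (v j) / \<bar>real_of_int j\<bar>"
        by (simp add: norm_divide norm_mult)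
      also have "\<dots> \<le> cmod (u j) * cmod (v j) / 1"
        using j by (intro divide_left_mono) auto
      also have "\<dots> \<le> (rt j * cmod (u j)) * (rt j * cmod (v j))"
        using j mult_right_mono[OF j(2), of "cmod (u j)"] mult_right_mono[OF j(2), of "cmod (v j)"]
        by (simp, intro mult_mono) auto
      also have "\<dots> \<le> (rt j * cmod (u j)) * n1 v"
        using assms by (intro mult_left_mono n1_ge) auto
      finally show ?thesis by (simp add: mult_ac)
    qed (use assms in \<open>simp add: w1_def\<close>)
  qed
  from abs_summable_summable[OF this] show ?thesis unfolding sp_def by (rule has_sum_infsum)
qed

lemma symp_form_sp:
  assumes "w1 u" "w1 v"
  shows "symp_form u v = of_real (2 * Im (sp u v))"
proof -
  have c: "((\<lambda>j. cnj (u j * cnj (v j) / of_int j)) has_sum cnj (sp u v)) UNIV"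
    using sp_has_sum[OF assms] by (simp only: has_sum_cnj_iff)
  from has_sum_diff[OF sp_has_sum[OF assms] c]
  have "((\<lambda>j. (u j * cnj (v j) - v j * cnj (u j)) / of_int j) has_sum (sp u v - cnj (sp u v))) UNIV"
    by (simp add: diff_divide_distrib mult_ac)
  then have "((\<lambda>j. (u j * cnj (v j) - v j * cnj (u j)) / of_int j) has_sum (sp u v - cnj (sp u v))) Zstar"
    by (rule has_sum_cong_neutral[THEN iffD1, rotated -1]) (auto simp: Zstar_def)
  then show ?thesis
    unfolding symp_form_def by (simp add: infsumI complex_eq_iff)
qed

lemma sp_cnj: "sp v u = cnj (sp u v)"
  unfolding sp_def infsum_cnj[symmetric] by (simp add: mult_ac)

lemma sp_add:
  assumes "w1 u" "w1 v" "w1 x"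
  shows "sp (u + v) x = sp u x + sp v x" "sp (u - v) x = sp u x - sp v x"
    "sp x (u + v) = sp x u + sp x v" "sp x (u - v) = sp x u - sp x v"
proof -
  note h = sp_has_sum[OF assms(1,3)] sp_has_sum[OF assms(2,3)]
  show 1: "sp (u + v) x = sp u x + sp v x"
    using has_sum_add[OF h] unfolding sp_def[of "u + v"] by (intro infsumI) (simp add: add_divide_distrib distrib_right)
  show 2: "sp (u - v) x = sp u x - sp v x"
    using has_sum_diff[OF h] unfolding sp_def[of "u - v"] by (intro infsumI) (simp add: diff_divide_distrib left_diff_distrib)
  show "sp x (u + v) = sp x u + sp x v" "sp x (u - v) = sp x u - sp x v"
    using arg_cong[OF 1, of cnj] arg_cong[OF 2, of cnj] by (simp_all flip: sp_cnj)
qed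

text \<open>Kernel of the generating function: \<open>chi a b c = (a - b + c) * kap a b c\<close>,
  and \<open>X\<close> is the Hamiltonian vector field of
  \<open>(\<i> / 2) * quad kap q q q q\<close>. The imaginary unit cancels against the one in the
  symplectic structure, which leaves real coefficients for \<open>X\<close>.\<close>

definition kap :: "int \<Rightarrow> int \<Rightarrow> int \<Rightarrow> real" where
  "kap a b c = 1 / (8 * pi * real_of_int ((a - b) * (b - c)))"

lemma inverse_int_le: "\<bar>1 / (8 * pi * real_of_int i)\<bar> \<le> 1"
proof (cases "i = 0")
  case False
  have "1 * 1 \<le> (8 * pi) * \<bar>real_of_int i\<bar>"
    using pi_gt3 False by (intro mult_mono) auto
  then show ?thesis using False by (simp add: abs_mult divide_simps)
qed simp

lemma rt4_ge_1:
  assumes "a \<noteq> 0" "b \<noteq> 0" "c \<noteq> 0" "d \<noteq> 0"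
  shows "1 \<le> rt a * rt b * rt c * rt d"
proof -
  have "1 * 1 * 1 * 1 \<le> rt a * rt b * rt c * rt d"
    by (intro mult_mono rt_ge_1 assms) auto
  then show ?thesis by simp
qed

lemma sp_XX:
  assumes w: "w1 u" "w1 v" "w1 w" "w1 x"
  shows "sp (XX u v w) x = quad kap u v w x"
proof -
  have "(qt kap u v w x has_sum quad kap u v w x) UNIV"
  proof (rule qt_has_sum(1)[OF w])
    fix a b c :: int
    assume "a \<noteq> 0" "b \<noteq> 0" "c \<noteq> 0" "a - b + c \<noteq> 0"
    from rt4_ge_1[OF this] show "\<bar>kap a b c\<bar> \<le> 1 * (rt a * rt b * rt c * rt (a - b + c))"
      unfolding kap_def using inverse_int_le[of "(a - b) * (b - c)"] by linarith
  qed
  moreover have "qt kap u v w x = qt (\<lambda>a b c. 1 / real_of_int (a - b + c) * chi a b c) u v w x"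
  proof
    fix t :: "int \<times> int \<times> int"
    obtain a b c where t: "t = (a, b, c)" by (cases t)
    show "qt kap u v w x t = qt (\<lambda>a b c. 1 / real_of_int (a - b + c) * chi a b c) u v w x t"
    proof (cases "a - b + c = 0")
      case True
      then show ?thesis by (simp add: t qt_def w1_0[OF w(4)])
    next
      case False
      then have "real_of_int (a - b + c) \<noteq> 0" by (metis of_int_eq_0_iff)
      then have "1 / real_of_int (a - b + c) * chi a b c = kap a b c"
        unfolding chi_def kap_def by (simp del: of_int_add of_int_diff of_int_mult)
      then show ?thesis by (simp only: t qt_def prod.case)
    qed
  qed
  ultimately have "(qt (\<lambda>a b c. 1 / real_of_int (a - b + c) * chi a b c) u v w x has_sum quad kap u v w x) UNIV"
    by simp
  from XX_pairing[where \<mu> = "\<lambda>m. 1 / real_of_int m", OF w this] show ?thesis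
    unfolding sp_def by (intro infsumI) (simp add: mult_ac)
qed

text \<open>The product \<open>(a - b) * (b - c)\<close> is invariant under each of the exchanges of
  \<open>a\<close> with \<open>c\<close> and of \<open>b\<close> with \<open>d\<close>, but changes
  sign when the two pairs are exchanged. That sign compensates the imaginary unit under conjugation
  and makes the generating function real.\<close>

lemma kap_sym: "kap c b a = kap a b c" "kap a (a - b + c) c = kap a b c" "kap b a (a - b + c) = - kap a b c"
proof -
  have "(c - b) * (b - a) = (a - b) * (b - c)" "(a - (a - b + c)) * ((a - b + c) - c) = (a - b) * (b - c)"
    "(b - a) * (a - (a - b + c)) = - ((a - b) * (b - c))" by (auto simp: algebra_simps)
  then show "kap c b a = kap a b c" "kap a (a - b + c) c = kap a b c" "kap b a (a - b + c) = - kap a b c"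
    unfolding kap_def by (simp_all only: of_int_minus) (simp_all del: of_int_mult of_int_diff)
qed

lemma quad_minus: "quad (\<lambda>a b c. - \<kappa> a b c) u v w x = - quad \<kappa> u v w x"
proof -
  have "qt (\<lambda>a b c. - \<kappa> a b c) u v w x = (\<lambda>t. - qt \<kappa> u v w x t)" by (auto simp: qt_def)
  then show ?thesis unfolding quad_def by (simp add: infsum_uminus)
qed

definition LX :: "seq \<Rightarrow> seq \<Rightarrow> seq" where
  "LX z a = XX a z z + XX z a z + XX z z a"

text \<open>The linearised vector field is Hamiltonian.\<close>

lemma sp_LX:
  assumes z: "w1 z" "w1 a" "w1 b"
  shows "Im (sp (LX z a) b) = Im (sp (LX z b) a)"
proof -
  have e: "sp (LX z a) b = 2 * quad kap a z z b + quad kap z a z b" if "w1 a" "w1 b" for a b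
  proof -
    have "sp (LX z a) b = quad kap a z z b + quad kap z a z b + quad kap z z a b"
      unfolding LX_def using that z by (simp add: sp_add sp_XX XX_w1 w1_lin)
    also have "quad kap z z a b = quad kap a z z b"
      by (subst quad_swap_ac) (simp add: kap_sym)
    finally show ?thesis by simp
  qed
  have "cnj (quad kap b z z a) = - quad kap z b a z"
    by (subst quad_cnj) (simp add: kap_sym quad_minus)
  also have "quad kap z b a z = quad kap a b z z"
    by (subst quad_swap_ac) (simp add: kap_sym)
  also have "quad kap a b z z = quad kap a z z b"
    by (subst quad_swap_bd) (simp add: kap_sym)
  finally have "Im (quad kap b z z a) = Im (quad kap a z z b)"
    by (metis cnj.sel(2) neg_equal_iff_equal uminus_complex.sel(2))
  moreover have "quad kap z a z b = quad kap z b z a"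
    by (subst quad_swap_bd) (simp add: kap_sym)
  ultimately show ?thesis using z by (simp add: e)
qed

text \<open>On expanding, the two sides differ only in the sign of the mixed terms, whose imaginary
  parts cancel because \<open>LX z\<close> is skew for the symplectic form; the term with
  \<open>LX\<close> in both slots is common.\<close>

lemma symp_cayley:
  assumes "w1 z" "w1 a" "w1 b"
  shows "symp_form (a + LX z a) (b + LX z b) = symp_form (a - LX z a) (b - LX z b)"
proof -
  have w: "w1 (LX z a)" "w1 (LX z b)" unfolding LX_def using assms by (auto intro!: w1_lin XX_w1)
  have "Im (sp a (LX z b)) = - Im (sp (LX z b) a)" by (subst sp_cnj) simp
  then have "Im (sp (LX z a) b) + Im (sp a (LX z b)) = 0"
    using sp_LX[OF assms] by simp
  then have "Im (sp (a + LX z a) (b + LX z b)) = Im (sp (a - LX z a) (b - LX z b))"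
    using assms w by (simp add: sp_add w1_lin)
  then show ?thesis using assms w by (simp add: symp_form_sp w1_lin)
qed

subsection \<open>The homological equation\<close>

lemma w1_sq:
  assumes "w1 q"
  shows "cmod (q j) * (rt j * cmod (q j)) \<le> n1 q * (rt j * cmod (q j))" "rt j * cmod (q j) * (rt j * cmod (q j)) \<le> n1 q * (rt j * cmod (q j))"
proof -
  have "cmod (q j) \<le> n1 q"
  proof (cases "j = 0")
    case False
    have "1 * cmod (q j) \<le> rt j * cmod (q j)" by (intro mult_right_mono rt_ge_1 False) auto
    then show ?thesis using n1_ge[OF assms, of j] by simp
  qed (use assms in \<open>simp add: w1_def\<close>)
  then show "cmod (q j) * (rt j * cmod (q j)) \<le> n1 q * (rt j * cmod (q j))"
    by (intro mult_right_mono) auto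
  show "rt j * cmod (q j) * (rt j * cmod (q j)) \<le> n1 q * (rt j * cmod (q j))"
    by (intro mult_right_mono n1_ge assms) auto
qed

lemma Lambda_UNIV: "Lambda q = (\<Sum>\<^sub>\<infinity>j. real_of_int j * (cmod (q j))\<^sup>2)"
  unfolding Lambda_def by (rule infsum_cong_neutral) (simp_all add: Zstar_def)

lemma Lambda_has_sum:
  assumes "w1 q"
  shows "((\<lambda>j. real_of_int j * (cmod (q j))\<^sup>2) has_sum Lambda q) UNIV"
proof -
  have su: "(\<lambda>j. n1 q * (rt j * cmod (q j))) summable_on UNIV"
    using assms by (intro summable_on_cmult_right) (simp add: w1_def)
  have "(\<lambda>j. norm (real_of_int j * (cmod (q j))\<^sup>2)) summable_on UNIV"
  proof (rule Infinite_Sum.abs_summable_on_comparison_test'[OF su])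
    fix j
    have "norm (real_of_int j * (cmod (q j))\<^sup>2) = (rt j * rt j) * (cmod (q j) * cmod (q j))"
      unfolding rt_sq by (simp add: abs_mult power2_eq_square)
    then show "norm (real_of_int j * (cmod (q j))\<^sup>2) \<le> n1 q * (rt j * cmod (q j))"
      using w1_sq(2)[OF assms, of j] by (simp add: mult_ac)
  qed
  then have "(\<lambda>j. real_of_int j * (cmod (q j))\<^sup>2) summable_on UNIV"
    by (rule abs_summable_summable)
  then show ?thesis
    unfolding Lambda_UNIV by (rule has_sum_infsum)
qed

definition mu :: "int \<Rightarrow> int \<Rightarrow> int \<Rightarrow> real" where
  "mu a b c = real_of_int (a - b + c) * chi a b c"

lemma mu_has_sum:
  assumes "w1 z"
  shows "(qt mu z z z z has_sum quad mu z z z z) UNIV"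
proof (rule qt_has_sum(1)[OF assms assms assms assms])
  fix a b c :: int
  assume "a \<noteq> 0" "b \<noteq> 0" "c \<noteq> 0"
  from chi_bound[OF this, of "a - b + c"]
  show "\<bar>mu a b c\<bar> \<le> 1 * (rt a * rt b * rt c * rt (a - b + c))"
    unfolding mu_def by (simp add: abs_mult mult_ac)
qed

text \<open>In each mode \<open>|z + X|^2 - |z - X|^2 = 4 Re (X cnj z)\<close>; pairing with the
  weight \<open>m\<close> sums these into a quartic form.\<close>

lemma Lambda_diff:
  assumes z: "w1 z"
  shows "Lambda (z + XX z z z) - Lambda (z - XX z z z) = 4 * Re (quad mu z z z z)"
proof -
  let ?X = "XX z z z"
  have w: "w1 ?X" by (intro XX_w1 z)
  have 1: "((\<lambda>j. real_of_int j * (cmod ((z + ?X) j))\<^sup>2 - real_of_int j * (cmod ((z - ?X) j))\<^sup>2) has_sum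
      Lambda (z + ?X) - Lambda (z - ?X)) UNIV"
    by (intro has_sum_diff Lambda_has_sum w1_lin z w)
  have "((\<lambda>m. of_real (real_of_int m) * ?X m * cnj (z m)) has_sum quad mu z z z z) UNIV"
    by (rule XX_pairing[OF z z z z]) (use mu_has_sum[OF z] in \<open>simp add: mu_def[abs_def]\<close>)
  from has_sum_cmult_right[OF has_sum_Re[OF this], of 4]
  have 2: "((\<lambda>m. 4 * Re (of_real (real_of_int m) * ?X m * cnj (z m))) has_sum 4 * Re (quad mu z z z z)) UNIV" .
  have "4 * Re (of_real (real_of_int j) * ?X j * cnj (z j)) =
      real_of_int j * (cmod ((z + ?X) j))\<^sup>2 - real_of_int j * (cmod ((z - ?X) j))\<^sup>2" for j
  proof -
    have "(cmod (x + y))\<^sup>2 - (cmod (x - y))\<^sup>2 = 4 * Re (y * cnj x)" for x y :: complex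
      unfolding cmod_power2 by (simp add: power2_eq_square algebra_simps)
    from this[of "z j" "?X j"] show ?thesis
      by (simp add: mult.assoc flip: right_diff_distrib)
  qed
  with 2 have "((\<lambda>j. real_of_int j * (cmod ((z + ?X) j))\<^sup>2 - real_of_int j * (cmod ((z - ?X) j))\<^sup>2) has_sum
      4 * Re (quad mu z z z z)) UNIV" by simp
  with 1 show ?thesis by (rule has_sum_unique)
qed

definition full_coeff :: "int \<Rightarrow> int \<Rightarrow> int \<Rightarrow> real" where
  "full_coeff a b c = 1 / (4 * pi)"

text \<open>The flow of \<open>Lambda\<close> rotates mode \<open>j\<close> with frequency
  \<open>j^2\<close>, so at zero momentum \<open>a = b \<or> b = c\<close> says exactly that the
  divisor \<open>a^2 - b^2 + c^2 - d^2\<close> vanishes.\<close>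

definition res_coeff :: "int \<Rightarrow> int \<Rightarrow> int \<Rightarrow> real" where
  "res_coeff a b c = (if a = b \<or> b = c then 1 / (4 * pi) else 0)"

definition nonres_coeff :: "int \<Rightarrow> int \<Rightarrow> int \<Rightarrow> real" where
  "nonres_coeff a b c = (if a = b \<or> b = c then 0 else 1 / (4 * pi))"

lemma bounded_coeff_has_sum:
  assumes w: "w1 u" "w1 v" "w1 w" "w1 x" and \<kappa>: "\<And>a b c. \<bar>\<kappa> a b c\<bar> \<le> 1"
  shows "(qt \<kappa> u v w x has_sum quad \<kappa> u v w x) UNIV"
proof (rule qt_has_sum(1)[OF w])
  fix a b c :: int
  assume "a \<noteq> 0" "b \<noteq> 0" "c \<noteq> 0" "a - b + c \<noteq> 0"
  from rt4_ge_1[OF this] \<kappa>[of a b c] show "\<bar>\<kappa> a b c\<bar> \<le> 1 * (rt a * rt b * rt c * rt (a - b + c))"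
    by linarith
qed

lemma coeff_le_1: "\<bar>full_coeff a b c\<bar> \<le> 1" "\<bar>res_coeff a b c\<bar> \<le> 1" "\<bar>nonres_coeff a b c\<bar> \<le> 1"
  using pi_gt3 by (auto simp: full_coeff_def res_coeff_def nonres_coeff_def divide_simps)

lemma quad_full:
  assumes "w1 z"
  shows "quad full_coeff z z z z = quad res_coeff z z z z + quad nonres_coeff z z z z"
proof -
  have "((\<lambda>t. qt res_coeff z z z z t + qt nonres_coeff z z z z t) has_sum quad res_coeff z z z z + quad nonres_coeff z z z z) UNIV"
    by (intro has_sum_add bounded_coeff_has_sum coeff_le_1 assms)
  moreover have "(\<lambda>t. qt res_coeff z z z z t + qt nonres_coeff z z z z t) = qt full_coeff z z z z"
    by (auto simp: qt_def res_coeff_def nonres_coeff_def full_coeff_def)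
  ultimately show ?thesis unfolding quad_def[of full_coeff] by (simp add: infsumI)
qed

text \<open>\<open>4 Re S\<close> is written as \<open>S + S + cnj S + cnj S\<close>, and the
  symmetries of the index set turn the four copies into sums with kernels \<open>d^2\<close>,
  \<open>b^2\<close>, \<open>-c^2\<close> and \<open>-a^2\<close> times \<open>kap\<close>. Their
  total is \<open>-2 (a - b) (b - c) * kap a b c\<close>, which is \<open>-1 / (4 \<pi>)\<close> off
  the resonances; this is where the divisor cancels.\<close>

lemma homological_equation:
  assumes z: "w1 z"
  shows "of_real (4 * Re (quad mu z z z z)) = - quad nonres_coeff z z z z"
proof -
  define S where "S = quad mu z z z z"
  define T where "T f = qt (\<lambda>a b c. f a b c * kap a b c) z z z z" for f :: "int \<Rightarrow> int \<Rightarrow> int \<Rightarrow> real"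
  have 0: "mu a b c = real_of_int ((a - b + c)\<^sup>2) * kap a b c" for a b c
    unfolding mu_def chi_def kap_def by (simp add: power2_eq_square)
  have 1: "(T (\<lambda>a b c. real_of_int ((a - b + c)\<^sup>2)) has_sum S) UNIV"
    using mu_has_sum[OF z] unfolding S_def T_def 0[abs_def] .
  have 2: "(T (\<lambda>a b c. real_of_int (b\<^sup>2)) has_sum S) UNIV"
    using 1 unfolding T_def by (subst (asm) qt_swap_bd) (simp add: kap_sym)
  have "((\<lambda>t. cnj (T (\<lambda>a b c. real_of_int ((a - b + c)\<^sup>2)) t)) has_sum cnj S) UNIV"
    using 1 by (simp only: has_sum_cnj_iff)
  then have 3: "(T (\<lambda>a b c. - real_of_int (c\<^sup>2)) has_sum cnj S) UNIV"
    unfolding T_def qt_cnj by (simp add: kap_sym)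
  have 4: "(T (\<lambda>a b c. - real_of_int (a\<^sup>2)) has_sum cnj S) UNIV"
    using 3 unfolding T_def by (subst (asm) qt_swap_ac) (simp add: kap_sym)
  from has_sum_add[OF has_sum_add[OF 1 2] has_sum_add[OF 3 4]]
  have "((\<lambda>t. T (\<lambda>a b c. real_of_int ((a - b + c)\<^sup>2)) t + T (\<lambda>a b c. real_of_int (b\<^sup>2)) t +
     (T (\<lambda>a b c. - real_of_int (c\<^sup>2)) t + T (\<lambda>a b c. - real_of_int (a\<^sup>2)) t)) has_sum S + S + (cnj S + cnj S)) UNIV" .
  moreover have "T (\<lambda>a b c. real_of_int ((a - b + c)\<^sup>2)) t + T (\<lambda>a b c. real_of_int (b\<^sup>2)) t +
     (T (\<lambda>a b c. - real_of_int (c\<^sup>2)) t + T (\<lambda>a b c. - real_of_int (a\<^sup>2)) t) = - qt nonres_coeff z z z z t" for t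
  proof -
    obtain a b c where t: "t = (a, b, c)" by (cases t)
    have "real_of_int ((a - b + c)\<^sup>2) + real_of_int (b\<^sup>2) - real_of_int (c\<^sup>2) - real_of_int (a\<^sup>2) = - 2 * real_of_int ((a - b) * (b - c))"
      by (simp add: power2_eq_square algebra_simps)
    then have "(real_of_int ((a - b + c)\<^sup>2) + real_of_int (b\<^sup>2) - real_of_int (c\<^sup>2) - real_of_int (a\<^sup>2)) * kap a b c = - nonres_coeff a b c"
    proof -
      assume eq: "real_of_int ((a - b + c)\<^sup>2) + real_of_int (b\<^sup>2) - real_of_int (c\<^sup>2) - real_of_int (a\<^sup>2) = - 2 * real_of_int ((a - b) * (b - c))"
      \<comment> \<open>For resonant indices both sides are zero, \<open>kap\<close> being a
        division by zero there.\<close>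
      have "real_of_int ((a - b) * (b - c)) = 0 \<longleftrightarrow> a = b \<or> b = c" by simp
      then show ?thesis
        unfolding eq kap_def nonres_coeff_def by (auto simp del: of_int_mult of_int_diff)
    qed
    then have k: "real_of_int ((a - b + c)\<^sup>2) * kap a b c + real_of_int (b\<^sup>2) * kap a b c + (- real_of_int (c\<^sup>2) * kap a b c + - real_of_int (a\<^sup>2) * kap a b c) = - nonres_coeff a b c"
      by (simp only: left_diff_distrib distrib_right)
    have "T (\<lambda>a b c. real_of_int ((a - b + c)\<^sup>2)) t + T (\<lambda>a b c. real_of_int (b\<^sup>2)) t +
     (T (\<lambda>a b c. - real_of_int (c\<^sup>2)) t + T (\<lambda>a b c. - real_of_int (a\<^sup>2)) t) =
      of_real (real_of_int ((a - b + c)\<^sup>2) * kap a b c + real_of_int (b\<^sup>2) * kap a b c + (- real_of_int (c\<^sup>2) * kap a b c + - real_of_int (a\<^sup>2) * kap a b c)) * (z a * cnj (z b) * z c * cnj (z (a - b + c)))"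
      unfolding T_def qt_def t prod.case by (simp only: of_real_add distrib_right mult.assoc)
    then show ?thesis unfolding k by (simp add: t qt_def mult.assoc)
  qed
  ultimately have "((\<lambda>t. - qt nonres_coeff z z z z t) has_sum S + S + (cnj S + cnj S)) UNIV" by simp
  moreover have "((\<lambda>t. - qt nonres_coeff z z z z t) has_sum - quad nonres_coeff z z z z) UNIV"
    by (intro has_sum_uminusI bounded_coeff_has_sum z coeff_le_1)
  ultimately have "S + S + (cnj S + cnj S) = - quad nonres_coeff z z z z" by (rule has_sum_unique)
  moreover have "S + S + (cnj S + cnj S) = of_real (4 * Re S)" by (simp add: complex_eq_iff)
  ultimately show ?thesis by (simp add: S_def)
qed

lemma Gquart_quad:
  assumes "w1 q"
  shows "Gquart q = quad full_coeff q q q q"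
proof -
  let ?Z = "{(j, k, l, m). j \<in> Zstar \<and> k \<in> Zstar \<and> l \<in> Zstar \<and> m \<in> Zstar \<and> j - k + l - m = (0::int)}"
  let ?f = "\<lambda>(a, b, c). q a * cnj (q b) * q c * cnj (q (a - b + c))"
  have "infsum (\<lambda>(j, k, l, m). q j * cnj (q k) * q l * cnj (q m)) ?Z =
      infsum ?f {(a, b, c). a \<noteq> 0 \<and> b \<noteq> 0 \<and> c \<noteq> 0 \<and> a - b + c \<noteq> 0}"
    by (rule infsum_reindex_bij_witness[where i = "\<lambda>(a, b, c). (a, b, c, a - b + c)" and j = "\<lambda>(a, b, c, d). (a, b, c)"])
       (auto simp: Zstar_def)
  also have "\<dots> = infsum ?f UNIV"
    by (rule infsum_cong_neutral) (use w1_0[OF assms] in auto)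
  also have "1 / (4 * complex_of_real pi) * \<dots> = infsum (\<lambda>t. 1 / (4 * complex_of_real pi) * ?f t) UNIV"
    by (rule infsum_cmult_right'[symmetric])
  also have "\<dots> = quad full_coeff q q q q"
    unfolding quad_def by (intro infsum_cong) (auto simp: qt_def full_coeff_def)
  finally show ?thesis unfolding Gquart_def .
qed

text \<open>Inclusion and exclusion on \<open>a = b\<close> and \<open>b = c\<close>: each set
  contributes \<open>N^2 / (4 \<pi>)\<close>, and the intersection, where all indices coincide, has
  been counted twice. This explains the two coefficients of \<open>B\<close> and the opposite sign
  of the first.\<close>

lemma Bquart_quad:
  assumes q: "w1 q"
  shows "of_real (Bquart q) = quad res_coeff q q q q"
proof -
  define f where "f j = (cmod (q j))\<^sup>2" for j
  have f0: "0 \<le> f j" for j by (simp add: f_def)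
  have su: "(\<lambda>j. n1 q * (rt j * cmod (q j))) summable_on UNIV"
    using q by (intro summable_on_cmult_right) (simp add: w1_def)
  have fle: "f j \<le> n1 q * (rt j * cmod (q j))" for j
  proof (cases "j = 0")
    case False
    have "1 * cmod (q j) \<le> rt j * cmod (q j)" by (intro mult_right_mono rt_ge_1 False) auto
    then have "cmod (q j) * cmod (q j) \<le> cmod (q j) * (rt j * cmod (q j))"
      by (intro mult_left_mono) auto
    then show ?thesis using w1_sq(1)[OF q, of j] by (simp add: f_def power2_eq_square)
  qed (simp add: f_def w1_0[OF q])
  have fs: "f summable_on UNIV"
    by (rule summable_on_comparison_test[OF su fle f0])
  define N where "N = (\<Sum>\<^sub>\<infinity>j. f j)"
  define Q where "Q = (\<Sum>\<^sub>\<infinity>j. (f j)\<^sup>2)"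
  have N: "(f has_sum N) UNIV" unfolding N_def using fs by simp
  have "N = (\<Sum>\<^sub>\<infinity>j\<in>Zstar. (cmod (q j))\<^sup>2)"
    unfolding N_def f_def by (rule infsum_cong_neutral) (auto simp: Zstar_def w1_0[OF q])
  moreover have "Q = (\<Sum>\<^sub>\<infinity>j\<in>Zstar. (cmod (q j)) ^ 4)"
    unfolding Q_def f_def by (rule infsum_cong_neutral) (auto simp: Zstar_def w1_0[OF q])
  ultimately have B: "Bquart q = - 1 / (4 * pi) * Q + 1 / (2 * pi) * N\<^sup>2"
    unfolding Bquart_def by simp
  have NN: "((\<lambda>(a, b). f a * f b) has_sum N * N) (UNIV \<times> UNIV)"
    by (intro has_sum_prod N f0)
  let ?T = "qt full_coeff q q q q"
  let ?E1 = "{(a, b, c). a = b}" and ?E2 = "{(a :: int, b :: int, c :: int). b = c}"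
  have qq: "q a * cnj (q a) = of_real (f a)" for a
    by (simp only: complex_norm_square[symmetric] f_def)
  have t1: "?T (a, a, c) = of_real (1 / (4 * pi) * (f a * f c))" for a c
  proof -
    have "?T (a, a, c) = of_real (1 / (4 * pi)) * ((q a * cnj (q a)) * (q c * cnj (q c)))"
      by (simp add: qt_def full_coeff_def)
    then show ?thesis unfolding qq by simp
  qed
  have t2: "?T (a, c, c) = of_real (1 / (4 * pi) * (f a * f c))" for a c
  proof -
    have "?T (a, c, c) = of_real (1 / (4 * pi)) * ((q a * cnj (q a)) * (q c * cnj (q c)))"
      by (simp add: qt_def full_coeff_def)
    then show ?thesis unfolding qq by simp
  qed
  have NN': "((\<lambda>(a, b). complex_of_real (1 / (4 * pi) * (f a * f b))) has_sum of_real (1 / (4 * pi) * (N * N))) UNIV"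
    using has_sum_of_real[OF has_sum_cmult_right[OF NN, of "1 / (4 * pi)"], where 'a = complex] by (simp add: case_prod_unfold)
  have s1: "(?T has_sum of_real (1 / (4 * pi) * (N * N))) ?E1"
    using NN' by (subst has_sum_reindex_bij_witness[where i = "\<lambda>(x, y). (x, x, y)" and j = "\<lambda>(a, b, c). (a, c)" and T = UNIV]) (auto simp: t1)
  have s2: "(?T has_sum of_real (1 / (4 * pi) * (N * N))) ?E2"
    using NN' by (subst has_sum_reindex_bij_witness[where i = "\<lambda>(x, y). (x, y, y)" and j = "\<lambda>(a, b, c). (a, c)" and T = UNIV]) (auto simp: t2)
  have sumT: "?T summable_on A" for A
    using bounded_coeff_has_sum[OF q q q q coeff_le_1(1)] by (meson has_sum_imp_summable subset_UNIV summable_on_subset_banach)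
  have "infsum ?T (?E1 \<inter> ?E2) = infsum (\<lambda>j. complex_of_real (1 / (4 * pi) * (f j)\<^sup>2)) UNIV"
    by (rule infsum_reindex_bij_witness[where i = "\<lambda>x. (x, x, x)" and j = "\<lambda>(a, b, c). a"]) (auto simp: t2 power2_eq_square)
  also have "\<dots> = of_real (infsum (\<lambda>j. 1 / (4 * pi) * (f j)\<^sup>2) UNIV)"
  proof -
    have "(\<lambda>j. 1 / (4 * pi) * (f j)\<^sup>2) summable_on UNIV"
    proof -
      have "(\<lambda>j. N * f j) summable_on UNIV" using fs by (rule summable_on_cmult_right)
      then have "(\<lambda>j. (f j)\<^sup>2) summable_on UNIV"
      proof (rule summable_on_comparison_test)
        show "(f j)\<^sup>2 \<le> N * f j" for j
          using finite_sum_le_has_sum[OF N, of "{j}"] f0 by (auto simp: power2_eq_square intro!: mult_right_mono)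
      qed simp
      then show ?thesis by (rule summable_on_cmult_right)
    qed
    then show ?thesis by (intro infsumI has_sum_of_real has_sum_infsum)
  qed
  also have "infsum (\<lambda>j. 1 / (4 * pi) * (f j)\<^sup>2) UNIV = 1 / (4 * pi) * Q"
    unfolding Q_def by (rule infsum_cmult_right')
  finally have s3: "infsum ?T (?E1 \<inter> ?E2) = of_real (1 / (4 * pi) * Q)" .
  have "quad res_coeff q q q q = infsum ?T (?E1 \<union> ?E2)"
    unfolding quad_def by (rule infsum_cong_neutral) (auto simp: qt_def res_coeff_def full_coeff_def)
  also have "\<dots> = infsum ?T ?E1 + infsum ?T ?E2 - infsum ?T (?E1 \<inter> ?E2)"
    by (rule infsum_Un_Int[OF sumT sumT sumT])
  also have "\<dots> = of_real (Bquart q)"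
    unfolding infsumI[OF s1] infsumI[OF s2] s3 B by (simp add: power2_eq_square field_simps)
  finally show ?thesis ..
qed

lemma Ham_transformed:
  assumes z: "w1 z"
  shows "Ham (z + XX z z z) = of_real (Lambda (z - XX z z z)) +
    (quad res_coeff z z z z - quad full_coeff z z z z + quad full_coeff (z + XX z z z) (z + XX z z z) (z + XX z z z) (z + XX z z z))"
proof -
  have "w1 (z + XX z z z)" by (intro w1_lin XX_w1 z)
  then have "Ham (z + XX z z z) = of_real (Lambda (z - XX z z z) + 4 * Re (quad mu z z z z)) +
    quad full_coeff (z + XX z z z) (z + XX z z z) (z + XX z z z) (z + XX z z z)"
    unfolding Ham_def using Lambda_diff[OF z] by (simp add: Gquart_quad flip: Lambda_diff[OF z])
  also have "\<dots> = of_real (Lambda (z - XX z z z)) + of_real (4 * Re (quad mu z z z z)) +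
    quad full_coeff (z + XX z z z) (z + XX z z z) (z + XX z z z) (z + XX z z z)"
    by (simp only: of_real_add)
  finally show ?thesis
    unfolding homological_equation[OF z] quad_full[OF z] by simp
qed

lemma quad_real:
  assumes "\<And>a b c. \<kappa> b a (a - b + c) = \<kappa> a b c"
  shows "Im (quad \<kappa> u u u u) = 0"
proof -
  have "cnj (quad \<kappa> u u u u) = quad \<kappa> u u u u"
    by (subst quad_cnj) (simp add: assms)
  then show ?thesis by (simp add: complex_eq_iff)
qed

section \<open>Expansion over multi-indices\<close>

fun alts :: "int list \<Rightarrow> int" where
  "alts [] = 0"
| "alts (j # js) = j - alts js"

lemma alts_append: "alts (xs @ ys) = (if even (length xs) then alts xs + alts ys else alts xs - alts ys)"
  by (induction xs) auto

lemma alts_sum: "(\<Sum>i<length js. (- 1) ^ i * js ! i) = alts js"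
proof (induction js)
  case (Cons j js)
  have "(\<Sum>i<length (j # js). (- 1) ^ i * (j # js) ! i) = j + (\<Sum>i<length js. (- 1) ^ Suc i * js ! i)"
    by (simp only: length_Cons sum.lessThan_Suc_shift nth_Cons_0 nth_Cons_Suc) simp
  also have "(\<Sum>i<length js. (- 1) ^ Suc i * js ! i) = - (\<Sum>i<length js. (- 1) ^ i * js ! i)"
    by (simp add: sum_negf)
  finally show ?case using Cons by simp
qed simp

text \<open>Removing the head shifts the parity of all positions, and conjugation undoes the shift.
  This recursion replaces the index arithmetic of \<open>monomial\<close> by list induction.\<close>

lemma monomial_simps [simp]: "monomial [] q = 1" "monomial (j # js) q = q j * cnj (monomial js q)"
proof -
  show "monomial (j # js) q = q j * cnj (monomial js q)"
    unfolding monomial_def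
    by (simp only: length_Cons prod.lessThan_Suc_shift nth_Cons_0 nth_Cons_Suc cnj_prod)
       (auto intro!: arg_cong2[of _ _ _ _ "(*)"] prod.cong)
qed (simp add: monomial_def)

lemma monomial_append: "monomial (xs @ ys) q =
    (if even (length xs) then monomial xs q * monomial ys q else monomial xs q * cnj (monomial ys q))"
  by (induction xs) auto

section \<open>Sums of products over lists\<close>

definition rprod :: "int list \<Rightarrow> real" where
  "rprod js = prod_list (map rt js)"

definition pm :: "(int \<Rightarrow> real) \<Rightarrow> int list \<Rightarrow> real" where
  "pm f js = prod_list (map f js)"

lemma rprod_simps [simp]: "rprod [] = 1" "rprod (j # js) = rt j * rprod js" "rprod (xs @ ys) = rprod xs * rprod ys"
  by (simp_all add: rprod_def)

lemma rprod_nonneg [simp]: "0 \<le> rprod js"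
  by (induction js) auto

lemma pm_simps [simp]: "pm f [] = 1" "pm f (j # js) = f j * pm f js" "pm f (xs @ ys) = pm f xs * pm f ys"
  by (simp_all add: pm_def)

lemma pm_nonneg: "(\<And>j. 0 \<le> f j) \<Longrightarrow> 0 \<le> pm f js"
  by (induction js) auto

lemma pm_monomial: "pm (\<lambda>j. rt j * cmod (q j)) js = rprod js * cmod (monomial js q)"
  by (induction js) (auto simp: norm_mult)

text \<open>The factors may differ from position to position, as the multilinear maps in the Taylor
  expansion of \<open>R\<close> require; \<open>pm_has_sum\<close> is the case of equal
  factors.\<close>

lemma has_sum_prod_lists:
  assumes "\<And>p. p \<in> set ps \<Longrightarrow> (fst p has_sum snd p) UNIV" "\<And>p j. p \<in> set ps \<Longrightarrow> 0 \<le> fst p (j::int)"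
  shows "((\<lambda>js. prod_list (map2 (\<lambda>p j. fst p j) ps js)) has_sum (prod_list (map snd ps) :: real)) {js. length js = length ps}"
  using assms
proof (induction ps)
  case Nil
  have "{js :: int list. length js = 0} = {[]}" by auto
  then show ?case by (simp add: has_sum_finiteI)
next
  case (Cons p ps)
  have nn: "0 \<le> prod_list (map2 (\<lambda>p j. fst p j) ps js)" for js
  proof -
    have "0 \<le> fst p' j" if "(p', j) \<in> set (zip ps js)" for p' j
      using Cons.prems(2)[of p' j] set_zip_leftD[OF that] by simp
    then show ?thesis by (intro prod_list_nonneg) auto
  qed
  have "((\<lambda>(j, js). fst p j * prod_list (map2 (\<lambda>p j. fst p j) ps js)) has_sum snd p * prod_list (map snd ps))
      (UNIV \<times> {js. length js = length ps})"
    by (rule has_sum_prod) (use Cons nn in auto)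
  then show ?case
    by (subst has_sum_reindex_bij_witness[where i = "\<lambda>(j, js). j # js" and j = "\<lambda>js. (hd js, tl js)"
          and T = "UNIV \<times> {js. length js = length ps}" and h = "\<lambda>(j, js). fst p j * prod_list (map2 (\<lambda>p j. fst p j) ps js)"])
       (auto simp: length_Suc_conv)
qed

lemma pm_has_sum:
  assumes "(f has_sum S) UNIV" "\<And>j. 0 \<le> f j"
  shows "(pm f has_sum S ^ n) {js. length js = n}"
proof -
  have eq: "prod_list (map2 (\<lambda>p j. fst p j) (replicate n (f, S)) js) = pm f js" if "length js = n" for js
    using that by (induction js arbitrary: n) (auto simp: length_Suc_conv)
  have "((\<lambda>js. prod_list (map2 (\<lambda>p j. fst p j) (replicate n (f, S)) js)) has_sum prod_list (map snd (replicate n (f, S))))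
     {js. length js = length (replicate n (f, S))}"
    by (rule has_sum_prod_lists) (use assms in auto)
  then show ?thesis
    by (subst (asm) has_sum_cong[OF eq]) auto
qed

lemma pm_series:
  assumes f: "(f has_sum S) UNIV" "\<And>j. 0 \<le> f j" and A: "\<And>n. 0 \<le> A n" "summable (\<lambda>n. A n * S ^ n)"
  shows "((\<lambda>js. A (length js) * pm f js) has_sum (\<Sum>n. A n * S ^ n)) UNIV"
proof -
  have S: "0 \<le> S" using has_sum_nonneg[OF f(1)] f(2) by auto
  have g: "((\<lambda>n. A n * S ^ n) has_sum (\<Sum>n. A n * S ^ n)) UNIV"
    by (intro sums_nonneg_imp_has_sum) (use A S in \<open>auto simp: summable_sums\<close>)
  have fib: "((\<lambda>js. case (n, js) of (n, js) \<Rightarrow> A n * pm f js) has_sum A n * S ^ n) {js. length js = n}" for n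
    using has_sum_cmult_right[OF pm_has_sum[OF f, of n]] by simp
  have "((\<lambda>(n, js). A n * pm f js) has_sum (\<Sum>n. A n * S ^ n)) (SIGMA n:UNIV. {js. length js = n})"
    by (intro has_sum_SigmaI[OF fib g] summable_on_SigmaI[OF fib has_sum_imp_summable[OF g]])
       (use A pm_nonneg f in auto)
  then show ?thesis
    by (subst has_sum_reindex_bij_witness[where i = snd and j = "\<lambda>js. (length js, js)"
          and T = "SIGMA n:UNIV. {js. length js = n}" and h = "\<lambda>(n, js). A n * pm f js"]) auto
qed

text \<open>A list of odd length stands for a monomial in a component of a map, and
  \<open>alts\<close> is the index of that component.\<close>

definition OL :: "int list set" where
  "OL = {js. odd (length js) \<and> 0 \<notin> set js}"

text \<open>Odd lengths put the start of the middle piece at an odd position, where it is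
  conjugated, in accordance with the middle argument of \<open>XX\<close>.\<close>

definition splits3 :: "int list \<Rightarrow> (int list \<times> int list \<times> int list) set" where
  "splits3 js = {(x, y, w). x @ y @ w = js \<and> odd (length x) \<and> odd (length y) \<and> odd (length w)}"

definition splits4 :: "int list \<Rightarrow> (int list \<times> int list \<times> int list \<times> int list) set" where
  "splits4 js = {(x, y, w, v). x @ y @ w @ v = js \<and> odd (length x) \<and> odd (length y) \<and> odd (length w) \<and> odd (length v)}"

text \<open>A split is determined by the lengths of its pieces, so a sum over splits whose terms
  depend on lengths alone is dominated by the sum over \<open>triples\<close> that defines
  \<open>majorant\<close>.\<close>

lemma splits3_lengths:
  "inj_on (\<lambda>(x, y, w). (length x, length y, length w)) (splits3 js)"
  "(x, y, w) \<in> splits3 js \<Longrightarrow> (length x, length y, length w) \<in> triples (length js)"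
proof -
  show "inj_on (\<lambda>(x, y, w). (length x, length y, length w)) (splits3 js)"
  proof (rule inj_onI, clarify, goal_cases)
    case (1 x y w x' y' w')
    then have "x @ (y @ w) = x' @ (y' @ w')" "length x = length x'" by (auto simp: splits3_def)
    then have "x = x'" "y @ w = y' @ w'" by (metis append_eq_append_conv)+
    moreover have "length y = length y'" using 1 by simp
    ultimately show ?case by (metis append_eq_append_conv)
  qed
  assume "(x, y, w) \<in> splits3 js"
  then have "js = x @ y @ w" "0 < length x" "0 < length y" "0 < length w"
    by (auto simp: splits3_def dest: odd_pos)
  then show "(length x, length y, length w) \<in> triples (length js)"
    by (simp add: triples_def)
qed

lemma splits3_less:
  assumes "t \<in> splits3 js"
  shows "length (fst t) < length js" "length (fst (snd t)) < length js" "length (snd (snd t)) < length js"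
proof -
  obtain x y w where t: "t = (x, y, w)" by (cases t)
  then have "js = x @ y @ w" "0 < length x" "0 < length y" "0 < length w"
    using assms by (auto simp: splits3_def dest: odd_pos)
  then show "length (fst t) < length js" "length (fst (snd t)) < length js" "length (snd (snd t)) < length js"
    by (simp_all add: t)
qed

lemma splits4_lengths:
  "inj_on (\<lambda>(x, y, w, v). (length x, length y, length w)) (splits4 js)"
  "(\<lambda>(x, y, w, v). (length x, length y, length w)) ` splits4 js \<subseteq> {..<length js} \<times> {..<length js} \<times> {..<length js}"
proof -
  show "inj_on (\<lambda>(x, y, w, v). (length x, length y, length w)) (splits4 js)"
  proof (rule inj_onI, clarify, goal_cases)
    case (1 x y w v x' y' w' v')
    then have "x @ (y @ w @ v) = x' @ (y' @ w' @ v')" "length x = length x'" by (auto simp: splits4_def)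
    then have x: "x = x'" "y @ (w @ v) = y' @ (w' @ v')" by (metis append_eq_append_conv)+
    moreover have "length y = length y'" "length w = length w'" using 1 by simp_all
    ultimately show ?case by (metis append_eq_append_conv)
  qed
  have "(length x, length y, length w) \<in> {..<length js} \<times> {..<length js} \<times> {..<length js}"
    if "(x, y, w, v) \<in> splits4 js" for x y w v
  proof -
    have "js = x @ y @ w @ v" "0 < length x" "0 < length y" "0 < length w"
      using that by (auto simp: splits4_def dest: odd_pos)
    then show ?thesis by simp
  qed
  then show "(\<lambda>(x, y, w, v). (length x, length y, length w)) ` splits4 js \<subseteq> {..<length js} \<times> {..<length js} \<times> {..<length js}"
    by auto
qed

lemma finite_splits [simp]: "finite (splits3 js)" "finite (splits4 js)"
proof -
  have "(\<lambda>(x, y, w). (length x, length y, length w)) ` splits3 js \<subseteq> triples (length js)"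
    using splits3_lengths(2) by auto
  then show "finite (splits3 js)"
    using splits3_lengths(1) by (meson finite_imageD finite_subset finite_triples)
  show "finite (splits4 js)"
    using splits4_lengths[of js] by (meson finite_imageD finite_subset finite_SigmaI finite_lessThan)
qed

text \<open>The number of splits is at most cubic in the length; the crude exponential form suits
  constants of the type \<open>C ^ r\<close>.\<close>

lemma card_splits4: "real (card (splits4 js)) \<le> 8 ^ length js"
proof -
  have "card (splits4 js) = card ((\<lambda>(x, y, w, v). (length x, length y, length w)) ` splits4 js)"
    by (rule card_image[OF splits4_lengths(1), symmetric])
  also have "\<dots> \<le> card ({..<length js} \<times> {..<length js} \<times> {..<length js})"
    by (rule card_mono[OF _ splits4_lengths(2)]) simp
  also have "\<dots> = length js ^ 3" by (simp add: card_cartesian_product power3_eq_cube)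
  finally have "real (card (splits4 js)) \<le> real (length js) ^ 3"
    by (metis of_nat_le_iff of_nat_power)
  also have "\<dots> \<le> (2 ^ length js) ^ 3"
    using of_nat_less_two_power[of "length js", where 'a = real] by (intro power_mono) auto
  also have "\<dots> = (2 ^ 3) ^ length js" by (metis power_mult mult.commute)
  finally show ?thesis by simp
qed

text \<open>Coefficients of the inverse of \<open>z \<mapsto> z - X(z, z, z)\<close>, by composition along ternary trees.\<close>

function phi :: "int list \<Rightarrow> real" where
  "phi js = (if length js = 1 then 1 else
     (\<Sum>t\<in>splits3 js. chi (alts (fst t)) (alts (fst (snd t))) (alts (snd (snd t))) *
        phi (fst t) * phi (fst (snd t)) * phi (snd (snd t))))"
  by auto
termination
  by (relation "Wellfounded.measure length") (simp_all add: splits3_less)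

declare phi.simps [simp del]

lemma phi_single: "length js = 1 \<Longrightarrow> phi js = 1"
  by (subst phi.simps) simp

lemma phi_rec: "length js \<noteq> 1 \<Longrightarrow> phi js =
    (\<Sum>(x, y, w)\<in>splits3 js. chi (alts x) (alts y) (alts w) * phi x * phi y * phi w)"
  by (subst phi.simps) (simp add: case_prod_unfold)

definition delta :: "int list \<Rightarrow> real" where
  "delta js = (if length js = 1 then 1 else 0)"

text \<open>Coefficients of the midpoint map in the form \<open>2 z - q\<close>, as
  \<open>delta\<close> represents the identity.\<close>

definition psi :: "int list \<Rightarrow> real" where
  "psi js = 2 * phi js - delta js"

text \<open>\<open>|\<alpha> js| \<cdot> max \<le> A sqrt (|m| \<Prod>|j|)\<close>, where \<open>m\<close> is the alternating sum and the maximum is over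
  \<open>m\<close> and all \<open>j\<close>. This form of the bound is preserved by composition.\<close>

definition bnd :: "(int list \<Rightarrow> real) \<Rightarrow> real \<Rightarrow> int list \<Rightarrow> bool" where
  "bnd \<alpha> A js \<longleftrightarrow> 0 \<le> A \<and> (\<forall>v\<in>insert (alts js) (set js). \<bar>\<alpha> js\<bar> * \<bar>real_of_int v\<bar> \<le> A * (rt (alts js) * rprod js))"

lemma rt_cancel:
  assumes "a \<noteq> 0" "x * \<bar>real_of_int a\<bar> \<le> rt a * y"
  shows "x * rt a \<le> y"
proof -
  have "rt a * (x * rt a) \<le> rt a * y" using assms(2) by (simp add: rt_sq[symmetric] mult_ac)
  then show ?thesis using rt_ge_1[OF assms(1)] by simp
qed

text \<open>If \<open>alts js = 0\<close>, the right-hand side of the bound vanishes although the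
  list has a nonzero entry, so the coefficient is zero. Otherwise taking \<open>v = alts js\<close>
  and cancelling one factor \<open>rt (alts js) \<ge> 1\<close> gives the weaker forms.\<close>

lemma bndD:
  assumes b: "bnd \<alpha> A js" and js: "js \<in> OL"
  shows "alts js = 0 \<Longrightarrow> \<alpha> js = 0" "\<bar>\<alpha> js\<bar> * rt (alts js) \<le> A * rprod js" "\<bar>\<alpha> js\<bar> \<le> A * rprod js"
    "v \<in> set js \<Longrightarrow> \<bar>\<alpha> js\<bar> * \<bar>real_of_int v\<bar> \<le> A * (rt (alts js) * rprod js)"
proof -
  have A: "0 \<le> A" using b by (simp add: bnd_def)
  show z: "\<alpha> js = 0" if "alts js = 0"
  proof -
    obtain v where v: "v \<in> set js" "v \<noteq> 0" using js by (cases js) (auto simp: OL_def)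
    then have "\<bar>\<alpha> js\<bar> * \<bar>real_of_int v\<bar> \<le> 0" using b that by (force simp: bnd_def)
    with v(2) show ?thesis by (simp add: mult_le_0_iff)
  qed
  show r: "\<bar>\<alpha> js\<bar> * rt (alts js) \<le> A * rprod js"
  proof (cases "alts js = 0")
    case False
    then show ?thesis using b by (intro rt_cancel) (auto simp: bnd_def mult_ac)
  qed (use A in simp)
  show "\<bar>\<alpha> js\<bar> \<le> A * rprod js"
  proof (cases "alts js = 0")
    case False
    have "\<bar>\<alpha> js\<bar> * 1 \<le> \<bar>\<alpha> js\<bar> * rt (alts js)" by (intro mult_left_mono rt_ge_1 False) auto
    then show ?thesis using r by simp
  qed (use A z in simp)
  show "v \<in> set js \<Longrightarrow> \<bar>\<alpha> js\<bar> * \<bar>real_of_int v\<bar> \<le> A * (rt (alts js) * rprod js)"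
    using b by (simp add: bnd_def)
qed

abbreviation am :: "nat \<Rightarrow> real" where
  "am \<equiv> majorant 0 1 1"

lemma am_nonneg: "0 \<le> am n"
  by (rule majorant_nonneg) auto

lemma OL_append3:
  assumes "odd (length x)" "odd (length y)" "odd (length w)"
  shows "x @ y @ w \<in> OL \<longleftrightarrow> x \<in> OL \<and> y \<in> OL \<and> w \<in> OL" "alts (x @ y @ w) = alts x - alts y + alts w"
    "monomial (x @ y @ w) q = monomial x q * cnj (monomial y q) * monomial w q"
proof -
  show "alts (x @ y @ w) = alts x - alts y + alts w"
    using alts_append[of x "y @ w"] alts_append[of y w] assms by simp
  show "monomial (x @ y @ w) q = monomial x q * cnj (monomial y q) * monomial w q"
    using monomial_append[of x "y @ w" q] monomial_append[of y w q] assms by simp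
  have "odd (length (x @ y @ w))" using assms by simp
  then show "x @ y @ w \<in> OL \<longleftrightarrow> x \<in> OL \<and> y \<in> OL \<and> w \<in> OL"
    using assms unfolding OL_def by (simp del: length_append)
qed

text \<open>For \<open>v\<close> the output index, \<open>chi_bound\<close> at \<open>m\<close>
  produces the factors \<open>rt\<close> of the three inner outputs, and the inner bounds absorb
  them. For \<open>v\<close> inside a piece, the bound of that piece trades \<open>|v|\<close> for
  the factor \<open>rt\<close> of its output; \<open>chi_bound\<close> at that output pays for it,
  and the other two pieces absorb the remaining factors. No constant is lost, so the recursion for
  \<open>am\<close> survives unchanged.\<close>

lemma bnd_compose:
  assumes x: "bnd \<alpha> A x" "x \<in> OL" and y: "bnd \<beta> B y" "y \<in> OL" and w: "bnd \<gamma> C w" "w \<in> OL"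
    and v: "v \<in> insert (alts (x @ y @ w)) (set (x @ y @ w))"
  shows "\<bar>chi (alts x) (alts y) (alts w) * \<alpha> x * \<beta> y * \<gamma> w\<bar> * \<bar>real_of_int v\<bar>
     \<le> A * B * C * (rt (alts (x @ y @ w)) * rprod (x @ y @ w))"
proof -
  let ?a = "alts x" and ?b = "alts y" and ?c = "alts w" and ?m = "alts (x @ y @ w)"
  have ABC: "0 \<le> A" "0 \<le> B" "0 \<le> C" using x y w by (auto simp: bnd_def)
  have m: "?m = ?a - ?b + ?c" using x y w by (intro OL_append3) (auto simp: OL_def)
  show ?thesis
  proof (cases "?a = 0 \<or> ?b = 0 \<or> ?c = 0")
    case True
    then have "\<alpha> x = 0 \<or> \<beta> y = 0 \<or> \<gamma> w = 0" using bndD(1)[OF x] bndD(1)[OF y] bndD(1)[OF w] by blast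
    then show ?thesis using ABC by auto
  next
    case False
    then have nz: "?a \<noteq> 0" "?b \<noteq> 0" "?c \<noteq> 0" by auto
    let ?chi = "\<bar>chi ?a ?b ?c\<bar>"
    note f = bndD(2)[OF x] bndD(2)[OF y] bndD(2)[OF w]
    have chi: "?chi * \<bar>real_of_int u\<bar> \<le> rt ?m * (rt ?a * rt ?b * rt ?c)" if "u \<in> {?m, ?a, ?b, ?c}" for u
      using chi_bound[OF nz, of u] that unfolding m by simp
    have ca: "?chi * rt ?a \<le> rt ?m * (rt ?b * rt ?c)"
      by (rule rt_cancel[OF nz(1)]) (use chi[of ?a] in \<open>simp add: mult_ac\<close>)
    have cb: "?chi * rt ?b \<le> rt ?m * (rt ?a * rt ?c)"
      by (rule rt_cancel[OF nz(2)]) (use chi[of ?b] in \<open>simp add: mult_ac\<close>)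
    have cc: "?chi * rt ?c \<le> rt ?m * (rt ?a * rt ?b)"
      by (rule rt_cancel[OF nz(3)]) (use chi[of ?c] in \<open>simp add: mult_ac\<close>)
    have abs: "\<bar>chi ?a ?b ?c * \<alpha> x * \<beta> y * \<gamma> w\<bar> = ?chi * \<bar>\<alpha> x\<bar> * \<bar>\<beta> y\<bar> * \<bar>\<gamma> w\<bar>"
      by (simp add: abs_mult)
    consider "v = ?m" | "v \<in> set x" | "v \<in> set y" | "v \<in> set w" using v by auto
    then show ?thesis
    proof cases
      case 1
      have "?chi * \<bar>real_of_int v\<bar> * (\<bar>\<alpha> x\<bar> * \<bar>\<beta> y\<bar> * \<bar>\<gamma> w\<bar>) \<le> rt ?m * (rt ?a * rt ?b * rt ?c) * (\<bar>\<alpha> x\<bar> * \<bar>\<beta> y\<bar> * \<bar>\<gamma> w\<bar>)"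
        using 1 chi[of v] by (intro mult_right_mono) auto
      also have "\<dots> = rt ?m * ((\<bar>\<alpha> x\<bar> * rt ?a) * (\<bar>\<beta> y\<bar> * rt ?b) * (\<bar>\<gamma> w\<bar> * rt ?c))" by simp
      also have "\<dots> \<le> rt ?m * ((A * rprod x) * (B * rprod y) * (C * rprod w))"
        using ABC by (intro mult_left_mono mult_mono f) auto
      finally show ?thesis unfolding abs by (simp add: mult_ac)
    next
      case 2
      have "?chi * (\<bar>\<alpha> x\<bar> * \<bar>real_of_int v\<bar>) * (\<bar>\<beta> y\<bar> * \<bar>\<gamma> w\<bar>) \<le> ?chi * (A * (rt ?a * rprod x)) * (\<bar>\<beta> y\<bar> * \<bar>\<gamma> w\<bar>)"
        by (intro mult_right_mono mult_left_mono bndD(4)[OF x 2]) auto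
      also have "\<dots> = (?chi * rt ?a) * (A * rprod x) * (\<bar>\<beta> y\<bar> * \<bar>\<gamma> w\<bar>)" by simp
      also have "\<dots> \<le> (rt ?m * (rt ?b * rt ?c)) * (A * rprod x) * (\<bar>\<beta> y\<bar> * \<bar>\<gamma> w\<bar>)"
        using ABC by (intro mult_right_mono ca) auto
      also have "\<dots> = rt ?m * ((A * rprod x) * (\<bar>\<beta> y\<bar> * rt ?b) * (\<bar>\<gamma> w\<bar> * rt ?c))" by simp
      also have "\<dots> \<le> rt ?m * ((A * rprod x) * (B * rprod y) * (C * rprod w))"
        using ABC by (intro mult_left_mono mult_mono f) auto
      finally show ?thesis unfolding abs by (simp add: mult_ac)
    next
      case 3
      have "?chi * (\<bar>\<beta> y\<bar> * \<bar>real_of_int v\<bar>) * (\<bar>\<alpha> x\<bar> * \<bar>\<gamma> w\<bar>) \<le> ?chi * (B * (rt ?b * rprod y)) * (\<bar>\<alpha> x\<bar> * \<bar>\<gamma> w\<bar>)"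
        by (intro mult_right_mono mult_left_mono bndD(4)[OF y 3]) auto
      also have "\<dots> = (?chi * rt ?b) * (B * rprod y) * (\<bar>\<alpha> x\<bar> * \<bar>\<gamma> w\<bar>)" by simp
      also have "\<dots> \<le> (rt ?m * (rt ?a * rt ?c)) * (B * rprod y) * (\<bar>\<alpha> x\<bar> * \<bar>\<gamma> w\<bar>)"
        using ABC by (intro mult_right_mono cb) auto
      also have "\<dots> = rt ?m * ((\<bar>\<alpha> x\<bar> * rt ?a) * (B * rprod y) * (\<bar>\<gamma> w\<bar> * rt ?c))" by simp
      also have "\<dots> \<le> rt ?m * ((A * rprod x) * (B * rprod y) * (C * rprod w))"
        using ABC by (intro mult_left_mono mult_mono f) auto
      finally show ?thesis unfolding abs by (simp add: mult_ac)
    next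
      case 4
      have "?chi * (\<bar>\<gamma> w\<bar> * \<bar>real_of_int v\<bar>) * (\<bar>\<alpha> x\<bar> * \<bar>\<beta> y\<bar>) \<le> ?chi * (C * (rt ?c * rprod w)) * (\<bar>\<alpha> x\<bar> * \<bar>\<beta> y\<bar>)"
        by (intro mult_right_mono mult_left_mono bndD(4)[OF w 4]) auto
      also have "\<dots> = (?chi * rt ?c) * (C * rprod w) * (\<bar>\<alpha> x\<bar> * \<bar>\<beta> y\<bar>)" by simp
      also have "\<dots> \<le> (rt ?m * (rt ?a * rt ?b)) * (C * rprod w) * (\<bar>\<alpha> x\<bar> * \<bar>\<beta> y\<bar>)"
        using ABC by (intro mult_right_mono cc) auto
      also have "\<dots> = rt ?m * ((\<bar>\<alpha> x\<bar> * rt ?a) * (\<bar>\<beta> y\<bar> * rt ?b) * (C * rprod w))" by simp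
      also have "\<dots> \<le> rt ?m * ((A * rprod x) * (B * rprod y) * (C * rprod w))"
        using ABC by (intro mult_left_mono mult_mono f) auto
      finally show ?thesis unfolding abs by (simp add: mult_ac)
    qed
  qed
qed

text \<open>Induction along the tree. Every split contributes the product of the three inner
  constants, and these products add up to at most \<open>am (length js)\<close>.\<close>

lemma bnd_phi: "js \<in> OL \<Longrightarrow> bnd phi (am (length js)) js"
proof (induction "length js" arbitrary: js rule: less_induct)
  case less
  show ?case
  proof (cases "length js = 1")
    case True
    then obtain j where "js = [j]" by (cases js) auto
    then show ?thesis by (simp add: bnd_def phi_single majorant_1 rt_sq)
  next
    case False
    then have n2: "2 \<le> length js" using less.prems by (cases js; cases "tl js") (auto simp: OL_def)
    have "\<bar>phi js\<bar> * \<bar>real_of_int v\<bar> \<le> am (length js) * (rt (alts js) * rprod js)"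
      if v: "v \<in> insert (alts js) (set js)" for v
    proof -
      let ?g = "\<lambda>(i, j, l). am i * am j * am l"
      let ?len = "\<lambda>(x :: int list, y :: int list, w :: int list). (length x, length y, length w)"
      have "\<bar>phi js\<bar> * \<bar>real_of_int v\<bar> \<le>
         (\<Sum>(x, y, w)\<in>splits3 js. \<bar>chi (alts x) (alts y) (alts w) * phi x * phi y * phi w\<bar> * \<bar>real_of_int v\<bar>)"
        unfolding phi_rec[OF False]
        by (simp add: case_prod_unfold sum_distrib_right[symmetric] mult_right_mono sum_abs)
      also have "\<dots> \<le> (\<Sum>t\<in>splits3 js. ?g (?len t) * (rt (alts js) * rprod js))"
      proof (rule sum_mono)
        fix t assume t: "t \<in> splits3 js"
        obtain x y w where tt: "t = (x, y, w)" by (cases t)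
        have j: "js = x @ y @ w" and o: "odd (length x)" "odd (length y)" "odd (length w)"
          using t by (auto simp: tt splits3_def)
        have OL: "x \<in> OL" "y \<in> OL" "w \<in> OL" using less.prems OL_append3(1)[OF o] j by auto
        have lt: "length x < length js" "length y < length js" "length w < length js"
          using j odd_pos[OF o(1)] odd_pos[OF o(2)] odd_pos[OF o(3)] by auto
        show "(case t of (x, y, w) \<Rightarrow> \<bar>chi (alts x) (alts y) (alts w) * phi x * phi y * phi w\<bar> * \<bar>real_of_int v\<bar>)
          \<le> ?g (?len t) * (rt (alts js) * rprod js)"
          unfolding tt prod.case j
          by (rule bnd_compose) (use less.hyps lt OL v j in auto)
      qed
      also have "\<dots> = (\<Sum>t\<in>splits3 js. ?g (?len t)) * (rt (alts js) * rprod js)"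
        by (simp add: sum_distrib_right)
      also have "(\<Sum>t\<in>splits3 js. ?g (?len t)) = sum ?g (?len ` splits3 js)"
        by (simp add: sum.reindex[OF splits3_lengths(1)])
      also have "\<dots> \<le> sum ?g (triples (length js))"
        by (intro sum_mono2) (use splits3_lengths(2) in \<open>auto simp: am_nonneg\<close>)
      also have "\<dots> = am (length js)"
        using majorant_rec[OF n2, of 0 1 1] by simp
      finally show ?thesis by (simp add: mult_right_mono)
    qed
    then show ?thesis by (simp add: bnd_def am_nonneg)
  qed
qed

lemma bnd_mono: "bnd \<alpha> A js \<Longrightarrow> \<bar>\<beta> js\<bar> \<le> C * \<bar>\<alpha> js\<bar> \<Longrightarrow> 0 \<le> C \<Longrightarrow> bnd \<beta> (C * A) js"
  unfolding bnd_def
proof (intro conjI ballI)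
  fix v assume b: "0 \<le> A \<and> (\<forall>v\<in>insert (alts js) (set js). \<bar>\<alpha> js\<bar> * \<bar>real_of_int v\<bar> \<le> A * (rt (alts js) * rprod js))"
    and le: "\<bar>\<beta> js\<bar> \<le> C * \<bar>\<alpha> js\<bar>" and C: "0 \<le> C" and v: "v \<in> insert (alts js) (set js)"
  have "\<bar>\<beta> js\<bar> * \<bar>real_of_int v\<bar> \<le> C * \<bar>\<alpha> js\<bar> * \<bar>real_of_int v\<bar>"
    using le by (intro mult_right_mono) auto
  also have "\<dots> = C * (\<bar>\<alpha> js\<bar> * \<bar>real_of_int v\<bar>)" by simp
  also have "\<dots> \<le> C * (A * (rt (alts js) * rprod js))"
    using b v C by (intro mult_left_mono) auto
  finally show "\<bar>\<beta> js\<bar> * \<bar>real_of_int v\<bar> \<le> C * A * (rt (alts js) * rprod js)" by simp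
qed auto

text \<open>On singletons \<open>phi\<close>, \<open>delta\<close> and \<open>psi\<close> are all 1,
  and on longer lists \<open>delta\<close> vanishes and \<open>psi\<close> is
  \<open>2 * phi\<close>. The common factor 2 lets all three be treated alike.\<close>

lemma bnd_all:
  assumes "js \<in> OL"
  shows "bnd phi (2 * am (length js)) js" "bnd delta (2 * am (length js)) js" "bnd psi (2 * am (length js)) js"
proof -
  have "\<bar>phi js\<bar> \<le> 2 * \<bar>phi js\<bar>" by simp
  then show "bnd phi (2 * am (length js)) js" by (rule bnd_mono[OF bnd_phi[OF assms]]) simp
  have "\<bar>delta js\<bar> \<le> 2 * \<bar>phi js\<bar>"
    by (cases "length js = 1") (simp_all add: delta_def phi_single)
  then show "bnd delta (2 * am (length js)) js" by (rule bnd_mono[OF bnd_phi[OF assms]]) simp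
  have "\<bar>psi js\<bar> \<le> 2 * \<bar>phi js\<bar>"
    by (cases "length js = 1") (simp_all add: psi_def delta_def phi_single)
  then show "bnd psi (2 * am (length js)) js" by (rule bnd_mono[OF bnd_phi[OF assms]]) simp
qed

section \<open>Evaluation of coefficient families\<close>

definition admissible :: "seq \<Rightarrow> bool" where
  "admissible q \<longleftrightarrow> w1 q \<and> summable (\<lambda>n. am n * n1 q ^ n)"

definition balanced :: "(int list \<Rightarrow> real) \<Rightarrow> bool" where
  "balanced \<alpha> \<longleftrightarrow> (\<forall>js\<in>OL. bnd \<alpha> (2 * am (length js)) js)"

definition wgt :: "seq \<Rightarrow> int list \<Rightarrow> real" where
  "wgt q js = am (length js) * pm (\<lambda>j. rt j * cmod (q j)) js"

definition trm :: "(int list \<Rightarrow> real) \<Rightarrow> seq \<Rightarrow> int list \<Rightarrow> complex" where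
  "trm \<alpha> q js = of_real (\<alpha> js) * monomial js q"

definition OLm :: "int \<Rightarrow> int list set" where
  "OLm m = {js \<in> OL. alts js = m}"

definition ev :: "(int list \<Rightarrow> real) \<Rightarrow> seq \<Rightarrow> seq" where
  "ev \<alpha> q m = infsum (trm \<alpha> q) (OLm m)"

lemma balanced_phi: "balanced phi" and balanced_delta: "balanced delta" and balanced_psi: "balanced psi"
  using bnd_all by (simp_all add: balanced_def)

lemma wgt_nonneg [simp]: "0 \<le> wgt q js"
  unfolding wgt_def by (intro mult_nonneg_nonneg am_nonneg pm_nonneg) simp_all

lemma wgt_has_sum: "admissible q \<Longrightarrow> (wgt q has_sum (\<Sum>n. am n * n1 q ^ n)) UNIV"
  unfolding wgt_def[abs_def] by (rule pm_series) (auto simp: admissible_def am_nonneg w1_has_sum)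

lemma wgt_summable: "admissible q \<Longrightarrow> wgt q summable_on A"
  using wgt_has_sum by (meson has_sum_imp_summable subset_UNIV summable_on_subset_banach)

lemma trm_le:
  assumes "balanced \<alpha>" "js \<in> OL"
  shows "cmod (trm \<alpha> q js) \<le> 2 * wgt q js" "rt (alts js) * cmod (trm \<alpha> q js) \<le> 2 * wgt q js"
proof -
  have b: "bnd \<alpha> (2 * am (length js)) js" using assms by (simp add: balanced_def)
  have w: "2 * wgt q js = (2 * am (length js) * rprod js) * cmod (monomial js q)"
    by (simp add: wgt_def pm_monomial)
  have "\<bar>\<alpha> js\<bar> * cmod (monomial js q) \<le> 2 * wgt q js"
    unfolding w by (intro mult_right_mono bndD(3)[OF b assms(2)]) simp
  then show "cmod (trm \<alpha> q js) \<le> 2 * wgt q js" by (simp add: trm_def norm_mult)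
  have "(\<bar>\<alpha> js\<bar> * rt (alts js)) * cmod (monomial js q) \<le> 2 * wgt q js"
    unfolding w by (intro mult_right_mono bndD(2)[OF b assms(2)]) simp
  then show "rt (alts js) * cmod (trm \<alpha> q js) \<le> 2 * wgt q js"
    by (simp add: trm_def norm_mult mult_ac)
qed

lemma trm_summable:
  assumes "balanced \<alpha>" "admissible q" "A \<subseteq> OL"
  shows "(\<lambda>js. cmod (trm \<alpha> q js)) summable_on A" "(trm \<alpha> q has_sum infsum (trm \<alpha> q) A) A"
proof -
  have "(\<lambda>js. 2 * wgt q js) summable_on A"
    using wgt_summable[OF assms(2)] by (rule summable_on_cmult_right)
  then show *: "(\<lambda>js. cmod (trm \<alpha> q js)) summable_on A"
    by (rule Infinite_Sum.abs_summable_on_comparison_test') (use assms trm_le(1) in blast)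
  from abs_summable_summable[OF *] show "(trm \<alpha> q has_sum infsum (trm \<alpha> q) A) A" by simp
qed

lemma OLm_subset: "OLm m \<subseteq> OL"
  by (auto simp: OLm_def)

lemma ev_has_sum:
  assumes "balanced \<alpha>" "admissible q"
  shows "(trm \<alpha> q has_sum ev \<alpha> q m) (OLm m)"
  unfolding ev_def by (rule trm_summable(2)[OF assms OLm_subset])

text \<open>The coefficient bound leaves room for the factor \<open>rt\<close> of the output index,
  so the values lie again in the weighted l1 space. Component 0 vanishes because coefficients with
  \<open>alts js = 0\<close> do.\<close>

lemma ev_w1:
  assumes \<alpha>: "balanced \<alpha>" and q: "admissible q"
  shows "w1 (ev \<alpha> q)" "n1 (ev \<alpha> q) \<le> 2 * (\<Sum>n. am n * n1 q ^ n)"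
proof -
  have 0: "ev \<alpha> q 0 = 0"
    unfolding ev_def
  proof (rule infsum_0)
    fix js assume "js \<in> OLm 0"
    then have "js \<in> OL" "alts js = 0" by (auto simp: OLm_def)
    then show "trm \<alpha> q js = 0"
      using bndD(1)[of \<alpha> "2 * am (length js)" js] \<alpha> by (simp add: balanced_def trm_def)
  qed
  define S where "S m = (\<Sum>\<^sub>\<infinity>js\<in>OLm m. 2 * wgt q js)" for m
  have su: "(\<lambda>js. 2 * wgt q js) summable_on A" for A
    using wgt_summable[OF q] by (rule summable_on_cmult_right)
  have "bij_betw snd (Sigma UNIV OLm) OL"
    by (rule bij_betwI[where g = "\<lambda>js. (alts js, js)"]) (auto simp: OLm_def)
  from has_sum_reindex_bij_betw[OF this, of "\<lambda>js. 2 * wgt q js"] has_sum_infsum[OF su, of OL]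
  have "((\<lambda>x. 2 * wgt q (snd x)) has_sum (\<Sum>\<^sub>\<infinity>js\<in>OL. 2 * wgt q js)) (Sigma UNIV OLm)" by simp
  then have S: "(S has_sum (\<Sum>\<^sub>\<infinity>js\<in>OL. 2 * wgt q js)) UNIV"
    by (rule has_sum_SigmaD) (use su in \<open>simp add: S_def\<close>)
  have le: "rt m * cmod (ev \<alpha> q m) \<le> S m" for m
  proof -
    have "norm (rt m *\<^sub>R ev \<alpha> q m) \<le> S m"
    proof (rule norm_infsum_le)
      show "((\<lambda>js. rt m *\<^sub>R trm \<alpha> q js) has_sum rt m *\<^sub>R ev \<alpha> q m) (OLm m)"
        by (intro has_sum_bounded_linear[OF bounded_linear_scaleR_right] ev_has_sum \<alpha> q)
      show "((\<lambda>js. 2 * wgt q js) has_sum S m) (OLm m)" unfolding S_def by (intro has_sum_infsum su)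
      show "norm (rt m *\<^sub>R trm \<alpha> q js) \<le> 2 * wgt q js" if "js \<in> OLm m" for js
        using trm_le(2)[OF \<alpha>, of js q] that by (simp add: OLm_def)
    qed
    then show ?thesis by simp
  qed
  have "(\<lambda>m. rt m * cmod (ev \<alpha> q m)) summable_on UNIV"
    by (rule summable_on_comparison_test[OF has_sum_imp_summable[OF S] le]) simp
  then show *: "w1 (ev \<alpha> q)" using 0 by (simp add: w1_def)
  have "n1 (ev \<alpha> q) \<le> (\<Sum>\<^sub>\<infinity>js\<in>OL. 2 * wgt q js)"
    by (rule has_sum_mono[OF w1_has_sum[OF *] S le])
  also have "\<dots> \<le> (\<Sum>\<^sub>\<infinity>js. 2 * wgt q js)"
    by (rule infsum_mono2[OF su su]) auto
  also have "\<dots> = 2 * (\<Sum>n. am n * n1 q ^ n)"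
    by (rule infsumI[OF has_sum_cmult_right[OF wgt_has_sum[OF q]]])
  finally show "n1 (ev \<alpha> q) \<le> 2 * (\<Sum>n. am n * n1 q ^ n)" .
qed

lemma ev_delta:
  assumes "admissible q"
  shows "ev delta q = q"
proof
  fix m
  show "ev delta q m = q m"
  proof (cases "m = 0")
    case True
    then show ?thesis
      using w1_0[OF ev_w1(1)[OF balanced_delta assms]] assms by (simp add: admissible_def w1_def)
  next
    case False
    have "ev delta q m = infsum (trm delta q) {[m]}"
      unfolding ev_def
    proof (rule infsum_cong_neutral)
      fix js assume "js \<in> OLm m - {[m]}"
      then have "length js \<noteq> 1" by (cases js) (auto simp: OLm_def)
      then show "trm delta q js = 0" by (simp add: trm_def delta_def)
    qed (use False in \<open>auto simp: OLm_def OL_def\<close>)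
    then show ?thesis by (simp add: trm_def delta_def)
  qed
qed

lemma ev_psi:
  assumes "admissible q"
  shows "ev psi q = 2 *\<^sub>R ev phi q - q"
proof
  fix m
  have "((\<lambda>js. 2 * trm phi q js - trm delta q js) has_sum 2 * ev phi q m - ev delta q m) (OLm m)"
    by (intro has_sum_diff has_sum_cmult_right ev_has_sum balanced_phi balanced_delta assms)
  moreover have "(\<lambda>js. 2 * trm phi q js - trm delta q js) = trm psi q"
    by (auto simp: trm_def psi_def algebra_simps)
  ultimately show "ev psi q m = (2 *\<^sub>R ev phi q - q) m"
    unfolding ev_def[of psi] using ev_delta[OF assms]
    by (simp add: infsumI scaleR_fun_def scaleR_conv_of_real)
qed

section \<open>Composition of the expansions\<close>

lemma has_sum_prod_complex:
  fixes f :: "'a \<Rightarrow> complex" and g :: "'b \<Rightarrow> complex"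
  assumes f: "(f has_sum F) A" "(\<lambda>x. norm (f x)) summable_on A"
    and g: "(g has_sum G) B" "(\<lambda>x. norm (g x)) summable_on B"
  shows "((\<lambda>(x, y). f x * g y) has_sum F * G) (A \<times> B)"
    and "(\<lambda>p. norm (case p of (x, y) \<Rightarrow> f x * g y)) summable_on (A \<times> B)"
proof -
  have "((\<lambda>(x, y). norm (f x) * norm (g y)) has_sum (\<Sum>\<^sub>\<infinity>x\<in>A. norm (f x)) * (\<Sum>\<^sub>\<infinity>y\<in>B. norm (g y))) (A \<times> B)"
    by (rule has_sum_prod) (use f(2) g(2) in auto)
  then have "(\<lambda>(x, y). norm (f x) * norm (g y)) summable_on (A \<times> B)" by (rule has_sum_imp_summable)
  then show *: "(\<lambda>p. norm (case p of (x, y) \<Rightarrow> f x * g y)) summable_on (A \<times> B)"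
    by (simp add: norm_mult case_prod_unfold)
  show "((\<lambda>(x, y). f x * g y) has_sum F * G) (A \<times> B)"
  proof (rule has_sum_SigmaI)
    show "((\<lambda>y. case (x, y) of (x, y) \<Rightarrow> f x * g y) has_sum f x * G) B" for x
      using has_sum_cmult_right[OF g(1)] by simp
    show "((\<lambda>x. f x * G) has_sum F * G) A" by (rule has_sum_cmult_left[OF f(1)])
    show "(\<lambda>(x, y). f x * g y) summable_on A \<times> B" using abs_summable_summable[OF *] .
  qed
qed

text \<open>Substituting series into a quartic form: the constrained sum is grouped by the keys
  \<open>a\<close>, \<open>b\<close>, \<open>c\<close>, with the fourth key then fixed. The groups
  need only convergence of products, while summability of the whole is a hypothesis, because it
  depends on the growth of \<open>\<kappa>\<close>.\<close>

lemma has_sum_grouped4: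
  fixes f1 :: "'a \<Rightarrow> complex" and f2 :: "'b \<Rightarrow> complex" and f3 :: "'c \<Rightarrow> complex" and f4 :: "'d \<Rightarrow> complex"
    and k1 :: "'a \<Rightarrow> int" and k2 :: "'b \<Rightarrow> int" and k3 :: "'c \<Rightarrow> int" and k4 :: "'d \<Rightarrow> int"
  assumes f1: "\<And>a. (f1 has_sum Fa a) {x \<in> I1. k1 x = a}" "\<And>a. (\<lambda>x. norm (f1 x)) summable_on {x \<in> I1. k1 x = a}"
    and f2: "\<And>a. (f2 has_sum Fb a) {x \<in> I2. k2 x = a}" "\<And>a. (\<lambda>x. norm (f2 x)) summable_on {x \<in> I2. k2 x = a}"
    and f3: "\<And>a. (f3 has_sum Fc a) {x \<in> I3. k3 x = a}" "\<And>a. (\<lambda>x. norm (f3 x)) summable_on {x \<in> I3. k3 x = a}"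
    and f4: "\<And>a. (f4 has_sum Fd a) {x \<in> I4. k4 x = a}" "\<And>a. (\<lambda>x. norm (f4 x)) summable_on {x \<in> I4. k4 x = a}"
  defines "T \<equiv> {(x, y, w, v). x \<in> I1 \<and> y \<in> I2 \<and> w \<in> I3 \<and> v \<in> I4 \<and> k4 v = k1 x - k2 y + k3 w}"
  assumes su: "(\<lambda>(x, y, w, v). \<kappa> (k1 x) (k2 y) (k3 w) * (f1 x * (f2 y * (f3 w * f4 v)))) summable_on T"
  shows "((\<lambda>(x, y, w, v). \<kappa> (k1 x) (k2 y) (k3 w) * (f1 x * (f2 y * (f3 w * f4 v)))) has_sum
     (\<Sum>\<^sub>\<infinity>(a, b, c). \<kappa> a b c * (Fa a * (Fb b * (Fc c * Fd (a - b + c)))))) T"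
proof -
  let ?f = "\<lambda>(x, y, w, v). \<kappa> (k1 x) (k2 y) (k3 w) * (f1 x * (f2 y * (f3 w * f4 v)))"
  define J where "J = (\<lambda>(a, b, c). {x \<in> I1. k1 x = a} \<times> {x \<in> I2. k2 x = b} \<times> {x \<in> I3. k3 x = c} \<times> {x \<in> I4. k4 x = a - b + c})"
  have bij: "bij_betw snd (Sigma UNIV J) T"
    by (rule bij_betwI[where g = "\<lambda>(x, y, w, v). ((k1 x, k2 y, k3 w), (x, y, w, v))"])
       (auto simp: J_def T_def)
  have fs: "(?f has_sum infsum ?f T) T" using su by (rule has_sum_infsum)
  then have "((\<lambda>p. ?f (snd p)) has_sum infsum ?f T) (Sigma UNIV J)"
    using has_sum_reindex_bij_betw[OF bij, of ?f] by simp
  then have "((\<lambda>(a, b, c). \<kappa> a b c * (Fa a * (Fb b * (Fc c * Fd (a - b + c))))) has_sum infsum ?f T) UNIV"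
  proof (rule has_sum_SigmaD)
    fix t :: "int \<times> int \<times> int"
    obtain a b c where t: "t = (a, b, c)" by (cases t)
    note p3 = has_sum_prod_complex[OF f3(1)[of c] f3(2) f4(1)[of "a - b + c"] f4(2)]
    note p2 = has_sum_prod_complex[OF f2(1)[of b] f2(2) p3]
    note p1 = has_sum_prod_complex(1)[OF f1(1)[of a] f1(2) p2]
    have "((\<lambda>s. \<kappa> a b c * (case s of (x, s) \<Rightarrow> f1 x * (case s of (y, s) \<Rightarrow> f2 y * (case s of (w, v) \<Rightarrow> f3 w * f4 v)))) has_sum
      \<kappa> a b c * (Fa a * (Fb b * (Fc c * Fd (a - b + c))))) (J t)"
      unfolding J_def t prod.case by (rule has_sum_cmult_right[OF p1])
    then show "((\<lambda>s. ?f (snd (t, s))) has_sum (case t of (a, b, c) \<Rightarrow> \<kappa> a b c * (Fa a * (Fb b * (Fc c * Fd (a - b + c)))))) (J t)"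
      unfolding t prod.case by (rule has_sum_cong[THEN iffD1, rotated]) (auto simp: J_def)
  qed
  from infsumI[OF this] show ?thesis using fs by (simp only:)
qed

lemma norm_product_summable:
  assumes q: "admissible q"
  shows "(\<lambda>(x, y, w, v). wgt q x * (wgt q y * (wgt q w * wgt q v))) summable_on A"
    and "(\<lambda>(x, y, w). wgt q x * (wgt q y * wgt q w)) summable_on B"
proof -
  note h = wgt_has_sum[OF q]
  note h2 = has_sum_prod[OF h h wgt_nonneg wgt_nonneg]
  have "((\<lambda>(x, p). wgt q x * (case p of (y, w) \<Rightarrow> wgt q y * wgt q w)) has_sum (\<Sum>n. am n * n1 q ^ n) * ((\<Sum>n. am n * n1 q ^ n) * (\<Sum>n. am n * n1 q ^ n))) (UNIV \<times> UNIV \<times> UNIV)"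
    by (rule has_sum_prod[OF h h2]) auto
  note h3 = this
  have "((\<lambda>(x, p). wgt q x * (case p of (y, p) \<Rightarrow> wgt q y * (case p of (w, v) \<Rightarrow> wgt q w * wgt q v))) has_sum (\<Sum>n. am n * n1 q ^ n) * ((\<Sum>n. am n * n1 q ^ n) * ((\<Sum>n. am n * n1 q ^ n) * (\<Sum>n. am n * n1 q ^ n)))) (UNIV \<times> UNIV \<times> UNIV \<times> UNIV)"
    by (rule has_sum_prod[OF h h3]) auto
  then have "(\<lambda>(x, y, w, v). wgt q x * (wgt q y * (wgt q w * wgt q v))) summable_on UNIV"
    by (auto dest!: has_sum_imp_summable simp: case_prod_unfold)
  then show "(\<lambda>(x, y, w, v). wgt q x * (wgt q y * (wgt q w * wgt q v))) summable_on A"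
    by (rule summable_on_subset_banach) auto
  have "(\<lambda>(x, y, w). wgt q x * (wgt q y * wgt q w)) summable_on UNIV"
    using has_sum_imp_summable[OF h3] by (simp add: case_prod_unfold)
  then show "(\<lambda>(x, y, w). wgt q x * (wgt q y * wgt q w)) summable_on B"
    by (rule summable_on_subset_banach) auto
qed

definition cubic_coeff :: "(int list \<Rightarrow> real) \<Rightarrow> int list \<Rightarrow> real" where
  "cubic_coeff \<alpha> js = (\<Sum>(x, y, w)\<in>splits3 js. chi (alts x) (alts y) (alts w) * \<alpha> x * \<alpha> y * \<alpha> w)"

text \<open>Concatenating three odd lists puts the product of their terms into a single monomial, so
  the coefficient of \<open>js\<close> collects all its splits. The factor \<open>chi\<close> is
  paid for by the factors \<open>rt\<close> of the inner outputs in \<open>trm_le\<close>.\<close>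

lemma XX_ev:
  assumes \<alpha>: "balanced \<alpha>" and q: "admissible q"
  shows "(trm (cubic_coeff \<alpha>) q has_sum XX (ev \<alpha> q) (ev \<alpha> q) (ev \<alpha> q) m) (OLm m)"
proof -
  let ?t = "trm \<alpha> q" and ?F = "ev \<alpha> q"
  \<comment> \<open>The fourth family is trivial, with constant key \<open>m\<close>; its constraint
    selects the component \<open>m\<close>.\<close>
  define T where "T = {(x, y, w, v :: unit). x \<in> OL \<and> y \<in> OL \<and> w \<in> OL \<and> v \<in> UNIV \<and> m = alts x - alts y + alts w}"
  let ?f = "\<lambda>(x, y, w, v :: unit). complex_of_real (chi (alts x) (alts y) (alts w)) * (?t x * (cnj (?t y) * (?t w * 1)))"
  have fib: "{x \<in> OL. alts x = a} = OLm a" for a by (simp add: OLm_def)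
  have le: "norm (?f (x, y, w, v)) \<le> 8 * (wgt q x * (wgt q y * wgt q w))"
    if "x \<in> OL" "y \<in> OL" "w \<in> OL" for x y w v
  proof (cases "alts x = 0 \<or> alts y = 0 \<or> alts w = 0")
    case True
    then have "\<alpha> x = 0 \<or> \<alpha> y = 0 \<or> \<alpha> w = 0" using bndD(1) \<alpha> that unfolding balanced_def by blast
    then show ?thesis by (auto simp: trm_def)
  next
    case False
    have "norm (?f (x, y, w, v)) = \<bar>chi (alts x) (alts y) (alts w)\<bar> * (cmod (?t x) * cmod (?t y) * cmod (?t w))"
      by (simp add: norm_mult mult_ac)
    also have "\<dots> \<le> (rt (alts x) * rt (alts y) * rt (alts w)) * (cmod (?t x) * cmod (?t y) * cmod (?t w))"
      using False by (intro mult_right_mono chi_rt(2)) auto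
    also have "\<dots> = (rt (alts x) * cmod (?t x)) * (rt (alts y) * cmod (?t y)) * (rt (alts w) * cmod (?t w))"
      by simp
    also have "\<dots> \<le> (2 * wgt q x) * (2 * wgt q y) * (2 * wgt q w)"
      by (intro mult_mono trm_le(2)[OF \<alpha>] that) auto
    finally show ?thesis by simp
  qed
  have "(\<lambda>(x, y, w). 8 * (wgt q x * (wgt q y * wgt q w))) summable_on {(x, y, w). (x, y, w, ()) \<in> T}"
    using summable_on_cmult_right[OF norm_product_summable(2)[OF q], of 8] by (simp add: case_prod_unfold)
  then have "(\<lambda>(x, y, w, v). 8 * (wgt q x * (wgt q y * wgt q w))) summable_on T"
    by (subst summable_on_reindex_bij_witness[where i = "\<lambda>(x, y, w). (x, y, w, ())" and j = "\<lambda>(x, y, w, v). (x, y, w)"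
       and T = "{(x, y, w). (x, y, w, ()) \<in> T}"]) auto
  then have "(\<lambda>t. norm (?f t)) summable_on T"
    by (rule Infinite_Sum.abs_summable_on_comparison_test') (use le in \<open>force simp: T_def\<close>)
  from abs_summable_summable[OF this] have su: "?f summable_on T" .
  have "(?f has_sum (\<Sum>\<^sub>\<infinity>(a, b, c). complex_of_real (chi a b c) * (?F a * (cnj (?F b) * (?F c * (if a - b + c = m then 1 else 0)))))) T"
    unfolding T_def
  proof (rule has_sum_grouped4[where Fa = ?F and Fb = "\<lambda>b. cnj (?F b)" and Fc = ?F and Fd = "\<lambda>d. if d = m then 1 else 0"])
    show "((\<lambda>_ :: unit. 1) has_sum (if a = m then 1 else 0 :: complex)) {x \<in> UNIV. m = a}" for a
      by (cases "a = m") (auto simp: has_sum_finiteI)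
    show "(\<lambda>_ :: unit. norm (1::complex)) summable_on {x \<in> UNIV. m = a}" for a by simp
    show "?f summable_on {(x, y, w, v :: unit). x \<in> OL \<and> y \<in> OL \<and> w \<in> OL \<and> v \<in> UNIV \<and> m = alts x - alts y + alts w}"
      using su unfolding T_def .
  qed (use ev_has_sum[OF \<alpha> q] trm_summable(1)[OF \<alpha> q OLm_subset] in \<open>simp_all add: fib\<close>)
  also have "(\<Sum>\<^sub>\<infinity>(a, b, c). complex_of_real (chi a b c) * (?F a * (cnj (?F b) * (?F c * (if a - b + c = m then 1 else 0))))) = XX ?F ?F ?F m"
    unfolding XX_def by (rule infsum_cong_neutral) (auto simp: fib_def)
  finally have "(?f has_sum XX ?F ?F ?F m) T" .
  then have "((\<lambda>(js, x, y, w). complex_of_real (chi (alts x) (alts y) (alts w) * \<alpha> x * \<alpha> y * \<alpha> w) * monomial js q) has_sum XX ?F ?F ?F m) (Sigma (OLm m) splits3)"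
  proof (rule has_sum_reindex_bij_witness[THEN iffD1, rotated -1])
    let ?j = "\<lambda>(x, y, w, v :: unit). (x @ y @ w, (x, y, w))" and ?i = "\<lambda>(js :: int list, x, y, w). (x, y, w, ())"
    show "?i (?j a) = a" for a by (cases a) auto
    show "?j a \<in> Sigma (OLm m) splits3" "(case ?j a of (js, x, y, w) \<Rightarrow> complex_of_real (chi (alts x) (alts y) (alts w) * \<alpha> x * \<alpha> y * \<alpha> w) * monomial js q) = ?f a"
      if a: "a \<in> T" for a
    proof -
      obtain x y w where aa: "a = (x, y, w, ())" by (cases a) auto
      have o: "odd (length x)" "odd (length y)" "odd (length w)" using a by (auto simp: aa T_def OL_def)
      show "?j a \<in> Sigma (OLm m) splits3"
        using a OL_append3[OF o] o by (auto simp: aa T_def OLm_def splits3_def)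
      show "(case ?j a of (js, x, y, w) \<Rightarrow> complex_of_real (chi (alts x) (alts y) (alts w) * \<alpha> x * \<alpha> y * \<alpha> w) * monomial js q) = ?f a"
        using OL_append3(3)[OF o, of q] by (simp add: aa trm_def)
    qed
    show "?j (?i b) = b" if "b \<in> Sigma (OLm m) splits3" for b
      using that by (auto simp: splits3_def)
    show "?i b \<in> T" if b: "b \<in> Sigma (OLm m) splits3" for b
    proof -
      obtain js x y w where bb: "b = (js, x, y, w)" by (cases b) auto
      have j: "js = x @ y @ w" and o: "odd (length x)" "odd (length y)" "odd (length w)"
        using b by (auto simp: bb splits3_def)
      then show ?thesis using b OL_append3[OF o] by (auto simp: bb T_def OLm_def)
    qed
  qed simp
  then show ?thesis
  proof (rule has_sum_SigmaD)
    fix js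
    have "complex_of_real (\<Sum>(x, y, w)\<in>splits3 js. chi (alts x) (alts y) (alts w) * \<alpha> x * \<alpha> y * \<alpha> w) * monomial js q =
      (\<Sum>s\<in>splits3 js. case (js, s) of (js, x, y, w) \<Rightarrow> complex_of_real (chi (alts x) (alts y) (alts w) * \<alpha> x * \<alpha> y * \<alpha> w) * monomial js q)"
      unfolding of_real_sum sum_distrib_right by (intro sum.cong) auto
    then show "((\<lambda>s. case (js, s) of (js, x, y, w) \<Rightarrow> complex_of_real (chi (alts x) (alts y) (alts w) * \<alpha> x * \<alpha> y * \<alpha> w) * monomial js q) has_sum trm (cubic_coeff \<alpha>) q js) (splits3 js)"
      by (intro has_sum_finiteI) (simp_all add: trm_def cubic_coeff_def)
  qed
qed

text \<open>The recursion for \<open>phi\<close> says precisely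
  \<open>cubic_coeff phi = phi - delta\<close>, which is the fixed point equation in
  coefficients.\<close>

lemma ev_phi_fixed_point:
  assumes q: "admissible q"
  shows "ev phi q - XX (ev phi q) (ev phi q) (ev phi q) = q"
proof
  fix m
  have cc: "cubic_coeff phi js = phi js - delta js" for js
  proof (cases "length js = 1")
    case True
    then have "splits3 js = {}"
      by (auto simp: splits3_def length_Suc_conv append_eq_Cons_conv)
    then show ?thesis using True by (simp add: cubic_coeff_def delta_def phi_single)
  qed (simp add: cubic_coeff_def delta_def phi_rec)
  have "trm (cubic_coeff phi) q = (\<lambda>js. trm phi q js - trm delta q js)"
    by (intro ext) (simp add: trm_def cc left_diff_distrib)
  with XX_ev[OF balanced_phi q, of m]
  have "((\<lambda>js. trm phi q js - trm delta q js) has_sum XX (ev phi q) (ev phi q) (ev phi q) m) (OLm m)" by simp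
  moreover have "((\<lambda>js. trm phi q js - trm delta q js) has_sum ev phi q m - ev delta q m) (OLm m)"
    by (intro has_sum_diff ev_has_sum balanced_phi balanced_delta q)
  ultimately have "XX (ev phi q) (ev phi q) (ev phi q) m = ev phi q m - ev delta q m"
    by (rule has_sum_unique)
  then show "(ev phi q - XX (ev phi q) (ev phi q) (ev phi q)) m = q m"
    using ev_delta[OF q] by simp
qed

lemma n1_triangle:
  assumes "w1 u" "w1 v"
  shows "n1 (u + v) \<le> n1 u + n1 v"
proof (rule has_sum_mono[OF w1_has_sum[OF w1_lin(2)[OF assms]] has_sum_add[OF w1_has_sum[OF assms(1)] w1_has_sum[OF assms(2)]]])
  show "rt j * cmod ((u + v) j) \<le> rt j * cmod (u j) + rt j * cmod (v j)" for j
    using mult_left_mono[OF norm_triangle_ineq[of "u j" "v j"], of "rt j"] by (simp add: distrib_left)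
qed

lemma n1_eq_0:
  assumes "w1 u" "n1 u \<le> 0"
  shows "u = 0"
proof
  fix j
  show "u j = 0 j"
  proof (cases "j = 0")
    case False
    have "1 * cmod (u j) \<le> rt j * cmod (u j)" by (intro mult_right_mono rt_ge_1 False) auto
    then have "cmod (u j) \<le> 0" using n1_ge[OF assms(1), of j] assms(2) by linarith
    then show ?thesis by simp
  qed (use assms in \<open>simp add: w1_def\<close>)
qed

text \<open>As \<open>XX\<close> has norm at most 1 for \<open>n1\<close>, telescoping over the ball
  of radius 1/2 gives \<open>n1 (z - w) \<le> 3/4 * n1 (z - w)\<close>. This identifies the tree
  series, controlled only in the l1 space, with the inverse constructed in
  \<open>ell2 s\<close>.\<close>

lemma cubic_unique:
  assumes z: "w1 z" "n1 z \<le> 1 / 2" and w: "w1 w" "n1 w \<le> 1 / 2"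
    and eq: "z - XX z z z = w - XX w w w"
  shows "z = w"
proof -
  let ?d = "z - w"
  have d: "w1 ?d" by (intro w1_lin z w)
  have diff1: "XX (u - v) x y = XX u x y - XX v x y" if "w1 u" "w1 v" "w1 x" "w1 y" for u v x y
    using XX_lin(1)[OF that, of 1 "-1"] by simp
  have diff2: "XX x (u - v) y = XX x u y - XX x v y" if "w1 u" "w1 v" "w1 x" "w1 y" for u v x y
    using XX_lin(2)[OF that, of 1 "-1"] by simp
  have diff3: "XX x y (u - v) = XX x y u - XX x y v" if "w1 u" "w1 v" "w1 x" "w1 y" for u v x y
    using XX_lin(3)[OF that, of 1 "-1"] by simp
  have "?d = XX z z z - XX w w w" using eq by (simp add: algebra_simps)
  also have "\<dots> = XX ?d z z + XX w ?d z + XX w w ?d"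
    using z w by (simp add: diff1 diff2 diff3)
  finally have "n1 ?d = n1 (XX ?d z z + XX w ?d z + XX w w ?d)" by simp
  also have "\<dots> \<le> n1 (XX ?d z z) + n1 (XX w ?d z) + n1 (XX w w ?d)"
    using d z w by (meson n1_triangle XX_w1(1) w1_lin(2) add_right_mono order_trans)
  also have "\<dots> \<le> n1 ?d * (n1 z * n1 z) + n1 w * (n1 ?d * n1 z) + n1 w * (n1 w * n1 ?d)"
    by (intro add_mono XX_w1 d z w)
  also have "\<dots> = (n1 z * n1 z + n1 w * n1 z + n1 w * n1 w) * n1 ?d" by (simp add: algebra_simps)
  also have "\<dots> \<le> (1/2 * (1/2) + 1/2 * (1/2) + 1/2 * (1/2)) * n1 ?d"
    using z w by (intro mult_right_mono add_mono mult_mono) auto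
  finally have "n1 ?d \<le> 0" by simp
  then have "?d = 0" by (rule n1_eq_0[OF d])
  then show ?thesis by simp
qed

section \<open>Coefficients of the remainder\<close>

definition EL :: "int list set" where
  "EL = {js. even (length js) \<and> 0 \<notin> set js \<and> alts js = 0}"

definition cq :: "(int \<Rightarrow> int \<Rightarrow> int \<Rightarrow> real) \<Rightarrow> (int list \<Rightarrow> real) \<Rightarrow> int list \<Rightarrow> real" where
  "cq \<kappa> \<alpha> js = (\<Sum>(x, y, w, v)\<in>splits4 js. \<kappa> (alts x) (alts y) (alts w) * (\<alpha> x * (\<alpha> y * (\<alpha> w * \<alpha> v))))"

lemma append4:
  assumes o: "odd (length x)" "odd (length y)" "odd (length w)" "odd (length v)"
  shows "alts (x @ y @ w @ v) = alts x - alts y + alts w - alts v"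
    "monomial (x @ y @ w @ v) q = monomial x q * (cnj (monomial y q) * (monomial w q * cnj (monomial v q)))"
    "x @ y @ w @ v \<in> EL \<longleftrightarrow> x \<in> OL \<and> y \<in> OL \<and> w \<in> OL \<and> v \<in> OL \<and> alts v = alts x - alts y + alts w"
proof -
  show a: "alts (x @ y @ w @ v) = alts x - alts y + alts w - alts v"
    using alts_append[of x "y @ w @ v"] alts_append[of y "w @ v"] alts_append[of w v] o by simp
  show "monomial (x @ y @ w @ v) q = monomial x q * (cnj (monomial y q) * (monomial w q * cnj (monomial v q)))"
    using monomial_append[of x "y @ w @ v" q] monomial_append[of y "w @ v" q] monomial_append[of w v q] o by simp
  have "even (length (x @ y @ w @ v))" using o by simp
  then show "x @ y @ w @ v \<in> EL \<longleftrightarrow> x \<in> OL \<and> y \<in> OL \<and> w \<in> OL \<and> v \<in> OL \<and> alts v = alts x - alts y + alts w"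
    unfolding EL_def mem_Collect_eq a OL_def using o by (auto simp del: length_append)
qed

text \<open>The regrouping of \<open>XX_ev\<close> once more, the constraint on the fourth key now
  being momentum conservation of the quartic form. A bounded kernel needs no factor
  \<open>rt\<close> from the inner outputs.\<close>

lemma quad_ev:
  assumes \<alpha>: "balanced \<alpha>" and q: "admissible q" and \<kappa>: "\<And>a b c. \<bar>\<kappa> a b c\<bar> \<le> 1"
  shows "((\<lambda>js. of_real (cq \<kappa> \<alpha> js) * monomial js q) has_sum
     quad \<kappa> (ev \<alpha> q) (ev \<alpha> q) (ev \<alpha> q) (ev \<alpha> q)) EL"
proof -
  let ?t = "trm \<alpha> q" and ?F = "ev \<alpha> q"
  define T where "T = {(x, y, w, v). x \<in> OL \<and> y \<in> OL \<and> w \<in> OL \<and> v \<in> OL \<and> alts v = alts x - alts y + alts w}"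
  let ?f = "\<lambda>(x, y, w, v). complex_of_real (\<kappa> (alts x) (alts y) (alts w)) * (?t x * (cnj (?t y) * (?t w * cnj (?t v))))"
  have fib: "{x \<in> OL. alts x = a} = OLm a" for a by (simp add: OLm_def)
  have le: "norm (?f (x, y, w, v)) \<le> 16 * (wgt q x * (wgt q y * (wgt q w * wgt q v)))"
    if "x \<in> OL" "y \<in> OL" "w \<in> OL" "v \<in> OL" for x y w v
  proof -
    have "norm (?f (x, y, w, v)) = \<bar>\<kappa> (alts x) (alts y) (alts w)\<bar> * (cmod (?t x) * (cmod (?t y) * (cmod (?t w) * cmod (?t v))))"
      by (simp add: norm_mult)
    also have "\<dots> \<le> 1 * ((2 * wgt q x) * ((2 * wgt q y) * ((2 * wgt q w) * (2 * wgt q v))))"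
      by (intro mult_mono \<kappa> trm_le(1)[OF \<alpha>] that mult_nonneg_nonneg) auto
    finally show ?thesis by simp
  qed
  have "(\<lambda>(x, y, w, v). 16 * (wgt q x * (wgt q y * (wgt q w * wgt q v)))) summable_on T"
    using summable_on_cmult_right[OF norm_product_summable(1)[OF q], of 16 T] by (simp add: case_prod_unfold)
  then have "(\<lambda>t. norm (?f t)) summable_on T"
    by (rule Infinite_Sum.abs_summable_on_comparison_test') (use le in \<open>force simp: T_def\<close>)
  from abs_summable_summable[OF this] have su: "?f summable_on T" .
  have "(?f has_sum (\<Sum>\<^sub>\<infinity>(a, b, c). complex_of_real (\<kappa> a b c) * (?F a * (cnj (?F b) * (?F c * cnj (?F (a - b + c))))))) T"
    unfolding T_def
  proof (rule has_sum_grouped4[where Fa = ?F and Fb = "\<lambda>b. cnj (?F b)" and Fc = ?F and Fd = "\<lambda>b. cnj (?F b)"])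
    show "?f summable_on {(x, y, w, v). x \<in> OL \<and> y \<in> OL \<and> w \<in> OL \<and> v \<in> OL \<and> alts v = alts x - alts y + alts w}"
      using su unfolding T_def .
  qed (use ev_has_sum[OF \<alpha> q] trm_summable(1)[OF \<alpha> q OLm_subset] in \<open>simp_all add: fib\<close>)
  also have "(\<Sum>\<^sub>\<infinity>(a, b, c). complex_of_real (\<kappa> a b c) * (?F a * (cnj (?F b) * (?F c * cnj (?F (a - b + c)))))) = quad \<kappa> ?F ?F ?F ?F"
    unfolding quad_def by (rule infsum_cong) (auto simp: qt_def)
  finally have "(?f has_sum quad \<kappa> ?F ?F ?F ?F) T" .
  then have "((\<lambda>(js, x, y, w, v). complex_of_real (\<kappa> (alts x) (alts y) (alts w) * (\<alpha> x * (\<alpha> y * (\<alpha> w * \<alpha> v)))) * monomial js q) has_sum quad \<kappa> ?F ?F ?F ?F) (Sigma EL splits4)"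
  proof (rule has_sum_reindex_bij_witness[THEN iffD1, rotated -1])
    let ?j = "\<lambda>(x, y, w, v). (x @ y @ w @ v, (x, y, w, v))" and ?i = "\<lambda>(js :: int list, x, y, w, v). (x, y, w, v)"
    show "?i (?j a) = a" for a by (cases a) auto
    show "?j a \<in> Sigma EL splits4" "(case ?j a of (js, x, y, w, v) \<Rightarrow> complex_of_real (\<kappa> (alts x) (alts y) (alts w) * (\<alpha> x * (\<alpha> y * (\<alpha> w * \<alpha> v)))) * monomial js q) = ?f a"
      if a: "a \<in> T" for a
    proof -
      obtain x y w v where aa: "a = (x, y, w, v)" by (cases a) auto
      have o: "odd (length x)" "odd (length y)" "odd (length w)" "odd (length v)" using a by (auto simp: aa T_def OL_def)
      show "?j a \<in> Sigma EL splits4"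
        using a append4(3)[OF o] o by (auto simp: aa T_def splits4_def)
      show "(case ?j a of (js, x, y, w, v) \<Rightarrow> complex_of_real (\<kappa> (alts x) (alts y) (alts w) * (\<alpha> x * (\<alpha> y * (\<alpha> w * \<alpha> v)))) * monomial js q) = ?f a"
        using append4(2)[OF o, of q] by (simp add: aa trm_def)
    qed
    show "?j (?i b) = b" if "b \<in> Sigma EL splits4" for b
      using that by (auto simp: splits4_def)
    show "?i b \<in> T" if b: "b \<in> Sigma EL splits4" for b
    proof -
      obtain js x y w v where bb: "b = (js, x, y, w, v)" by (cases b) auto
      have j: "js = x @ y @ w @ v" and o: "odd (length x)" "odd (length y)" "odd (length w)" "odd (length v)"
        using b by (auto simp: bb splits4_def)
      then show ?thesis using b append4(3)[OF o] by (auto simp: bb T_def)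
    qed
  qed simp
  then show ?thesis
  proof (rule has_sum_SigmaD)
    fix js
    have "complex_of_real (cq \<kappa> \<alpha> js) * monomial js q =
      (\<Sum>s\<in>splits4 js. case (js, s) of (js, x, y, w, v) \<Rightarrow> complex_of_real (\<kappa> (alts x) (alts y) (alts w) * (\<alpha> x * (\<alpha> y * (\<alpha> w * \<alpha> v)))) * monomial js q)"
      unfolding cq_def of_real_sum sum_distrib_right by (intro sum.cong) auto
    then show "((\<lambda>s. case (js, s) of (js, x, y, w, v) \<Rightarrow> complex_of_real (\<kappa> (alts x) (alts y) (alts w) * (\<alpha> x * (\<alpha> y * (\<alpha> w * \<alpha> v)))) * monomial js q) has_sum of_real (cq \<kappa> \<alpha> js) * monomial js q) (splits4 js)"
      by (intro has_sum_finiteI) (simp_all only: finite_splits)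
  qed
qed

text \<open>One summand for each term of \<open>G y - G z + B z - B q\<close>.\<close>

definition cR :: "int list \<Rightarrow> real" where
  "cR js = cq full_coeff psi js - cq full_coeff phi js + cq res_coeff phi js - cq res_coeff delta js"

text \<open>A list of length 4 splits only into singletons, where \<open>phi\<close>,
  \<open>psi\<close> and \<open>delta\<close> agree, so the quartic terms cancel in pairs; shorter
  lists have no split at all.\<close>

lemma cR_short:
  assumes "js \<in> EL" "length js < 6"
  shows "cR js = 0"
proof -
  have one: "length x = 1 \<and> length y = 1 \<and> length w = 1 \<and> length v = 1" if "(x, y, w, v) \<in> splits4 js" for x y w v
  proof -
    have "length x + length y + length w + length v = length js" "odd (length x)" "odd (length y)" "odd (length w)" "odd (length v)"
      using that by (auto simp: splits4_def)
    moreover have "even (length js)" using assms by (simp add: EL_def)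
    ultimately show ?thesis using assms(2) by presburger
  qed
  have 1: "phi x = 1" "psi x = 1" "delta x = 1" if "length x = 1" for x
    using that by (simp_all add: psi_def delta_def phi_single)
  have "cq \<kappa> \<alpha> js = cq \<kappa> \<beta> js"
    if "\<And>x. length x = 1 \<Longrightarrow> \<alpha> x = 1" "\<And>x. length x = 1 \<Longrightarrow> \<beta> x = 1" for \<kappa> \<alpha> \<beta>
    unfolding cq_def
  proof (rule sum.cong)
    fix t assume t: "t \<in> splits4 js"
    obtain x y w v where tt: "t = (x, y, w, v)" by (cases t)
    show "(case t of (x, y, w, v) \<Rightarrow> \<kappa> (alts x) (alts y) (alts w) * (\<alpha> x * (\<alpha> y * (\<alpha> w * \<alpha> v)))) =
      (case t of (x, y, w, v) \<Rightarrow> \<kappa> (alts x) (alts y) (alts w) * (\<beta> x * (\<beta> y * (\<beta> w * \<beta> v))))"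
      using one[of x y w v] t that by (simp add: tt)
  qed simp
  from this[of psi phi full_coeff] this[of phi delta res_coeff] 1 show ?thesis by (simp add: cR_def)
qed

lemma rt_le_prod3:
  assumes nz: "b \<noteq> 0" "c \<noteq> 0" "d \<noteq> 0" and le: "\<bar>a\<bar> \<le> \<bar>b\<bar> + \<bar>c\<bar> + \<bar>d\<bar>"
  shows "rt a \<le> 2 * (rt b * rt c * rt d)"
proof -
  define B C D where "B = \<bar>real_of_int b\<bar>" "C = \<bar>real_of_int c\<bar>" "D = \<bar>real_of_int d\<bar>"
  have g: "1 \<le> B" "1 \<le> C" "1 \<le> D" using nz by (auto simp: B_C_D_def)
  have "B * 1 * 1 \<le> B * C * D" "1 * C * 1 \<le> B * C * D" "1 * 1 * D \<le> B * C * D"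
    using g by (intro mult_mono mult_nonneg_nonneg; simp)+
  then have "B + C + D \<le> 3 * (B * C * D)" by simp
  moreover have "real_of_int \<bar>a\<bar> \<le> B + C + D"
    using le unfolding B_C_D_def by linarith
  moreover have "0 \<le> B * C * D" using g by simp
  ultimately have "real_of_int \<bar>a\<bar> \<le> 2\<^sup>2 * (B * C * D)" by simp
  then have "sqrt (real_of_int \<bar>a\<bar>) \<le> sqrt (2\<^sup>2 * (B * C * D))" by (rule real_sqrt_le_mono)
  also have "\<dots> = 2 * (rt b * rt c * rt d)"
    by (simp only: real_sqrt_mult real_sqrt_abs) (simp add: rt_def B_C_D_def)
  finally show ?thesis by (simp only: rt_def)
qed

text \<open>The piece with the marked entry leaves a factor \<open>rt a\<close> of its output.
  Momentum conservation bounds \<open>|a|\<close> by the sum of the other three outputs, hence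
  \<open>rt a\<close> by twice the product of their factors \<open>rt\<close>, and these are
  absorbed by the remaining pieces.\<close>

lemma four_factor_bound:
  fixes f1 f2 f3 f4 :: real
  assumes nn: "0 \<le> f1" "0 \<le> f2" "0 \<le> f3" "0 \<le> f4" "0 \<le> P1" "0 \<le> U"
    and b1: "f1 * U \<le> P1 * rt a" and b2: "f2 * rt b \<le> P2" and b3: "f3 * rt c \<le> P3" and b4: "f4 * rt d \<le> P4"
    and nz: "b \<noteq> 0" "c \<noteq> 0" "d \<noteq> 0" and le: "\<bar>a\<bar> \<le> \<bar>b\<bar> + \<bar>c\<bar> + \<bar>d\<bar>"
  shows "f1 * U * (f2 * (f3 * f4)) \<le> 2 * (P1 * (P2 * (P3 * P4)))"
proof -
  have P: "0 \<le> P2" "0 \<le> P3" "0 \<le> P4"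
    using b2 b3 b4 nn by (meson mult_nonneg_nonneg order_trans rt_nonneg)+
  have "f1 * U * (f2 * (f3 * f4)) \<le> (P1 * rt a) * (f2 * (f3 * f4))"
    using nn by (intro mult_right_mono b1) auto
  also have "\<dots> \<le> (P1 * (2 * (rt b * rt c * rt d))) * (f2 * (f3 * f4))"
    using nn by (intro mult_right_mono mult_left_mono rt_le_prod3[OF nz le]) auto
  also have "\<dots> = 2 * (P1 * ((f2 * rt b) * ((f3 * rt c) * (f4 * rt d))))" by simp
  also have "\<dots> \<le> 2 * (P1 * (P2 * (P3 * P4)))"
    using nn P by (intro mult_left_mono mult_mono b2 b3 b4) auto
  finally show ?thesis .
qed

text \<open>The 32 is the 2 of \<open>rt_le_prod3\<close> times the factor 2 that
  \<open>balanced\<close> allows to each of the four pieces.\<close>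

lemma split_term_bound:
  assumes \<alpha>: "balanced \<alpha>" and xs: "x \<in> OL" "y \<in> OL" "w \<in> OL" "v \<in> OL" "alts v = alts x - alts y + alts w"
    and u: "u \<in> set (x @ y @ w @ v)"
  shows "\<bar>\<alpha> x * (\<alpha> y * (\<alpha> w * \<alpha> v))\<bar> * \<bar>real_of_int u\<bar> \<le>
    32 * ((am (length x) * am (length y) * am (length w) * am (length v)) * rprod (x @ y @ w @ v))"
proof (cases "alts x = 0 \<or> alts y = 0 \<or> alts w = 0 \<or> alts v = 0")
  case True
  then have "\<alpha> x = 0 \<or> \<alpha> y = 0 \<or> \<alpha> w = 0 \<or> \<alpha> v = 0" using bndD(1) \<alpha> xs unfolding balanced_def by blast
  then show ?thesis using am_nonneg by auto
next
  case False
  define P where "P z = 2 * am (length z) * rprod z" for z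
  have P0: "0 \<le> P z" for z unfolding P_def using am_nonneg by simp
  have b: "\<bar>\<alpha> z\<bar> * rt (alts z) \<le> P z" if "z \<in> OL" for z
    using bndD(2)[of \<alpha> "2 * am (length z)" z] \<alpha> that by (simp add: balanced_def P_def)
  have b': "\<bar>\<alpha> z\<bar> * \<bar>real_of_int u\<bar> \<le> P z * rt (alts z)" if "z \<in> OL" "u \<in> set z" for z
    using bndD(4)[of \<alpha> "2 * am (length z)" z u] \<alpha> that by (simp add: balanced_def P_def mult_ac)
  have tri: "\<bar>alts x\<bar> \<le> \<bar>alts y\<bar> + \<bar>alts w\<bar> + \<bar>alts v\<bar>" "\<bar>alts y\<bar> \<le> \<bar>alts x\<bar> + \<bar>alts w\<bar> + \<bar>alts v\<bar>"
    "\<bar>alts w\<bar> \<le> \<bar>alts x\<bar> + \<bar>alts y\<bar> + \<bar>alts v\<bar>" "\<bar>alts v\<bar> \<le> \<bar>alts x\<bar> + \<bar>alts y\<bar> + \<bar>alts w\<bar>"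
    using xs(5) by linarith+
  have nz: "alts x \<noteq> 0" "alts y \<noteq> 0" "alts w \<noteq> 0" "alts v \<noteq> 0" using False by auto
  have fin: "2 * (P x * (P y * (P w * P v))) = 32 * ((am (length x) * am (length y) * am (length w) * am (length v)) * rprod (x @ y @ w @ v))"
    by (simp add: P_def)
  consider "u \<in> set x" | "u \<in> set y" | "u \<in> set w" | "u \<in> set v" using u by auto
  then have "\<bar>\<alpha> x * (\<alpha> y * (\<alpha> w * \<alpha> v))\<bar> * \<bar>real_of_int u\<bar> \<le> 2 * (P x * (P y * (P w * P v)))"
  proof cases
    case 1
    have "\<bar>\<alpha> x\<bar> * \<bar>real_of_int u\<bar> * (\<bar>\<alpha> y\<bar> * (\<bar>\<alpha> w\<bar> * \<bar>\<alpha> v\<bar>)) \<le> 2 * (P x * (P y * (P w * P v)))"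
      by (rule four_factor_bound[OF _ _ _ _ _ _ b'[OF xs(1) 1] b[OF xs(2)] b[OF xs(3)] b[OF xs(4)] nz(2,3,4) tri(1)]) (auto simp: P0)
    then show ?thesis by (simp add: abs_mult mult_ac)
  next
    case 2
    have "\<bar>\<alpha> y\<bar> * \<bar>real_of_int u\<bar> * (\<bar>\<alpha> x\<bar> * (\<bar>\<alpha> w\<bar> * \<bar>\<alpha> v\<bar>)) \<le> 2 * (P y * (P x * (P w * P v)))"
      by (rule four_factor_bound[OF _ _ _ _ _ _ b'[OF xs(2) 2] b[OF xs(1)] b[OF xs(3)] b[OF xs(4)] nz(1,3,4) tri(2)]) (auto simp: P0)
    then show ?thesis by (simp add: abs_mult mult_ac)
  next
    case 3
    have "\<bar>\<alpha> w\<bar> * \<bar>real_of_int u\<bar> * (\<bar>\<alpha> x\<bar> * (\<bar>\<alpha> y\<bar> * \<bar>\<alpha> v\<bar>)) \<le> 2 * (P w * (P x * (P y * P v)))"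
      by (rule four_factor_bound[OF _ _ _ _ _ _ b'[OF xs(3) 3] b[OF xs(1)] b[OF xs(2)] b[OF xs(4)] nz(1,2,4) tri(3)]) (auto simp: P0)
    then show ?thesis by (simp add: abs_mult mult_ac)
  next
    case 4
    have "\<bar>\<alpha> v\<bar> * \<bar>real_of_int u\<bar> * (\<bar>\<alpha> x\<bar> * (\<bar>\<alpha> y\<bar> * \<bar>\<alpha> w\<bar>)) \<le> 2 * (P v * (P x * (P y * P w)))"
      by (rule four_factor_bound[OF _ _ _ _ _ _ b'[OF xs(4) 4] b[OF xs(1)] b[OF xs(2)] b[OF xs(3)] nz(1,2,3) tri(4)]) (auto simp: P0)
    then show ?thesis by (simp add: abs_mult mult_ac)
  qed
  then show ?thesis unfolding fin .
qed

lemma cq_bound: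
  assumes \<alpha>: "balanced \<alpha>" and \<kappa>: "\<And>a b c. \<bar>\<kappa> a b c\<bar> \<le> 1" and js: "js \<in> EL" and u: "u \<in> set js"
    and am: "\<And>n. am n \<le> B * \<sigma> ^ n" and B: "0 \<le> B" "0 \<le> \<sigma>"
  shows "\<bar>cq \<kappa> \<alpha> js\<bar> * \<bar>real_of_int u\<bar> \<le> 32 * B ^ 4 * (8 * \<sigma>) ^ length js * rprod js"
proof -
  have "\<bar>cq \<kappa> \<alpha> js\<bar> * \<bar>real_of_int u\<bar> \<le> (\<Sum>(x, y, w, v)\<in>splits4 js. \<bar>\<kappa> (alts x) (alts y) (alts w) * (\<alpha> x * (\<alpha> y * (\<alpha> w * \<alpha> v)))\<bar>) * \<bar>real_of_int u\<bar>"
    unfolding cq_def case_prod_unfold by (intro mult_right_mono sum_abs) auto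
  also have "\<dots> = (\<Sum>(x, y, w, v)\<in>splits4 js. \<bar>\<kappa> (alts x) (alts y) (alts w) * (\<alpha> x * (\<alpha> y * (\<alpha> w * \<alpha> v)))\<bar> * \<bar>real_of_int u\<bar>)"
    by (simp add: sum_distrib_right case_prod_unfold)
  also have "\<dots> \<le> (\<Sum>t\<in>splits4 js. 32 * (B ^ 4 * \<sigma> ^ length js * rprod js))"
  proof (rule sum_mono)
    fix t assume t: "t \<in> splits4 js"
    obtain x y w v where tt: "t = (x, y, w, v)" by (cases t)
    have j: "js = x @ y @ w @ v" and o: "odd (length x)" "odd (length y)" "odd (length w)" "odd (length v)"
      using t by (auto simp: tt splits4_def)
    have xs: "x \<in> OL" "y \<in> OL" "w \<in> OL" "v \<in> OL" "alts v = alts x - alts y + alts w"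
      using append4(3)[OF o] js unfolding j by auto
    have "\<bar>\<kappa> (alts x) (alts y) (alts w) * (\<alpha> x * (\<alpha> y * (\<alpha> w * \<alpha> v)))\<bar> * \<bar>real_of_int u\<bar> =
       \<bar>\<kappa> (alts x) (alts y) (alts w)\<bar> * (\<bar>\<alpha> x * (\<alpha> y * (\<alpha> w * \<alpha> v))\<bar> * \<bar>real_of_int u\<bar>)"
      by (simp add: abs_mult)
    also have "\<dots> \<le> 1 * (\<bar>\<alpha> x * (\<alpha> y * (\<alpha> w * \<alpha> v))\<bar> * \<bar>real_of_int u\<bar>)"
      by (intro mult_right_mono \<kappa>) auto
    also have "\<dots> \<le> 32 * ((am (length x) * am (length y) * am (length w) * am (length v)) * rprod js)"
      using split_term_bound[OF \<alpha> xs, of u] u unfolding j by simp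
    also have "\<dots> \<le> 32 * (((B * \<sigma> ^ length x) * (B * \<sigma> ^ length y) * (B * \<sigma> ^ length w) * (B * \<sigma> ^ length v)) * rprod js)"
      using B by (intro mult_left_mono mult_right_mono mult_mono am mult_nonneg_nonneg am_nonneg) auto
    also have "\<dots> = 32 * (B ^ 4 * \<sigma> ^ length js * rprod js)"
      by (simp add: j power_add power_numeral_reduce)
    finally show "(case t of (x, y, w, v) \<Rightarrow> \<bar>\<kappa> (alts x) (alts y) (alts w) * (\<alpha> x * (\<alpha> y * (\<alpha> w * \<alpha> v)))\<bar> * \<bar>real_of_int u\<bar>) \<le> 32 * (B ^ 4 * \<sigma> ^ length js * rprod js)"
      by (simp add: tt)
  qed
  also have "\<dots> = real (card (splits4 js)) * (32 * (B ^ 4 * \<sigma> ^ length js * rprod js))" by simp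
  also have "\<dots> \<le> 8 ^ length js * (32 * (B ^ 4 * \<sigma> ^ length js * rprod js))"
    using B by (intro mult_right_mono card_splits4) auto
  also have "\<dots> = 32 * B ^ 4 * (8 * \<sigma>) ^ length js * rprod js" by (simp add: power_mult_distrib)
  finally show ?thesis .
qed

definition E6 :: "int list set" where
  "E6 = {js \<in> EL. 6 \<le> length js}"

lemma cR_bound:
  obtains D where "1 \<le> D" "\<And>js u. js \<in> E6 \<Longrightarrow> u \<in> set js \<Longrightarrow> \<bar>cR js\<bar> * \<bar>real_of_int u\<bar> \<le> D ^ length js * rprod js"
proof -
  obtain \<rho> where \<rho>: "0 < \<rho>" "\<rho> \<le> 1" "summable (\<lambda>n. am n * \<rho> ^ n)"
    by (rule majorant_summable[of 0 1 1]) auto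
  define B where "B = (\<Sum>n. am n * \<rho> ^ n)"
  have B: "0 \<le> B" unfolding B_def using \<rho> am_nonneg by (intro suminf_nonneg) auto
  have am: "am n \<le> B * (1 / \<rho>) ^ n" for n
  proof -
    have "am n * \<rho> ^ n \<le> B"
      unfolding B_def using sum_le_suminf[OF \<rho>(3), of "{n}"] \<rho> am_nonneg by simp
    then show ?thesis using \<rho> by (simp add: power_divide pos_le_divide_eq)
  qed
  \<comment> \<open>The first factor absorbs the constant \<open>4 * 32 * B ^ 4\<close>, being
    raised to a positive power. In the second, \<open>1 / \<rho>\<close> is the growth rate of
    \<open>am\<close> and 8 counts splits.\<close>
  define D where "D = (128 * B ^ 4 + 1) * (8 * (1 / \<rho>))"
  have g: "1 \<le> 128 * B ^ 4 + 1" "1 \<le> 8 * (1 / \<rho>)" using B \<rho> by (auto simp: divide_simps)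
  have D: "1 \<le> D" unfolding D_def using mult_mono[OF g] g by simp
  have "\<bar>cR js\<bar> * \<bar>real_of_int u\<bar> \<le> D ^ length js * rprod js" if js: "js \<in> E6" and u: "u \<in> set js" for js u
  proof -
    have E: "js \<in> EL" and n: "1 \<le> length js" using js by (auto simp: E6_def)
    let ?X = "32 * B ^ 4 * (8 * (1 / \<rho>)) ^ length js * rprod js"
    have c: "\<bar>cq \<kappa> \<alpha> js\<bar> * \<bar>real_of_int u\<bar> \<le> ?X" if "balanced \<alpha>" "\<And>a b c. \<bar>\<kappa> a b c\<bar> \<le> 1" for \<kappa> \<alpha>
      using that B \<rho> by (intro cq_bound E u am) auto
    have "\<bar>cR js\<bar> \<le> \<bar>cq full_coeff psi js\<bar> + \<bar>cq full_coeff phi js\<bar> + \<bar>cq res_coeff phi js\<bar> + \<bar>cq res_coeff delta js\<bar>"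
      unfolding cR_def by linarith
    then have "\<bar>cR js\<bar> * \<bar>real_of_int u\<bar> \<le> (\<bar>cq full_coeff psi js\<bar> + \<bar>cq full_coeff phi js\<bar> + \<bar>cq res_coeff phi js\<bar> + \<bar>cq res_coeff delta js\<bar>) * \<bar>real_of_int u\<bar>"
      by (intro mult_right_mono) auto
    also have "\<dots> \<le> ?X + ?X + ?X + ?X"
      unfolding distrib_right by (intro add_mono c balanced_psi balanced_phi balanced_delta coeff_le_1)
    also have "\<dots> = (128 * B ^ 4) * ((8 * (1 / \<rho>)) ^ length js * rprod js)" by simp
    also have "\<dots> \<le> (128 * B ^ 4 + 1) ^ length js * ((8 * (1 / \<rho>)) ^ length js * rprod js)"
    proof (rule mult_right_mono)
      have "128 * B ^ 4 \<le> (128 * B ^ 4 + 1) ^ 1" by simp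
      also have "\<dots> \<le> (128 * B ^ 4 + 1) ^ length js" using g n by (intro power_increasing) auto
      finally show "128 * B ^ 4 \<le> (128 * B ^ 4 + 1) ^ length js" .
    qed (use \<rho> in auto)
    also have "\<dots> = D ^ length js * rprod js" unfolding D_def power_mult_distrib by simp
    finally show ?thesis .
  qed
  with D show ?thesis by (rule that)
qed

lemma remainder_expansion:
  assumes q: "admissible q"
  defines "z \<equiv> ev phi q" and "y \<equiv> ev psi q"
  shows "((\<lambda>js. of_real (cR js) * monomial js q) has_sum
    (quad full_coeff y y y y - quad full_coeff z z z z + quad res_coeff z z z z - quad res_coeff q q q q)) E6"
proof -
  note ex = quad_ev[OF _ q coeff_le_1(1)] quad_ev[OF _ q coeff_le_1(2)]
  have "((\<lambda>js. of_real (cq full_coeff psi js) * monomial js q - of_real (cq full_coeff phi js) * monomial js q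
      + of_real (cq res_coeff phi js) * monomial js q - of_real (cq res_coeff delta js) * monomial js q) has_sum
    (quad full_coeff y y y y - quad full_coeff z z z z + quad res_coeff z z z z - quad res_coeff q q q q)) EL"
    unfolding z_def y_def
    by (intro has_sum_diff has_sum_add ex balanced_phi balanced_psi) (use ex(2)[OF balanced_delta] ev_delta[OF q] in simp)
  moreover have "(\<lambda>js. of_real (cq full_coeff psi js) * monomial js q - of_real (cq full_coeff phi js) * monomial js q
      + of_real (cq res_coeff phi js) * monomial js q - of_real (cq res_coeff delta js) * monomial js q) = (\<lambda>js. of_real (cR js) * monomial js q)"
    by (intro ext) (simp add: cR_def algebra_simps)
  ultimately have "((\<lambda>js. of_real (cR js) * monomial js q) has_sum
    (quad full_coeff y y y y - quad full_coeff z z z z + quad res_coeff z z z z - quad res_coeff q q q q)) EL" by simp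
  then show ?thesis
    by (rule has_sum_cong_neutral[THEN iffD1, rotated -1]) (auto simp: E6_def cR_short)
qed

section \<open>The remainder\<close>

text \<open>The polarised \<open>monomial\<close>, from which the Taylor coefficients of
  \<open>R\<close> are formed.\<close>

fun mlin :: "int list \<Rightarrow> seq list \<Rightarrow> complex" where
  "mlin [] xs = 1"
| "mlin (j # js) [] = 1"
| "mlin (j # js) (x # xs) = x j * cnj (mlin js xs)"

lemma mlin_replicate: "mlin js (replicate (length js) q) = monomial js q"
  by (induction js) auto

lemma mlin_linear:
  "length js = length xs + 1 + length ys \<Longrightarrow>
   mlin js (xs @ (a *\<^sub>R u + b *\<^sub>R v) # ys) = a *\<^sub>R mlin js (xs @ u # ys) + b *\<^sub>R mlin js (xs @ v # ys)"
proof (induction xs arbitrary: js)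
  case Nil
  then obtain j js' where "js = j # js'" by (cases js) auto
  then show ?case by (simp add: scaleR_fun_def algebra_simps)
next
  case (Cons x xs)
  then obtain j js' where js: "js = j # js'" by (cases js) auto
  then show ?case using Cons by (simp add: scaleR_conv_of_real algebra_simps)
qed

lemma mlin_norm:
  "length js = length xs \<Longrightarrow> rprod js * cmod (mlin js xs) =
     prod_list (map2 (\<lambda>p j. fst p j) (map (\<lambda>x. (\<lambda>j. rt j * cmod (x j), n1 x)) xs) js)"
proof (induction xs arbitrary: js)
  case (Cons x xs)
  then obtain j js' where js: "js = j # js'" by (cases js) auto
  with Cons(1)[of js'] Cons(2) show ?case by (simp add: norm_mult flip: mult.assoc)
qed simp

text \<open>Derivative of \<open>monomial js\<close> at \<open>q\<close> in the direction
  \<open>v\<close>; real linear in \<open>v\<close>.\<close>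

fun dmon :: "int list \<Rightarrow> seq \<Rightarrow> seq \<Rightarrow> complex" where
  "dmon [] q v = 0"
| "dmon (j # js) q v = v j * cnj (monomial js q) + q j * cnj (dmon js q v)"

text \<open>The part of degree \<open>k\<close> in \<open>t\<close> is at most
  \<open>(|t| / \<eta>)^k\<close> times the corresponding part of \<open>P js\<close>, the product
  of the numbers \<open>|q| + \<eta> |v|\<close>. As \<open>|t| \<le> \<eta>\<close>, removing the
  first one or two degrees gains the stated power of \<open>t / \<eta>\<close>.\<close>

lemma dmon_bounds:
  fixes q v :: seq and t \<eta> :: real
  assumes \<eta>: "0 < \<eta>" "\<bar>t\<bar> \<le> \<eta>"
  defines "P \<equiv> pm (\<lambda>j. cmod (q j) + \<eta> * cmod (v j))"
  shows "cmod (monomial js (q + t *\<^sub>R v)) \<le> P js"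
    and "cmod (monomial js q) \<le> P js"
    and "cmod (monomial js (q + t *\<^sub>R v) - monomial js q) \<le> \<bar>t\<bar> / \<eta> * P js"
    and "cmod (monomial js (q + t *\<^sub>R v) - monomial js q - of_real t * dmon js q v) \<le> (t / \<eta>)\<^sup>2 * P js"
    and "cmod (dmon js q v) \<le> P js / \<eta>"
proof -
  let ?a = "\<lambda>j. cmod (q j)" and ?b = "\<lambda>j. cmod (v j)"
  have P0: "0 \<le> P js" for js unfolding P_def using \<eta> by (intro pm_nonneg) auto
  have PC: "P (j # js) = (?a j + \<eta> * ?b j) * P js" for j js by (simp add: P_def)
  have PN: "P [] = 1" by (simp add: P_def)
  have tb: "cmod ((q + t *\<^sub>R v) j) \<le> ?a j + \<eta> * ?b j" for j
  proof -
    have "cmod ((q + t *\<^sub>R v) j) \<le> ?a j + \<bar>t\<bar> * ?b j"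
      using norm_triangle_ineq[of "q j" "t *\<^sub>R v j"] by (simp add: scaleR_fun_def)
    also have "\<dots> \<le> ?a j + \<eta> * ?b j" using \<eta> by (intro add_left_mono mult_right_mono) auto
    finally show ?thesis .
  qed
  have mono: "cmod (monomial js w) \<le> P js" if "\<And>j. cmod (w j) \<le> ?a j + \<eta> * ?b j" for w js
  proof (induction js)
    case (Cons j js)
    have "cmod (monomial (j # js) w) = cmod (w j) * cmod (monomial js w)" by (simp add: norm_mult)
    also have "\<dots> \<le> P (j # js)" unfolding PC using \<eta> by (intro mult_mono that Cons) auto
    finally show ?case .
  qed (simp add: PN)
  show 1: "cmod (monomial js (q + t *\<^sub>R v)) \<le> P js" for js by (rule mono[OF tb])
  show 2: "cmod (monomial js q) \<le> P js" for js by (rule mono) (use \<eta> in simp)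
  show 3: "cmod (monomial js (q + t *\<^sub>R v) - monomial js q) \<le> \<bar>t\<bar> / \<eta> * P js" for js
  proof (induction js)
    case (Cons j js)
    let ?m = "monomial js q" and ?m' = "monomial js (q + t *\<^sub>R v)"
    have "monomial (j # js) (q + t *\<^sub>R v) - monomial (j # js) q = q j * cnj (?m' - ?m) + of_real t * v j * cnj ?m'"
      by (simp add: scaleR_fun_def scaleR_conv_of_real algebra_simps)
    then have "cmod (monomial (j # js) (q + t *\<^sub>R v) - monomial (j # js) q) \<le> ?a j * cmod (?m' - ?m) + \<bar>t\<bar> * ?b j * cmod ?m'"
      using norm_triangle_ineq[of "q j * cnj (?m' - ?m)" "of_real t * v j * cnj ?m'"]
      by (simp only: norm_mult complex_mod_cnj norm_of_real)
    also have "\<dots> \<le> ?a j * (\<bar>t\<bar> / \<eta> * P js) + \<bar>t\<bar> * ?b j * P js"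
      by (intro add_mono mult_left_mono Cons.IH 1) auto
    also have "\<dots> = \<bar>t\<bar> / \<eta> * P (j # js)" using \<eta>(1) by (simp add: PC field_simps)
    finally show ?case .
  qed (use \<eta> in \<open>simp add: PN\<close>)
  show "cmod (monomial js (q + t *\<^sub>R v) - monomial js q - of_real t * dmon js q v) \<le> (t / \<eta>)\<^sup>2 * P js"
  proof (induction js)
    case (Cons j js)
    let ?m = "monomial js q" and ?m' = "monomial js (q + t *\<^sub>R v)" and ?d = "dmon js q v"
    have "monomial (j # js) (q + t *\<^sub>R v) - monomial (j # js) q - of_real t * dmon (j # js) q v =
       q j * cnj (?m' - ?m - of_real t * ?d) + of_real t * v j * cnj (?m' - ?m)"
      by (simp add: scaleR_fun_def scaleR_conv_of_real algebra_simps)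
    then have "cmod (monomial (j # js) (q + t *\<^sub>R v) - monomial (j # js) q - of_real t * dmon (j # js) q v) \<le>
       ?a j * cmod (?m' - ?m - of_real t * ?d) + \<bar>t\<bar> * ?b j * cmod (?m' - ?m)"
      using norm_triangle_ineq[of "q j * cnj (?m' - ?m - of_real t * ?d)" "of_real t * v j * cnj (?m' - ?m)"]
      by (simp only: norm_mult complex_mod_cnj norm_of_real)
    also have "\<dots> \<le> ?a j * ((t / \<eta>)\<^sup>2 * P js) + \<bar>t\<bar> * ?b j * (\<bar>t\<bar> / \<eta> * P js)"
      by (intro add_mono mult_left_mono Cons.IH 3) auto
    also have "\<dots> = (t / \<eta>)\<^sup>2 * P (j # js)"
      using \<eta>(1) by (simp add: PC power2_eq_square field_simps)
    finally show ?case .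
  qed (simp add: PN)
  show "cmod (dmon js q v) \<le> P js / \<eta>"
  proof (induction js)
    case (Cons j js)
    have "cmod (dmon (j # js) q v) \<le> ?b j * cmod (monomial js q) + ?a j * cmod (dmon js q v)"
      using norm_triangle_ineq[of "v j * cnj (monomial js q)" "q j * cnj (dmon js q v)"] by (simp add: norm_mult)
    also have "\<dots> \<le> ?b j * P js + ?a j * (P js / \<eta>)"
      by (intro add_mono mult_left_mono Cons.IH 2) auto
    also have "\<dots> = P (j # js) / \<eta>" using \<eta>(1) by (simp add: PC field_simps)
    finally show ?case .
  qed (use \<eta> in \<open>simp add: PN\<close>)
qed

section \<open>Marked entries of a multi-index\<close>

definition cuts :: "int \<Rightarrow> int list \<Rightarrow> (int list \<times> int list) set" where
  "cuts j js = {(x, r). x @ j # r = js}"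

lemma finite_cuts [simp]: "finite (cuts j js)"
proof (rule finite_subset)
  show "cuts j js \<subseteq> (\<lambda>n. (take n js, drop (Suc n) js)) ` {..length js}"
  proof
    fix t assume "t \<in> cuts j js"
    then obtain x r where t: "t = (x, r)" "js = x @ j # r" by (auto simp: cuts_def)
    then show "t \<in> (\<lambda>n. (take n js, drop (Suc n) js)) ` {..length js}"
      by (intro image_eqI[of _ _ "length x"]) auto
  qed
qed simp

lemma cuts_Cons: "cuts j (k # js) = (if k = j then {([], js)} else {}) \<union> (\<lambda>(x, r). (k # x, r)) ` cuts j js"
proof (rule set_eqI)
  fix t :: "int list \<times> int list"
  obtain x r where t: "t = (x, r)" by (cases t)
  show "t \<in> cuts j (k # js) \<longleftrightarrow> t \<in> (if k = j then {([], js)} else {}) \<union> (\<lambda>(x, r). (k # x, r)) ` cuts j js"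
    unfolding t by (cases x) (auto simp: cuts_def image_iff)
qed

text \<open>In a coordinate direction the product rule leaves one term for each occurrence of
  \<open>j\<close>, namely the product over the entries to its left and right.\<close>

lemma dmon_unit:
  assumes "cmod e = 1"
  shows "cmod (dmon js q (unit_seq j e)) \<le> (\<Sum>(x, r)\<in>cuts j js. pm (\<lambda>k. cmod (q k)) x * pm (\<lambda>k. cmod (q k)) r)"
proof (induction js)
  case (Cons k js)
  let ?p = "pm (\<lambda>k. cmod (q k))" and ?v = "unit_seq j e"
  have pm: "cmod (monomial js q) = ?p js" for js by (induction js) (auto simp: norm_mult)
  have "cmod (dmon (k # js) q ?v) \<le> (if k = j then ?p js else 0) + cmod (q k) * cmod (dmon js q ?v)"
    using norm_triangle_ineq[of "?v k * cnj (monomial js q)" "q k * cnj (dmon js q ?v)"] assms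
    by (auto simp: norm_mult unit_seq_def pm)
  also have "\<dots> \<le> (if k = j then ?p js else 0) + cmod (q k) * (\<Sum>(x, r)\<in>cuts j js. ?p x * ?p r)"
    using Cons by (intro add_left_mono mult_left_mono) auto
  also have "\<dots> = (\<Sum>(x, r)\<in>cuts j (k # js). ?p x * ?p r)"
  proof -
    have "(\<Sum>(x, r)\<in>cuts j (k # js). ?p x * ?p r) =
      (\<Sum>(x, r)\<in>(if k = j then {([], js)} else {}). ?p x * ?p r) + (\<Sum>(x, r)\<in>(\<lambda>(x, r). (k # x, r)) ` cuts j js. ?p x * ?p r)"
      unfolding cuts_Cons by (intro sum.union_disjoint) auto
    also have "(\<Sum>(x, r)\<in>(\<lambda>(x, r). (k # x, r)) ` cuts j js. ?p x * ?p r) = (\<Sum>(x, r)\<in>cuts j js. cmod (q k) * (?p x * ?p r))"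
      by (subst sum.reindex) (auto simp: inj_on_def case_prod_unfold mult_ac)
    finally show ?thesis by (auto simp: sum_distrib_left case_prod_unfold)
  qed
  finally show ?case .
qed (simp add: cuts_def)

definition sg :: "int list \<Rightarrow> int" where
  "sg xs = (if even (length xs) then 1 else - 1)"

lemma alts_append_sg: "alts (xs @ ys) = alts xs + sg xs * alts ys"
  by (simp add: alts_append sg_def)

lemma alts_le:
  assumes "\<And>v. v \<in> set xs \<Longrightarrow> \<bar>v\<bar> \<le> L"
  shows "\<bar>alts xs\<bar> \<le> int (length xs) * L"
  using assms
proof (induction xs)
  case (Cons x xs)
  have "\<bar>alts (x # xs)\<bar> \<le> \<bar>x\<bar> + \<bar>alts xs\<bar>" by simp
  also have "\<dots> \<le> L + int (length xs) * L" using Cons by (intro add_mono) auto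
  finally show ?case by (simp add: algebra_simps)
qed simp

text \<open>In \<open>x @ j # y @ l # z\<close> or \<open>x @ l # y @ j # z\<close> the entry \<open>l\<close> is determined by \<open>j\<close> and momentum
  conservation.\<close>

fun partner :: "int \<Rightarrow> bool \<times> int list \<times> int list \<times> int list \<Rightarrow> int" where
  "partner j (True, x, y, z) = alts z + sg y * (j - alts y + sg x * alts x)"
| "partner j (False, x, y, z) = alts y + sg y * (j - alts z) - sg x * alts x"

text \<open>Recovers the cut at \<open>j\<close> by forgetting the second mark; this left inverse
  makes any choice of the second mark injective.\<close>

fun join :: "int \<Rightarrow> bool \<times> int list \<times> int list \<times> int list \<Rightarrow> int list \<times> int list" where
  "join j (True, x, y, z) = (x, y @ partner j (True, x, y, z) # z)"
| "join j (False, x, y, z) = (x @ partner j (False, x, y, z) # y, z)"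

text \<open>\<open>partner\<close> is affine in \<open>j\<close> with slope 1 or -1. Hence, with the
  other entries fixed, the l2 norm in \<open>j\<close> of the values of \<open>q\<close> at the
  partner is at most that of \<open>q\<close>.\<close>

lemma inj_partner: "inj (\<lambda>j. partner j i)"
proof -
  obtain b x y z where i: "i = (b, x, y, z)" by (cases i) auto
  have "sg y = 1 \<or> sg y = - 1" by (simp add: sg_def)
  then show ?thesis unfolding i by (cases b) (auto simp: inj_def)
qed

lemma partner_eq:
  "alts (x @ j # y @ l # z) = 0 \<Longrightarrow> l = partner j (True, x, y, z)"
  "alts (x @ l # y @ j # z) = 0 \<Longrightarrow> l = partner j (False, x, y, z)"
proof -
  have "sg x = 1 \<or> sg x = - 1" "sg y = 1 \<or> sg y = - 1" by (simp_all add: sg_def)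
  then show "alts (x @ j # y @ l # z) = 0 \<Longrightarrow> l = partner j (True, x, y, z)"
    "alts (x @ l # y @ j # z) = 0 \<Longrightarrow> l = partner j (False, x, y, z)"
    by (elim disjE; simp add: alts_append_sg)+
qed

text \<open>Only this bound on the coefficients matters for the convergence of \<open>R\<close> and
  for its vector field; how they arose is left behind.\<close>

locale remainder =
  fixes c :: "int list \<Rightarrow> real" and D :: real
  assumes D: "1 \<le> D"
    and c_bound: "\<And>js u. js \<in> E6 \<Longrightarrow> u \<in> set js \<Longrightarrow> \<bar>c js\<bar> * \<bar>real_of_int u\<bar> \<le> D ^ length js * rprod js"
begin

definition Rc :: "seq \<Rightarrow> complex" where
  "Rc q = (\<Sum>\<^sub>\<infinity>js\<in>E6. of_real (c js) * monomial js q)"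

definition R :: "seq \<Rightarrow> real" where "R q = Re (Rc q)"

lemma c_le: "js \<in> E6 \<Longrightarrow> \<bar>c js\<bar> \<le> D ^ length js * rprod js"
proof -
  assume js: "js \<in> E6"
  then obtain u where u: "u \<in> set js" "u \<noteq> 0" by (cases js) (auto simp: E6_def EL_def)
  then have "\<bar>c js\<bar> * 1 \<le> \<bar>c js\<bar> * \<bar>real_of_int u\<bar>" by (intro mult_left_mono) auto
  with c_bound[OF js u(1)] show ?thesis by simp
qed

lemma geometric_summable:
  assumes f: "(f has_sum S) UNIV" "\<And>j. 0 \<le> f j" and S: "D * S < 1"
  shows "(\<lambda>js. D ^ length js * pm f js) summable_on A"
proof -
  have S0: "0 \<le> S" using has_sum_nonneg[OF f(1)] f(2) by auto
  have "summable (\<lambda>n. D ^ n * S ^ n)"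
    unfolding power_mult_distrib[symmetric] using S S0 D by (intro summable_geometric) (simp add: abs_mult)
  from pm_series[OF f _ this] D have "(\<lambda>js. D ^ length js * pm f js) summable_on UNIV"
    by (auto dest: has_sum_imp_summable)
  then show ?thesis by (rule summable_on_subset_banach) simp
qed

lemma term_summable:
  assumes q: "w1 q" "D * n1 q < 1"
  shows "(\<lambda>js. cmod (of_real (c js) * monomial js q)) summable_on A \<inter> E6"
    and "((\<lambda>js. of_real (c js) * monomial js q) has_sum Rc q) E6"
proof -
  show *: "(\<lambda>js. cmod (of_real (c js) * monomial js q)) summable_on A \<inter> E6" for A
  proof (rule Infinite_Sum.abs_summable_on_comparison_test'[OF geometric_summable[OF w1_has_sum[OF q(1)] _ q(2)]])
    fix js assume "js \<in> A \<inter> E6"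
    then have "\<bar>c js\<bar> * cmod (monomial js q) \<le> (D ^ length js * rprod js) * cmod (monomial js q)"
      by (intro mult_right_mono c_le) auto
    then show "cmod (of_real (c js) * monomial js q) \<le> D ^ length js * pm (\<lambda>j. rt j * cmod (q j)) js"
      by (simp add: pm_monomial norm_mult mult.assoc)
  qed simp
  from abs_summable_summable[OF *[of UNIV]]
  show "((\<lambda>js. of_real (c js) * monomial js q) has_sum Rc q) E6" unfolding Rc_def by simp
qed

definition RA :: "nat \<Rightarrow> seq list \<Rightarrow> real" where
  "RA n xs = Re (\<Sum>\<^sub>\<infinity>js\<in>{js \<in> E6. length js = n}. of_real (c js) * mlin js xs)"

lemma mlin_summable:
  assumes xs: "\<And>x. x \<in> set xs \<Longrightarrow> w1 x" "length xs = n"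
  shows "((\<lambda>js. of_real (c js) * mlin js xs) has_sum (\<Sum>\<^sub>\<infinity>js\<in>{js \<in> E6. length js = n}. of_real (c js) * mlin js xs)) {js \<in> E6. length js = n}"
    and "\<bar>RA n xs\<bar> \<le> D ^ n * prod_list (map n1 xs)"
proof -
  let ?ps = "map (\<lambda>x. (\<lambda>j. rt j * cmod (x j), n1 x)) xs"
  have "((\<lambda>js. prod_list (map2 (\<lambda>p j. fst p j) ?ps js)) has_sum prod_list (map snd ?ps)) {js. length js = length ?ps}"
    by (rule has_sum_prod_lists) (use xs w1_has_sum in auto)
  then have ps: "((\<lambda>js. prod_list (map2 (\<lambda>p j. fst p j) ?ps js)) has_sum prod_list (map n1 xs)) {js. length js = n}"
    using xs(2) by (simp add: o_def)
  have le: "norm (of_real (c js) * mlin js xs) \<le> D ^ n * prod_list (map2 (\<lambda>p j. fst p j) ?ps js)"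
    if "js \<in> {js \<in> E6. length js = n}" for js
  proof -
    have "\<bar>c js\<bar> * cmod (mlin js xs) \<le> (D ^ n * rprod js) * cmod (mlin js xs)"
      using that c_le[of js] by (intro mult_right_mono) auto
    also have "\<dots> = D ^ n * (rprod js * cmod (mlin js xs))" by simp
    finally show ?thesis using mlin_norm[of js xs] that xs(2) by (simp add: norm_mult)
  qed
  have P: "((\<lambda>js. D ^ n * prod_list (map2 (\<lambda>p j. fst p j) ?ps js)) has_sum D ^ n * prod_list (map n1 xs)) {js. length js = n}"
    by (rule has_sum_cmult_right[OF ps])
  have su: "(\<lambda>js. D ^ n * prod_list (map2 (\<lambda>p j. fst p j) ?ps js)) summable_on {js \<in> E6. length js = n}"
    by (rule summable_on_subset_banach[OF has_sum_imp_summable[OF P]]) auto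
  from Infinite_Sum.abs_summable_on_comparison_test'[OF su le]
  have ab: "(\<lambda>js. norm (of_real (c js) * mlin js xs)) summable_on {js \<in> E6. length js = n}" .
  from abs_summable_summable[OF ab]
  show hs: "((\<lambda>js. of_real (c js) * mlin js xs) has_sum (\<Sum>\<^sub>\<infinity>js\<in>{js \<in> E6. length js = n}. of_real (c js) * mlin js xs)) {js \<in> E6. length js = n}"
    by (rule has_sum_infsum)
  have nn: "0 \<le> prod_list (map2 (\<lambda>p j. fst p j) ?ps js)" if "length js = n" for js
  proof -
    have len: "length js = length xs" using that xs(2) by simp
    show ?thesis unfolding mlin_norm[OF len, symmetric] by simp
  qed
  have "\<bar>RA n xs\<bar> \<le> cmod (\<Sum>\<^sub>\<infinity>js\<in>{js \<in> E6. length js = n}. of_real (c js) * mlin js xs)"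
    unfolding RA_def by (rule abs_Re_le_cmod)
  also have "\<dots> \<le> (\<Sum>\<^sub>\<infinity>js\<in>{js \<in> E6. length js = n}. D ^ n * prod_list (map2 (\<lambda>p j. fst p j) ?ps js))"
    by (rule norm_infsum_le[OF hs has_sum_infsum[OF su] le])
  also have "\<dots> \<le> D ^ n * prod_list (map n1 xs)"
    unfolding infsumI[OF P, symmetric]
    by (rule infsum_mono2[OF su has_sum_imp_summable[OF P]]) (use nn D in auto)
  finally show "\<bar>RA n xs\<bar> \<le> D ^ n * prod_list (map n1 xs)" .
qed

lemma RA_sums:
  assumes q: "w1 q" "D * n1 q < 1"
  shows "(\<lambda>n. RA n (replicate n q)) sums R q"
proof -
  let ?f = "\<lambda>js. of_real (c js) * monomial js q"
  define B where "B n = {js \<in> E6. length js = n}" for n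
  have "bij_betw snd (Sigma UNIV B) E6"
    by (rule bij_betwI[where g = "\<lambda>js. (length js, js)"]) (auto simp: B_def)
  from has_sum_reindex_bij_betw[OF this, of ?f] term_summable(2)[OF q]
  have "((\<lambda>x. ?f (snd x)) has_sum Rc q) (Sigma UNIV B)" by simp
  then have "((\<lambda>n. infsum ?f (B n)) has_sum Rc q) UNIV"
  proof (rule has_sum_SigmaD)
    fix n
    have "{js. length js = n} \<inter> E6 = B n" by (auto simp: B_def)
    with term_summable(1)[OF q, of "{js. length js = n}"]
    have "(\<lambda>js. cmod (?f js)) summable_on B n" by simp
    from abs_summable_summable[OF this] show "((\<lambda>y. ?f (snd (n, y))) has_sum infsum ?f (B n)) (B n)" by simp
  qed
  from has_sum_Re[OF this] have "((\<lambda>n. Re (infsum ?f (B n))) has_sum R q) UNIV" unfolding R_def .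
  moreover have "infsum ?f (B n) = (\<Sum>\<^sub>\<infinity>js\<in>{js \<in> E6. length js = n}. of_real (c js) * mlin js (replicate n q))" for n
    unfolding B_def by (rule infsum_cong) (use mlin_replicate[of _ q] in auto)
  ultimately have "((\<lambda>n. RA n (replicate n q)) has_sum R q) UNIV" by (simp add: RA_def)
  then show ?thesis by (rule has_sum_imp_sums)
qed

text \<open>The multilinear maps group the multi-indices by length, and \<open>E6\<close> has none
  of length below 6. Passing from \<open>n1\<close> to the norm of \<open>ell2 s\<close> costs one
  \<open>k1 s\<close> per argument.\<close>

lemma order_at_least:
  assumes s: "1 < s"
  shows "has_order_at_least (ell2 s) (ell2_norm s) R 6"
  unfolding has_order_at_least_def
proof (intro exI[of _ RA] conjI allI impI ballI)
  show "RA n (replicate n h) = 0" if "n < 6" for n h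
  proof -
    have "{js \<in> E6. length js = n} = {}" using that by (auto simp: E6_def)
    then show ?thesis unfolding RA_def by (simp only: infsum_empty) simp
  qed
  define k where "k = D * k1 s"
  have k0: "0 \<le> k" using D by (simp add: k_def)
  define \<rho> where "\<rho> = 1 / (2 * (k + 1))"
  have \<rho>: "0 < \<rho>" "k * \<rho> < 1" using k0 by (auto simp: \<rho>_def divide_simps)
  show "has_power_series (ell2 s) (ell2_norm s) UNIV abs R 0 RA"
    unfolding has_power_series_def
  proof (intro exI[of _ \<rho>] exI[of _ "\<lambda>n. k ^ n"] conjI allI ballI impI UNIV_I)
    show "summable (\<lambda>n. k ^ n * \<rho> ^ n)"
      unfolding power_mult_distrib[symmetric] using \<rho> k0 by (intro summable_geometric) simp
    show "bounded_multilinear (ell2 s) (ell2_norm s) UNIV abs n (RA n) (k ^ n)" for n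
      unfolding bounded_multilinear_def
    proof (intro conjI allI impI UNIV_I)
      fix xs assume xs: "length xs = n \<and> set xs \<subseteq> ell2 s"
      have "\<bar>RA n xs\<bar> \<le> D ^ n * prod_list (map n1 xs)"
        using xs ell2_w1(1)[OF s] by (intro mlin_summable(2)) auto
      also have "\<dots> \<le> D ^ n * (k1 s ^ n * prod_list (map (ell2_norm s) xs))"
      proof (rule mult_left_mono)
        have "set xs \<subseteq> ell2 s \<Longrightarrow> prod_list (map n1 xs) \<le> k1 s ^ length xs * prod_list (map (ell2_norm s) xs)"
        proof (induction xs)
          case (Cons x xs)
          have "n1 x * prod_list (map n1 xs) \<le> (k1 s * ell2_norm s x) * (k1 s ^ length xs * prod_list (map (ell2_norm s) xs))"
            using Cons ell2_w1(2)[OF s] by (intro mult_mono) (auto intro!: prod_list_nonneg)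
          then show ?case by (simp add: mult_ac)
        qed simp
        then show "prod_list (map n1 xs) \<le> k1 s ^ n * prod_list (map (ell2_norm s) xs)" using xs by auto
      qed (use D in simp)
      finally show "\<bar>RA n xs\<bar> \<le> k ^ n * prod_list (map (ell2_norm s) xs)"
        by (simp add: k_def power_mult_distrib)
    next
      fix xs ys u v and a b :: real
      assume *: "length xs + 1 + length ys = n \<and> set xs \<subseteq> ell2 s \<and> set ys \<subseteq> ell2 s \<and> u \<in> ell2 s \<and> v \<in> ell2 s"
      let ?S = "{js \<in> E6. length js = n}" and ?I = "\<lambda>w. \<Sum>\<^sub>\<infinity>js\<in>{js \<in> E6. length js = n}. of_real (c js) * mlin js (xs @ w # ys)"
      have hs: "((\<lambda>js. of_real (c js) * mlin js (xs @ w # ys)) has_sum ?I w) ?S" if "w \<in> ell2 s" for w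
        using * that ell2_w1(1)[OF s] by (intro mlin_summable(1)) auto
      have "((\<lambda>js. a *\<^sub>R (of_real (c js) * mlin js (xs @ u # ys)) + b *\<^sub>R (of_real (c js) * mlin js (xs @ v # ys))) has_sum a *\<^sub>R ?I u + b *\<^sub>R ?I v) ?S"
        using * by (intro has_sum_add has_sum_bounded_linear[OF bounded_linear_scaleR_right] hs) auto
      then have "((\<lambda>js. of_real (c js) * mlin js (xs @ (a *\<^sub>R u + b *\<^sub>R v) # ys)) has_sum a *\<^sub>R ?I u + b *\<^sub>R ?I v) ?S"
        by (rule has_sum_cong[THEN iffD1, rotated]) (use * in \<open>simp add: mlin_linear algebra_simps\<close>)
      then have "?I (a *\<^sub>R u + b *\<^sub>R v) = a *\<^sub>R ?I u + b *\<^sub>R ?I v" by (rule infsumI)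
      then show "RA n (xs @ (a *\<^sub>R u + b *\<^sub>R v) # ys) = a *\<^sub>R RA n (xs @ u # ys) + b *\<^sub>R RA n (xs @ v # ys)"
        unfolding RA_def by simp
    qed
    fix h assume h: "h \<in> ell2 s" "ell2_norm s h < \<rho>"
    have "D * n1 h \<le> D * (k1 s * ell2_norm s h)" using D ell2_w1(2)[OF s h(1)] by (intro mult_left_mono) auto
    also have "\<dots> \<le> k * \<rho>" unfolding k_def mult.assoc[symmetric] using h D by (intro mult_left_mono) auto
    finally have "(\<lambda>n. RA n (replicate n h)) sums R h"
      using \<rho> by (intro RA_sums ell2_w1(1)[OF s h(1)]) simp
    then have "(\<lambda>m. \<bar>R h - (\<Sum>n<m. RA n (replicate n h))\<bar>) \<longlonglongrightarrow> \<bar>R h - R h\<bar>"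
      unfolding sums_def by (intro tendsto_intros)
    then show "(\<lambda>m. \<bar>R (0 + h) - (\<Sum>n<m. RA n (replicate n h))\<bar>) \<longlonglongrightarrow> 0" by simp
  qed (use \<rho> in simp)
qed

end

section \<open>Termwise differentiation and the vector field\<close>

lemma pm_rt: "pm (\<lambda>j. rt j * g j) js = rprod js * pm g js"
  by (induction js) auto

lemma pm_scale: "pm (\<lambda>j. a * g j) js = a ^ length js * pm g js"
  by (induction js) auto

lemma DERIV_quadratic:
  fixes f :: "real \<Rightarrow> real"
  assumes "0 < \<eta>" "0 \<le> C" and le: "\<And>t. \<bar>t\<bar> \<le> \<eta> \<Longrightarrow> \<bar>f t - f 0 - t * d\<bar> \<le> C * t\<^sup>2"
  shows "(f has_field_derivative d) (at 0)"
  unfolding DERIV_def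
proof (rule LIM_I)
  fix r :: real assume "0 < r"
  define \<delta> where "\<delta> = min \<eta> (r / (C + 1))"
  have \<delta>: "0 < \<delta>" using assms \<open>0 < r\<close> by (simp add: \<delta>_def)
  have "norm ((f (0 + h) - f 0) / h - d) < r" if h: "h \<noteq> 0 \<and> norm (h - 0) < \<delta>" for h
  proof -
    have "\<bar>f h - f 0 - h * d\<bar> \<le> C * h\<^sup>2" using h by (intro le) (simp add: \<delta>_def)
    then have "\<bar>f h - f 0 - h * d\<bar> / \<bar>h\<bar> \<le> C * h\<^sup>2 / \<bar>h\<bar>" by (intro divide_right_mono) auto
    moreover have "(f h - f 0) / h - d = (f h - f 0 - h * d) / h" using h by (simp add: field_simps)
    moreover have "C * h\<^sup>2 / \<bar>h\<bar> = C * \<bar>h\<bar>" using h by (simp add: power2_eq_square divide_simps abs_if)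
    ultimately have "norm ((f (0 + h) - f 0) / h - d) \<le> C * \<bar>h\<bar>" by (simp add: abs_divide)
    also have "\<dots> \<le> (C + 1) * \<bar>h\<bar>" by (simp add: algebra_simps)
    also have "\<dots> < (C + 1) * (r / (C + 1))" using h assms(2) by (intro mult_strict_left_mono) (auto simp: \<delta>_def)
    also have "\<dots> = r" using assms(2) by simp
    finally show ?thesis .
  qed
  with \<delta> show "\<exists>s>0. \<forall>h. h \<noteq> 0 \<and> norm (h - 0) < s \<longrightarrow> norm ((f (0 + h) - f 0) / h - d) < r" by blast
qed

context remainder
begin

lemma directional_derivative:
  assumes q: "w1 q" "D * n1 q < 1" and v: "w1 v"
  defines "S \<equiv> \<Sum>\<^sub>\<infinity>js\<in>E6. of_real (c js) * dmon js q v"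
  shows "((\<lambda>js. of_real (c js) * dmon js q v) has_sum S) E6"
    and "((\<lambda>t. R (q + t *\<^sub>R v)) has_field_derivative Re S) (at 0)"
proof -
  \<comment> \<open>Uses up at most half of the gap \<open>1 - D * n1 q\<close>, so that the
    dominating series at \<open>|q| + \<eta> |v|\<close> still converges.\<close>
  define \<eta> where "\<eta> = (1 - D * n1 q) / (2 * (D * (n1 v + 1)))"
  have "0 < n1 v + 1" using n1_nonneg[of v] by linarith
  then have Dv: "0 < D * (n1 v + 1)" using D by (intro mult_pos_pos) auto
  have \<eta>: "0 < \<eta>" using Dv q by (simp add: \<eta>_def)
  define P where "P = pm (\<lambda>j. cmod (q j) + \<eta> * cmod (v j))"
  define f where "f j = rt j * (cmod (q j) + \<eta> * cmod (v j))" for j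
  have fs: "(f has_sum n1 q + \<eta> * n1 v) UNIV"
    using has_sum_add[OF w1_has_sum[OF q(1)] has_sum_cmult_right[OF w1_has_sum[OF v], of \<eta>]]
    unfolding f_def[abs_def] by (simp add: algebra_simps)
  have small: "D * (n1 q + \<eta> * n1 v) < 1"
  proof -
    have "D * (\<eta> * n1 v) \<le> \<eta> * (D * (n1 v + 1))" using \<eta> D by (simp add: algebra_simps)
    also have "\<dots> = (1 - D * n1 q) / 2"
    proof -
      have "a / (2 * d) * d = a / 2" if "0 < d" for a d :: real using that by simp
      from this[OF Dv] show ?thesis unfolding \<eta>_def .
    qed
    finally show ?thesis using q(2) by (simp add: distrib_left)
  qed
  define G where "G = (\<Sum>\<^sub>\<infinity>js\<in>E6. D ^ length js * pm f js)"
  have Gs: "((\<lambda>js. D ^ length js * pm f js) has_sum G) E6"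
    unfolding G_def using \<eta> by (intro has_sum_infsum geometric_summable[OF fs _ small]) (simp add: f_def)
  have G0: "0 \<le> G" unfolding G_def using D \<eta> by (intro infsum_nonneg mult_nonneg_nonneg pm_nonneg) (auto simp: f_def)
  have cP: "\<bar>c js\<bar> * P js \<le> D ^ length js * pm f js" if "js \<in> E6" for js
  proof -
    have "\<bar>c js\<bar> * P js \<le> (D ^ length js * rprod js) * P js"
      using \<eta> unfolding P_def by (intro mult_right_mono c_le that pm_nonneg) auto
    also have "\<dots> = D ^ length js * pm f js" unfolding f_def[abs_def] pm_rt P_def by simp
    finally show ?thesis .
  qed
  have sumI: "((\<lambda>js. of_real (c js) * g js) has_sum (\<Sum>\<^sub>\<infinity>js\<in>E6. of_real (c js) * g js)) E6"
    if le: "\<And>js. cmod (g js) \<le> B * P js" and B: "0 \<le> B" for g :: "int list \<Rightarrow> complex" and B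
  proof -
    have "(\<lambda>js. B * (D ^ length js * pm f js)) summable_on E6"
      using Gs by (intro summable_on_cmult_right) (rule has_sum_imp_summable)
    then have "(\<lambda>js. norm (of_real (c js) * g js)) summable_on E6"
    proof (rule Infinite_Sum.abs_summable_on_comparison_test')
      fix js assume js: "js \<in> E6"
      have "norm (of_real (c js) * g js) \<le> \<bar>c js\<bar> * (B * P js)"
        using le by (simp add: norm_mult mult_left_mono)
      also have "\<dots> \<le> B * (D ^ length js * pm f js)" using mult_left_mono[OF cP[OF js] B] by (simp add: mult_ac)
      finally show "norm (of_real (c js) * g js) \<le> B * (D ^ length js * pm f js)" .
    qed
    from abs_summable_summable[OF this] show ?thesis by (rule has_sum_infsum)
  qed
  have d0: "\<bar>0::real\<bar> \<le> \<eta>" using \<eta> by simp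
  show S: "((\<lambda>js. of_real (c js) * dmon js q v) has_sum S) E6"
    unfolding S_def by (rule sumI[of _ "1 / \<eta>"]) (use dmon_bounds(5)[OF \<eta> d0, of _ q v] \<eta> in \<open>auto simp: P_def\<close>)
  have Rs: "((\<lambda>js. of_real (c js) * monomial js (q + t *\<^sub>R v)) has_sum Rc (q + t *\<^sub>R v)) E6" if "\<bar>t\<bar> \<le> \<eta>" for t
    unfolding Rc_def by (rule sumI[of _ 1]) (use dmon_bounds(1)[OF \<eta> that, of _ q v] in \<open>auto simp: P_def\<close>)
  have "((\<lambda>t. R (q + t *\<^sub>R v)) has_field_derivative Re S) (at 0)"
  proof (rule DERIV_quadratic[OF \<eta>])
    show "0 \<le> G / \<eta>\<^sup>2" using G0 by simp
    fix t assume t: "\<bar>t\<bar> \<le> \<eta>"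
    have "((\<lambda>js. of_real (c js) * monomial js (q + t *\<^sub>R v) - of_real (c js) * monomial js (q + 0 *\<^sub>R v) - of_real t * (of_real (c js) * dmon js q v)) has_sum
       Rc (q + t *\<^sub>R v) - Rc (q + 0 *\<^sub>R v) - of_real t * S) E6"
      by (intro has_sum_diff has_sum_cmult_right Rs t d0 S)
    then have "norm (Rc (q + t *\<^sub>R v) - Rc (q + 0 *\<^sub>R v) - of_real t * S) \<le> (t / \<eta>)\<^sup>2 * G"
    proof (rule norm_infsum_le[OF _ has_sum_cmult_right[OF Gs]])
      fix js assume js: "js \<in> E6"
      have "of_real (c js) * monomial js (q + t *\<^sub>R v) - of_real (c js) * monomial js (q + 0 *\<^sub>R v) - of_real t * (of_real (c js) * dmon js q v)
        = of_real (c js) * (monomial js (q + t *\<^sub>R v) - monomial js q - of_real t * dmon js q v)"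
        by (simp add: right_diff_distrib mult_ac)
      then have "norm (of_real (c js) * monomial js (q + t *\<^sub>R v) - of_real (c js) * monomial js (q + 0 *\<^sub>R v) - of_real t * (of_real (c js) * dmon js q v))
        = \<bar>c js\<bar> * cmod (monomial js (q + t *\<^sub>R v) - monomial js q - of_real t * dmon js q v)"
        by (simp only: norm_mult norm_of_real)
      also have "\<dots> \<le> \<bar>c js\<bar> * ((t / \<eta>)\<^sup>2 * P js)"
        unfolding P_def by (intro mult_left_mono dmon_bounds(4)[OF \<eta> t]) auto
      also have "\<dots> \<le> (t / \<eta>)\<^sup>2 * (D ^ length js * pm f js)"
        using mult_left_mono[OF cP[OF js], of "(t / \<eta>)\<^sup>2"] by (simp add: mult_ac)
      finally show "norm (of_real (c js) * monomial js (q + t *\<^sub>R v) - of_real (c js) * monomial js (q + 0 *\<^sub>R v) - of_real t * (of_real (c js) * dmon js q v))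
        \<le> (t / \<eta>)\<^sup>2 * (D ^ length js * pm f js)" .
    qed
    moreover have "\<bar>R (q + t *\<^sub>R v) - R (q + 0 *\<^sub>R v) - t * Re S\<bar> \<le> norm (Rc (q + t *\<^sub>R v) - Rc (q + 0 *\<^sub>R v) - of_real t * S)"
      using abs_Re_le_cmod[of "Rc (q + t *\<^sub>R v) - Rc (q + 0 *\<^sub>R v) - of_real t * S"] by (simp add: R_def)
    ultimately show "\<bar>R (q + t *\<^sub>R v) - R (q + 0 *\<^sub>R v) - t * Re S\<bar> \<le> G / \<eta>\<^sup>2 * t\<^sup>2"
      by (simp add: power_divide mult.commute)
  qed
  then show "((\<lambda>t. R (q + t *\<^sub>R v)) has_field_derivative Re S) (at 0)" .
qed

text \<open>Since \<open>n \<le> 2 ^ n\<close>, the factor \<open>2 powr (s + 1)\<close> per entry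
  absorbs the polynomial loss \<open>n powr (s + 1)\<close> in the length \<open>n\<close>.\<close>

definition growth :: "real \<Rightarrow> real" where
  "growth s = D * 2 powr (s + 1)"

text \<open>\<open>i\<close> encodes a multi-index with two marked entries, \<open>j\<close> and \<open>partner j i\<close>; the partner will
  be an entry of largest modulus among those other than \<open>j\<close>. At least four entries remain, whence the fourth power of \<open>\<nu>\<close>; the factors \<open>1 / (2 \<nu>)\<close> make the
  sum over all lengths converge when \<open>n1 q \<le> \<nu>\<close>.\<close>

definition hterm :: "real \<Rightarrow> real \<Rightarrow> seq \<Rightarrow> bool \<times> int list \<times> int list \<times> int list \<Rightarrow> int \<Rightarrow> real" where
  "hterm s \<nu> q = (\<lambda>i j. (growth s)\<^sup>2 * (2 * growth s * \<nu>) ^ 4 * (cmod (q (partner j i)) * wt s (partner j i)) *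
     (case i of (_, x, y, z) \<Rightarrow> pm (\<lambda>j. rt j * cmod (q j) / (2 * \<nu>)) x *
        (pm (\<lambda>j. rt j * cmod (q j) / (2 * \<nu>)) y * pm (\<lambda>j. rt j * cmod (q j) / (2 * \<nu>)) z)))"

lemma growth: "0 \<le> s \<Longrightarrow> D \<le> growth s" "0 \<le> s \<Longrightarrow> 1 \<le> growth s"
proof -
  assume "0 \<le> s"
  then have "(2::real) powr 0 \<le> 2 powr (s + 1)" by (intro powr_mono) auto
  then show *: "D \<le> growth s" using D mult_left_mono[of 1 "2 powr (s + 1)" D] by (simp add: growth_def)
  then show "1 \<le> growth s" using D by simp
qed

text \<open>Let \<open>n\<close> be the length. The coefficient bound at the entry \<open>l\<close>
  gains \<open>|l| = rt l * rt l\<close>, and \<open>|j| \<le> n |l|\<close> gives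
  \<open>rt j * rt l \<le> n * (rt l * rt l)\<close>, so the two marked entries cancel up to
  \<open>n\<close>. The weight \<open>wt s j\<close> passes to \<open>l\<close> at the price
  \<open>n powr s\<close>.\<close>

lemma core_bound:
  assumes s: "0 \<le> s" and \<nu>: "0 < \<nu>" "2 * growth s * \<nu> \<le> 1"
    and js: "js \<in> E6" "l \<in> set js" "\<bar>j\<bar> \<le> int (length js) * \<bar>l\<bar>"
    and rp: "rprod js = rt j * rt l * (rprod x * (rprod y * rprod z))" and len: "length js = length x + length y + length z + 2"
  shows "wt s j * \<bar>c js\<bar> * (cmod (q l) * (pm (\<lambda>k. cmod (q k)) x * (pm (\<lambda>k. cmod (q k)) y * pm (\<lambda>k. cmod (q k)) z)))
    \<le> (growth s)\<^sup>2 * (2 * growth s * \<nu>) ^ 4 * (cmod (q l) * wt s l) * (pm (\<lambda>j. rt j * cmod (q j) / (2 * \<nu>)) x *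
        (pm (\<lambda>j. rt j * cmod (q j) / (2 * \<nu>)) y * pm (\<lambda>j. rt j * cmod (q j) / (2 * \<nu>)) z))"
proof -
  let ?n = "length js" and ?p = "pm (\<lambda>k. cmod (q k))" and ?G = "pm (\<lambda>j. rt j * cmod (q j))"
    and ?G' = "pm (\<lambda>j. rt j * cmod (q j) / (2 * \<nu>))" and ?P = "rprod x * (rprod y * rprod z)"
  define m where "m = length x + length y + length z"
  have n: "6 \<le> ?n" "?n = m + 2" "4 \<le> m" using js len by (auto simp: E6_def m_def)
  have l0: "l \<noteq> 0" using js by (auto simp: E6_def EL_def)
  have P0: "0 \<le> ?P" by simp
  have p0: "0 \<le> ?p x" for x by (rule pm_nonneg) simp
  have jn: "real_of_int \<bar>j\<bar> \<le> real ?n * real_of_int \<bar>l\<bar>"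
    using js(3) by (metis of_int_le_iff of_int_mult of_int_of_nat_eq)
  have "rt j \<le> sqrt (real ?n * real_of_int \<bar>l\<bar>)" unfolding rt_def using jn by (rule real_sqrt_le_mono)
  also have "\<dots> = sqrt (real ?n) * rt l" by (simp add: rt_def real_sqrt_mult)
  also have "\<dots> \<le> real ?n * rt l"
    using n by (intro mult_right_mono real_le_lsqrt) (auto simp: power2_eq_square mult_left_mono[of 1 "real ?n" "real ?n", simplified])
  finally have rtj: "rt j \<le> real ?n * rt l" .
  have "(rt l * rt l) * \<bar>c js\<bar> \<le> D ^ ?n * rprod js"
    using c_bound[OF js(1,2)] by (simp add: rt_sq mult.commute)
  also have "\<dots> = D ^ ?n * (rt j * (rt l * ?P))" by (simp add: rp)
  also have "\<dots> \<le> D ^ ?n * ((real ?n * rt l) * (rt l * ?P))"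
    using D P0 by (intro mult_left_mono mult_right_mono rtj) auto
  finally have "(rt l * rt l) * \<bar>c js\<bar> \<le> (rt l * rt l) * (D ^ ?n * real ?n * ?P)" by (simp add: mult_ac)
  moreover have "0 < rt l * rt l" using rt_ge_1[OF l0] by simp
  ultimately have cle: "\<bar>c js\<bar> \<le> D ^ ?n * real ?n * ?P" by (simp only: mult_le_cancel_left_pos)
  have wtj: "wt s j \<le> real ?n powr s * wt s l"
  proof -
    have "wt s j \<le> (real ?n * real_of_int \<bar>l\<bar>) powr s"
      unfolding wt_def using jn s by (intro powr_mono2) auto
    then show ?thesis by (simp add: wt_def powr_mult)
  qed
  have grow: "real ?n powr s * real ?n * D ^ ?n \<le> growth s ^ ?n"
  proof -
    have "real ?n powr s * real ?n = real ?n powr (s + 1)" using n by (simp add: powr_add)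
    also have "\<dots> \<le> (2 ^ ?n) powr (s + 1)"
      using s of_nat_less_two_power[of ?n, where 'a = real] by (intro powr_mono2) auto
    also have "\<dots> = (2 powr (s + 1)) ^ ?n"
      by (simp add: powr_powr mult.commute flip: powr_realpow)
    finally have "real ?n powr s * real ?n * D ^ ?n \<le> (2 powr (s + 1)) ^ ?n * D ^ ?n"
      using D by (intro mult_right_mono) auto
    then show ?thesis by (simp add: growth_def power_mult_distrib mult.commute)
  qed
  have "wt s j * \<bar>c js\<bar> * (cmod (q l) * (?p x * (?p y * ?p z))) \<le>
      (real ?n powr s * wt s l) * (D ^ ?n * real ?n * ?P) * (cmod (q l) * (?p x * (?p y * ?p z)))"
    using p0 by (intro mult_right_mono mult_mono wtj cle) auto
  also have "\<dots> = (real ?n powr s * real ?n * D ^ ?n) * ((cmod (q l) * wt s l) * (?G x * (?G y * ?G z)))"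
    unfolding pm_rt by simp
  also have "\<dots> \<le> growth s ^ ?n * ((cmod (q l) * wt s l) * (?G x * (?G y * ?G z)))"
    using grow by (intro mult_right_mono mult_nonneg_nonneg pm_nonneg) auto
  also have "\<dots> = (growth s)\<^sup>2 * (2 * growth s * \<nu>) ^ m * ((cmod (q l) * wt s l) * (?G' x * (?G' y * ?G' z)))"
  proof -
    have G: "?G x = (2 * \<nu>) ^ length x * ?G' x" for x
      using \<nu> pm_scale[of "2 * \<nu>" "\<lambda>j. rt j * cmod (q j) / (2 * \<nu>)" x] by simp
    show ?thesis unfolding G n(2) by (simp add: m_def power_add power_mult_distrib power2_eq_square)
  qed
  also have "\<dots> \<le> (growth s)\<^sup>2 * (2 * growth s * \<nu>) ^ 4 * ((cmod (q l) * wt s l) * (?G' x * (?G' y * ?G' z)))"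
    using \<nu> n growth(2)[OF s] by (intro mult_right_mono mult_left_mono power_decreasing mult_nonneg_nonneg pm_nonneg) auto
  finally show ?thesis by (simp add: mult.assoc)
qed

text \<open>Let \<open>l\<close> have largest modulus among the entries other than the marked
  \<open>j\<close>. Momentum conservation expresses \<open>j\<close> through these entries, so
  \<open>|j|\<close> is at most the length times \<open>|l|\<close>.\<close>

lemma term_bound:
  assumes s: "0 \<le> s" and \<nu>: "0 < \<nu>" "2 * growth s * \<nu> \<le> 1" and js: "x @ j # r \<in> E6"
  obtains i where "join j i = (x, r)"
    "wt s j * \<bar>c (x @ j # r)\<bar> * (pm (\<lambda>k. cmod (q k)) x * pm (\<lambda>k. cmod (q k)) r) \<le> hterm s \<nu> q i j"
proof -
  let ?js = "x @ j # r" and ?S = "abs ` set (x @ r)"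
  have n: "6 \<le> length ?js" and a0: "alts ?js = 0" using js by (auto simp: E6_def EL_def)
  have "?S \<noteq> {}" using n by auto
  then have "Max ?S \<in> ?S" by (intro Max_in) auto
  then obtain l where l: "l \<in> set (x @ r)" "\<bar>l\<bar> = Max ?S" by (metis imageE)
  have mx: "\<bar>v\<bar> \<le> \<bar>l\<bar>" if "v \<in> set (x @ r)" for v unfolding l(2) using that by (intro Max_ge) auto
  have "\<bar>alts x\<bar> \<le> int (length x) * \<bar>l\<bar>" "\<bar>alts r\<bar> \<le> int (length r) * \<bar>l\<bar>"
    using mx by (auto intro: alts_le)
  moreover have "\<bar>j\<bar> \<le> \<bar>alts x\<bar> + \<bar>alts r\<bar>" using a0 by (auto simp: alts_append_sg sg_def split: if_splits)
  ultimately have "\<bar>j\<bar> \<le> int (length x) * \<bar>l\<bar> + int (length r) * \<bar>l\<bar>" by linarith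
  then have jl: "\<bar>j\<bar> \<le> int (length ?js) * \<bar>l\<bar>" by (simp add: algebra_simps)
  have lj: "l \<in> set ?js" using l by auto
  note core = core_bound[OF s \<nu> js lj jl, where q = q]
  consider "l \<in> set x" | "l \<in> set r" using l by auto
  then show ?thesis
  proof cases
    case 1
    then obtain x1 y where x: "x = x1 @ l # y" by (auto dest: split_list)
    have p: "partner j (False, x1, y, r) = l" using partner_eq(2)[of x1 l y j r] a0 x by simp
    show ?thesis
    proof (rule that)
      show "join j (False, x1, y, r) = (x, r)" using p x by simp
      show "wt s j * \<bar>c ?js\<bar> * (pm (\<lambda>k. cmod (q k)) x * pm (\<lambda>k. cmod (q k)) r) \<le> hterm s \<nu> q (False, x1, y, r) j"
        using core[of x1 y r] unfolding hterm_def p by (simp add: x mult_ac)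
    qed
  next
    case 2
    then obtain y z where r: "r = y @ l # z" by (auto dest: split_list)
    have p: "partner j (True, x, y, z) = l" using partner_eq(1)[of x j y l z] a0 r by simp
    show ?thesis
    proof (rule that)
      show "join j (True, x, y, z) = (x, r)" using p r by simp
      show "wt s j * \<bar>c ?js\<bar> * (pm (\<lambda>k. cmod (q k)) x * pm (\<lambda>k. cmod (q k)) r) \<le> hterm s \<nu> q (True, x, y, z) j"
        using core[of x y z] unfolding hterm_def p by (simp add: r mult_ac)
    qed
  qed
qed

text \<open>For fixed \<open>i\<close> the l2 norm in \<open>j\<close> is controlled by
  \<open>inj_partner\<close>, and Minkowski sums over \<open>i\<close>. Each of the three lists
  contributes a geometric series of ratio at most 1/2, hence at most 2, and the flag another 2,
  which makes 16.\<close>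

lemma hterm_minkowski:
  assumes s: "1 < s" and \<nu>: "0 < \<nu>" "2 * growth s * \<nu> \<le> 1" and q: "q \<in> ell2 s" "n1 q \<le> \<nu>"
  shows "(\<lambda>i. hterm s \<nu> q i j) summable_on A"
    and "finite F \<Longrightarrow> L2_set (\<lambda>j. \<Sum>\<^sub>\<infinity>i. hterm s \<nu> q i j) F \<le> 16 * ((growth s)\<^sup>2 * (2 * growth s * \<nu>) ^ 4) * ell2_norm s q"
proof -
  let ?G' = "pm (\<lambda>j. rt j * cmod (q j) / (2 * \<nu>))" and ?C = "(growth s)\<^sup>2 * (2 * growth s * \<nu>) ^ 4"
  have C0: "0 \<le> ?C" using \<nu> growth(2)[of s] s by simp
  have G0: "0 \<le> ?G' x" for x using \<nu> by (intro pm_nonneg) auto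
  define a where "a = n1 q / (2 * \<nu>)"
  have a: "0 \<le> a" "a \<le> 1 / 2" using \<nu> q by (auto simp: a_def divide_simps)
  have "((\<lambda>j. rt j * cmod (q j) * (1 / (2 * \<nu>))) has_sum n1 q * (1 / (2 * \<nu>))) UNIV"
    by (intro has_sum_cmult_left w1_has_sum ell2_w1(1)[OF s q(1)])
  then have f: "((\<lambda>j. rt j * cmod (q j) / (2 * \<nu>)) has_sum a) UNIV" by (simp add: a_def)
  define W where "W = (\<Sum>n. a ^ n)"
  have "summable (\<lambda>n. 1 * a ^ n)" using a by (simp add: summable_geometric)
  from pm_series[OF f _ _ this] \<nu> have GW: "(?G' has_sum W) UNIV" by (simp add: W_def)
  have "W = 1 / (1 - a)" unfolding W_def using a by (intro suminf_geometric) simp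
  moreover have "1 / (1 - a) \<le> 1 / (1 / 2)" using a by (intro divide_left_mono) auto
  moreover have "0 \<le> 1 / (1 - a)" using a by simp
  ultimately have W: "0 \<le> W" "W \<le> 2" by auto
  have b: "((\<lambda>b. 1) has_sum 2) (UNIV :: bool set)" by (intro has_sum_finiteI) (auto simp: UNIV_bool)
  note h2 = has_sum_prod[OF GW GW G0 G0]
  have h3: "((\<lambda>(x, p). ?G' x * (case p of (y, z) \<Rightarrow> ?G' y * ?G' z)) has_sum W * (W * W)) (UNIV \<times> UNIV \<times> UNIV)"
    by (rule has_sum_prod[OF GW h2 G0]) (auto intro!: mult_nonneg_nonneg G0)
  have "((\<lambda>(b :: bool, p). 1 * (case p of (x, p) \<Rightarrow> ?G' x * (case p of (y, z) \<Rightarrow> ?G' y * ?G' z))) has_sum 2 * (W * (W * W))) (UNIV \<times> UNIV \<times> UNIV \<times> UNIV)"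
    by (rule has_sum_prod[OF b h3]) (auto intro!: mult_nonneg_nonneg G0)
  then have "((\<lambda>(b :: bool, x, y, z). ?G' x * (?G' y * ?G' z)) has_sum 2 * (W * (W * W))) UNIV"
    by (simp add: case_prod_unfold)
  from has_sum_cmult_right[OF this, of "?C * ell2_norm s q"]
  have g: "((\<lambda>i. ?C * ell2_norm s q * (case i of (b :: bool, x, y, z) \<Rightarrow> ?G' x * (?G' y * ?G' z))) has_sum ?C * ell2_norm s q * (2 * (W * (W * W)))) UNIV" .
  have h0: "0 \<le> hterm s \<nu> q i j" for i j
    unfolding hterm_def using C0 G0 by (auto intro!: mult_nonneg_nonneg split: prod.split)
  have L: "L2_set (hterm s \<nu> q i) F \<le> ?C * ell2_norm s q * (case i of (b :: bool, x, y, z) \<Rightarrow> ?G' x * (?G' y * ?G' z))"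
    if "finite F" for i F
  proof -
    obtain b x y z where i: "i = (b, x, y, z)" by (cases i) auto
    let ?k = "?C * (?G' x * (?G' y * ?G' z))"
    have k0: "0 \<le> ?k" using C0 G0 by (intro mult_nonneg_nonneg) auto
    have "L2_set (hterm s \<nu> q i) F = L2_set (\<lambda>j. (cmod (q (partner j i)) * wt s (partner j i)) * ?k) F"
      by (intro arg_cong2[of _ _ _ _ L2_set]) (auto simp: hterm_def i)
    also have "\<dots> = L2_set (\<lambda>j. cmod (q (partner j i)) * wt s (partner j i)) F * ?k"
      by (rule L2_set_left_distrib[symmetric, OF k0])
    also have "L2_set (\<lambda>j. cmod (q (partner j i)) * wt s (partner j i)) F = L2_set (\<lambda>l. cmod (q l) * wt s l) ((\<lambda>j. partner j i) ` F)"
      unfolding L2_set_def using inj_partner[of i] by (subst sum.reindex) (auto simp: inj_on_def)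
    also have "\<dots> \<le> ell2_norm s q"
      unfolding L2_set_def using ell2_finite_sum_le[OF q(1), of "(\<lambda>j. partner j i) ` F"] that by (simp add: real_le_lsqrt)
    finally show ?thesis using k0 by (simp add: i mult_right_mono mult_ac)
  qed
  have "(\<lambda>i. hterm s \<nu> q i j) summable_on UNIV"
    by (rule minkowski(1)[where h = "hterm s \<nu> q" and I = UNIV, OF h0 L has_sum_imp_summable[OF g]]) auto
  then show "(\<lambda>i. hterm s \<nu> q i j) summable_on A" by (rule summable_on_subset_banach) simp
  assume F: "finite F"
  have "L2_set (\<lambda>j. \<Sum>\<^sub>\<infinity>i. hterm s \<nu> q i j) F \<le> (\<Sum>\<^sub>\<infinity>i. ?C * ell2_norm s q * (case i of (b :: bool, x, y, z) \<Rightarrow> ?G' x * (?G' y * ?G' z)))"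
    by (rule minkowski(2)[where h = "hterm s \<nu> q" and I = UNIV, OF h0 _ has_sum_imp_summable[OF g] F]) (use L in auto)
  also have "\<dots> = ?C * ell2_norm s q * (2 * (W * (W * W)))" by (rule infsumI[OF g])
  also have "\<dots> \<le> ?C * ell2_norm s q * (2 * (2 * (2 * 2)))"
    using W C0 by (intro mult_left_mono mult_mono) auto
  finally show "L2_set (\<lambda>j. \<Sum>\<^sub>\<infinity>i. hterm s \<nu> q i j) F \<le> 16 * ?C * ell2_norm s q" by simp
qed

text \<open>Each occurrence of \<open>j\<close> in a multi-index is assigned marked data whose term
  dominates it. By \<open>join\<close> the assignment is injective, so the sum over occurrences is
  at most the sum over all marked data.\<close>

lemma vf_component_bound:
  assumes s: "1 < s" and \<nu>: "0 < \<nu>" "2 * growth s * \<nu> \<le> 1" and q: "q \<in> ell2 s" "n1 q \<le> \<nu>" and e: "cmod e = 1"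
    and S: "((\<lambda>js. of_real (c js) * dmon js q (unit_seq j e)) has_sum S) E6"
  shows "wt s j * cmod S \<le> (\<Sum>\<^sub>\<infinity>i. hterm s \<nu> q i j)"
proof -
  let ?p = "pm (\<lambda>k. cmod (q k))"
  define C where "C = {(x, r). x @ j # r \<in> E6}"
  define T where "T = (\<lambda>(x, r). wt s j * \<bar>c (x @ j # r)\<bar> * (?p x * ?p r))"
  have p0: "0 \<le> ?p x" for x by (rule pm_nonneg) simp
  have T0: "0 \<le> T p" for p unfolding T_def using p0 by (auto split: prod.split)
  have h0: "0 \<le> hterm s \<nu> q i j" for i j
    unfolding hterm_def using \<nu> growth(2)[of s] s by (auto intro!: mult_nonneg_nonneg pm_nonneg split: prod.split)
  have "\<forall>p\<in>C. \<exists>i. join j i = p \<and> T p \<le> hterm s \<nu> q i j"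
  proof
    fix p assume "p \<in> C"
    then obtain x r where p: "p = (x, r)" "x @ j # r \<in> E6" by (auto simp: C_def)
    obtain i where "join j i = (x, r)" "wt s j * \<bar>c (x @ j # r)\<bar> * (?p x * ?p r) \<le> hterm s \<nu> q i j"
      by (rule term_bound[OF _ \<nu> p(2)]) (use s in auto)
    then show "\<exists>i. join j i = p \<and> T p \<le> hterm s \<nu> q i j"
      by (intro exI[of _ i]) (simp add: p T_def)
  qed
  then obtain \<iota> where \<iota>: "\<And>p. p \<in> C \<Longrightarrow> join j (\<iota> p) = p" "\<And>p. p \<in> C \<Longrightarrow> T p \<le> hterm s \<nu> q (\<iota> p) j"
    by metis
  have inj: "inj_on \<iota> C" by (rule inj_onI) (metis \<iota>(1))
  note hs = hterm_minkowski(1)[OF s \<nu> q]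
  have su: "((\<lambda>i. hterm s \<nu> q i j) \<circ> \<iota>) summable_on C"
    using hs summable_on_reindex[OF inj] by blast
  have Ts: "T summable_on C"
    by (rule summable_on_comparison_test[OF su]) (use \<iota>(2) T0 in auto)
  have "infsum T C \<le> infsum ((\<lambda>i. hterm s \<nu> q i j) \<circ> \<iota>) C"
    by (rule infsum_mono[OF Ts su]) (use \<iota>(2) in auto)
  also have "\<dots> = infsum (\<lambda>i. hterm s \<nu> q i j) (\<iota> ` C)" by (rule infsum_reindex[OF inj, symmetric])
  also have "\<dots> \<le> (\<Sum>\<^sub>\<infinity>i. hterm s \<nu> q i j)" by (rule infsum_mono2[OF hs hs]) (auto simp: h0)
  finally have TV: "infsum T C \<le> (\<Sum>\<^sub>\<infinity>i. hterm s \<nu> q i j)" .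
  have "bij_betw snd (Sigma E6 (cuts j)) C"
    by (rule bij_betwI[where g = "\<lambda>(x, r). (x @ j # r, (x, r))"]) (auto simp: C_def cuts_def)
  from has_sum_reindex_bij_betw[OF this, of T] has_sum_infsum[OF Ts]
  have "((\<lambda>p. T (snd p)) has_sum infsum T C) (Sigma E6 (cuts j))" by simp
  then have maj: "((\<lambda>js. wt s j * \<bar>c js\<bar> * (\<Sum>(x, r)\<in>cuts j js. ?p x * ?p r)) has_sum infsum T C) E6"
  proof (rule has_sum_SigmaD)
    fix js
    have "wt s j * \<bar>c js\<bar> * (\<Sum>(x, r)\<in>cuts j js. ?p x * ?p r) = (\<Sum>p\<in>cuts j js. T (snd (js, p)))"
      unfolding sum_distrib_left by (intro sum.cong) (auto simp: T_def cuts_def)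
    then show "((\<lambda>p. T (snd (js, p))) has_sum wt s j * \<bar>c js\<bar> * (\<Sum>(x, r)\<in>cuts j js. ?p x * ?p r)) (cuts j js)"
      by (intro has_sum_finiteI) simp_all
  qed
  have "((\<lambda>js. wt s j *\<^sub>R (of_real (c js) * dmon js q (unit_seq j e))) has_sum wt s j *\<^sub>R S) E6"
    by (intro has_sum_bounded_linear[OF bounded_linear_scaleR_right] S)
  then have "norm (wt s j *\<^sub>R S) \<le> infsum T C"
  proof (rule norm_infsum_le[OF _ maj])
    fix js
    have "wt s j * (\<bar>c js\<bar> * cmod (dmon js q (unit_seq j e))) \<le> wt s j * (\<bar>c js\<bar> * (\<Sum>(x, r)\<in>cuts j js. ?p x * ?p r))"
      by (intro mult_left_mono dmon_unit e) auto
    then show "norm (wt s j *\<^sub>R (of_real (c js) * dmon js q (unit_seq j e))) \<le> wt s j * \<bar>c js\<bar> * (\<Sum>(x, r)\<in>cuts j js. ?p x * ?p r)"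
      by (simp add: norm_mult mult.assoc)
  qed
  then show ?thesis using TV by simp
qed

lemma w1_unit_seq: "j \<noteq> 0 \<Longrightarrow> w1 (unit_seq j e)"
proof -
  assume "j \<noteq> 0"
  have "(\<lambda>k. rt k * cmod (unit_seq j e k)) summable_on UNIV"
    by (rule finite_nonzero_values_imp_summable_on, rule finite_subset[of _ "{j}"])
       (auto simp: unit_seq_def split: if_splits)
  with \<open>j \<noteq> 0\<close> show ?thesis by (simp add: w1_def unit_seq_def)
qed

text \<open>The factor \<open>j\<close> of the vector field raises \<open>wt (s - 1)\<close> to
  \<open>wt s\<close>, and the two real directions of each mode obey the same component
  bound.\<close>

lemma ham_vf_bound:
  assumes s: "1 < s" and \<nu>: "0 < \<nu>" "2 * growth s * \<nu> \<le> 1" and q: "q \<in> ell2 s" "n1 q \<le> \<nu>"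
  shows "ham_vf R q \<in> ell2 (s - 1)" "ell2_norm (s - 1) (ham_vf R q) \<le> 16 * ((growth s)\<^sup>2 * (2 * growth s * \<nu>) ^ 4) * ell2_norm s q"
proof -
  let ?B = "16 * ((growth s)\<^sup>2 * (2 * growth s * \<nu>) ^ 4) * ell2_norm s q"
  have W: "w1 q" by (rule ell2_w1(1)[OF s q(1)])
  have "D * n1 q \<le> growth s * \<nu>" using growth(1)[of s] q D s by (intro mult_mono) auto
  then have Dq: "D * n1 q < 1" using \<nu> by linarith
  have comp: "cmod (ham_vf R q j) * wt (s - 1) j \<le> (\<Sum>\<^sub>\<infinity>i. hterm s \<nu> q i j)" for j
  proof (cases "j = 0")
    case True
    have "0 \<le> (\<Sum>\<^sub>\<infinity>i. hterm s \<nu> q i j)"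
      unfolding hterm_def using \<nu> growth(2)[of s] s by (intro infsum_nonneg) (auto intro!: mult_nonneg_nonneg pm_nonneg split: prod.split)
    then show ?thesis using True by simp
  next
    case False
    define S where "S e = (\<Sum>\<^sub>\<infinity>js\<in>E6. of_real (c js) * dmon js q (unit_seq j e))" for e
    note dd = directional_derivative[OF W Dq w1_unit_seq[OF False]]
    have d: "deriv (\<lambda>t. R (q + t *\<^sub>R unit_seq j e)) 0 = Re (S e)" for e
      unfolding S_def by (intro DERIV_imp_deriv dd(2))
    have b: "wt s j * cmod (S e) \<le> (\<Sum>\<^sub>\<infinity>i. hterm s \<nu> q i j)" if "cmod e = 1" for e
      by (rule vf_component_bound[OF s \<nu> q that]) (use dd(1) in \<open>simp add: S_def\<close>)
    have "cmod (partial_qbar R j q) = cmod (of_real (Re (S 1)) + \<i> * of_real (Re (S \<i>))) / 2"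
      unfolding partial_qbar_def d by (simp add: norm_divide)
    also have "\<dots> \<le> (\<bar>Re (S 1)\<bar> + \<bar>Re (S \<i>)\<bar>) / 2"
      using norm_triangle_ineq[of "of_real (Re (S 1))" "\<i> * of_real (Re (S \<i>))"] by (simp add: norm_mult)
    also have "\<dots> \<le> (cmod (S 1) + cmod (S \<i>)) / 2"
      using abs_Re_le_cmod[of "S 1"] abs_Re_le_cmod[of "S \<i>"] by simp
    finally have "wt s j * cmod (partial_qbar R j q) \<le> wt s j * ((cmod (S 1) + cmod (S \<i>)) / 2)"
      by (intro mult_left_mono) auto
    also have "\<dots> \<le> (\<Sum>\<^sub>\<infinity>i. hterm s \<nu> q i j)" using b[of 1] b[of \<i>] by (simp add: field_simps)
    also have "wt s j * cmod (partial_qbar R j q) = cmod (ham_vf R q j) * wt (s - 1) j"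
    proof -
      have "wt s j = \<bar>real_of_int j\<bar> * wt (s - 1) j" using False by (simp add: wt_def powr_diff)
      then show ?thesis by (simp add: ham_vf_def norm_mult)
    qed
    finally show ?thesis .
  qed
  have B0: "0 \<le> ?B" using \<nu> growth(2)[of s] s by simp
  have fin: "(\<Sum>j\<in>F. (cmod (ham_vf R q j) * wt (s - 1) j)\<^sup>2) \<le> ?B\<^sup>2" if F: "finite F" for F
  proof -
    have "L2_set (\<lambda>j. cmod (ham_vf R q j) * wt (s - 1) j) F \<le> L2_set (\<lambda>j. \<Sum>\<^sub>\<infinity>i. hterm s \<nu> q i j) F"
      by (intro L2_set_mono comp) auto
    also have "\<dots> \<le> ?B" by (rule hterm_minkowski(2)[OF s \<nu> q F])
    finally have "(L2_set (\<lambda>j. cmod (ham_vf R q j) * wt (s - 1) j) F)\<^sup>2 \<le> ?B\<^sup>2" by (intro power_mono) auto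
    then show ?thesis by (simp add: L2_set_def sum_nonneg)
  qed
  have "ham_vf R q 0 = 0" by (simp add: ham_vf_def)
  from ell2I[OF this B0 fin] show "ham_vf R q \<in> ell2 (s - 1)" "ell2_norm (s - 1) (ham_vf R q) \<le> ?B" by auto
qed

text \<open>\<open>\<nu>\<close> is taken proportional to the norm of \<open>q\<close>; the fourth
  power in the bound times that norm is the fifth order.\<close>

lemma ham_vf_order:
  assumes s: "1 < s"
  shows "\<exists>\<epsilon>>0. \<exists>K. \<forall>q\<in>ell2 s. ell2_norm s q < \<epsilon> \<longrightarrow> ham_vf R q \<in> ell2 (s - 1) \<and>
     ell2_norm (s - 1) (ham_vf R q) \<le> K * ell2_norm s q ^ 5"
proof -
  define k where "k = k1 s + 1"
  have k: "0 < k" using k1_nonneg[of s] unfolding k_def by linarith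
  have g: "1 \<le> growth s" using growth(2) s by simp
  define \<epsilon> where "\<epsilon> = 1 / (2 * growth s * k)"
  define K where "K = 16 * ((growth s)\<^sup>2 * (2 * growth s * k) ^ 4)"
  have "ham_vf R q \<in> ell2 (s - 1) \<and> ell2_norm (s - 1) (ham_vf R q) \<le> K * ell2_norm s q ^ 5"
    if q: "q \<in> ell2 s" "ell2_norm s q < \<epsilon>" for q
  proof (cases "ell2_norm s q = 0")
    \<comment> \<open>The proportional choice would be zero here, so the largest permitted
      \<open>\<nu>\<close> is used instead.\<close>
    case True
    have "n1 q \<le> 0" using ell2_w1(2)[OF s q(1)] True by simp
    then have "n1 q \<le> 1 / (2 * growth s)" using g by (simp add: order_trans[of _ 0])
    from ham_vf_bound[OF s _ _ q(1) this] g True show ?thesis by (simp add: K_def)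
  next
    case False
    then have pos: "0 < ell2_norm s q" using ell2_norm_nonneg[of s q] by linarith
    have "n1 q \<le> k1 s * ell2_norm s q" by (rule ell2_w1(2)[OF s q(1)])
    also have "\<dots> \<le> k * ell2_norm s q" by (simp add: k_def algebra_simps)
    finally have n: "n1 q \<le> k * ell2_norm s q" .
    have "2 * growth s * k * ell2_norm s q \<le> 2 * growth s * k * \<epsilon>"
      using q g k by (intro mult_left_mono) auto
    also have "\<dots> = 1" using g k by (simp add: \<epsilon>_def)
    finally have "2 * growth s * (k * ell2_norm s q) \<le> 1" by (simp add: mult_ac)
    from ham_vf_bound[OF s _ this q(1) n] k pos show ?thesis
      by (simp add: K_def power_mult_distrib numeral_eq_Suc mult_ac)
  qed
  moreover have "0 < \<epsilon>" using g k by (simp add: \<epsilon>_def)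
  ultimately show ?thesis by blast
qed

end

section \<open>The normal form theorem\<close>

lemma Mset_E6: "js \<in> Mset r \<and> 3 \<le> r \<longleftrightarrow> js \<in> E6 \<and> length js = 2 * r"
proof -
  have "js \<in> Mset r \<longleftrightarrow> length js = 2 * r \<and> 0 \<notin> set js \<and> alts js = 0"
    using alts_sum[of js] by (auto simp: Mset_def Zstar_def)
  then show ?thesis by (auto simp: E6_def EL_def)
qed

text \<open>With \<open>u\<close> an entry of largest modulus, the square root of the quotient is
  \<open>rprod js / |u|\<close>, so the bounds of the form \<open>|c js| * |u|\<close> are exactly
  the required ones.\<close>

lemma decr_abs_quotient:
  assumes "js \<noteq> []" "0 \<notin> set js"
  obtains u where "u \<in> set js" "u \<noteq> 0"
    "0 < sqrt (real_of_int (prod_list (tl (decr_abs js))) / real_of_int (hd (decr_abs js)))"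
    "rprod js = \<bar>real_of_int u\<bar> * sqrt (real_of_int (prod_list (tl (decr_abs js))) / real_of_int (hd (decr_abs js)))"
proof -
  have st: "set (decr_abs js) = abs ` set js" by (simp add: decr_abs_def)
  have ms: "mset (decr_abs js) = mset (map abs js)" by (simp add: decr_abs_def)
  then have "prod_list (decr_abs js) = prod_list (map abs js)"
    by (metis prod_mset_prod_list)
  then have pr: "rprod js = sqrt (real_of_int (prod_list (decr_abs js)))"
  proof -
    have "rprod js = sqrt (real_of_int (prod_list (map abs js)))"
      by (induction js) (auto simp: rt_def real_sqrt_mult)
    then show ?thesis using \<open>prod_list (decr_abs js) = prod_list (map abs js)\<close> by simp
  qed
  have "decr_abs js \<noteq> []" using assms(1) ms by (metis map_is_Nil_conv mset_zero_iff)
  then obtain h t where ht: "decr_abs js = h # t" by (cases "decr_abs js") auto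
  then obtain u where u: "u \<in> set js" "h = \<bar>u\<bar>" using st by (metis imageE list.set_intros(1))
  have u0: "u \<noteq> 0" using u assms by metis
  have pos: "0 < v" if "v \<in> set t" for v
  proof -
    have "v \<in> abs ` set js" using st ht that by auto
    then show ?thesis using assms(2) by (metis abs_eq_0 imageE order.not_eq_order_implies_strict abs_ge_zero)
  qed
  then have T: "0 < prod_list t" by (induction t) auto
  let ?h = "real_of_int h" and ?T = "real_of_int (prod_list t)"
  have h0: "0 < ?h" using u u0 by simp
  have "?h * sqrt (?T / ?h) = sqrt (?h * ?T)"
  proof -
    have "?h * sqrt (?T / ?h) = sqrt (?h\<^sup>2) * sqrt (?T / ?h)" using h0 by simp
    also have "\<dots> = sqrt (?h\<^sup>2 * (?T / ?h))" by (rule real_sqrt_mult[symmetric])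
    also have "?h\<^sup>2 * (?T / ?h) = ?h * ?T" using h0 by (simp add: power2_eq_square)
    finally show ?thesis .
  qed
  then show ?thesis
    using that[OF u(1) u0] pr u(2) T h0 by (simp add: ht)
qed

text \<open>The square comes from the length \<open>2 * r\<close>, and adding 1 makes the inequality
  strict.\<close>

lemma coefficient_bound:
  assumes D: "1 \<le> D" and b: "\<And>js u. js \<in> E6 \<Longrightarrow> u \<in> set js \<Longrightarrow> \<bar>cR js\<bar> * \<bar>real_of_int u\<bar> \<le> D ^ length js * rprod js"
    and js: "3 \<le> r" "js \<in> Mset r"
  shows "\<bar>cR js\<bar> < (D\<^sup>2 + 1) ^ r * sqrt (real_of_int (prod_list (tl (decr_abs js))) / real_of_int (hd (decr_abs js)))"
proof -
  have E: "js \<in> E6" and len: "length js = 2 * r" using Mset_E6[of js r] js by auto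
  have ne: "js \<noteq> []" "0 \<notin> set js" using E by (auto simp: E6_def EL_def)
  let ?S = "sqrt (real_of_int (prod_list (tl (decr_abs js))) / real_of_int (hd (decr_abs js)))"
  obtain u where u: "u \<in> set js" "u \<noteq> 0" "0 < ?S" "rprod js = \<bar>real_of_int u\<bar> * ?S"
    by (rule decr_abs_quotient[OF ne])
  have "\<bar>real_of_int u\<bar> * \<bar>cR js\<bar> \<le> \<bar>real_of_int u\<bar> * ((D\<^sup>2) ^ r * ?S)"
    using b[OF E u(1)] unfolding len u(4) power_mult by (simp only: mult_ac)
  moreover have "0 < \<bar>real_of_int u\<bar>" using u(2) by simp
  ultimately have "\<bar>cR js\<bar> \<le> (D\<^sup>2) ^ r * ?S" by (simp only: mult_le_cancel_left_pos)
  also have "\<dots> < (D\<^sup>2 + 1) ^ r * ?S"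
    using u(3) js(1) by (intro mult_strict_right_mono power_strict_mono) auto
  finally show ?thesis .
qed

text \<open>Since \<open>am 0 = 0\<close>, the series is at most proportional to \<open>t\<close>.
  The value 1/4 is doubled in \<open>ev_w1\<close> to the radius 1/2 of
  \<open>cubic_unique\<close>.\<close>

lemma am_small:
  obtains \<tau> where "0 < \<tau>" "\<And>t. 0 \<le> t \<Longrightarrow> t \<le> \<tau> \<Longrightarrow> summable (\<lambda>n. am n * t ^ n) \<and> (\<Sum>n. am n * t ^ n) \<le> 1 / 4"
proof -
  obtain \<rho> where \<rho>: "0 < \<rho>" "\<rho> \<le> 1" "summable (\<lambda>n. am n * \<rho> ^ n)"
    by (rule majorant_summable[of 0 1 1]) auto
  define B where "B = (\<Sum>n. am n * \<rho> ^ n)"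
  have B: "0 \<le> B" unfolding B_def using \<rho> am_nonneg by (intro suminf_nonneg) auto
  define \<tau> where "\<tau> = \<rho> / (4 * (B + 1))"
  have "0 < \<tau>" using \<rho> B by (simp add: \<tau>_def)
  moreover have "summable (\<lambda>n. am n * t ^ n) \<and> (\<Sum>n. am n * t ^ n) \<le> 1 / 4" if t: "0 \<le> t" "t \<le> \<tau>" for t
  proof -
    have "\<tau> \<le> \<rho>" using \<rho> B by (simp add: \<tau>_def divide_simps)
    then have t1: "t / \<rho> \<le> 1" "0 \<le> t / \<rho>" using t \<rho> by (auto simp: divide_simps)
    have le: "am n * t ^ n \<le> (t / \<rho>) * (am n * \<rho> ^ n)" for n
    proof (cases n)
      case (Suc m)
      have "am n * t ^ n = am n * \<rho> ^ n * (t / \<rho>) ^ n" using \<rho> by (simp add: power_divide)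
      also have "\<dots> \<le> am n * \<rho> ^ n * (t / \<rho>) ^ 1"
        using t1 \<rho> am_nonneg Suc by (intro mult_left_mono power_decreasing) auto
      finally show ?thesis by (simp add: mult_ac)
    qed (simp add: majorant_0)
    have su: "summable (\<lambda>n. (t / \<rho>) * (am n * \<rho> ^ n))" by (intro summable_mult \<rho>)
    have s: "summable (\<lambda>n. am n * t ^ n)"
      by (rule summable_comparison_test'[OF su, where N = 0]) (use le t am_nonneg in \<open>auto simp: abs_mult\<close>)
    have "(\<Sum>n. am n * t ^ n) \<le> (\<Sum>n. (t / \<rho>) * (am n * \<rho> ^ n))" by (rule suminf_le[OF le s su])
    also have "\<dots> = (t / \<rho>) * B" unfolding B_def by (rule suminf_mult[OF \<rho>(3)])
    also have "\<dots> \<le> (\<tau> / \<rho>) * B" using t \<rho> B by (intro mult_right_mono divide_right_mono) auto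
    also have "\<dots> = (B / (B + 1)) / 4" using \<rho> by (simp add: \<tau>_def)
    also have "\<dots> \<le> 1 / 4" using B by (simp add: divide_simps)
    finally show ?thesis using s by simp
  qed
  ultimately show ?thesis by (rule that)
qed

section \<open>The midpoint map on sequences\<close>

lemma emb_L:
  assumes "1 < s"
  shows "emb s (trilinear.L (Xl s) z a) = LX (emb s z) (emb s a)"
  unfolding trilinear.L_def[OF trilinear_Xl[OF assms]] LX_def using assms by (simp add: emb_Xl)

lemma open_emb_mid_dom:
  assumes tri: "trilinear X M" and r: "6 * M * r\<^sup>2 \<le> 1"
  shows "openin (norm_topology (ell2 s) (ell2_norm s)) (emb s ` mid_dom X r)"
  unfolding openin_norm_topology
proof (intro conjI ballI)
  show "emb s ` mid_dom X r \<subseteq> ell2 s" by auto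
  fix q assume "q \<in> emb s ` mid_dom X r"
  then obtain x where x: "x \<in> mid_dom X r" "q = emb s x" by auto
  obtain \<rho> K A where A: "0 < \<rho>" "\<forall>n. 0 \<le> K n" "summable (\<lambda>n. K n * \<rho> ^ n)"
    "\<forall>n. bounded_multilinear UNIV norm UNIV norm n (A n) (K n)"
    "\<forall>h. norm h < \<rho> \<longrightarrow> x + h \<in> mid_dom X r \<and> (\<lambda>n. A n (replicate n h)) sums mid_map X r (x + h)"
    "\<forall>u. \<exists>a. u = a - trilinear.L X (mid_inv X r x) a \<and> A 1 [u] = a + trilinear.L X (mid_inv X r x) a"
    by (rule trilinear.mid_map_series[OF tri r x(1)]) (rule that)
  show "\<exists>\<rho>>0. \<forall>h\<in>ell2 s. ell2_norm s h < \<rho> \<longrightarrow> q + h \<in> emb s ` mid_dom X r"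
  proof (intro exI[of _ \<rho>] conjI ballI impI A(1))
    fix h assume h: "h \<in> ell2 s" "ell2_norm s h < \<rho>"
    then have "x + proj s h \<in> mid_dom X r" using A(5) by simp
    moreover have "q + h = emb s (x + proj s h)" using h x by (simp add: emb_proj)
    ultimately show "q + h \<in> emb s ` mid_dom X r" by (rule image_eqI[rotated])
  qed
qed

lemma analytic_emb_mid_map:
  assumes tri: "trilinear X M" and r: "6 * M * r\<^sup>2 \<le> 1"
    and f: "\<And>x. x \<in> mid_dom X r \<Longrightarrow> f (emb s x) = emb s (mid_map X r x)"
  shows "real_analytic_on (ell2 s) (ell2_norm s) (ell2 s) (ell2_norm s) f (emb s ` mid_dom X r)"
  unfolding real_analytic_on_def
proof
  fix q assume "q \<in> emb s ` mid_dom X r"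
  then obtain x where x: "x \<in> mid_dom X r" "q = emb s x" by auto
  obtain \<rho> K A where A: "0 < \<rho>" "\<forall>n. 0 \<le> K n" "summable (\<lambda>n. K n * \<rho> ^ n)"
    "\<forall>n. bounded_multilinear UNIV norm UNIV norm n (A n) (K n)"
    "\<forall>h. norm h < \<rho> \<longrightarrow> x + h \<in> mid_dom X r \<and> (\<lambda>n. A n (replicate n h)) sums mid_map X r (x + h)"
    "\<forall>u. \<exists>a. u = a - trilinear.L X (mid_inv X r x) a \<and> A 1 [u] = a + trilinear.L X (mid_inv X r x) a"
    by (rule trilinear.mid_map_series[OF tri r x(1)]) (rule that)
  have "has_power_series (ell2 s) (ell2_norm s) (ell2 s) (ell2_norm s) f q (\<lambda>n xs. emb s (A n (map (proj s) xs)))"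
  proof (rule has_power_series_emb[OF A(1,3)])
    show "f (q + emb s h) = emb s (mid_map X r (x + h))" if "norm h < \<rho>" for h
      using f[of "x + h"] A(5) that x by simp
  qed (use A in auto)
  then show "\<exists>A. has_power_series (ell2 s) (ell2_norm s) (ell2 s) (ell2_norm s) f q A" by blast
qed

text \<open>Tangent vectors are taken in the form \<open>a - L a\<close> with image
  \<open>a + L a\<close>, so \<open>symp_cayley\<close> applies directly.\<close>

lemma symplectic_emb_mid_map:
  assumes s: "1 < s" and r: "6 * x_bound s * r\<^sup>2 \<le> 1"
    and f: "\<And>x. x \<in> mid_dom (Xl s) r \<Longrightarrow> f (emb s x) = emb s (mid_map (Xl s) r x)"
  shows "symplectic_on s f (emb s ` mid_dom (Xl s) r)"
  unfolding symplectic_on_def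
proof
  let ?X = "Xl s"
  note tri = trilinear_Xl[OF s]
  fix q assume "q \<in> emb s ` mid_dom ?X r"
  then obtain x where x: "x \<in> mid_dom ?X r" "q = emb s x" by auto
  let ?z = "mid_inv ?X r x"
  obtain \<rho> K A where A: "0 < \<rho>" "\<forall>n. 0 \<le> K n" "summable (\<lambda>n. K n * \<rho> ^ n)"
    "\<forall>n. bounded_multilinear UNIV norm UNIV norm n (A n) (K n)"
    "\<forall>h. norm h < \<rho> \<longrightarrow> x + h \<in> mid_dom ?X r \<and> (\<lambda>n. A n (replicate n h)) sums mid_map ?X r (x + h)"
    "\<forall>u. \<exists>a. u = a - trilinear.L ?X ?z a \<and> A 1 [u] = a + trilinear.L ?X ?z a"
    by (rule trilinear.mid_map_series[OF tri r x(1)]) (rule that)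
  let ?D = "\<lambda>u. emb s (A 1 [proj s u])"
  have "has_frechet_derivative (ell2 s) (ell2_norm s) (ell2 s) (ell2_norm s) f ?D q"
  proof (rule has_frechet_derivative_emb[OF A(1,3)])
    show "f (q + emb s h) = emb s (mid_map ?X r (x + h))" if "norm h < \<rho>" for h
      using f[of "x + h"] A(5) that x by simp
  qed (use A in auto)
  moreover have "symp_form (?D u) (?D v) = symp_form u v" if uv: "u \<in> ell2 s" "v \<in> ell2 s" for u v
  proof -
    obtain a where a: "proj s u = a - trilinear.L ?X ?z a" "A 1 [proj s u] = a + trilinear.L ?X ?z a" using A(6) by blast
    obtain b where b: "proj s v = b - trilinear.L ?X ?z b" "A 1 [proj s v] = b + trilinear.L ?X ?z b" using A(6) by blast
    have D: "?D u = emb s a + LX (emb s ?z) (emb s a)" "?D v = emb s b + LX (emb s ?z) (emb s b)"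
      unfolding a(2) b(2) by (simp_all add: emb_L s)
    have "u = emb s (a - trilinear.L ?X ?z a)" "v = emb s (b - trilinear.L ?X ?z b)"
      using emb_proj[OF uv(1)] emb_proj[OF uv(2)] unfolding a(1) b(1) by simp_all
    then have "u = emb s a - LX (emb s ?z) (emb s a)" "v = emb s b - LX (emb s ?z) (emb s b)"
      by (simp_all add: emb_L s)
    then show ?thesis unfolding D by (simp only: symp_cayley ell2_w1(1)[OF s emb_in])
  qed
  ultimately show "\<exists>D. has_frechet_derivative (ell2 s) (ell2_norm s) (ell2 s) (ell2_norm s) f D q \<and>
        (\<forall>u\<in>ell2 s. \<forall>v\<in>ell2 s. symp_form (D u) (D v) = symp_form u v)" by blast
qed

lemma mid_map_transformation:
  assumes s: "1 < s" and r: "0 < r" "6 * x_bound s * r\<^sup>2 \<le> 1"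
  defines "\<Psi> \<equiv> \<lambda>q. emb s (mid_map (Xl s) r (proj s q))"
    and "U \<equiv> emb s ` mid_dom (Xl s) r" and "V \<equiv> emb s ` mid_dom (\<lambda>x y z. - Xl s x y z) r"
  shows "analytic_symplectic_transformation s \<Psi> U V"
proof -
  let ?X = "Xl s" and ?Y = "\<lambda>x y z. - Xl s x y z"
  interpret trilinear ?X "x_bound s" by (rule trilinear_Xl[OF s])
  interpret Y: trilinear ?Y "x_bound s" by (rule uminus)
  have \<Psi>: "\<Psi> (emb s x) = emb s (mid_map ?X r x)" for x by (simp add: \<Psi>_def)
  have inv: "mid_map ?X r x \<in> mid_dom ?Y r" "mid_map ?Y r (mid_map ?X r x) = x" if "x \<in> mid_dom ?X r" for x
    using mid_map_inverse[OF r(2) that] .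
  have inv': "mid_map ?Y r x \<in> mid_dom ?X r" "mid_map ?X r (mid_map ?Y r x) = x" if "x \<in> mid_dom ?Y r" for x
    using Y.mid_map_inverse[OF r(2) that] by simp_all
  have bij: "bij_betw \<Psi> U V"
    by (rule bij_betwI[where g = "\<lambda>q. emb s (mid_map ?Y r (proj s q))"])
       (auto simp: U_def V_def \<Psi> inv inv')
  have X0: "?X 0 0 0 = 0" using bound[of 0 0 0] by simp
  have m0: "mid_inv ?X r 0 = 0" using mid_inv(1)[OF r(2), of 0] X0 r(1) by simp
  have d0: "0 \<in> mid_dom ?X r" unfolding mid_dom_def using X0 r(1) by (intro image_eqI[of _ _ 0]) auto
  have "\<Psi> 0 = 0" using \<Psi>[of 0] m0 by (simp add: mid_map_def)
  moreover have "0 \<in> U" unfolding U_def using d0 by (intro image_eqI[of _ _ 0]) auto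
  moreover have "real_analytic_on (ell2 s) (ell2_norm s) (ell2 s) (ell2_norm s) (inv_into U \<Psi>) V"
    unfolding V_def
  proof (rule analytic_emb_mid_map[OF Y.trilinear_axioms r(2)])
    fix x assume x: "x \<in> mid_dom ?Y r"
    have "\<Psi> (emb s (mid_map ?Y r x)) = emb s x" using x by (simp add: \<Psi> inv')
    moreover have "emb s (mid_map ?Y r x) \<in> U" using inv'(1)[OF x] by (simp add: U_def)
    ultimately show "inv_into U \<Psi> (emb s x) = emb s (mid_map ?Y r x)"
      using bij inv_into_f_eq[of \<Psi> U] by (auto simp: bij_betw_def)
  qed
  ultimately show ?thesis
    unfolding analytic_symplectic_transformation_def
    using bij open_emb_mid_dom[OF trilinear_axioms r(2), of s] open_emb_mid_dom[OF Y.trilinear_axioms r(2), of s]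
      analytic_emb_mid_map[OF trilinear_axioms r(2) \<Psi>] symplectic_emb_mid_map[OF s r(2) \<Psi>]
    by (simp add: U_def V_def)
qed

theorem theorem1p1:
  fixes s :: real
  assumes "s > 1"
  shows "\<exists>\<Psi> U V. \<exists>R :: seq \<Rightarrow> real.
    analytic_symplectic_transformation s \<Psi> U V \<and>
    (\<forall>q\<in>U. Ham (\<Psi> q) = complex_of_real (Lambda q + Bquart q + R q)) \<and>
    has_order_at_least (ell2 s) (ell2_norm s) R 6 \<and>
    (\<exists>\<epsilon>>0. \<exists>K. \<forall>q\<in>ell2 s. ell2_norm s q < \<epsilon> \<longrightarrow>
       ham_vf R q \<in> ell2 (s - 1) \<and>
       ell2_norm (s - 1) (ham_vf R q) \<le> K * ell2_norm s q ^ 5) \<and>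
    (\<exists>c :: int list \<Rightarrow> complex. \<exists>C>0.
       (\<forall>q\<in>U. ((\<lambda>(r, js). c js * monomial js q) has_sum complex_of_real (R q))
                 (SIGMA r:{3..}. Mset r)) \<and>
       (\<forall>r\<ge>3. \<forall>js\<in>Mset r.
          cmod (c js) < C ^ r *
            sqrt (real_of_int (prod_list (tl (decr_abs js))) / real_of_int (hd (decr_abs js)))))"
proof -
  have "\<exists>D\<ge>1. \<forall>js\<in>E6. \<forall>u\<in>set js. \<bar>cR js\<bar> * \<bar>real_of_int u\<bar> \<le> D ^ length js * rprod js"
    by (rule cR_bound) blast
  then obtain D where bd: "1 \<le> D" "\<And>js u. js \<in> E6 \<Longrightarrow> u \<in> set js \<Longrightarrow> \<bar>cR js\<bar> * \<bar>real_of_int u\<bar> \<le> D ^ length js * rprod js"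
    by blast
  interpret remainder cR D by unfold_locales (use bd in auto)
  interpret trilinear "Xl s" "x_bound s" by (rule trilinear_Xl[OF assms])
  have "\<exists>\<tau>>0. \<forall>t. 0 \<le> t \<longrightarrow> t \<le> \<tau> \<longrightarrow> summable (\<lambda>n. am n * t ^ n) \<and> (\<Sum>n. am n * t ^ n) \<le> 1 / 4"
    by (rule am_small) blast
  then obtain \<tau>' where \<tau>': "0 < \<tau>'" "\<And>t. 0 \<le> t \<Longrightarrow> t \<le> \<tau>' \<Longrightarrow> summable (\<lambda>n. am n * t ^ n) \<and> (\<Sum>n. am n * t ^ n) \<le> 1 / 4"
    by blast
  \<comment> \<open>Bound for \<open>n1\<close> of points of \<open>U\<close>: 1/2 is the radius of
    \<open>cubic_unique\<close>, \<open>\<tau>'\<close> makes them admissible, and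
    \<open>1 / (2 * D)\<close> puts them inside the region of convergence of
    \<open>Rc\<close>.\<close>
  define \<tau> where "\<tau> = min (1 / 2) (min \<tau>' (1 / (2 * D)))"
  have \<tau>: "0 < \<tau>" "\<tau> \<le> 1 / 2" "\<tau> \<le> \<tau>'" "\<tau> \<le> 1 / (2 * D)" using \<tau>' bd(1) by (auto simp: \<tau>_def)
  have D\<tau>: "D * \<tau> < 1"
    using mult_left_mono[OF \<tau>(4), of D] D by simp
  \<comment> \<open>The second entry, with \<open>r \<le> 1\<close>, gives the contraction condition
    \<open>Mr\<close>; the third turns norms up to \<open>2 * r\<close> into \<open>n1\<close> at
    most \<open>\<tau>\<close>.\<close>
  define r where "r = min 1 (min (1 / (6 * x_bound s + 1)) (\<tau> / (2 * (k1 s + 1))))"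
  have k: "0 < k1 s + 1" using k1_nonneg[of s] by linarith
  have r: "0 < r" "r \<le> 1" "r \<le> 1 / (6 * x_bound s + 1)" "r \<le> \<tau> / (2 * (k1 s + 1))"
    using \<tau> k M_nonneg by (auto simp: r_def)
  have Mr: "6 * x_bound s * r\<^sup>2 \<le> 1"
  proof -
    have "6 * x_bound s * r\<^sup>2 \<le> (6 * x_bound s + 1) * (r * 1)"
      unfolding power2_eq_square using r M_nonneg by (intro mult_mono) auto
    also have "\<dots> \<le> (6 * x_bound s + 1) * (1 / (6 * x_bound s + 1))"
      using r M_nonneg by (intro mult_left_mono) auto
    also have "\<dots> = 1" using M_nonneg by simp
    finally show ?thesis .
  qed
  have kr: "k1 s * (2 * r) \<le> \<tau>"
  proof -
    have "k1 s * (2 * r) \<le> (k1 s + 1) * (2 * r)" using r by (intro mult_right_mono) auto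
    also have "\<dots> \<le> (k1 s + 1) * (2 * (\<tau> / (2 * (k1 s + 1))))" using r k by (intro mult_left_mono) auto
    also have "\<dots> = \<tau>" using k by (simp add: divide_simps)
    finally show ?thesis .
  qed
  define \<Psi> where "\<Psi> = (\<lambda>q. emb s (mid_map (Xl s) r (proj s q)))"
  define U where "U = emb s ` mid_dom (Xl s) r"
  define V where "V = emb s ` mid_dom (\<lambda>x y z. - Xl s x y z) r"
  have tr: "analytic_symplectic_transformation s \<Psi> U V"
    unfolding \<Psi>_def U_def V_def by (rule mid_map_transformation[OF assms r(1) Mr])
  have main: "Ham (\<Psi> q) = complex_of_real (Lambda q + Bquart q + R q)"
    "((\<lambda>js. of_real (cR js) * monomial js q) has_sum of_real (R q)) E6" if "q \<in> U" for q
  proof -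
    obtain x where x: "x \<in> mid_dom (Xl s) r" "q = emb s x" using \<open>q \<in> U\<close> unfolding U_def by blast
    define z where "z = mid_inv (Xl s) r x"
    define Z where "Z = emb s z"
    have z: "norm z < r" "z - Xl s z z z = x" "mid_map (Xl s) r x = z + Xl s z z z"
      using mid_inv(2-4)[OF Mr x(1)] by (simp_all add: z_def)
    have qZ: "q = Z - XX Z Z Z" and yZ: "\<Psi> q = Z + XX Z Z Z"
      unfolding \<Psi>_def x(2) proj_emb z(3) by (simp_all add: Z_def emb_Xl assms flip: z(2))
    have wZ: "w1 Z" and wq: "w1 q" unfolding Z_def x(2) by (rule ell2_w1(1)[OF assms emb_in])+
    \<comment> \<open>The cubic term is at most half of \<open>z\<close>, so the points
      \<open>x\<close> stay in the ball of radius \<open>2 * r\<close>.\<close>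
    have "norm (Xl s z z z) \<le> 1/2 * norm (z - 0)"
      using cubic_lipschitz[OF Mr, of z 0] z(1) r(1) bound[of 0 0 0] by simp
    then have nx: "norm x \<le> 2 * r"
      using z norm_triangle_ineq4[of z "Xl s z z z"] r(1) by simp
    have "n1 q \<le> k1 s * norm x"
      using ell2_w1(2)[OF assms emb_in, of x] by (simp add: x(2))
    also have "\<dots> \<le> k1 s * (2 * r)" by (rule mult_left_mono[OF nx k1_nonneg])
    finally have nq: "n1 q \<le> \<tau>" using kr by linarith
    have "n1 Z \<le> k1 s * norm z"
      using ell2_w1(2)[OF assms emb_in, of z] by (simp add: Z_def)
    also have "\<dots> \<le> k1 s * (2 * r)" using z r by (intro mult_left_mono) auto
    finally have nZ: "n1 Z \<le> 1 / 2" using kr \<tau> by linarith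
    have am: "summable (\<lambda>n. am n * n1 q ^ n)" "(\<Sum>n. am n * n1 q ^ n) \<le> 1 / 4"
      using \<tau>'(2)[of "n1 q"] nq \<tau> by auto
    have adm: "admissible q" using wq am by (simp add: admissible_def)
    have n: "n1 (ev phi q) \<le> 1 / 2" using ev_w1(2)[OF balanced_phi adm] am by linarith
    \<comment> \<open>Both sides solve \<open>w - XX w w w = q\<close> with
      \<open>n1 w \<le> 1 / 2\<close>, one by the tree series and one by the Banach space
      inverse.\<close>
    have phi: "ev phi q = Z"
      using ev_phi_fixed_point[OF adm] qZ
      by (intro cubic_unique[OF ev_w1(1)[OF balanced_phi adm] n wZ nZ]) simp
    have psi: "ev psi q = Z + XX Z Z Z"
      using ev_psi[OF adm] qZ unfolding phi by (simp add: scaleR_2)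
    define Y where "Y = Z + XX Z Z Z"
    define Q where "Q = quad full_coeff Y Y Y Y - quad full_coeff Z Z Z Z + quad res_coeff Z Z Z Z - quad res_coeff q q q q"
    have ex: "((\<lambda>js. of_real (cR js) * monomial js q) has_sum Q) E6"
      using remainder_expansion[OF adm] unfolding phi psi Q_def Y_def .
    \<comment> \<open>Exchanging the conjugated with the other indices fixes both kernels, so the
      four quartic values in \<open>Q\<close> are real.\<close>
    have f: "full_coeff b a (a - b + c) = full_coeff a b c" "res_coeff b a (a - b + c) = res_coeff a b c" for a b c
      by (auto simp: full_coeff_def res_coeff_def)
    have "Im Q = 0" unfolding Q_def by (simp add: quad_real f)
    moreover have "Rc q = Q" unfolding Rc_def by (rule infsumI[OF ex])
    ultimately have RQ: "of_real (R q) = Q" by (simp add: R_def complex_eq_iff)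
    then show "((\<lambda>js. of_real (cR js) * monomial js q) has_sum of_real (R q)) E6" using ex by simp
    have "Ham (\<Psi> q) = of_real (Lambda q) + (quad res_coeff Z Z Z Z - quad full_coeff Z Z Z Z + quad full_coeff Y Y Y Y)"
      unfolding yZ Y_def using Ham_transformed[OF wZ] unfolding qZ[symmetric] .
    also have "\<dots> = of_real (Lambda q) + of_real (Bquart q) + Q"
      unfolding Bquart_quad[OF wq] Q_def by simp
    finally show "Ham (\<Psi> q) = complex_of_real (Lambda q + Bquart q + R q)" by (simp add: RQ)
  qed
  have expansion: "((\<lambda>(r, js). of_real (cR js) * monomial js q) has_sum complex_of_real (R q)) (SIGMA r:{3..}. Mset r)"
    if "q \<in> U" for q
  proof -
    \<comment> \<open>The number \<open>r\<close> is half the length, so grading by \<open>r\<close>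
      only relabels \<open>E6\<close>.\<close>
    have "bij_betw snd (SIGMA r:{3..}. Mset r) E6"
    proof (rule bij_betwI[where g = "\<lambda>js. (length js div 2, js)"])
      show "(\<lambda>js. (length js div 2, js)) \<in> E6 \<rightarrow> (SIGMA r:{3..}. Mset r)"
      proof
        fix js assume js: "js \<in> E6"
        then have "length js = 2 * (length js div 2)" by (simp add: E6_def EL_def)
        then have "js \<in> Mset (length js div 2) \<and> 3 \<le> length js div 2" using js Mset_E6 by blast
        then show "(length js div 2, js) \<in> (SIGMA r:{3..}. Mset r)" by simp
      qed
      show "snd \<in> (SIGMA r:{3..}. Mset r) \<rightarrow> E6"
      proof
        fix p assume "p \<in> (SIGMA r:{3..}. Mset r)"
        then show "snd p \<in> E6" using Mset_E6[of "snd p" "fst p"] by auto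
      qed
      show "(length (snd p) div 2, snd p) = p" if "p \<in> (SIGMA r:{3..}. Mset r)" for p
        using that Mset_E6[of "snd p" "fst p"] by (cases p) auto
    qed simp
    from has_sum_reindex_bij_betw[OF this, of "\<lambda>js. of_real (cR js) * monomial js q"] main(2)[OF that]
    show ?thesis by (simp add: case_prod_unfold)
  qed
  have C: "cmod (of_real (cR js)) < (D\<^sup>2 + 1) ^ r *
      sqrt (real_of_int (prod_list (tl (decr_abs js))) / real_of_int (hd (decr_abs js)))" if "3 \<le> r" "js \<in> Mset r" for r js
    unfolding norm_of_real by (rule coefficient_bound[OF bd(1) _ that]) (rule bd(2))
  have "0 < D\<^sup>2 + 1" using bd(1) by (simp add: add_nonneg_pos)
  show ?thesis
  proof (rule exI[of _ \<Psi>], rule exI[of _ U], rule exI[of _ V], rule exI[of _ R], intro conjI)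
    show "\<forall>q\<in>U. Ham (\<Psi> q) = complex_of_real (Lambda q + Bquart q + R q)" by (intro ballI main(1))
    show "\<exists>c :: int list \<Rightarrow> complex. \<exists>C>0.
       (\<forall>q\<in>U. ((\<lambda>(r, js). c js * monomial js q) has_sum complex_of_real (R q)) (SIGMA r:{3..}. Mset r)) \<and>
       (\<forall>r\<ge>3. \<forall>js\<in>Mset r. cmod (c js) < C ^ r *
            sqrt (real_of_int (prod_list (tl (decr_abs js))) / real_of_int (hd (decr_abs js))))"
      using expansion C \<open>0 < D\<^sup>2 + 1\<close>
      by (intro exI[of _ "\<lambda>js. of_real (cR js)"] exI[of _ "D\<^sup>2 + 1"] conjI ballI allI impI) assumption+
  qed (fact tr order_at_least[OF assms] ham_vf_order[OF assms])+
qed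

end
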